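(* Let $(R,\mathfrak m)$ be a one-dimensional Noetherian Cohen-Macaulay local ring with $R/\mathfrak m$ infinite, having a canonical module $\omega_R$ that is a fractional ideal with $R\subseteq\omega_R\subseteq\overline R$. Let $I$ be an $\mathfrak m$-primary (proper) ideal of $R$, let $I^\vee=(\omega_R:I)$, let $zR$ (with $z\in Q(R)$) be a minimal reduction of $I^\vee$, and let $a,b\in R$. The ring $R(I)_{a,b}$ is almost Gorenstein if and only if $z^{-1}I^\vee$ is a ring and $R\subseteq z^{-1}I^\vee\subseteq(\mathfrak m:\mathfrak m)$.
   Context: All rings are commutative with unity. For a Noetherian ring $R$, a nonzero proper ideal $I$ and $a,b\in R$, the Rees algebra is the subring $\bigoplus_{n\ge 0} I^n t^n$ of $R[t]$, and $R(I)_{a,b}$ denotes the quotient of $\bigoplus_{n\ge 0} I^n t^n$ by the ideal $\big((t^2+at+b)R[t]\big)\cap \bigoplus_{n\ge 0} I^n t^n$. As an $R$-module $R(I)_{a,b}\cong R\oplus I$; its elements are written uniquely as $r+it$ with $r\in R$, $i\in I$, with product $(r+it)(s+jt)=rs-bij+(rj+is-aij)t$. If $(R,\mathfrak m)$ is local, then $R(I)_{a,b}$ is local with maximal ideal $\{m+it \mid m\in\mathfrak m, i\in I\}$. $Q(R)$ is the total ring of fractions of $R$, $\overline R$ the integral closure of $R$ in $Q(R)$, and $(A:B)=\{q\in Q(R)\mid qB\subseteq A\}$. If $H$ is a fractional ideal and $y\in R$ is regular with $yH\subseteq R$, then for a minimal reduction $xR$ of the ideal $yH$ one calls $xy^{-1}R$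 a minimal reduction of $H$; the element $z$ is then invertible in $Q(R)$. "$z^{-1}I^\vee$ is a ring" means that it is a subring of $Q(R)$. A one-dimensional Cohen-Macaulay local ring $(S,\mathfrak n)$ is almost Gorenstein if it has a canonical module that is isomorphic to a fractional ideal $\omega_S$ of $S$ with $S\subseteq\omega_S\subseteq(\mathfrak n:\mathfrak n)$ (colon in $Q(S)$). *)

theory Defs
  imports "HOL-Algebra.Algebra" "HOL-Library.Extended_Nat"
begin

section \<open>Local rings, dimension, depth\<close>

definition local_ring :: "('a, 'm) ring_scheme \<Rightarrow> 'a set \<Rightarrow> bool" where
  "local_ring R \<mm> \<longleftrightarrow>
     cring R \<and> maximalideal \<mm> R \<and> (\<forall>\<nn>. maximalideal \<nn> R \<longrightarrow> \<nn> = \<mm>)"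

definition krull_dim :: "('a, 'm) ring_scheme \<Rightarrow> enat" where
  "krull_dim R = Sup {enat n | n. \<exists>P :: nat \<Rightarrow> 'a set.
     (\<forall>i\<le>n. primeideal (P i) R) \<and> (\<forall>i<n. P i \<subset> P (Suc i))}"

definition regular_element :: "('a, 'm) ring_scheme \<Rightarrow> 'a \<Rightarrow> bool" where
  "regular_element R x \<longleftrightarrow>
     x \<in> carrier R \<and> (\<forall>r\<in>carrier R. x \<otimes>\<^bsub>R\<^esub> r = \<zero>\<^bsub>R\<^esub> \<longrightarrow> r = \<zero>\<^bsub>R\<^esub>)"

definition regular_sequence :: "('a, 'm) ring_scheme \<Rightarrow> 'a list \<Rightarrow> bool" where
  "regular_sequence R xs \<longleftrightarrow>
     set xs \<subseteq> carrier R \<and> Idl\<^bsub>R\<^esub> (set xs) \<noteq> carrier R \<and>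
     (\<forall>i<length xs. \<forall>r\<in>carrier R.
        xs ! i \<otimes>\<^bsub>R\<^esub> r \<in> Idl\<^bsub>R\<^esub> (set (take i xs)) \<longrightarrow> r \<in> Idl\<^bsub>R\<^esub> (set (take i xs)))"

definition depth :: "('a, 'm) ring_scheme \<Rightarrow> 'a set \<Rightarrow> enat" where
  "depth R \<mm> = Sup {enat (length xs) | xs. regular_sequence R xs \<and> set xs \<subseteq> \<mm>}"

definition cohen_macaulay_local :: "('a, 'm) ring_scheme \<Rightarrow> 'a set \<Rightarrow> bool" where
  "cohen_macaulay_local R \<mm> \<longleftrightarrow>
     noetherian_ring R \<and> local_ring R \<mm> \<and> depth R \<mm> = krull_dim R"


section \<open>Ideals: primary ideals, reductions\<close>

definition radical :: "('a, 'm) ring_scheme \<Rightarrow> 'a set \<Rightarrow> 'a set" where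
  "radical R I = {r \<in> carrier R. \<exists>n::nat. r [^]\<^bsub>R\<^esub> n \<in> I}"

definition primary_ideal :: "('a, 'm) ring_scheme \<Rightarrow> 'a set \<Rightarrow> bool" where
  "primary_ideal R I \<longleftrightarrow>
     ideal I R \<and> I \<noteq> carrier R \<and>
     (\<forall>x\<in>carrier R. \<forall>y\<in>carrier R. x \<otimes>\<^bsub>R\<^esub> y \<in> I \<longrightarrow> x \<in> I \<or> y \<in> radical R I)"

abbreviation ideal_pow :: "('a, 'm) ring_scheme \<Rightarrow> 'a set \<Rightarrow> nat \<Rightarrow> 'a set" where
  "ideal_pow R I n \<equiv> I [^]\<^bsub>ideals_set R\<^esub> n"

definition reduction :: "('a, 'm) ring_scheme \<Rightarrow> 'a set \<Rightarrow> 'a set \<Rightarrow> bool" where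
  "reduction R K J \<longleftrightarrow>
     ideal K R \<and> ideal J R \<and> J \<subseteq> K \<and>
     (\<exists>n. ideal_prod R J (ideal_pow R K n) = ideal_pow R K (Suc n))"

definition minimal_reduction :: "('a, 'm) ring_scheme \<Rightarrow> 'a set \<Rightarrow> 'a set \<Rightarrow> bool" where
  "minimal_reduction R K J \<longleftrightarrow>
     reduction R K J \<and> (\<forall>J'. reduction R K J' \<longrightarrow> J' \<subseteq> J \<longrightarrow> J' = J)"


section \<open>The total ring of fractions\<close>

text \<open>
  The fraction \<open>r/s\<close> is the class of all pairs \<open>(r', s')\<close> with \<open>s'\<close> regular and \<open>r s' = r' s\<close>.
  Products and sums are unions over all representatives, as in \<^const>\<open>rcoset_mult\<close>; the sets in
  the union all coincide.
\<close>

definition fraction :: "('a, 'm) ring_scheme \<Rightarrow> 'a \<Rightarrow> 'a \<Rightarrow> ('a \<times> 'a) set" where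
  "fraction R r s = {(r', s'). r' \<in> carrier R \<and> regular_element R s' \<and> r \<otimes>\<^bsub>R\<^esub> s' = r' \<otimes>\<^bsub>R\<^esub> s}"

definition total_frac :: "('a, 'm) ring_scheme \<Rightarrow> ('a \<times> 'a) set ring" where
  "total_frac R =
     \<lparr>carrier = {fraction R r s | r s. r \<in> carrier R \<and> regular_element R s},
      monoid.mult = (\<lambda>p q. \<Union>(r, s)\<in>p. \<Union>(r', s')\<in>q. fraction R (r \<otimes>\<^bsub>R\<^esub> r') (s \<otimes>\<^bsub>R\<^esub> s')),
      monoid.one = fraction R \<one>\<^bsub>R\<^esub> \<one>\<^bsub>R\<^esub>,
      ring.zero = fraction R \<zero>\<^bsub>R\<^esub> \<one>\<^bsub>R\<^esub>,
      ring.add = (\<lambda>p q. \<Union>(r, s)\<in>p. \<Union>(r', s')\<in>q.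
               fraction R (r \<otimes>\<^bsub>R\<^esub> s' \<oplus>\<^bsub>R\<^esub> r' \<otimes>\<^bsub>R\<^esub> s) (s \<otimes>\<^bsub>R\<^esub> s'))\<rparr>"

definition emb :: "('a, 'm) ring_scheme \<Rightarrow> 'a \<Rightarrow> ('a \<times> 'a) set" where
  "emb R r = fraction R r \<one>\<^bsub>R\<^esub>"

text \<open>All subsets of \<open>Q(R)\<close> below are sets of fractions; \<open>R\<close> itself becomes \<open>base R\<close>.\<close>

abbreviation base :: "('a, 'm) ring_scheme \<Rightarrow> ('a \<times> 'a) set set" where
  "base R \<equiv> emb R ` carrier R"

definition integral_closure :: "('a, 'm) ring_scheme \<Rightarrow> ('a \<times> 'a) set set" where
  "integral_closure R =
     {q \<in> carrier (total_frac R). \<exists>(n::nat) c. c \<in> {..<n} \<rightarrow> carrier R \<and>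
        q [^]\<^bsub>total_frac R\<^esub> n \<oplus>\<^bsub>total_frac R\<^esub>
          (\<Oplus>\<^bsub>total_frac R\<^esub>i\<in>{..<n}. emb R (c i) \<otimes>\<^bsub>total_frac R\<^esub> q [^]\<^bsub>total_frac R\<^esub> i)
        = \<zero>\<^bsub>total_frac R\<^esub>}"

definition frac_colon ::
    "('a, 'm) ring_scheme \<Rightarrow> ('a \<times> 'a) set set \<Rightarrow> ('a \<times> 'a) set set \<Rightarrow> ('a \<times> 'a) set set" where
  "frac_colon R A B = {q \<in> carrier (total_frac R). \<forall>b\<in>B. q \<otimes>\<^bsub>total_frac R\<^esub> b \<in> A}"

definition frac_scale ::
    "('a, 'm) ring_scheme \<Rightarrow> ('a \<times> 'a) set \<Rightarrow> ('a \<times> 'a) set set \<Rightarrow> ('a \<times> 'a) set set" where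
  "frac_scale R q A = (\<lambda>h. q \<otimes>\<^bsub>total_frac R\<^esub> h) ` A"


section \<open>Modules\<close>

text \<open>The ring \<open>B\<close> as a module over \<open>A\<close> along a homomorphism \<open>\<phi>\<close> from \<open>A\<close> to \<open>B\<close>.\<close>

definition ring_as_module :: "('a \<Rightarrow> 'b) \<Rightarrow> 'b ring \<Rightarrow> ('a, 'b) module" where
  "ring_as_module \<phi> B = ring.extend B (module.fields (\<lambda>a b. \<phi> a \<otimes>\<^bsub>B\<^esub> b))"

abbreviation frac_module :: "('a, 'm) ring_scheme \<Rightarrow> ('a, ('a \<times> 'a) set) module" where
  "frac_module R \<equiv> ring_as_module (emb R) (total_frac R)"

abbreviation residue_field_module :: "('a, 'm) ring_scheme \<Rightarrow> 'a set \<Rightarrow> ('a, 'a set) module" where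
  "residue_field_module A \<nn> \<equiv> ring_as_module (\<lambda>a. \<nn> +>\<^bsub>A\<^esub> a) (A Quot \<nn>)"

text \<open>
  \<open>W/xW\<close> as a module over \<open>R/xR\<close>. The factor construction is used for its additive structure
  only: a module record extends a ring record, but its multiplication and unit carry no meaning.
\<close>

definition quotient_module ::
    "('a, 'm) ring_scheme \<Rightarrow> ('a, 'b, 'n) module_scheme \<Rightarrow> 'a \<Rightarrow> ('a set, 'b set) module" where
  "quotient_module R W x =
     (let xW = (\<lambda>w. x \<odot>\<^bsub>W\<^esub> w) ` carrier W
      in ring.extend (W Quot xW)
           (module.fields (\<lambda>A V. \<Union>r\<in>A. \<Union>w\<in>V. xW +>\<^bsub>W\<^esub> (r \<odot>\<^bsub>W\<^esub> w))))"

definition linear_maps ::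
    "('a, 'm) ring_scheme \<Rightarrow> ('a, 'b, 'n) module_scheme \<Rightarrow> ('a, 'c, 'k) module_scheme
      \<Rightarrow> ('b \<Rightarrow> 'c) set" where
  "linear_maps R M N =
     {f \<in> carrier M \<rightarrow> carrier N.
        (\<forall>x\<in>carrier M. \<forall>y\<in>carrier M. f (x \<oplus>\<^bsub>M\<^esub> y) = f x \<oplus>\<^bsub>N\<^esub> f y) \<and>
        (\<forall>r\<in>carrier R. \<forall>x\<in>carrier M. f (r \<odot>\<^bsub>M\<^esub> x) = r \<odot>\<^bsub>N\<^esub> f x)}"

definition fin_gen_module :: "('a, 'm) ring_scheme \<Rightarrow> ('a, 'b, 'n) module_scheme \<Rightarrow> bool" where
  "fin_gen_module R M \<longleftrightarrow>
     module R M \<and>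
     (\<exists>G. finite G \<and> G \<subseteq> carrier M \<and> (\<forall>N. submodule N R M \<longrightarrow> G \<subseteq> N \<longrightarrow> N = carrier M))"

text \<open>
  HOL cannot quantify over the element type of the test modules \<open>M\<close> and \<open>N\<close>. The element type of
  the ring loses nothing: it accommodates all ideals of \<open>R\<close>, and by Baer's criterion these
  suffice for injectivity.
\<close>

definition injective_module :: "('a, 'm) ring_scheme \<Rightarrow> ('a, 'b, 'n) module_scheme \<Rightarrow> bool" where
  "injective_module R E \<longleftrightarrow>
     module R E \<and>
     (\<forall>(M :: ('a, 'a) module) (N :: ('a, 'a) module). module R M \<longrightarrow> module R N \<longrightarrow>
        (\<forall>f\<in>linear_maps R M N. inj_on f (carrier M) \<longrightarrow>
           (\<forall>g\<in>linear_maps R M E. \<exists>h\<in>linear_maps R N E. \<forall>x\<in>carrier M. h (f x) = g x)))"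

definition injective_hull ::
    "('a, 'm) ring_scheme \<Rightarrow> ('a, 'b, 'n) module_scheme \<Rightarrow> ('a, 'c, 'k) module_scheme \<Rightarrow> bool" where
  "injective_hull R M E \<longleftrightarrow>
     module R M \<and> injective_module R E \<and>
     (\<exists>f\<in>linear_maps R M E. inj_on f (carrier M) \<and>
        (\<forall>N. submodule N R E \<longrightarrow> N \<noteq> {\<zero>\<^bsub>E\<^esub>} \<longrightarrow> N \<inter> f ` carrier M \<noteq> {\<zero>\<^bsub>E\<^esub>}))"


section \<open>Canonical modules and almost Gorenstein rings\<close>

text \<open>
  Canonical modules are defined as in Eisenbud's \<^emph>\<open>Commutative Algebra with a View Toward
  Algebraic Geometry\<close>, Chapter 21: for a zero-dimensional local ring it is the injective hull of
  the residue field, and a finitely generated module \<open>W\<close> over a one-dimensional Cohen-Macaulay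
  local ring is canonical if, for some \<open>x\<close> in the maximal ideal regular on \<open>R\<close> and on \<open>W\<close>, the
  module \<open>W/xW\<close> is canonical over \<open>R/xR\<close>.
\<close>

definition canonical_module_dim0 ::
    "('a, 'm) ring_scheme \<Rightarrow> ('a, 'b, 'n) module_scheme \<Rightarrow> bool" where
  "canonical_module_dim0 A W \<longleftrightarrow>
     (\<exists>\<nn>. local_ring A \<nn> \<and> injective_hull A (residue_field_module A \<nn>) W)"

definition canonical_module_dim1 ::
    "('a, 'm) ring_scheme \<Rightarrow> 'a set \<Rightarrow> ('a, 'b, 'n) module_scheme \<Rightarrow> bool" where
  "canonical_module_dim1 R \<mm> W \<longleftrightarrow>
     fin_gen_module R W \<and>
     (\<exists>x\<in>\<mm>. regular_element R x \<and>
        (\<forall>w\<in>carrier W. x \<odot>\<^bsub>W\<^esub> w = \<zero>\<^bsub>W\<^esub> \<longrightarrow> w = \<zero>\<^bsub>W\<^esub>) \<and>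
        canonical_module_dim0 (R Quot (PIdl\<^bsub>R\<^esub> x)) (quotient_module R W x))"

definition fractional_ideal :: "('a, 'm) ring_scheme \<Rightarrow> ('a \<times> 'a) set set \<Rightarrow> bool" where
  "fractional_ideal R H \<longleftrightarrow>
     submodule H R (frac_module R) \<and>
     (\<exists>y. regular_element R y \<and> frac_scale R (emb R y) H \<subseteq> base R)"

definition canonical_fractional_ideal ::
    "('a, 'm) ring_scheme \<Rightarrow> 'a set \<Rightarrow> ('a \<times> 'a) set set \<Rightarrow> bool" where
  "canonical_fractional_ideal R \<mm> \<omega> \<longleftrightarrow>
     fractional_ideal R \<omega> \<and> canonical_module_dim1 R \<mm> ((frac_module R)\<lparr>carrier := \<omega>\<rparr>)"

text \<open>
  \<open>Z = x y\<inverse> R\<close> for some regular \<open>y\<close> with \<open>yH \<subseteq> R\<close> and some minimal reduction \<open>xR\<close> of \<open>yH\<close>,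
  regarded as an ideal of \<open>R\<close>.
\<close>

definition frac_minimal_reduction ::
    "('a, 'm) ring_scheme \<Rightarrow> ('a \<times> 'a) set set \<Rightarrow> ('a \<times> 'a) set set \<Rightarrow> bool" where
  "frac_minimal_reduction R H Z \<longleftrightarrow>
     (\<exists>x y. x \<in> carrier R \<and> regular_element R y \<and>
        frac_scale R (emb R y) H \<subseteq> base R \<and>
        minimal_reduction R {r \<in> carrier R. emb R r \<in> frac_scale R (emb R y) H} (PIdl\<^bsub>R\<^esub> x) \<and>
        Z = frac_scale R (fraction R x y) (base R))"

text \<open>
  Being a canonical module is invariant under isomorphism, so a canonical module isomorphic to the
  fractional ideal \<open>\<omega>\<close> exists iff \<open>\<omega>\<close> is itself a canonical module.
\<close>

definition almost_gorenstein :: "('a, 'm) ring_scheme \<Rightarrow> bool" where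
  "almost_gorenstein S \<longleftrightarrow>
     (\<exists>\<nn>. cohen_macaulay_local S \<nn> \<and> krull_dim S = 1 \<and>
        (\<exists>\<omega>. canonical_fractional_ideal S \<nn> \<omega> \<and>
             base S \<subseteq> \<omega> \<and> \<omega> \<subseteq> frac_colon S (emb S ` \<nn>) (emb S ` \<nn>)))"


section \<open>The quadratic quotients of the Rees algebra\<close>

definition rees_algebra :: "('a, 'm) ring_scheme \<Rightarrow> 'a set \<Rightarrow> (nat \<Rightarrow> 'a) set" where
  "rees_algebra R I = {p \<in> carrier (UP R). \<forall>n. coeff (UP R) p n \<in> ideal_pow R I n}"

definition quadratic_poly :: "('a, 'm) ring_scheme \<Rightarrow> 'a \<Rightarrow> 'a \<Rightarrow> (nat \<Rightarrow> 'a)" where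
  "quadratic_poly R a b =
     monom (UP R) \<one>\<^bsub>R\<^esub> 2 \<oplus>\<^bsub>UP R\<^esub> monom (UP R) a 1 \<oplus>\<^bsub>UP R\<^esub> monom (UP R) b 0"

definition rees_quotient ::
    "('a, 'm) ring_scheme \<Rightarrow> 'a set \<Rightarrow> 'a \<Rightarrow> 'a \<Rightarrow> (nat \<Rightarrow> 'a) set ring" where
  "rees_quotient R I a b =
     (UP R)\<lparr>carrier := rees_algebra R I\<rparr> Quot
       (PIdl\<^bsub>UP R\<^esub> (quadratic_poly R a b) \<inter> rees_algebra R I)"

end

theory Submission
  imports Defs
begin

text \<open>
Write \<open>S\<close> for the quadratic quotient; its elements are \<open>r + it\<close> with \<open>t\<^sup>2 + at + b = 0\<close>, and
\<open>Q(S) = Q(R) + Q(R)t\<close>. Everything takes place inside these two rings of fractions once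
canonical fractional ideals have been described there without modules.

\<^bold>\<open>Dualizing fractional ideals.\<close> A regular fractional ideal \<open>W\<close> is called dualizing if for every regular
fractional ideal \<open>J\<close> and every fraction \<open>u\<close> outside \<open>J\<close> some fraction \<open>q\<close> has \<open>qJ \<subseteq> W\<close> but not
\<open>qu \<in> W\<close>; in other words \<open>(W : (W : J)) = J\<close> for all \<open>J\<close>. The theorem
\<open>canonical_fractional_ideal_iff\<close> says that these are exactly the canonical fractional ideals. A
canonical \<open>W\<close> has \<open>W/xW\<close> injective over \<open>R/xR\<close>, so homomorphisms from ideals containing \<open>x\<close> to
\<open>x\<^sup>-\<^sup>1W/W\<close> are multiplications; together with the socle of \<open>Q(R)/W\<close> this separates points from
ideals (\<open>dualizing_if_baer\<close>). Conversely, over a dualizing \<open>W\<close> the socle of \<open>Q(R)/W\<close> is simple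
and all homomorphisms \<open>J \<rightarrow> Q(R)/W\<close> are multiplications (\<open>dualizing_baer\<close>), which by Baer's
criterion makes \<open>W/xW\<close> the injective hull of the residue field. Dualizing ideals are unique up to
a unit of the ring of fractions (\<open>dualizing_unique\<close>).

\<^bold>\<open>The dual of the extension.\<close> If \<open>\<omega>\<close> is dualizing for \<open>R\<close>, then \<open>(\<omega> : I) + \<omega>t\<close> is dualizing for
\<open>S\<close> (\<open>ext_dual_dualizing\<close>): it consists of the elements \<open>q\<close> for which the coefficient of \<open>t\<close> in
every element of \<open>qS\<close> lies in \<open>\<omega>\<close>, and every pair of coefficient functionals comes from a
multiplication.

\<^bold>\<open>The criterion.\<close> Let \<open>H = (\<omega> : I)\<close>, \<open>V = z\<^sup>-\<^sup>1H\<close> and \<open>K = V + z\<^sup>-\<^sup>1\<omega>t\<close>, which contains \<open>1\<close>. Let \<open>\<nn>\<close> be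
the maximal ideal of \<open>S\<close>. If \<open>S\<close> is almost Gorenstein, uniqueness gives a unit \<open>w \<in> K\<close> with \<open>K\<nn> \<subseteq> w\<nn>\<close>. As \<open>zR\<close> is a reduction of \<open>H\<close>,
the coefficients of \<open>w\<close> stabilize a regular ideal, so the powers of \<open>w\<close> have a common
denominator and the chain \<open>\<nn> \<subseteq> w\<nn> \<subseteq> w\<^sup>2\<nn> \<subseteq> \<dots>\<close> is stationary. Hence \<open>w\<nn> = \<nn>\<close> and \<open>K\<nn> \<subseteq> \<nn>\<close>; reading
off coefficients, \<open>V\<mm> \<subseteq> \<mm>\<close> and \<open>VI \<subseteq> I\<close>, and the latter makes \<open>V\<close> a ring. Conversely, if \<open>V\<close> is a
ring with \<open>V\<mm> \<subseteq> \<mm>\<close>, then \<open>K\<close> itself is a canonical ideal containing \<open>S\<close>, and biduality of \<open>I\<close> with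
respect to \<open>\<omega>\<close> yields \<open>K\<nn> \<subseteq> \<nn>\<close>.
\<close>

section \<open>Submodules of a ring of fractions\<close>

definition submod :: "('q, 'm) ring_scheme \<Rightarrow> 'q set \<Rightarrow> 'q set \<Rightarrow> bool" where
  "submod Q A J \<longleftrightarrow> J \<subseteq> carrier Q \<and> \<zero>\<^bsub>Q\<^esub> \<in> J \<and>
     (\<forall>x\<in>J. \<forall>y\<in>J. x \<oplus>\<^bsub>Q\<^esub> y \<in> J) \<and> (\<forall>r\<in>A. \<forall>x\<in>J. r \<otimes>\<^bsub>Q\<^esub> x \<in> J)"

definition regular_fractional :: "('q, 'm) ring_scheme \<Rightarrow> 'q set \<Rightarrow> 'q set \<Rightarrow> bool" where
  "regular_fractional Q A J \<longleftrightarrow> submod Q A J \<and> J \<inter> Units Q \<noteq> {} \<and>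
     (\<exists>c\<in>A \<inter> Units Q. \<forall>x\<in>J. c \<otimes>\<^bsub>Q\<^esub> x \<in> A)"

text \<open>
Biduality \<open>(W : (W : J)) = J\<close>, phrased as separation of a fraction from an ideal that omits it. In
this form no choice of modules or of dual ideals enters.
\<close>

definition dualizing :: "('q, 'm) ring_scheme \<Rightarrow> 'q set \<Rightarrow> 'q set \<Rightarrow> bool" where
  "dualizing Q A W \<longleftrightarrow> regular_fractional Q A W \<and>
     (\<forall>J u. regular_fractional Q A J \<longrightarrow> u \<in> carrier Q - J \<longrightarrow>
        (\<exists>q\<in>carrier Q. (\<forall>j\<in>J. q \<otimes>\<^bsub>Q\<^esub> j \<in> W) \<and> q \<otimes>\<^bsub>Q\<^esub> u \<notin> W))"

definition adjoin :: "('q, 'm) ring_scheme \<Rightarrow> 'q set \<Rightarrow> 'q set \<Rightarrow> 'q \<Rightarrow> 'q set" where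
  "adjoin Q A J u = {j \<oplus>\<^bsub>Q\<^esub> r \<otimes>\<^bsub>Q\<^esub> u | j r. j \<in> J \<and> r \<in> A}"

text \<open>
A simplifier normal form for identities in a commutative ring. The order of the summands need not put a
monomial next to its negative, so that cancellation has to look past the summands in between.
\<close>

context cring
begin

lemma cancel_summand:
  assumes [simp]: "x \<in> carrier R" "p \<in> carrier R"
  shows "x \<oplus> (p \<oplus> \<ominus> x) = p" "u \<in> carrier R \<Longrightarrow> x \<oplus> (p \<oplus> (\<ominus> x \<oplus> u)) = p \<oplus> u"
proof -
  show "x \<oplus> (p \<oplus> \<ominus> x) = p" using a_lcomm[of x p "\<ominus> x"] by (simp add: r_neg)
  assume u: "u \<in> carrier R"
  have "x \<oplus> (p \<oplus> (\<ominus> x \<oplus> u)) = p \<oplus> (x \<oplus> (\<ominus> x \<oplus> u))" by (rule a_lcomm) (simp_all add: u)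
  then show "x \<oplus> (p \<oplus> (\<ominus> x \<oplus> u)) = p \<oplus> u" using u by (simp add: r_neg1 r_neg2)
qed

lemma cancel_summand2:
  assumes "x \<in> carrier R" "p \<in> carrier R" "q \<in> carrier R"
  shows "x \<oplus> (p \<oplus> (q \<oplus> \<ominus> x)) = p \<oplus> q"
    "u \<in> carrier R \<Longrightarrow> x \<oplus> (p \<oplus> (q \<oplus> (\<ominus> x \<oplus> u))) = p \<oplus> (q \<oplus> u)"
  using assms cancel_summand[where x = x and p = "p \<oplus> q"] by (simp_all add: a_assoc)

lemma cancel_summand3:
  assumes "x \<in> carrier R" "p \<in> carrier R" "q \<in> carrier R" "r \<in> carrier R"
  shows "x \<oplus> (p \<oplus> (q \<oplus> (r \<oplus> \<ominus> x))) = p \<oplus> (q \<oplus> r)"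
    "u \<in> carrier R \<Longrightarrow> x \<oplus> (p \<oplus> (q \<oplus> (r \<oplus> (\<ominus> x \<oplus> u)))) = p \<oplus> (q \<oplus> (r \<oplus> u))"
  using assms cancel_summand[where x = x and p = "p \<oplus> (q \<oplus> r)"] by (simp_all add: a_assoc)

lemma cancel_summand4:
  assumes "x \<in> carrier R" "p \<in> carrier R" "q \<in> carrier R" "r \<in> carrier R" "s \<in> carrier R"
  shows "x \<oplus> (p \<oplus> (q \<oplus> (r \<oplus> (s \<oplus> \<ominus> x)))) = p \<oplus> (q \<oplus> (r \<oplus> s))"
    "u \<in> carrier R \<Longrightarrow> x \<oplus> (p \<oplus> (q \<oplus> (r \<oplus> (s \<oplus> (\<ominus> x \<oplus> u))))) = p \<oplus> (q \<oplus> (r \<oplus> (s \<oplus> u)))"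
  using assms cancel_summand[where x = x and p = "p \<oplus> (q \<oplus> (r \<oplus> s))"] by (simp_all add: a_assoc)

lemma cancel_summand5:
  assumes "x \<in> carrier R" "p \<in> carrier R" "q \<in> carrier R" "r \<in> carrier R" "s \<in> carrier R" "t \<in> carrier R"
  shows "x \<oplus> (p \<oplus> (q \<oplus> (r \<oplus> (s \<oplus> (t \<oplus> \<ominus> x))))) = p \<oplus> (q \<oplus> (r \<oplus> (s \<oplus> t)))"
    "u \<in> carrier R \<Longrightarrow> x \<oplus> (p \<oplus> (q \<oplus> (r \<oplus> (s \<oplus> (t \<oplus> (\<ominus> x \<oplus> u)))))) = p \<oplus> (q \<oplus> (r \<oplus> (s \<oplus> (t \<oplus> u))))"
  using assms cancel_summand[where x = x and p = "p \<oplus> (q \<oplus> (r \<oplus> (s \<oplus> t)))"] by (simp_all add: a_assoc)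

lemmas ring_norm = minus_eq l_distr r_distr l_minus r_minus minus_add minus_minus
  a_assoc a_comm a_lcomm m_assoc m_comm m_lcomm r_neg l_neg r_neg1 r_neg2 cancel_summand
  cancel_summand2 cancel_summand3 cancel_summand4 cancel_summand5

lemma ring_eqI:
  assumes "x \<ominus> y = \<zero>" "x \<in> carrier R" "y \<in> carrier R"
  shows "x = y"
  using assms by (simp add: r_right_minus_eq)

end

text \<open>
An abstract ring \<open>Q\<close> of fractions of its subring \<open>A\<close>: regular denominators are the elements of \<open>A\<close>
that are units of \<open>Q\<close>. Both the ring of fractions of \<open>R\<close> and that of the quadratic quotient are
instances, so that duality theory is developed once.
\<close>

locale fraction_pair = cring Q for Q (structure) +
  fixes A :: "'a set"
  assumes subringA: "subring A Q"
    and fraction_form: "q \<in> carrier Q \<Longrightarrow> \<exists>s\<in>A \<inter> Units Q. s \<otimes> q \<in> A"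
begin

abbreviation smod where "smod \<equiv> submod Q A"

lemma A_carr [simp]: "r \<in> A \<Longrightarrow> r \<in> carrier Q"
  using subringE(1)[OF subringA] by auto

lemma A_closed [simp]:
  "\<zero> \<in> A" "\<one> \<in> A" "r \<in> A \<Longrightarrow> s \<in> A \<Longrightarrow> r \<oplus> s \<in> A" "r \<in> A \<Longrightarrow> s \<in> A \<Longrightarrow> r \<otimes> s \<in> A"
  "r \<in> A \<Longrightarrow> \<ominus> r \<in> A" "r \<in> A \<Longrightarrow> s \<in> A \<Longrightarrow> r \<ominus> s \<in> A"
  using subringE[OF subringA] by (auto simp: a_minus_def)

lemma smodD:
  assumes "smod J"
  shows "x \<in> J \<Longrightarrow> x \<in> carrier Q" "\<zero> \<in> J" "x \<in> J \<Longrightarrow> y \<in> J \<Longrightarrow> x \<oplus> y \<in> J"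
    "r \<in> A \<Longrightarrow> x \<in> J \<Longrightarrow> r \<otimes> x \<in> J"
  using assms by (auto simp: submod_def)

lemma smod_uminus:
  assumes "smod J" "x \<in> J"
  shows "\<ominus> x \<in> J"
proof -
  have [simp]: "x \<in> carrier Q" using smodD(1)[OF assms(1)] assms(2) .
  have "\<ominus> x = \<ominus> \<one> \<otimes> x" by ((simp add: ring_norm; fail) | (rule ring_eqI, (simp add: ring_norm; fail), simp_all))
  then show ?thesis using smodD(4)[OF assms(1), of "\<ominus> \<one>" x] assms(2) by simp
qed

lemma smod_minus:
  assumes "smod J" "x \<in> J" "y \<in> J"
  shows "x \<ominus> y \<in> J"
  using smodD(3)[OF assms(1,2) smod_uminus[OF assms(1,3)]] by (simp add: a_minus_def)

lemma smod_minus_cancel: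
  assumes "smod J" "x \<in> carrier Q" "y \<in> J" "x \<ominus> y \<in> J"
  shows "x \<in> J"
proof -
  have [simp]: "y \<in> carrier Q" using smodD(1)[OF assms(1,3)] .
  note assms(2)[simp]
  have "x = (x \<ominus> y) \<oplus> y" by ((simp add: ring_norm; fail) | (rule ring_eqI, (simp add: ring_norm; fail), simp_all))
  then show ?thesis using smodD(3)[OF assms(1,4,3)] by simp
qed

lemma smod_minus_cancel2:
  assumes "smod J" "y \<in> carrier Q" "x \<in> J" "x \<ominus> y \<in> J"
  shows "y \<in> J"
proof -
  have [simp]: "x \<in> carrier Q" using smodD(1)[OF assms(1,3)] .
  note assms(2)[simp]
  have "y = x \<ominus> (x \<ominus> y)" by ((simp add: ring_norm; fail) | (rule ring_eqI, (simp add: ring_norm; fail), simp_all))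
  then show ?thesis using smod_minus[OF assms(1,3,4)] by simp
qed

lemma smod_A: "smod A"
  by (auto simp: submod_def)

lemma smod_scale:
  assumes "smod J" and [simp]: "c \<in> carrier Q"
  shows "smod ((\<lambda>x. c \<otimes> x) ` J)"
proof -
  have 1: "c \<otimes> x \<oplus> c \<otimes> y = c \<otimes> (x \<oplus> y)" "r \<otimes> (c \<otimes> x) = c \<otimes> (r \<otimes> x)"
    if [simp]: "x \<in> carrier Q" "y \<in> carrier Q" "r \<in> carrier Q" for x y r
    by ((simp add: ring_norm; fail) | (rule ring_eqI, (simp add: ring_norm; fail), simp, simp))+
  note J = smodD[OF assms(1)]
  show ?thesis
    unfolding submod_def
  proof (intro conjI ballI)
    show "(\<lambda>x. c \<otimes> x) ` J \<subseteq> carrier Q" using J by auto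
    show "\<zero> \<in> (\<lambda>x. c \<otimes> x) ` J" using imageI[OF J(2), of "\<lambda>x. c \<otimes> x"] by simp
    show "x \<oplus> y \<in> (\<lambda>x. c \<otimes> x) ` J" if "x \<in> (\<lambda>x. c \<otimes> x) ` J" "y \<in> (\<lambda>x. c \<otimes> x) ` J" for x y
    proof -
      from that obtain x' y' where xy: "x' \<in> J" "x = c \<otimes> x'" "y' \<in> J" "y = c \<otimes> y'" by auto
      have e: "x \<oplus> y = c \<otimes> (x' \<oplus> y')" unfolding xy(2,4) using 1(1)[OF J(1)[OF xy(1)] J(1)[OF xy(3)] zero_closed] .
      show ?thesis unfolding e by (rule imageI) (rule J(3)[OF xy(1,3)])
    qed
    show "r \<otimes> x \<in> (\<lambda>x. c \<otimes> x) ` J" if "r \<in> A" "x \<in> (\<lambda>x. c \<otimes> x) ` J" for r x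
    proof -
      from that obtain x' where x: "x' \<in> J" "x = c \<otimes> x'" by auto
      have e: "r \<otimes> x = c \<otimes> (r \<otimes> x')" unfolding x(2) using 1(2)[OF J(1)[OF x(1)] zero_closed] A_carr[OF that(1)] .
      show ?thesis unfolding e by (rule imageI) (rule J(4)[OF that(1) x(1)])
    qed
  qed
qed

lemma smod_colon:
  assumes "smod W" "J \<subseteq> carrier Q"
  shows "smod {q \<in> carrier Q. \<forall>j\<in>J. q \<otimes> j \<in> W}"
proof -
  have 1: "r \<otimes> q \<otimes> j = r \<otimes> (q \<otimes> j)" "(q \<oplus> q') \<otimes> j = q \<otimes> j \<oplus> q' \<otimes> j"
    if [simp]: "r \<in> carrier Q" "q \<in> carrier Q" "q' \<in> carrier Q" "j \<in> carrier Q" for r q q' j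
    by ((simp add: ring_norm; fail) | (rule ring_eqI, (simp add: ring_norm; fail), simp, simp))+
  show ?thesis
    unfolding submod_def using smodD[OF assms(1)] assms(2)
    by (auto simp: 1 subset_iff)
qed

lemma smod_colon1:
  assumes "smod W" "u \<in> carrier Q"
  shows "smod {r \<in> A. r \<otimes> u \<in> W}"
proof -
  note [simp] = assms(2)
  have 1: "r \<otimes> q \<otimes> u = r \<otimes> (q \<otimes> u)" "(q \<oplus> r) \<otimes> u = q \<otimes> u \<oplus> r \<otimes> u"
    if [simp]: "r \<in> carrier Q" "q \<in> carrier Q" for r q
    by ((simp add: ring_norm; fail) | (rule ring_eqI, (simp add: ring_norm; fail), simp, simp))+
  show ?thesis
    unfolding submod_def using smodD[OF assms(1)] assms(2)
    by (auto simp: 1 subset_iff)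
qed

lemma adjoin_cases:
  assumes "v \<in> adjoin Q A J u"
  obtains j r where "j \<in> J" "r \<in> A" "v = j \<oplus> r \<otimes> u"
  using assms unfolding adjoin_def by blast

lemma adjoinI: "j \<in> J \<Longrightarrow> r \<in> A \<Longrightarrow> v = j \<oplus> r \<otimes> u \<Longrightarrow> v \<in> adjoin Q A J u"
  unfolding adjoin_def by blast

lemma adjoin:
  assumes "smod J" and [simp]: "u \<in> carrier Q"
  shows "smod (adjoin Q A J u)" "J \<subseteq> adjoin Q A J u" "u \<in> adjoin Q A J u"
proof -
  note J = smodD[OF assms(1)]
  have 1: "(j \<oplus> r \<otimes> u) \<oplus> (j' \<oplus> r' \<otimes> u) = (j \<oplus> j') \<oplus> (r \<oplus> r') \<otimes> u"
    "r \<otimes> (j \<oplus> r' \<otimes> u) = r \<otimes> j \<oplus> (r \<otimes> r') \<otimes> u"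
    if [simp]: "j \<in> carrier Q" "r \<in> carrier Q" "j' \<in> carrier Q" "r' \<in> carrier Q" for j r j' r'
    by ((simp add: ring_norm; fail) | (rule ring_eqI, (simp add: ring_norm; fail), simp, simp))+
  have 2: "j \<oplus> \<zero> \<otimes> u = j" "\<zero> \<oplus> \<one> \<otimes> u = u" if [simp]: "j \<in> carrier Q" for j by ((simp add: ring_norm; fail) | (rule ring_eqI, (simp add: ring_norm; fail), simp, simp))+
  show A: "J \<subseteq> adjoin Q A J u"
  proof
    fix j assume j: "j \<in> J"
    show "j \<in> adjoin Q A J u"
      unfolding adjoin_def
      by (intro CollectI exI[of _ j] exI[of _ "\<zero>"]) (use j J(1) in simp)
  qed
  show "u \<in> adjoin Q A J u"
    unfolding adjoin_def
    by (rule CollectI, rule exI[of _ "\<zero>"], rule exI[of _ "\<one>"]) (use J(2) in simp)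
  show "smod (adjoin Q A J u)"
    unfolding submod_def
  proof (intro conjI ballI)
    show "adjoin Q A J u \<subseteq> carrier Q" unfolding adjoin_def using J by auto
    show "\<zero> \<in> adjoin Q A J u" using A J by auto
    show "x \<oplus> y \<in> adjoin Q A J u" if "x \<in> adjoin Q A J u" "y \<in> adjoin Q A J u" for x y
    proof -
      from that(1) obtain j r where x: "j \<in> J" "r \<in> A" "x = j \<oplus> r \<otimes> u" by (rule adjoin_cases)
      from that(2) obtain j' r' where y: "j' \<in> J" "r' \<in> A" "y = j' \<oplus> r' \<otimes> u" by (rule adjoin_cases)
      show ?thesis
        unfolding x(3) y(3) 1(1)[OF J(1)[OF x(1)] A_carr[OF x(2)] J(1)[OF y(1)] A_carr[OF y(2)]]
        by (rule adjoinI[OF J(3)[OF x(1) y(1)] A_closed(3)[OF x(2) y(2)] refl])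
    qed
    show "r \<otimes> x \<in> adjoin Q A J u" if "r \<in> A" "x \<in> adjoin Q A J u" for r x
    proof -
      from that(2) obtain j r' where x: "j \<in> J" "r' \<in> A" "x = j \<oplus> r' \<otimes> u" by (rule adjoin_cases)
      show ?thesis
        unfolding x(3) 1(2)[OF J(1)[OF x(1)] A_carr[OF that(1)] J(1)[OF x(1)] A_carr[OF x(2)]]
        by (rule adjoinI[OF J(4)[OF that(1) x(1)] A_closed(4)[OF that(1) x(2)] refl])
    qed
  qed
qed

lemma UnitsE:
  assumes "u \<in> Units Q"
  obtains v where "u \<in> carrier Q" "v \<in> carrier Q" "v \<in> Units Q" "u \<otimes> v = \<one>" "v \<otimes> u = \<one>"
  using assms Units_inv_Units Units_inv_closed Units_l_inv Units_r_inv Units_closed by metis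

lemma unit_cancel:
  assumes "u \<in> Units Q" "x \<in> carrier Q" "y \<in> carrier Q" "u \<otimes> x = u \<otimes> y"
  shows "x = y"
  using assms Units_l_cancel by blast

lemma regular_fractionalD:
  assumes "regular_fractional Q A J"
  shows "smod J" "\<exists>u\<in>J. u \<in> Units Q" "\<exists>c\<in>A. c \<in> Units Q \<and> (\<forall>x\<in>J. c \<otimes> x \<in> A)"
  using assms unfolding regular_fractional_def by auto

lemma regular_fractionalI:
  assumes "smod J" "u \<in> J" "u \<in> Units Q" "c \<in> A" "c \<in> Units Q" "\<And>x. x \<in> J \<Longrightarrow> c \<otimes> x \<in> A"
  shows "regular_fractional Q A J"
  using assms unfolding regular_fractional_def by auto

lemma regular_fractional_adjoin:
  assumes "regular_fractional Q A J" and [simp]: "v \<in> carrier Q"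
  shows "regular_fractional Q A (adjoin Q A J v)"
proof -
  note J = regular_fractionalD[OF assms(1)]
  obtain u c where u: "u \<in> J" "u \<in> Units Q" and c: "c \<in> A" "c \<in> Units Q" "\<And>x. x \<in> J \<Longrightarrow> c \<otimes> x \<in> A"
    using J by blast
  obtain s where s: "s \<in> A" "s \<in> Units Q" "s \<otimes> v \<in> A" using fraction_form[OF assms(2)] by auto
  show ?thesis
  proof (rule regular_fractionalI)
    show "smod (adjoin Q A J v)" using adjoin[OF J(1) assms(2)] by blast
    show "u \<in> adjoin Q A J v" using adjoin[OF J(1) assms(2)] u by blast
    show "u \<in> Units Q" by fact
    show "c \<otimes> s \<in> A" "c \<otimes> s \<in> Units Q" using c s by auto
    fix x assume "x \<in> adjoin Q A J v"
    then obtain j r where j: "j \<in> J" "r \<in> A" "x = j \<oplus> r \<otimes> v" by (rule adjoin_cases)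
    have [simp]: "j \<in> carrier Q" "r \<in> carrier Q" "c \<in> carrier Q" "s \<in> carrier Q"
      using j c s smodD[OF J(1)] by auto
    have "c \<otimes> s \<otimes> x = s \<otimes> (c \<otimes> j) \<oplus> c \<otimes> r \<otimes> (s \<otimes> v)" unfolding j by ((simp add: ring_norm; fail) | (rule ring_eqI, (simp add: ring_norm; fail), simp_all))
    then show "c \<otimes> s \<otimes> x \<in> A" using j c s by simp
  qed
qed

lemma regular_fractional_scale:
  assumes "regular_fractional Q A J" and v: "v \<in> Units Q"
  shows "regular_fractional Q A ((\<lambda>x. v \<otimes> x) ` J)"
proof -
  note J = regular_fractionalD[OF assms(1)]
  have [simp]: "v \<in> carrier Q" using v by auto
  obtain u c where u: "u \<in> J" "u \<in> Units Q" and c: "c \<in> A" "c \<in> Units Q" "\<And>x. x \<in> J \<Longrightarrow> c \<otimes> x \<in> A"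
    using J by blast
  obtain s where s: "s \<in> A" "s \<in> Units Q" "s \<otimes> v \<in> A" using fraction_form[of v] by auto
  show ?thesis
  proof (rule regular_fractionalI)
    show "smod ((\<lambda>x. v \<otimes> x) ` J)" using smod_scale[OF J(1)] by simp
    show "v \<otimes> u \<in> (\<lambda>x. v \<otimes> x) ` J" using u by blast
    show "v \<otimes> u \<in> Units Q" using u v by auto
    show "s \<otimes> c \<in> A" "s \<otimes> c \<in> Units Q" using c s by auto
    fix x assume "x \<in> (\<lambda>x. v \<otimes> x) ` J"
    then obtain j where j: "j \<in> J" "x = v \<otimes> j" by blast
    have [simp]: "j \<in> carrier Q" "c \<in> carrier Q" "s \<in> carrier Q"
      using j c s smodD[OF J(1)] by auto
    have "s \<otimes> c \<otimes> x = (s \<otimes> v) \<otimes> (c \<otimes> j)" unfolding j by ((simp add: ring_norm; fail) | (rule ring_eqI, (simp add: ring_norm; fail), simp_all))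
    then show "s \<otimes> c \<otimes> x \<in> A" using j c s by simp
  qed
qed

lemma dualizingD:
  assumes "dualizing Q A W"
  shows "regular_fractional Q A W" "smod W"
    "\<And>J u. regular_fractional Q A J \<Longrightarrow> u \<in> carrier Q \<Longrightarrow> u \<notin> J \<Longrightarrow>
       \<exists>q\<in>carrier Q. (\<forall>j\<in>J. q \<otimes> j \<in> W) \<and> q \<otimes> u \<notin> W"
  using assms unfolding dualizing_def regular_fractional_def by auto

lemma dualizing_scale:
  assumes W: "dualizing Q A W" and v: "v \<in> Units Q"
  shows "dualizing Q A ((\<lambda>x. v \<otimes> x) ` W)"
proof -
  have [simp]: "v \<in> carrier Q" using v by auto
  show ?thesis
    unfolding dualizing_def
  proof (intro conjI allI impI)
    show "regular_fractional Q A ((\<lambda>x. v \<otimes> x) ` W)"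
      using regular_fractional_scale dualizingD(1)[OF W] v by simp
    fix J u assume J: "regular_fractional Q A J" and u: "u \<in> carrier Q - J"
    obtain q where q: "q \<in> carrier Q" "\<And>j. j \<in> J \<Longrightarrow> q \<otimes> j \<in> W" "q \<otimes> u \<notin> W"
      using dualizingD(3)[OF W J, of u] u by auto
    have "v \<otimes> q \<otimes> j = v \<otimes> (q \<otimes> j)" if [simp]: "j \<in> carrier Q" for j using q(1) by (simp add: m_assoc)
    moreover have "v \<otimes> (q \<otimes> u) \<notin> (\<lambda>x. v \<otimes> x) ` W"
    proof
      assume "v \<otimes> (q \<otimes> u) \<in> (\<lambda>x. v \<otimes> x) ` W"
      then obtain w where w: "w \<in> W" "v \<otimes> (q \<otimes> u) = v \<otimes> w" by blast
      then have "q \<otimes> u = w" using unit_cancel[OF v, of "q \<otimes> u" w] q(1) u smodD(1)[OF dualizingD(2)[OF W]] by auto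
      then show False using q w by simp
    qed
    ultimately show "\<exists>q\<in>carrier Q. (\<forall>j\<in>J. q \<otimes> j \<in> (\<lambda>x. v \<otimes> x) ` W) \<and> q \<otimes> u \<notin> (\<lambda>x. v \<otimes> x) ` W"
      using q u smodD(1)[OF regular_fractionalD(1)[OF J]] by (intro bexI[of _ "v \<otimes> q"]) auto
  qed
qed

lemma dualizing_colon_self:
  assumes "dualizing Q A W" "q \<in> carrier Q" "\<And>w. w \<in> W \<Longrightarrow> q \<otimes> w \<in> W"
  shows "q \<in> A"
proof (rule ccontr)
  assume n: "q \<notin> A"
  have "regular_fractional Q A A"
    by (rule regular_fractionalI[of _ "\<one>" "\<one>"]) (auto simp: smod_A)
  from dualizingD(3)[OF assms(1) this assms(2) n] obtain p
    where p: "p \<in> carrier Q" "\<And>j. j \<in> A \<Longrightarrow> p \<otimes> j \<in> W" "p \<otimes> q \<notin> W" by blast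
  have "p \<in> W" using p(1) p(2)[of \<one>] by simp
  then show False using assms(3)[of p] p assms(2) by (simp add: m_comm)
qed

end

text \<open>
The traces in \<open>Q\<close> of the properties of a one-dimensional Cohen-Macaulay local ring: it is
Noetherian and local, every prime ideal with a regular element is maximal, and there is a regular
element that is not a unit.
\<close>

locale one_dim_local_pair = fraction_pair +
  fixes \<mm> :: "'a set"
  assumes maxideal: "submod Q A \<mm>" "\<mm> \<subseteq> A" "\<one> \<notin> \<mm>"
    and invertible: "r \<in> A \<Longrightarrow> r \<notin> \<mm> \<Longrightarrow> \<exists>s\<in>A. r \<otimes> s = \<one>"
    and maximal_condition:
      "F \<noteq> {} \<Longrightarrow> (\<And>J. J \<in> F \<Longrightarrow> submod Q A J \<and> J \<subseteq> A) \<Longrightarrow> \<exists>M\<in>F. \<forall>J\<in>F. M \<subseteq> J \<longrightarrow> J = M"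
    and regular_prime:
      "submod Q A P \<Longrightarrow> P \<subseteq> A \<Longrightarrow> \<one> \<notin> P \<Longrightarrow> (\<And>r s. r \<in> A \<Longrightarrow> s \<in> A \<Longrightarrow> r \<otimes> s \<in> P \<Longrightarrow> r \<in> P \<or> s \<in> P) \<Longrightarrow>
         P \<inter> Units Q \<noteq> {} \<Longrightarrow> P = \<mm>"
    and regular_parameter: "\<mm> \<inter> Units Q \<noteq> {}"
begin

lemma mm_A [simp]: "r \<in> \<mm> \<Longrightarrow> r \<in> A" using maxideal by auto

lemma one_minus_invertible:
  assumes "r \<in> \<mm>"
  shows "\<exists>s\<in>A. (\<one> \<ominus> r) \<otimes> s = \<one>"
proof (rule invertible)
  show "\<one> \<ominus> r \<in> A" using assms by simp
  show "\<one> \<ominus> r \<notin> \<mm>"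
    using smod_minus_cancel[OF maxideal(1), of \<one> r] assms maxideal(3) by auto
qed

text \<open>
Multiplication by the common denominator \<open>c\<close> embeds the family into the ideals of \<open>A\<close>.
\<close>

lemma maximal_condition_frac:
  assumes "F \<noteq> {}" "\<And>J. J \<in> F \<Longrightarrow> smod J" "c \<in> Units Q" "\<And>J x. J \<in> F \<Longrightarrow> x \<in> J \<Longrightarrow> c \<otimes> x \<in> A"
  shows "\<exists>M\<in>F. \<forall>J\<in>F. M \<subseteq> J \<longrightarrow> J = M"
proof -
  have [simp]: "c \<in> carrier Q" using assms by auto
  have inj: "J = M" if "J \<in> F" "M \<in> F" "(\<lambda>x. c \<otimes> x) ` J = (\<lambda>x. c \<otimes> x) ` M" for J M
  proof -
    have "inj_on (\<lambda>x. c \<otimes> x) (carrier Q)" using unit_cancel[OF assms(3)] by (auto simp: inj_on_def)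
    then show ?thesis using that assms(2) by (meson inj_on_image_eq_iff submod_def)
  qed
  have "\<exists>M\<in>(`) (\<lambda>x. c \<otimes> x) ` F. \<forall>J\<in>(`) (\<lambda>x. c \<otimes> x) ` F. M \<subseteq> J \<longrightarrow> J = M"
    by (rule maximal_condition) (use assms smod_scale in auto)
  then obtain M where M: "M \<in> F" "\<And>J. J \<in> F \<Longrightarrow> (\<lambda>x. c \<otimes> x) ` M \<subseteq> (\<lambda>x. c \<otimes> x) ` J \<Longrightarrow> (\<lambda>x. c \<otimes> x) ` J = (\<lambda>x. c \<otimes> x) ` M"
    by auto
  show ?thesis using M inj by (intro bexI[of _ M]) (auto simp: image_mono)
qed

text \<open>
Among the annihilators of the nonzero multiples of \<open>u0\<close> modulo \<open>J\<close>, a maximal one is prime. It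
contains a regular element, because \<open>J\<close> does, and so it is the maximal ideal.
\<close>

lemma socle_element:
  assumes J: "smod J" and v: "v \<in> J" "v \<in> Units Q" and u0: "u0 \<in> carrier Q" "u0 \<notin> J"
  shows "\<exists>s\<in>A. s \<otimes> u0 \<notin> J \<and> (\<forall>r\<in>\<mm>. r \<otimes> (s \<otimes> u0) \<in> J)"
proof -
  note [simp] = u0(1)
  note JD = smodD[OF J]
  define ann where "ann s = {r \<in> A. r \<otimes> (s \<otimes> u0) \<in> J}" for s
  define F where "F = ann ` {s \<in> A. s \<otimes> u0 \<notin> J}"
  have smod_ann: "smod (ann s)" if "s \<in> A" for s
    unfolding ann_def by (rule smod_colon1) (use J that in auto)
  have "\<exists>M\<in>F. \<forall>J\<in>F. M \<subseteq> J \<longrightarrow> J = M"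
  proof (rule maximal_condition)
    show "F \<noteq> {}" unfolding F_def using u0(2) by (auto intro!: exI[of _ "\<one>"])
    show "smod J \<and> J \<subseteq> A" if "J \<in> F" for J
      using that smod_ann by (auto simp: F_def ann_def)
  qed
  then obtain s where s: "s \<in> A" "s \<otimes> u0 \<notin> J"
    and max: "\<And>s'. s' \<in> A \<Longrightarrow> s' \<otimes> u0 \<notin> J \<Longrightarrow> ann s \<subseteq> ann s' \<Longrightarrow> ann s' = ann s"
    unfolding F_def by auto
  have "ann s = \<mm>"
  proof (rule regular_prime)
    show "smod (ann s)" using smod_ann s by simp
    show "ann s \<subseteq> A" by (auto simp: ann_def)
    show "\<one> \<notin> ann s" using s by (auto simp: ann_def)
    fix r t assume r: "r \<in> A" and t: "t \<in> A" and rt: "r \<otimes> t \<in> ann s"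
    show "r \<in> ann s \<or> t \<in> ann s"
    proof (rule disjCI)
      assume "t \<notin> ann s"
      then have 1: "(t \<otimes> s) \<otimes> u0 \<notin> J" using t s by (simp add: ann_def m_assoc)
      have "ann s \<subseteq> ann (t \<otimes> s)"
      proof
        fix a assume a: "a \<in> ann s"
        then have [simp]: "a \<in> carrier Q" "t \<in> carrier Q" "s \<in> carrier Q" using t s by (auto simp: ann_def)
        have "a \<otimes> (t \<otimes> s \<otimes> u0) = t \<otimes> (a \<otimes> (s \<otimes> u0))" by ((simp add: ring_norm; fail) | (rule ring_eqI, (simp add: ring_norm; fail), simp_all))
        then show "a \<in> ann (t \<otimes> s)" using a JD t by (auto simp: ann_def)
      qed
      then have "ann (t \<otimes> s) = ann s" using max 1 t s by auto
      moreover have "r \<in> ann (t \<otimes> s)" using rt r t s by (simp add: ann_def m_assoc)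
      ultimately show "r \<in> ann s" by simp
    qed
  next
    obtain w where w: "v \<in> carrier Q" "w \<in> carrier Q" "v \<otimes> w = \<one>" using UnitsE[OF v(2)] by metis
    obtain d where d: "d \<in> A" "d \<in> Units Q" "d \<otimes> (w \<otimes> (s \<otimes> u0)) \<in> A"
      using fraction_form[of "w \<otimes> (s \<otimes> u0)"] w s by auto
    have [simp]: "w \<in> carrier Q" "v \<in> carrier Q" "s \<in> carrier Q" "d \<in> carrier Q" using w s d by auto
    have "d \<otimes> (s \<otimes> u0) = \<one> \<otimes> (d \<otimes> (s \<otimes> u0))" by ((simp add: ring_norm; fail) | (rule ring_eqI, (simp add: ring_norm; fail), simp_all))
    also have "\<dots> = (d \<otimes> (w \<otimes> (s \<otimes> u0))) \<otimes> v" unfolding w(3)[symmetric] by ((simp add: ring_norm; fail) | (rule ring_eqI, (simp add: ring_norm; fail), simp_all))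
    finally have "d \<in> ann s" using d v JD(4)[of "d \<otimes> (w \<otimes> (s \<otimes> u0))" v] by (simp add: ann_def)
    then show "ann s \<inter> Units Q \<noteq> {}" using d by auto
  qed
  then show ?thesis using s by (auto simp: ann_def intro!: bexI[of _ s])
qed

text \<open>
The chain of the ideals \<open>(J : x\<^sup>n)\<close> becomes stationary at some \<open>n\<close>. If \<open>(J : x\<^sup>n)\<close> were proper, a socle
element of it would be multiplied by \<open>x\<close> into it and lie in \<open>(J : x\<^sup>n\<^sup>+\<^sup>1)\<close>.
\<close>

lemma power_in_regular_ideal:
  assumes J: "smod J" "J \<subseteq> A" and v: "v \<in> J" "v \<in> Units Q" and x: "x \<in> \<mm>"
  shows "\<exists>n::nat. x [^] n \<in> J"
proof (rule ccontr)
  assume n: "\<nexists>n::nat. x [^] n \<in> J"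
  have [simp]: "x \<in> A" "x \<in> carrier Q" using x mm_A by (auto intro: A_carr)
  have xn [simp]: "x [^] n \<in> A" for n :: nat by (induction n) auto
  define K where "K n = {r \<in> A. r \<otimes> x [^] (n::nat) \<in> J}" for n
  have K: "smod (K n)" for n unfolding K_def by (rule smod_colon1) (use J in auto)
  have "\<exists>M\<in>range K. \<forall>J\<in>range K. M \<subseteq> J \<longrightarrow> J = M"
    by (rule maximal_condition) (use K in \<open>auto simp: K_def\<close>)
  then obtain n where n0: "\<And>k. K n \<subseteq> K k \<Longrightarrow> K k = K n" by auto
  have vA: "v \<in> A" using v J by auto
  have vK: "v \<in> K n" using vA v smodD(4)[OF J(1), of "x [^] n" v] by (simp add: K_def m_comm)
  have "\<one> \<notin> K n" using n by (auto simp: K_def)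
  from socle_element[OF K vK v(2) _ this] obtain s
    where s: "s \<in> A" "s \<notin> K n" "\<And>r. r \<in> \<mm> \<Longrightarrow> r \<otimes> s \<in> K n" by auto
  have "x \<otimes> s \<otimes> x [^] n = s \<otimes> x [^] Suc n" using s by (simp add: m_ac)
  then have "s \<in> K (Suc n)" using s(3)[OF x] s(1) by (simp add: K_def)
  moreover have "K n \<subseteq> K (Suc n)"
  proof
    fix a assume a: "a \<in> K n"
    then have "a \<otimes> x [^] Suc n = x \<otimes> (a \<otimes> x [^] n)" by (simp add: K_def m_ac)
    then show "a \<in> K (Suc n)" using a smodD(4)[OF J(1)] by (simp add: K_def)
  qed
  ultimately show False using n0 s(2) by blast
qed

text \<open>
Nakayama's lemma for a fractional ideal \<open>J\<close>: the third assumption says that \<open>N + \<mm>J = J\<close>, since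
the submodules \<open>N'\<close> in it are those between \<open>N + \<mm>J\<close> and \<open>J\<close>.
\<close>

lemma nakayama:
  assumes J: "smod J" "c \<in> Units Q" "\<And>x. x \<in> J \<Longrightarrow> c \<otimes> x \<in> A"
    and N: "smod N" "N \<subseteq> J"
    and gen: "\<And>N'. smod N' \<Longrightarrow> N \<subseteq> N' \<Longrightarrow> N' \<subseteq> J \<Longrightarrow> (\<And>r j. r \<in> \<mm> \<Longrightarrow> j \<in> J \<Longrightarrow> r \<otimes> j \<in> N') \<Longrightarrow> N' = J"
  shows "N = J"
proof (rule ccontr)
  assume neq: "N \<noteq> J"
  define F where "F = {M. smod M \<and> N \<subseteq> M \<and> M \<subset> J}"
  have "\<exists>M\<in>F. \<forall>J\<in>F. M \<subseteq> J \<longrightarrow> J = M"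
    by (rule maximal_condition_frac[of _ c]) (use assms neq in \<open>auto simp: F_def\<close>)
  then obtain M where MF: "M \<in> F" and maxF: "\<forall>J\<in>F. M \<subseteq> J \<longrightarrow> J = M" by blast
  have M: "smod M" "N \<subseteq> M" "M \<subset> J" using MF by (simp_all add: F_def)
  have max: "K = M" if "smod K" "N \<subseteq> K" "K \<subset> J" "M \<subseteq> K" for K
    using maxF that by (simp add: F_def)
  note MD = smodD[OF M(1)] and JD = smodD[OF J(1)]
  have "r \<otimes> y \<in> M" if r: "r \<in> \<mm>" and y: "y \<in> J" for r y
  proof (cases "y \<in> M")
    case True then show ?thesis using MD r by simp
  next
    case False
    have [simp]: "y \<in> carrier Q" "r \<in> carrier Q" using JD y r mm_A A_carr by auto
    let ?K = "adjoin Q A M (r \<otimes> y)"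
    have K: "smod ?K" "M \<subseteq> ?K" "r \<otimes> y \<in> ?K" using adjoin[OF M(1), of "r \<otimes> y"] by auto
    have sub: "?K \<subseteq> J"
      unfolding adjoin_def using M JD y r by auto
    have "y \<notin> ?K"
    proof
      assume "y \<in> ?K"
      then obtain j a where j: "j \<in> M" "a \<in> A" and ye: "y = j \<oplus> a \<otimes> (r \<otimes> y)" by (rule adjoin_cases)
      have "a \<otimes> r \<in> \<mm>" using smodD(4)[OF maxideal(1)] j r by auto
      then obtain s where s: "s \<in> A" "(\<one> \<ominus> a \<otimes> r) \<otimes> s = \<one>" using one_minus_invertible by blast
      have [simp]: "j \<in> carrier Q" "a \<in> carrier Q" "s \<in> carrier Q" using j s MD by auto
      have "(j \<oplus> a \<otimes> (r \<otimes> y)) \<ominus> a \<otimes> (r \<otimes> y) = j" by ((simp add: ring_norm; fail) | (rule ring_eqI, (simp add: ring_norm; fail), simp_all))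
      then have 1: "y \<ominus> a \<otimes> (r \<otimes> y) = j" unfolding ye[symmetric] .
      have "((\<one> \<ominus> a \<otimes> r) \<otimes> s) \<otimes> y = s \<otimes> (y \<ominus> a \<otimes> (r \<otimes> y))" by ((simp add: ring_norm; fail) | (rule ring_eqI, (simp add: ring_norm; fail), simp_all))
      then have "y = s \<otimes> j" unfolding 1 s(2) by simp
      then show False using False MD(4)[OF s(1) j(1)] by simp
    qed
    then have "?K \<subset> J" using sub y by blast
    then have "?K = M" using max[OF K(1)] K M by blast
    then show ?thesis using K by simp
  qed
  then have "M = J" using gen[OF M(1,2)] M(3) by blast
  then show False using M by simp
qed

end

section \<open>Dualizing fractional ideals\<close>

text \<open>
A homomorphism \<open>J \<rightarrow> Q/W\<close>, given by representatives \<open>f j\<close> of its values.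
\<close>

definition hom_mod :: "('q, 'm) ring_scheme \<Rightarrow> 'q set \<Rightarrow> 'q set \<Rightarrow> 'q set \<Rightarrow> ('q \<Rightarrow> 'q) \<Rightarrow> bool" where
  "hom_mod Q A W J f \<longleftrightarrow> f \<in> J \<rightarrow> carrier Q \<and>
     (\<forall>i\<in>J. \<forall>j\<in>J. f (i \<oplus>\<^bsub>Q\<^esub> j) \<ominus>\<^bsub>Q\<^esub> (f i \<oplus>\<^bsub>Q\<^esub> f j) \<in> W) \<and>
     (\<forall>r\<in>A. \<forall>j\<in>J. f (r \<otimes>\<^bsub>Q\<^esub> j) \<ominus>\<^bsub>Q\<^esub> r \<otimes>\<^bsub>Q\<^esub> f j \<in> W)"

text \<open>
Homomorphisms \<open>J \<rightarrow> Q/W\<close> with \<open>x \<in> J\<close> that kill \<open>x\<close> correspond to homomorphisms from ideals of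
\<open>A/xA\<close> to \<open>x\<^sup>-\<^sup>1W/W\<close>, which is isomorphic to \<open>W/xW\<close>. The condition is therefore Baer's criterion for
\<open>W/xW\<close> over \<open>A/xA\<close>, expressed inside \<open>Q\<close>.
\<close>

definition baer_at :: "('q, 'm) ring_scheme \<Rightarrow> 'q set \<Rightarrow> 'q set \<Rightarrow> 'q \<Rightarrow> bool" where
  "baer_at Q A W x \<longleftrightarrow> (\<forall>J f. submod Q A J \<longrightarrow> J \<subseteq> A \<longrightarrow> x \<in> J \<longrightarrow> hom_mod Q A W J f \<longrightarrow> f x \<in> W \<longrightarrow>
     (\<exists>q\<in>carrier Q. \<forall>j\<in>J. f j \<ominus>\<^bsub>Q\<^esub> q \<otimes>\<^bsub>Q\<^esub> j \<in> W))"

context fraction_pair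
begin

text \<open>
Homomorphisms to \<open>Q/W\<close> arise below as additive relations that are single-valued modulo \<open>W\<close>; the
representatives are then chosen arbitrarily.
\<close>

lemma hom_modI:
  assumes W: "smod W" and J: "smod J"
    and rep: "\<And>j. j \<in> J \<Longrightarrow> f j \<in> carrier Q"
    and rel: "\<And>j. j \<in> J \<Longrightarrow> G j (f j)"
    and add: "\<And>i j p q. i \<in> J \<Longrightarrow> j \<in> J \<Longrightarrow> p \<in> carrier Q \<Longrightarrow> q \<in> carrier Q \<Longrightarrow> G i p \<Longrightarrow> G j q \<Longrightarrow> G (i \<oplus> j) (p \<oplus> q)"
    and mult: "\<And>r j q. r \<in> A \<Longrightarrow> j \<in> J \<Longrightarrow> q \<in> carrier Q \<Longrightarrow> G j q \<Longrightarrow> G (r \<otimes> j) (r \<otimes> q)"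
    and uniq: "\<And>j p q. j \<in> J \<Longrightarrow> p \<in> carrier Q \<Longrightarrow> q \<in> carrier Q \<Longrightarrow> G j p \<Longrightarrow> G j q \<Longrightarrow> p \<ominus> q \<in> W"
  shows "hom_mod Q A W J f"
  unfolding hom_mod_def
proof (intro conjI ballI)
  show "f \<in> J \<rightarrow> carrier Q" using rep by auto
  show "f (i \<oplus> j) \<ominus> (f i \<oplus> f j) \<in> W" if "i \<in> J" "j \<in> J" for i j
    using that smodD(3)[OF J that] by (intro uniq[of "i \<oplus> j"] add rel a_closed rep) auto
  show "f (r \<otimes> j) \<ominus> r \<otimes> f j \<in> W" if "r \<in> A" "j \<in> J" for r j
    using that smodD(4)[OF J that] by (intro uniq[of "r \<otimes> j"] mult rel m_closed A_carr rep) auto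
qed

end

context one_dim_local_pair
begin

text \<open>
Some multiple \<open>su\<close> of \<open>u\<close> is a socle element of \<open>A/J\<close>. The assignment \<open>j + r(su) \<mapsto> re\<close> is then well
defined modulo \<open>W\<close>, because \<open>e\<close> is killed by \<open>\<mm>\<close> modulo \<open>W\<close>, and it kills \<open>x \<in> J\<close>. Multiplication by
the fraction that induces it separates \<open>su\<close>, hence \<open>u\<close>, from \<open>J\<close>.
\<close>

lemma separate_ideal_at_parameter:
  assumes W: "smod W" and x: "x \<in> \<mm>" "x \<in> Units Q" and baer: "baer_at Q A W x"
    and e: "e \<in> carrier Q" "e \<notin> W" "\<And>r. r \<in> \<mm> \<Longrightarrow> r \<otimes> e \<in> W"
    and J: "smod J" "J \<subseteq> A" "x \<in> J" and u: "u \<in> A" "u \<notin> J"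
  shows "\<exists>q\<in>carrier Q. (\<forall>j\<in>J. q \<otimes> j \<in> W) \<and> q \<otimes> u \<notin> W"
proof -
  note WD = smodD[OF W] and JD = smodD[OF J(1)]
  have [simp]: "u \<in> carrier Q" "e \<in> carrier Q" using u e by auto
  let ?K = "adjoin Q A J u"
  note K = adjoin[OF J(1) \<open>u \<in> carrier Q\<close>]
  define G where "G v p \<longleftrightarrow> (\<exists>r\<in>A. v \<ominus> r \<otimes> u \<in> J \<and> p = r \<otimes> e)" for v p
  define f where "f v = (SOME p. G v p)" for v
  have ex: "\<exists>p. G v p" if v: "v \<in> ?K" for v
  proof -
    from v obtain j r where jr: "j \<in> J" "r \<in> A" and ve: "v = j \<oplus> r \<otimes> u" by (rule adjoin_cases)
    have [simp]: "j \<in> carrier Q" "r \<in> carrier Q" using jr JD by auto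
    have "v \<ominus> r \<otimes> u = j" unfolding ve by ((simp add: ring_norm; fail) | (rule ring_eqI, (simp add: ring_norm; fail), simp_all))
    then show ?thesis unfolding G_def using jr by auto
  qed
  have Gf: "G v (f v)" if "v \<in> ?K" for v unfolding f_def using ex[OF that] by (rule someI_ex)
  have unique: "p \<ominus> p' \<in> W" if v: "v \<in> ?K" and G: "G v p" "G v p'" for v p p'
  proof -
    obtain r r' where r: "r \<in> A" "v \<ominus> r \<otimes> u \<in> J" "p = r \<otimes> e" and r': "r' \<in> A" "v \<ominus> r' \<otimes> u \<in> J" "p' = r' \<otimes> e"
      using G unfolding G_def by blast
    have [simp]: "r \<in> carrier Q" "r' \<in> carrier Q" "v \<in> carrier Q" using r r' v smodD(1)[OF K(1)] by auto
    have "(r \<ominus> r') \<otimes> u = (v \<ominus> r' \<otimes> u) \<ominus> (v \<ominus> r \<otimes> u)" by ((simp add: ring_norm; fail) | (rule ring_eqI, (simp add: ring_norm; fail), simp_all))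
    then have 1: "(r \<ominus> r') \<otimes> u \<in> J" using smod_minus[OF J(1) r'(2) r(2)] by simp
    have "r \<ominus> r' \<in> \<mm>"
    proof (rule ccontr)
      assume "r \<ominus> r' \<notin> \<mm>"
      then obtain s where s: "s \<in> A" "(r \<ominus> r') \<otimes> s = \<one>" using invertible[of "r \<ominus> r'"] r r' by auto
      have [simp]: "s \<in> carrier Q" using s by simp
      have "s \<otimes> ((r \<ominus> r') \<otimes> u) = ((r \<ominus> r') \<otimes> s) \<otimes> u" by ((simp add: ring_norm; fail) | (rule ring_eqI, (simp add: ring_norm; fail), simp_all))
      then have "s \<otimes> ((r \<ominus> r') \<otimes> u) = u" unfolding s(2) by simp
      then show False using JD(4)[OF s(1) 1] u by simp
    qed
    moreover have "p \<ominus> p' = (r \<ominus> r') \<otimes> e" unfolding r r' by ((simp add: ring_norm; fail) | (rule ring_eqI, (simp add: ring_norm; fail), simp_all))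
    ultimately show ?thesis using e by simp
  qed
  have xG: "G x \<zero>"
    unfolding G_def using J(3) JD(1)[OF J(3)] by (intro bexI[of _ \<zero>]) (auto simp: minus_eq)
  have uG: "G u e"
    unfolding G_def using JD(2) by (intro bexI[of _ \<one>]) (auto simp: minus_eq r_neg)
  have fc: "f v \<in> carrier Q" if "v \<in> ?K" for v using Gf[OF that] unfolding G_def by auto
  have "hom_mod Q A W ?K f"
  proof (rule hom_modI[OF W K(1), where G = G])
    show "f v \<in> carrier Q" if "v \<in> ?K" for v by (rule fc[OF that])
    show "G v (f v)" if "v \<in> ?K" for v by (rule Gf[OF that])
    show "p \<ominus> q \<in> W" if "v \<in> ?K" "G v p" "G v q" for v p q by (rule unique[OF that])
    show "G (i \<oplus> j) (p \<oplus> q)" if ij: "i \<in> ?K" "j \<in> ?K" "G i p" "G j q" for i j p q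
    proof -
      obtain r s where r: "r \<in> A" "i \<ominus> r \<otimes> u \<in> J" "p = r \<otimes> e" and s: "s \<in> A" "j \<ominus> s \<otimes> u \<in> J" "q = s \<otimes> e"
        using ij unfolding G_def by blast
      have [simp]: "r \<in> carrier Q" "s \<in> carrier Q" "i \<in> carrier Q" "j \<in> carrier Q"
        using r s ij smodD(1)[OF K(1)] by auto
      have "i \<oplus> j \<ominus> (r \<oplus> s) \<otimes> u = (i \<ominus> r \<otimes> u) \<oplus> (j \<ominus> s \<otimes> u)" by ((simp add: ring_norm; fail) | (rule ring_eqI, (simp add: ring_norm; fail), simp_all))
      then have "i \<oplus> j \<ominus> (r \<oplus> s) \<otimes> u \<in> J" using JD(3)[OF r(2) s(2)] by simp
      moreover have "p \<oplus> q = (r \<oplus> s) \<otimes> e" unfolding r s by ((simp add: ring_norm; fail) | (rule ring_eqI, (simp add: ring_norm; fail), simp_all))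
      ultimately show ?thesis unfolding G_def using r s by (intro bexI[of _ "r \<oplus> s"]) auto
    qed
    show "G (t \<otimes> j) (t \<otimes> q)" if tj: "t \<in> A" "j \<in> ?K" "G j q" for t j q
    proof -
      obtain s where s: "s \<in> A" "j \<ominus> s \<otimes> u \<in> J" "q = s \<otimes> e"
        using tj unfolding G_def by blast
      have [simp]: "t \<in> carrier Q" "s \<in> carrier Q" "j \<in> carrier Q"
        using s tj smodD(1)[OF K(1)] by auto
      have "t \<otimes> j \<ominus> (t \<otimes> s) \<otimes> u = t \<otimes> (j \<ominus> s \<otimes> u)" by ((simp add: ring_norm; fail) | (rule ring_eqI, (simp add: ring_norm; fail), simp_all))
      then have "t \<otimes> j \<ominus> (t \<otimes> s) \<otimes> u \<in> J" using JD(4)[OF tj(1) s(2)] by simp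
      moreover have "t \<otimes> q = (t \<otimes> s) \<otimes> e" unfolding s by ((simp add: ring_norm; fail) | (rule ring_eqI, (simp add: ring_norm; fail), simp_all))
      ultimately show ?thesis unfolding G_def using tj s by (intro bexI[of _ "t \<otimes> s"]) auto
    qed
  qed
  moreover have "f x \<in> W"
    using unique[OF _ Gf xG] K J(3) fc by (auto simp: minus_eq)
  moreover have "?K \<subseteq> A"
    unfolding adjoin_def using J u by auto
  ultimately obtain q where q: "q \<in> carrier Q" "\<And>v. v \<in> ?K \<Longrightarrow> f v \<ominus> q \<otimes> v \<in> W"
    using baer K J(3) unfolding baer_at_def by (meson subsetD)
  have "q \<otimes> j \<in> W" if j: "j \<in> J" for j
  proof -
    have jK: "j \<in> ?K" using K j by auto
    have "G j \<zero>" unfolding G_def using j JD(1)[OF j] by (auto intro!: bexI[of _ \<zero>] simp: minus_eq)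
    then have "f j \<ominus> \<zero> \<in> W" using unique[OF jK Gf[OF jK]] by simp
    then have "f j \<in> W" using fc[OF jK] by (simp add: minus_eq)
    then show ?thesis using smod_minus_cancel2[OF W _ _ q(2)[OF jK]] q(1) JD(1)[OF j] by simp
  qed
  moreover have "q \<otimes> u \<notin> W"
  proof
    assume qu: "q \<otimes> u \<in> W"
    have uK: "u \<in> ?K" using K by auto
    have "f u \<in> W" using smod_minus_cancel[OF W fc[OF uK] qu q(2)[OF uK]] .
    then have "e \<in> W" using smod_minus_cancel2[OF W _ _ unique[OF uK Gf[OF uK] uG]] by simp
    then show False using e by simp
  qed
  ultimately show ?thesis using q by blast
qed

text \<open>
Induction on the power of \<open>x\<close> contained in \<open>J\<close>. If \<open>u\<close> is not in \<open>J + Ax\<close>, that ideal is separated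
from \<open>u\<close>. Otherwise \<open>u = j0 + vx\<close> with \<open>v\<close> outside \<open>(J : x)\<close>, which contains a smaller power of \<open>x\<close>.
A fraction \<open>q\<close> that separates \<open>v\<close> from \<open>(J : x)\<close> gives \<open>p = q/x\<close>, and \<open>j + rx \<mapsto> pj\<close> is well defined modulo \<open>W\<close>
and kills \<open>x\<close>. If \<open>h\<close> induces this homomorphism, then \<open>p - h\<close> maps \<open>J\<close> into \<open>W\<close>, but not \<open>u\<close>.
\<close>

lemma separate_ideal:
  assumes W: "smod W" and x: "x \<in> \<mm>" "x \<in> Units Q" and baer: "baer_at Q A W x"
    and e: "e \<in> carrier Q" "e \<notin> W" "\<And>r. r \<in> \<mm> \<Longrightarrow> r \<otimes> e \<in> W"
  shows "smod J \<Longrightarrow> J \<subseteq> A \<Longrightarrow> x [^] Suc n \<in> J \<Longrightarrow> u \<in> A \<Longrightarrow> u \<notin> J \<Longrightarrow>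
    \<exists>q\<in>carrier Q. (\<forall>j\<in>J. q \<otimes> j \<in> W) \<and> q \<otimes> u \<notin> W"
proof (induction n arbitrary: J u)
  case 0
  have "x \<in> J" using 0(3) x by auto
  then show ?case using separate_ideal_at_parameter[OF W x baer e 0(1,2) _ 0(4,5)] by blast
next
  case (Suc n)
  note WD = smodD[OF W] and JD = smodD[OF Suc.prems(1)]
  have xA: "x \<in> A" using x by simp
  have [simp]: "x \<in> carrier Q" "u \<in> carrier Q" using x Suc.prems by auto
  let ?K = "adjoin Q A J x"
  note K = adjoin[OF Suc.prems(1) \<open>x \<in> carrier Q\<close>]
  have KA: "?K \<subseteq> A" unfolding adjoin_def using Suc.prems(2) xA by auto
  show ?case
  proof (cases "u \<in> ?K")
    case False
    from separate_ideal_at_parameter[OF W x baer e K(1) KA K(3) Suc.prems(4) False]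
    show ?thesis using K(2) by auto
  next
    case True
    then obtain j0 v where j0: "j0 \<in> J" "v \<in> A" and ue: "u = j0 \<oplus> v \<otimes> x" by (rule adjoin_cases)
    define C where "C = {r \<in> A. r \<otimes> x \<in> J}"
    have C: "smod C" unfolding C_def by (rule smod_colon1[OF Suc.prems(1)]) simp
    have [simp]: "j0 \<in> carrier Q" "v \<in> carrier Q" using j0 JD by auto
    have vC: "v \<notin> C"
      using Suc.prems(5) JD(3)[of j0 "v \<otimes> x"] j0 by (auto simp: ue C_def)
    have xnA: "x [^] n \<in> A" for n :: nat using xA by (induction n) auto
    have "x [^] Suc n \<in> C" unfolding C_def using Suc.prems(3) xnA xnA[of "Suc n"] by simp
    from Suc.IH[OF C _ this j0(2) vC] obtain q where
      q: "q \<in> carrier Q" "\<And>c. c \<in> C \<Longrightarrow> q \<otimes> c \<in> W" "q \<otimes> v \<notin> W"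
      unfolding C_def by auto
    obtain y where y: "y \<in> carrier Q" "x \<otimes> y = \<one>" using UnitsE[OF x(2)] by metis
    note [simp] = q(1) y(1)
    define p where "p = q \<otimes> y"
    have [simp]: "p \<in> carrier Q" by (simp add: p_def)
    have pmul: "p \<otimes> (r \<otimes> x) = q \<otimes> r" if [simp]: "r \<in> carrier Q" for r
    proof -
      have "p \<otimes> (r \<otimes> x) = (x \<otimes> y) \<otimes> (q \<otimes> r)" unfolding p_def by ((simp add: ring_norm; fail) | (rule ring_eqI, (simp add: ring_norm; fail), simp_all))
      then show ?thesis unfolding y(2) by simp
    qed
    \<comment> \<open>the homomorphism \<open>j + rx \<mapsto> pj\<close>, as a relation because \<open>j\<close> is not determined by \<open>j + rx\<close>\<close>
    define G where "G w z \<longleftrightarrow> (\<exists>j\<in>J. \<exists>r\<in>A. w = j \<oplus> r \<otimes> x \<and> z = p \<otimes> j)" for w z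
    define f where "f w = (SOME z. G w z)" for w
    have "\<exists>z. G w z" if "w \<in> ?K" for w
      using that unfolding adjoin_def G_def by blast
    then have Gf: "G w (f w)" if "w \<in> ?K" for w unfolding f_def using someI_ex that by metis
    have unique: "z \<ominus> z' \<in> W" if w: "w \<in> ?K" and G: "G w z" "G w z'" for w z z'
    proof -
      obtain j r where j: "j \<in> J" "r \<in> A" "w = j \<oplus> r \<otimes> x" "z = p \<otimes> j" using G(1) unfolding G_def by blast
      obtain j' r' where j': "j' \<in> J" "r' \<in> A" "w = j' \<oplus> r' \<otimes> x" "z' = p \<otimes> j'" using G(2) unfolding G_def by blast
      have [simp]: "j \<in> carrier Q" "r \<in> carrier Q" "j' \<in> carrier Q" "r' \<in> carrier Q" using j(1,2) j'(1,2) JD by auto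
      have "j \<ominus> j' = (j \<oplus> r \<otimes> x) \<ominus> (j' \<oplus> r' \<otimes> x) \<oplus> (r' \<ominus> r) \<otimes> x" by ((simp add: ring_norm; fail) | (rule ring_eqI, (simp add: ring_norm; fail), simp_all))
      also have "\<dots> = (r' \<ominus> r) \<otimes> x" unfolding j(3)[symmetric] j'(3)[symmetric]
        using j(3) by (simp add: minus_eq r_neg)
      finally have e: "j \<ominus> j' = (r' \<ominus> r) \<otimes> x" .
      then have "r' \<ominus> r \<in> C" unfolding C_def using smod_minus[OF Suc.prems(1) j(1) j'(1)] j(2) j'(2) by simp
      then have "q \<otimes> (r' \<ominus> r) \<in> W" by (rule q)
      moreover have "z \<ominus> z' = p \<otimes> (j \<ominus> j')" unfolding j(4) j'(4) by ((simp add: ring_norm; fail) | (rule ring_eqI, (simp add: ring_norm; fail), simp_all))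
      ultimately show ?thesis unfolding e using pmul by simp
    qed
    have fc: "f w \<in> carrier Q" if "w \<in> ?K" for w using Gf[OF that] JD unfolding G_def by auto
    have "hom_mod Q A W ?K f"
    proof (rule hom_modI[OF W K(1), where G = G])
      show "f v \<in> carrier Q" if "v \<in> ?K" for v by (rule fc[OF that])
      show "G v (f v)" if "v \<in> ?K" for v by (rule Gf[OF that])
      show "p \<ominus> q \<in> W" if "v \<in> ?K" "G v p" "G v q" for v p q by (rule unique[OF that])
      show "G (w \<oplus> w') (z \<oplus> z')" if G: "G w z" "G w' z'" for w w' z z'
      proof -
        obtain j r where j: "j \<in> J" "r \<in> A" "w = j \<oplus> r \<otimes> x" "z = p \<otimes> j" using G(1) unfolding G_def by blast
        obtain j' r' where j': "j' \<in> J" "r' \<in> A" "w' = j' \<oplus> r' \<otimes> x" "z' = p \<otimes> j'" using G(2) unfolding G_def by blast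
        have [simp]: "j \<in> carrier Q" "r \<in> carrier Q" "j' \<in> carrier Q" "r' \<in> carrier Q" using j(1,2) j'(1,2) JD by auto
        have "w \<oplus> w' = (j \<oplus> j') \<oplus> (r \<oplus> r') \<otimes> x" unfolding j(3) j'(3) by ((simp add: ring_norm; fail) | (rule ring_eqI, (simp add: ring_norm; fail), simp_all))
        moreover have "z \<oplus> z' = p \<otimes> (j \<oplus> j')" unfolding j(4) j'(4) by ((simp add: ring_norm; fail) | (rule ring_eqI, (simp add: ring_norm; fail), simp_all))
        ultimately show ?thesis unfolding G_def using JD(3)[OF j(1) j'(1)] A_closed(3)[OF j(2) j'(2)] by blast
      qed
      show "G (t \<otimes> w) (t \<otimes> z)" if t: "t \<in> A" and G: "G w z" for t w z
      proof -
        obtain j r where j: "j \<in> J" "r \<in> A" "w = j \<oplus> r \<otimes> x" "z = p \<otimes> j" using G unfolding G_def by blast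
        have [simp]: "j \<in> carrier Q" "r \<in> carrier Q" "t \<in> carrier Q" using j(1,2) t JD by auto
        have "t \<otimes> w = t \<otimes> j \<oplus> (t \<otimes> r) \<otimes> x" unfolding j(3) by ((simp add: ring_norm; fail) | (rule ring_eqI, (simp add: ring_norm; fail), simp_all))
        moreover have "t \<otimes> z = p \<otimes> (t \<otimes> j)" unfolding j(4) by ((simp add: ring_norm; fail) | (rule ring_eqI, (simp add: ring_norm; fail), simp_all))
        ultimately show ?thesis unfolding G_def using JD(4)[OF t j(1)] A_closed(4)[OF t j(2)] by blast
      qed
    qed
    moreover have "f x \<in> W"
    proof -
      have "G x \<zero>" unfolding G_def using JD(2) by (rule_tac bexI[of _ \<zero>], rule_tac bexI[of _ \<one>]) auto
      from unique[OF K(3) Gf[OF K(3)] this] show ?thesis using fc[OF K(3)] by (simp add: minus_eq)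
    qed
    ultimately obtain h where h: "h \<in> carrier Q" "\<And>w. w \<in> ?K \<Longrightarrow> f w \<ominus> h \<otimes> w \<in> W"
      using baer K KA unfolding baer_at_def by meson
    note [simp] = h(1)
    have 1: "(p \<ominus> h) \<otimes> j \<in> W" if j: "j \<in> J" for j
    proof -
      have [simp]: "j \<in> carrier Q" using JD j by simp
      have jK: "j \<in> ?K" using K j by auto
      note [simp] = fc[OF jK]
      have "G j (p \<otimes> j)" unfolding G_def using j by (rule_tac bexI[of _ j], rule_tac bexI[of _ \<zero>]) auto
      then have "f j \<ominus> p \<otimes> j \<in> W" using unique[OF jK Gf[OF jK]] by simp
      then have "(f j \<ominus> h \<otimes> j) \<ominus> (f j \<ominus> p \<otimes> j) \<in> W" using smod_minus[OF W h(2)[OF jK]] by simp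
      moreover have "(f j \<ominus> h \<otimes> j) \<ominus> (f j \<ominus> p \<otimes> j) = (p \<ominus> h) \<otimes> j"
      proof -
        have "(fj \<ominus> h \<otimes> j) \<ominus> (fj \<ominus> p \<otimes> j) = (p \<ominus> h) \<otimes> j" if [simp]: "fj \<in> carrier Q" for fj
          by ((simp add: ring_norm; fail) | (rule ring_eqI, (simp add: ring_norm; fail), simp_all))
        then show ?thesis by simp
      qed
      ultimately show ?thesis by simp
    qed
    have hx: "h \<otimes> x \<in> W" using smod_minus_cancel2[OF W _ \<open>f x \<in> W\<close> h(2)[OF K(3)]] by simp
    have "(p \<ominus> h) \<otimes> u \<notin> W"
    proof
      assume a: "(p \<ominus> h) \<otimes> u \<in> W"
      have "(p \<ominus> h) \<otimes> u \<ominus> (p \<ominus> h) \<otimes> j0 \<oplus> v \<otimes> (h \<otimes> x) = p \<otimes> (v \<otimes> x)" unfolding ue by ((simp add: ring_norm; fail) | (rule ring_eqI, (simp add: ring_norm; fail), simp_all))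
      then have "p \<otimes> (v \<otimes> x) \<in> W"
        using WD(3)[OF smod_minus[OF W a 1[OF j0(1)]] WD(4)[OF j0(2) hx]] by simp
      then show False using q(3) pmul by simp
    qed
    then show ?thesis using 1 by (intro bexI[of _ "p \<ominus> h"]) auto
  qed
qed

text \<open>
A common denominator turns \<open>J\<close> and \<open>u\<close> into an ideal and an element of \<open>A\<close>, and a regular ideal
contains a power of \<open>x\<close>.
\<close>

theorem dualizing_if_baer:
  assumes W: "regular_fractional Q A W" and x: "x \<in> \<mm>" "x \<in> Units Q" and baer: "baer_at Q A W x"
    and e: "e \<in> carrier Q" "e \<notin> W" "\<And>r. r \<in> \<mm> \<Longrightarrow> r \<otimes> e \<in> W"
  shows "dualizing Q A W"
  unfolding dualizing_def
proof (intro conjI allI impI W)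
  note Ws = regular_fractionalD(1)[OF W]
  fix J u assume J: "regular_fractional Q A J" and u: "u \<in> carrier Q - J"
  note Jr = regular_fractionalD[OF J]
  obtain v c where v: "v \<in> J" "v \<in> Units Q" and c: "c \<in> A" "c \<in> Units Q" "\<And>x. x \<in> J \<Longrightarrow> c \<otimes> x \<in> A"
    using Jr by blast
  obtain s where s: "s \<in> A" "s \<in> Units Q" "s \<otimes> u \<in> A" using fraction_form[of u] u by auto
  define d where "d = c \<otimes> s"
  have [simp]: "u \<in> carrier Q" "c \<in> carrier Q" "s \<in> carrier Q" using u c s by auto
  have dU: "d \<in> Units Q" and [simp]: "d \<in> carrier Q" using c s by (auto simp: d_def)
  have du: "d \<otimes> u \<in> A" using c(1) s(3) by (simp add: d_def m_assoc)
  let ?J = "(\<lambda>j. d \<otimes> j) ` J"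
  have J': "smod ?J" using smod_scale[OF Jr(1)] by simp
  have "?J \<subseteq> A"
  proof
    fix y assume "y \<in> ?J"
    then obtain j where j: "j \<in> J" "y = d \<otimes> j" by blast
    have [simp]: "j \<in> carrier Q" using smodD(1)[OF Jr(1)] j by simp
    have "d \<otimes> j = s \<otimes> (c \<otimes> j)" unfolding d_def by ((simp add: ring_norm; fail) | (rule ring_eqI, (simp add: ring_norm; fail), simp_all))
    then show "y \<in> A" using j(2) s(1) c(3)[OF j(1)] by simp
  qed
  have "d \<otimes> v \<in> ?J" "d \<otimes> v \<in> Units Q" using v dU by auto
  from power_in_regular_ideal[OF J' \<open>?J \<subseteq> A\<close> this x(1)] obtain n :: nat where n: "x [^] n \<in> ?J" by blast
  have "x [^] Suc n \<in> ?J"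
    using smodD(4)[OF J' _ n, of x] x mm_A by (simp add: m_comm Units_closed)
  moreover have "d \<otimes> u \<notin> ?J"
  proof
    assume "d \<otimes> u \<in> ?J"
    then obtain j where j: "j \<in> J" "d \<otimes> u = d \<otimes> j" by blast
    then have "u = j" using unit_cancel[OF dU, of u j] smodD(1)[OF Jr(1)] by simp
    then show False using u j by simp
  qed
  ultimately have "\<exists>q\<in>carrier Q. (\<forall>j\<in>?J. q \<otimes> j \<in> W) \<and> q \<otimes> (d \<otimes> u) \<notin> W"
    by (intro separate_ideal[OF Ws x baer e J' \<open>?J \<subseteq> A\<close> _ du])
  then obtain q where q0: "q \<in> carrier Q" "\<forall>j\<in>?J. q \<otimes> j \<in> W" "q \<otimes> (d \<otimes> u) \<notin> W"
    by (elim bexE conjE) (rule that)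
  note q = q0(1) bspec[OF q0(2)] q0(3)
  have "q \<otimes> d \<otimes> j \<in> W" if "j \<in> J" for j
    using q(2)[of "d \<otimes> j"] q(1) that smodD(1)[OF Jr(1) that] by (simp add: m_assoc)
  moreover have "q \<otimes> d \<otimes> u \<notin> W" using q(1,3) by (simp add: m_assoc)
  ultimately show "\<exists>q\<in>carrier Q. (\<forall>j\<in>J. q \<otimes> j \<in> W) \<and> q \<otimes> u \<notin> W"
    using q(1) by (intro bexI[of _ "q \<otimes> d"]) auto
qed

lemma regular_fractional_between:
  assumes "regular_fractional Q A J" "smod N" "N \<subseteq> J" "u \<in> N" "u \<in> Units Q"
  shows "regular_fractional Q A N"
  using assms unfolding regular_fractional_def by blast

text \<open>
The submodule \<open>\<mm>\<close> is separated from \<open>1\<close> by a fraction; that fraction represents a socle element of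
\<open>Q/W\<close>.
\<close>

lemma dualizing_socle_exists:
  assumes "dualizing Q A W"
  shows "\<exists>e\<in>carrier Q. e \<notin> W \<and> (\<forall>r\<in>\<mm>. r \<otimes> e \<in> W)"
proof -
  obtain x where x: "x \<in> \<mm>" "x \<in> Units Q" using regular_parameter by blast
  have "regular_fractional Q A \<mm>"
    by (rule regular_fractionalI[of _ x \<one>]) (use x maxideal in auto)
  from dualizingD(3)[OF assms this one_closed maxideal(3)] obtain q
    where q: "q \<in> carrier Q" "\<And>j. j \<in> \<mm> \<Longrightarrow> q \<otimes> j \<in> W" "q \<otimes> \<one> \<notin> W" by blast
  have "r \<otimes> q \<in> W" if "r \<in> \<mm>" for r
    using q(2)[OF that] q(1) m_comm[of r q] mm_A[OF that] by simp
  then show ?thesis using q by auto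
qed

text \<open>
Otherwise some \<open>q\<close> would separate \<open>e'\<close> from \<open>W + Ae\<close>. Since \<open>qW \<subseteq> W\<close> forces \<open>q \<in> A\<close>, and \<open>qe'\<close> is not in
\<open>W\<close>, the element \<open>q\<close> is a unit of \<open>A\<close>; but \<open>qe \<in> W\<close>.
\<close>

lemma dualizing_socle_simple:
  assumes W: "dualizing Q A W"
    and e: "e \<in> carrier Q" "e \<notin> W" "\<And>r. r \<in> \<mm> \<Longrightarrow> r \<otimes> e \<in> W"
    and e': "e' \<in> carrier Q" "\<And>r. r \<in> \<mm> \<Longrightarrow> r \<otimes> e' \<in> W"
  shows "\<exists>r\<in>A. e' \<ominus> r \<otimes> e \<in> W"
proof -
  note [simp] = e(1) e'(1)
  note Ws = dualizingD(2)[OF W]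
  let ?X = "adjoin Q A W e"
  note X = adjoin[OF Ws e(1)]
  have "e' \<in> ?X"
  proof (rule ccontr)
    assume n: "e' \<notin> ?X"
    from dualizingD(3)[OF W regular_fractional_adjoin[OF dualizingD(1)[OF W] e(1)] e'(1) n]
    obtain q where q: "q \<in> carrier Q" "\<And>j. j \<in> ?X \<Longrightarrow> q \<otimes> j \<in> W" "q \<otimes> e' \<notin> W" by blast
    have qA: "q \<in> A" using dualizing_colon_self[OF W q(1)] q(2) X(2) by blast
    then have "q \<notin> \<mm>" using e'(2) q(3) by auto
    then obtain s where s: "s \<in> A" "q \<otimes> s = \<one>" using invertible[OF qA] by blast
    have [simp]: "s \<in> carrier Q" "q \<in> carrier Q" using s q by auto
    have "s \<otimes> (q \<otimes> e) = (q \<otimes> s) \<otimes> e" by ((simp add: ring_norm; fail) | (rule ring_eqI, (simp add: ring_norm; fail), simp_all))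
    then have "s \<otimes> (q \<otimes> e) = e" unfolding s(2) by simp
    then show False using smodD(4)[OF Ws s(1) q(2)[OF X(3)]] e(2) by simp
  qed
  then obtain w r where w: "w \<in> W" "r \<in> A" and ee: "e' = w \<oplus> r \<otimes> e" by (rule adjoin_cases)
  have [simp]: "w \<in> carrier Q" "r \<in> carrier Q" using w smodD(1)[OF Ws] by auto
  have "e' \<ominus> r \<otimes> e = w" unfolding ee by ((simp add: ring_norm; fail) | (rule ring_eqI, (simp add: ring_norm; fail), simp_all))
  then show ?thesis using w by auto
qed

text \<open>
On a cyclic submodule \<open>Av\<close> with \<open>v\<close> regular, \<open>f\<close> is multiplication by \<open>f(v)/v\<close>. Take a maximal
submodule \<open>N\<close> of \<open>J\<close> on which \<open>f\<close> is a multiplication, by \<open>q\<close> say. If \<open>N \<noteq> J\<close>, pick \<open>u \<in> J\<close> that is a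
socle element modulo \<open>N\<close>, and \<open>p\<close> that separates \<open>u\<close> from \<open>N\<close>. Both \<open>f(u) - qu\<close> and \<open>pu\<close> represent
socle elements of \<open>Q/W\<close>, and the second is nonzero, so that \<open>f(u) - qu = tpu\<close> modulo \<open>W\<close>
for some \<open>t \<in> A\<close>. Then \<open>f\<close> is multiplication by \<open>q + tp\<close> on the larger submodule \<open>N + Au\<close>.
\<close>

theorem dualizing_baer:
  assumes W: "dualizing Q A W" and J: "regular_fractional Q A J" and f: "hom_mod Q A W J f"
  shows "\<exists>q\<in>carrier Q. \<forall>j\<in>J. f j \<ominus> q \<otimes> j \<in> W"
proof -
  note Ws = dualizingD(2)[OF W] and Jr = regular_fractionalD[OF J]
  note WD = smodD[OF Ws] and JD = smodD[OF Jr(1)]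
  have fc [simp]: "j \<in> J \<Longrightarrow> f j \<in> carrier Q" for j using f unfolding hom_mod_def by auto
  have fadd: "f (i \<oplus> j) \<ominus> (f i \<oplus> f j) \<in> W" if "i \<in> J" "j \<in> J" for i j
    using f that unfolding hom_mod_def by auto
  have fmul: "f (r \<otimes> j) \<ominus> r \<otimes> f j \<in> W" if "r \<in> A" "j \<in> J" for r j
    using f that unfolding hom_mod_def by auto
  obtain v c where v: "v \<in> J" "v \<in> Units Q" and c: "c \<in> A" "c \<in> Units Q" "\<And>x. x \<in> J \<Longrightarrow> c \<otimes> x \<in> A"
    using Jr by blast
  define F where "F = {N. smod N \<and> v \<in> N \<and> N \<subseteq> J \<and> (\<exists>q\<in>carrier Q. \<forall>j\<in>N. f j \<ominus> q \<otimes> j \<in> W)}"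
  have "adjoin Q A {\<zero>} v \<in> F"
  proof -
    obtain v' where v': "v \<in> carrier Q" "v' \<in> carrier Q" "v \<otimes> v' = \<one>" using UnitsE[OF v(2)] by metis
    note [simp] = v'(1,2)
    have z: "smod {\<zero>}" by (auto simp: submod_def)
    note a = adjoin[OF z v'(1)]
    have e: "\<exists>r\<in>A. j = r \<otimes> v" if "j \<in> adjoin Q A {\<zero>} v" for j
      using that unfolding adjoin_def by auto
    have "f j \<ominus> f v \<otimes> v' \<otimes> j \<in> W" if j: "j \<in> adjoin Q A {\<zero>} v" for j
    proof -
      obtain r where r: "r \<in> A" "j = r \<otimes> v" using e[OF j] by blast
      have [simp]: "r \<in> carrier Q" using r by simp
      have "fv \<otimes> v' \<otimes> j = (v \<otimes> v') \<otimes> (r \<otimes> fv)" if [simp]: "fv \<in> carrier Q" for fv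
        unfolding r by ((simp add: ring_norm; fail) | (rule ring_eqI, (simp add: ring_norm; fail), simp_all))
      then show ?thesis using fmul[OF r(1) v(1)] v(1) v'(3) by (simp add: r(2))
    qed
    moreover have "adjoin Q A {\<zero>} v \<subseteq> J" using e JD(4) v(1) by blast
    ultimately show ?thesis unfolding F_def using a v(1) by (auto intro!: bexI[of _ "f v \<otimes> v'"])
  qed
  have "\<exists>M\<in>F. \<forall>J\<in>F. M \<subseteq> J \<longrightarrow> J = M"
    by (rule maximal_condition_frac[of _ c]) (use \<open>_ \<in> F\<close> c in \<open>auto simp: F_def\<close>)
  then obtain N where NF: "N \<in> F" and maxF: "\<forall>J\<in>F. N \<subseteq> J \<longrightarrow> J = N" by blast
  then obtain q where N: "smod N" "v \<in> N" "N \<subseteq> J" and q: "q \<in> carrier Q" "\<And>j. j \<in> N \<Longrightarrow> f j \<ominus> q \<otimes> j \<in> W"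
    unfolding F_def by blast
  have "N = J"
  proof (rule ccontr)
    assume "N \<noteq> J"
    then obtain u0 where u0: "u0 \<in> J" "u0 \<notin> N" using N by blast
    obtain s where s: "s \<in> A" "s \<otimes> u0 \<notin> N" "\<And>r. r \<in> \<mm> \<Longrightarrow> r \<otimes> (s \<otimes> u0) \<in> N"
      using socle_element[OF N(1,2) v(2) JD(1)[OF u0(1)] u0(2)] by blast
    define u where "u = s \<otimes> u0"
    have u: "u \<in> J" "u \<notin> N" "\<And>r. r \<in> \<mm> \<Longrightarrow> r \<otimes> u \<in> N"
      using s JD(4)[OF s(1) u0(1)] by (auto simp: u_def)
    have uc [simp]: "u \<in> carrier Q" using JD(1)[OF u(1)] .
    note [simp] = q(1)
    have Nr: "regular_fractional Q A N" using regular_fractional_between[OF J N(1,3,2) v(2)] .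
    obtain p where p: "p \<in> carrier Q" "\<And>j. j \<in> N \<Longrightarrow> p \<otimes> j \<in> W" "p \<otimes> u \<notin> W"
      using dualizingD(3)[OF W Nr uc u(2)] by blast
    note [simp] = p(1)
    define g where "g = f u \<ominus> q \<otimes> u"
    have fu [simp]: "f u \<in> carrier Q" using u by simp
    have gc [simp]: "g \<in> carrier Q" by (simp add: g_def)
    have 1: "r \<otimes> (p \<otimes> u) \<in> W" if r: "r \<in> \<mm>" for r
    proof -
      have [simp]: "r \<in> carrier Q" using r mm_A by (auto intro: A_carr)
      have "r \<otimes> (p \<otimes> u) = p \<otimes> (r \<otimes> u)" by ((simp add: ring_norm; fail) | (rule ring_eqI, (simp add: ring_norm; fail), simp_all))
      then show ?thesis using p(2)[OF u(3)[OF r]] by simp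
    qed
    have 2: "r \<otimes> g \<in> W" if r: "r \<in> \<mm>" for r
    proof -
      have rA: "r \<in> A" and [simp]: "r \<in> carrier Q" using r mm_A by (auto intro: A_carr)
      have ruJ: "r \<otimes> u \<in> J" using JD(4)[OF rA u(1)] .
      have *: "(fru \<ominus> q \<otimes> (r \<otimes> u)) \<ominus> (fru \<ominus> r \<otimes> fu) = r \<otimes> (fu \<ominus> q \<otimes> u)"
        if [simp]: "fru \<in> carrier Q" "fu \<in> carrier Q" for fru fu by ((simp add: ring_norm; fail) | (rule ring_eqI, (simp add: ring_norm; fail), simp_all))
      show ?thesis
        using smod_minus[OF Ws q(2)[OF u(3)[OF r]] fmul[OF rA u(1)]] *[OF fc[OF ruJ] fu] by (simp add: g_def)
    qed
    obtain t where t: "t \<in> A" "g \<ominus> t \<otimes> (p \<otimes> u) \<in> W"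
      using dualizing_socle_simple[OF W _ p(3) 1 gc 2] by auto
    have [simp]: "t \<in> carrier Q" using t by simp
    let ?N = "adjoin Q A N u"
    note aN = adjoin[OF N(1) uc]
    have sub: "?N \<subseteq> J" unfolding adjoin_def using N(3) u(1) JD(3,4) by blast
    have "f w \<ominus> (q \<oplus> t \<otimes> p) \<otimes> w \<in> W" if w: "w \<in> ?N" for w
    proof -
      from w obtain j r where j: "j \<in> N" "r \<in> A" and we: "w = j \<oplus> r \<otimes> u" by (rule adjoin_cases)
      have jJ: "j \<in> J" and ruJ: "r \<otimes> u \<in> J" using j N(3) JD(4)[OF j(2) u(1)] by auto
      have wJ: "w \<in> J" using w sub by auto
      have [simp]: "j \<in> carrier Q" "r \<in> carrier Q" "w \<in> carrier Q" using jJ wJ JD(1) j by auto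
      have *: "(fw \<ominus> (fj \<oplus> fru)) \<oplus> ((fj \<ominus> q \<otimes> j) \<oplus> ((fru \<ominus> r \<otimes> fu) \<oplus> r \<otimes> ((fu \<ominus> q \<otimes> u) \<ominus> t \<otimes> (p \<otimes> u)))) \<ominus> t \<otimes> (p \<otimes> j)
           = fw \<ominus> (q \<oplus> t \<otimes> p) \<otimes> w"
        if [simp]: "fw \<in> carrier Q" "fj \<in> carrier Q" "fru \<in> carrier Q" "fu \<in> carrier Q" for fw fj fru fu
        unfolding we by ((simp add: ring_norm; fail) | (rule ring_eqI, (simp add: ring_norm; fail), simp_all))
      have "(f w \<ominus> (f j \<oplus> f (r \<otimes> u))) \<oplus> ((f j \<ominus> q \<otimes> j) \<oplus> ((f (r \<otimes> u) \<ominus> r \<otimes> f u) \<oplus> r \<otimes> ((f u \<ominus> q \<otimes> u) \<ominus> t \<otimes> (p \<otimes> u)))) \<ominus> t \<otimes> (p \<otimes> j) \<in> W"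
        by (intro smod_minus[OF Ws] WD(3) WD(4)[OF j(2)] WD(4)[OF t(1)] fmul[OF j(2) u(1)] q(2)[OF j(1)] p(2)[OF j(1)]
            fadd[OF jJ ruJ, folded we] t(2)[unfolded g_def])
      then show ?thesis using *[OF fc[OF wJ] fc[OF jJ] fc[OF ruJ] fu] by simp
    qed
    then have "?N \<in> F" unfolding F_def using aN N sub by (auto intro!: bexI[of _ "q \<oplus> t \<otimes> p"])
    then have "?N = N" using maxF aN by blast
    then show False using aN u by auto
  qed
  then show ?thesis using q by blast
qed

text \<open>
The ideal \<open>J = (W : W')\<close> satisfies \<open>(W : J) = W'\<close>, so it suffices that \<open>J\<close> is principal. Let \<open>e\<close>
represent the simple socle of \<open>Q/W'\<close> and choose \<open>u \<in> J\<close> with \<open>eu\<close> outside \<open>W\<close>. By Nakayama's lemma \<open>J = Au\<close>: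
if \<open>Au + \<mm>J\<close> were contained in a proper submodule of \<open>J\<close>, the separating fraction would represent a
socle element of \<open>Q/W'\<close>, that is, a multiple of \<open>e\<close>, which kills \<open>u\<close> but is not zero.
\<close>

theorem dualizing_unique:
  assumes W: "dualizing Q A W" and W': "dualizing Q A W'"
  shows "\<exists>v\<in>Units Q. W' = (\<lambda>x. v \<otimes> x) ` W"
proof -
  note Ws = dualizingD(2)[OF W] and Ws' = dualizingD(2)[OF W']
  note WD = smodD[OF Ws] and WD' = smodD[OF Ws']
  obtain w c where w: "w \<in> W" "w \<in> Units Q" and c: "c \<in> A" "c \<in> Units Q" "\<And>x. x \<in> W \<Longrightarrow> c \<otimes> x \<in> A"
    using regular_fractionalD[OF dualizingD(1)[OF W]] by blast
  obtain w' c' where w': "w' \<in> W'" "w' \<in> Units Q" and c': "c' \<in> A" "c' \<in> Units Q" "\<And>x. x \<in> W' \<Longrightarrow> c' \<otimes> x \<in> A"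
    using regular_fractionalD[OF dualizingD(1)[OF W']] by blast
  have [simp]: "w \<in> carrier Q" "c \<in> carrier Q" "w' \<in> carrier Q" "c' \<in> carrier Q" using w c w' c' by auto
  define J where "J = {q \<in> carrier Q. \<forall>j\<in>W'. q \<otimes> j \<in> W}"
  have Js: "smod J" unfolding J_def by (rule smod_colon[OF Ws]) (use WD'(1) in blast)
  have wcJ: "w \<otimes> c' \<in> J" "w \<otimes> c' \<in> Units Q"
  proof -
    have "w \<otimes> c' \<otimes> j \<in> W" if j: "j \<in> W'" for j
    proof -
      have [simp]: "j \<in> carrier Q" using WD'(1)[OF j] .
      have "w \<otimes> c' \<otimes> j = (c' \<otimes> j) \<otimes> w" by ((simp add: ring_norm; fail) | (rule ring_eqI, (simp add: ring_norm; fail), simp_all))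
      then show ?thesis using WD(4)[OF c'(3)[OF j] w(1)] by simp
    qed
    then show "w \<otimes> c' \<in> J" by (simp add: J_def)
    show "w \<otimes> c' \<in> Units Q" using w c' by simp
  qed
  obtain s where s: "s \<in> A" "s \<in> Units Q" "s \<otimes> (c \<otimes> w') \<in> A" using fraction_form[of "c \<otimes> w'"] by auto
  define d where "d = s \<otimes> (c \<otimes> w')"
  have [simp]: "s \<in> carrier Q" using s by simp
  have d: "d \<in> A" "d \<in> Units Q" "\<And>j. j \<in> J \<Longrightarrow> d \<otimes> j \<in> A"
  proof -
    show "d \<in> A" using s by (simp add: d_def)
    show "d \<in> Units Q" using s c w' by (simp add: d_def)
    fix j assume j: "j \<in> J"
    have [simp]: "j \<in> carrier Q" using j by (simp add: J_def)
    have "d \<otimes> j = s \<otimes> (c \<otimes> (j \<otimes> w'))" unfolding d_def by ((simp add: ring_norm; fail) | (rule ring_eqI, (simp add: ring_norm; fail), simp_all))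
    moreover have "j \<otimes> w' \<in> W" using j w' by (simp add: J_def)
    ultimately show "d \<otimes> j \<in> A" using s(1) c(3) by simp
  qed
  have Jr: "regular_fractional Q A J" using regular_fractionalI[OF Js wcJ d(1,2)] d(3) by simp
  have dual: "p \<in> W'" if p: "p \<in> carrier Q" "\<And>j. j \<in> J \<Longrightarrow> p \<otimes> j \<in> W" for p
  proof (rule ccontr)
    assume "p \<notin> W'"
    from dualizingD(3)[OF W dualizingD(1)[OF W'] p(1) this] obtain q
      where q: "q \<in> carrier Q" "\<forall>j\<in>W'. q \<otimes> j \<in> W" "q \<otimes> p \<notin> W" by blast
    then have "p \<otimes> q \<in> W" using p(2)[of q] by (simp add: J_def)
    then show False using q p(1) by (simp add: m_comm)
  qed
  obtain e where e: "e \<in> carrier Q" "e \<notin> W'" "\<And>r. r \<in> \<mm> \<Longrightarrow> r \<otimes> e \<in> W'"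
    using dualizing_socle_exists[OF W'] by blast
  obtain u where u: "u \<in> J" "e \<otimes> u \<notin> W" using dual[OF e(1)] e(2) by blast
  have [simp]: "u \<in> carrier Q" "e \<in> carrier Q" using u e by (auto simp: J_def)
  obtain x where x: "x \<in> \<mm>" "x \<in> Units Q" using regular_parameter by blast
  have z: "smod {\<zero>}" by (auto simp: submod_def)
  have uA: "\<exists>r\<in>A. j = r \<otimes> u" if "j \<in> adjoin Q A {\<zero>} u" for j
    using that unfolding adjoin_def by auto
  note au = adjoin[OF z \<open>u \<in> carrier Q\<close>]
  have "adjoin Q A {\<zero>} u = J"
  proof (rule nakayama[OF Js d(2,3) au(1)])
    show "adjoin Q A {\<zero>} u \<subseteq> J" using uA smodD(4)[OF Js _ u(1)] by blast
    fix N assume N: "smod N" "adjoin Q A {\<zero>} u \<subseteq> N" "N \<subseteq> J" "\<And>r j. r \<in> \<mm> \<Longrightarrow> j \<in> J \<Longrightarrow> r \<otimes> j \<in> N"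
    show "N = J"
    proof (rule ccontr)
      assume "N \<noteq> J"
      then obtain v where v: "v \<in> J" "v \<notin> N" using N(3) by blast
      have [simp]: "v \<in> carrier Q" using v by (simp add: J_def)
      have "x \<otimes> (w \<otimes> c') \<in> N" "x \<otimes> (w \<otimes> c') \<in> Units Q" using N(4)[OF x(1) wcJ(1)] x wcJ(2) by auto
      from regular_fractional_between[OF Jr N(1,3) this]
      have "regular_fractional Q A N" .
      from dualizingD(3)[OF W this _ v(2)] obtain p
        where p: "p \<in> carrier Q" "\<And>j. j \<in> N \<Longrightarrow> p \<otimes> j \<in> W" "p \<otimes> v \<notin> W" by auto
      note [simp] = p(1)
      have "r \<otimes> p \<in> W'" if r: "r \<in> \<mm>" for r
      proof (rule dual)
        have [simp]: "r \<in> carrier Q" using r mm_A by (auto intro: A_carr)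
        show "r \<otimes> p \<in> carrier Q" by simp
        fix j assume j: "j \<in> J"
        have [simp]: "j \<in> carrier Q" using j by (simp add: J_def)
        have "r \<otimes> p \<otimes> j = p \<otimes> (r \<otimes> j)" by ((simp add: ring_norm; fail) | (rule ring_eqI, (simp add: ring_norm; fail), simp_all))
        then show "r \<otimes> p \<otimes> j \<in> W" using p(2)[OF N(4)[OF r j]] by simp
      qed
      from dualizing_socle_simple[OF W' e p(1) this] obtain r where r: "r \<in> A" "p \<ominus> r \<otimes> e \<in> W'" by blast
      have [simp]: "r \<in> carrier Q" using r by simp
      show False
      proof (cases "r \<in> \<mm>")
        case True
        then have "p \<in> W'" using smod_minus_cancel[OF Ws' p(1) e(3)[OF True] r(2)] by simp
        then show False using v p(3) by (auto simp: J_def m_comm)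
      next
        case False
        then obtain t where t: "t \<in> A" "r \<otimes> t = \<one>" using invertible[OF r(1)] by blast
        have [simp]: "t \<in> carrier Q" using t by simp
        have "u \<otimes> (p \<ominus> r \<otimes> e) \<in> W" using u(1) r(2) by (simp add: J_def)
        moreover have "p \<otimes> u \<in> W" using p(2) N(2) au(3) by blast
        ultimately have "t \<otimes> (p \<otimes> u \<ominus> u \<otimes> (p \<ominus> r \<otimes> e)) \<in> W" using smod_minus[OF Ws] WD(4) t(1) by blast
        moreover have "t \<otimes> (p \<otimes> u \<ominus> u \<otimes> (p \<ominus> r \<otimes> e)) = (r \<otimes> t) \<otimes> (e \<otimes> u)" by ((simp add: ring_norm; fail) | (rule ring_eqI, (simp add: ring_norm; fail), simp_all))
        ultimately show False using u(2) unfolding t(2) by simp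
      qed
    qed
  qed
  then have JA: "j \<in> J \<Longrightarrow> \<exists>r\<in>A. j = r \<otimes> u" for j using uA by simp
  obtain r0 where r0: "r0 \<in> A" "w \<otimes> c' = r0 \<otimes> u" using JA[OF wcJ(1)] by blast
  have uU: "u \<in> Units Q"
  proof -
    have "u \<otimes> r0 \<in> Units Q" using wcJ(2) r0 by (simp add: m_comm)
    then show ?thesis using unit_factor[of u r0] r0(1) by simp
  qed
  obtain v where v: "v \<in> carrier Q" "v \<in> Units Q" "u \<otimes> v = \<one>" using UnitsE[OF uU] by metis
  note [simp] = v(1)
  have "W' = (\<lambda>x. v \<otimes> x) ` W"
  proof (intro equalityI subsetI)
    fix y assume y: "y \<in> W'"
    have [simp]: "y \<in> carrier Q" using WD'(1)[OF y] .
    have "v \<otimes> (u \<otimes> y) = (u \<otimes> v) \<otimes> y" by ((simp add: ring_norm; fail) | (rule ring_eqI, (simp add: ring_norm; fail), simp_all))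
    then have "y = v \<otimes> (u \<otimes> y)" unfolding v(3) by simp
    moreover have "u \<otimes> y \<in> W" using u(1) y by (simp add: J_def)
    ultimately show "y \<in> (\<lambda>x. v \<otimes> x) ` W" by (rule image_eqI)
  next
    fix y assume "y \<in> (\<lambda>x. v \<otimes> x) ` W"
    then obtain a where a: "a \<in> W" "y = v \<otimes> a" by blast
    have [simp]: "a \<in> carrier Q" using WD(1)[OF a(1)] .
    show "y \<in> W'"
    proof (rule dual)
      show "y \<in> carrier Q" by (simp add: a)
      fix j assume "j \<in> J"
      then obtain r where r: "r \<in> A" "j = r \<otimes> u" using JA by blast
      have [simp]: "r \<in> carrier Q" using r by simp
      have "y \<otimes> j = (u \<otimes> v) \<otimes> (r \<otimes> a)" unfolding a r by ((simp add: ring_norm; fail) | (rule ring_eqI, (simp add: ring_norm; fail), simp_all))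
      then show "y \<otimes> j \<in> W" unfolding v(3) using WD(4)[OF r(1) a(1)] WD(1) by simp
    qed
  qed
  then show ?thesis using v(2) by blast
qed

end

section \<open>The total ring of fractions\<close>

context cring
begin

abbreviation reg where "reg \<equiv> regular_element R"

lemma regD: "reg s \<Longrightarrow> s \<in> carrier R" "reg s \<Longrightarrow> r \<in> carrier R \<Longrightarrow> s \<otimes> r = \<zero> \<Longrightarrow> r = \<zero>"
  by (auto simp: regular_element_def)

lemma reg_one: "reg \<one>" by (auto simp: regular_element_def)

lemma reg_mult:
  assumes "reg s" "reg t"
  shows "reg (s \<otimes> t)"
proof -
  have c: "s \<in> carrier R" "t \<in> carrier R" using assms regD(1) by blast+
  have "r = \<zero>" if r: "r \<in> carrier R" "s \<otimes> t \<otimes> r = \<zero>" for r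
  proof -
    have "s \<otimes> (t \<otimes> r) = \<zero>" using r c by (simp add: m_assoc)
    then have "t \<otimes> r = \<zero>" using regD(2)[OF assms(1)] r(1) c by blast
    then show ?thesis using regD(2)[OF assms(2)] r(1) by blast
  qed
  then show ?thesis unfolding regular_element_def using c by simp
qed

lemma reg_cancel:
  assumes "reg s" "x \<in> carrier R" "y \<in> carrier R" "s \<otimes> x = s \<otimes> y"
  shows "x = y"
proof -
  have [simp]: "s \<in> carrier R" using assms(1) by (rule regD)
  have "s \<otimes> (x \<ominus> y) = s \<otimes> x \<ominus> s \<otimes> y" using assms(2,3) by (simp add: minus_eq r_distr r_minus)
  also have "\<dots> = \<zero>" unfolding assms(4) using assms(3) by (simp add: minus_eq r_neg)
  finally show ?thesis using regD(2)[OF assms(1), of "x \<ominus> y"] assms(2,3) by (simp add: r_right_minus_eq)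
qed

lemma fraction_eq_iff:
  assumes "r \<in> carrier R" "reg s" "r' \<in> carrier R" "reg s'"
  shows "fraction R r s = fraction R r' s' \<longleftrightarrow> r \<otimes> s' = r' \<otimes> s"
proof
  assume "fraction R r s = fraction R r' s'"
  moreover have "(r', s') \<in> fraction R r' s'" using assms by (simp add: fraction_def)
  ultimately have "(r', s') \<in> fraction R r s" by simp
  then show "r \<otimes> s' = r' \<otimes> s" by (simp add: fraction_def)
next
  assume e: "r \<otimes> s' = r' \<otimes> s"
  have trans: "a \<otimes> w = v \<otimes> b"
    if c: "a \<in> carrier R" "reg b" "a' \<in> carrier R" "reg b'" "v \<in> carrier R" "reg w"
      and eq: "a \<otimes> b' = a' \<otimes> b" "a' \<otimes> w = v \<otimes> b'" for a b a' b' v w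
  proof (rule reg_cancel[OF c(4)])
    have [simp]: "b \<in> carrier R" "b' \<in> carrier R" "w \<in> carrier R" using c regD(1) by blast+
    note [simp] = c(1,3,5)
    have "b' \<otimes> (a \<otimes> w) = (a \<otimes> b') \<otimes> w" by ((simp add: ring_norm; fail) | (rule ring_eqI, (simp add: ring_norm; fail), simp_all))
    also have "\<dots> = (a' \<otimes> w) \<otimes> b" unfolding eq(1) by ((simp add: ring_norm; fail) | (rule ring_eqI, (simp add: ring_norm; fail), simp_all))
    also have "\<dots> = b' \<otimes> (v \<otimes> b)" unfolding eq(2) by ((simp add: ring_norm; fail) | (rule ring_eqI, (simp add: ring_norm; fail), simp_all))
    finally show "b' \<otimes> (a \<otimes> w) = b' \<otimes> (v \<otimes> b)" .
    show "a \<otimes> w \<in> carrier R" "v \<otimes> b \<in> carrier R" by simp_all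
  qed
  have "r \<otimes> w = v \<otimes> s \<longleftrightarrow> r' \<otimes> w = v \<otimes> s'" if "v \<in> carrier R" "reg w" for v w
    using trans[OF assms that e] trans[OF assms(3,4,1,2) that e[symmetric]] by blast
  then show "fraction R r s = fraction R r' s'"
    unfolding fraction_def by blast
qed

lemma fraction_mem:
  assumes "r \<in> carrier R" "reg s"
  shows "(a, b) \<in> fraction R r s \<longleftrightarrow> a \<in> carrier R \<and> reg b \<and> fraction R a b = fraction R r s"
proof -
  have "(a, b) \<in> fraction R r s \<longleftrightarrow> a \<in> carrier R \<and> reg b \<and> r \<otimes> b = a \<otimes> s" by (simp add: fraction_def)
  then show ?thesis using fraction_eq_iff[OF assms, of a b] by auto
qed

abbreviation TF where "TF \<equiv> total_frac R"

lemma frac_carrierI: "r \<in> carrier R \<Longrightarrow> reg s \<Longrightarrow> fraction R r s \<in> carrier TF"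
  by (auto simp: total_frac_def)

lemma frac_carrierE:
  assumes "q \<in> carrier TF"
  obtains r s where "r \<in> carrier R" "reg s" "q = fraction R r s"
  using assms by (auto simp: total_frac_def)

lemma constant_Union:
  fixes f :: "'x \<Rightarrow> 'y \<Rightarrow> 'u \<Rightarrow> 'v \<Rightarrow> 'w set"
  assumes "(a, b) \<in> p" "(c, d) \<in> q" "\<And>a b c d. (a, b) \<in> p \<Longrightarrow> (c, d) \<in> q \<Longrightarrow> f a b c d = Y"
  shows "(\<Union>(a, b)\<in>p. \<Union>(c, d)\<in>q. f a b c d) = Y"
  using assms by fastforce

lemma frac_mult:
  assumes "r \<in> carrier R" "reg s" "r' \<in> carrier R" "reg s'"
  shows "fraction R r s \<otimes>\<^bsub>TF\<^esub> fraction R r' s' = fraction R (r \<otimes> r') (s \<otimes> s')"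
proof -
  note [simp] = assms(1,3) regD(1)[OF assms(2)] regD(1)[OF assms(4)]
  have "(\<Union>(a, b)\<in>fraction R r s. \<Union>(c, d)\<in>fraction R r' s'. fraction R (a \<otimes> c) (b \<otimes> d)) = fraction R (r \<otimes> r') (s \<otimes> s')"
  proof (rule constant_Union)
    show "(r, s) \<in> fraction R r s" "(r', s') \<in> fraction R r' s'" using assms by (auto simp: fraction_mem)
    fix a b c d assume "(a, b) \<in> fraction R r s" "(c, d) \<in> fraction R r' s'"
    then have ab: "a \<in> carrier R" "reg b" "r \<otimes> b = a \<otimes> s" and cd: "c \<in> carrier R" "reg d" "r' \<otimes> d = c \<otimes> s'"
      by (auto simp: fraction_def)
    note [simp] = ab(1) cd(1) regD(1)[OF ab(2)] regD(1)[OF cd(2)]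
    have "(r \<otimes> r') \<otimes> (b \<otimes> d) = (r \<otimes> b) \<otimes> (r' \<otimes> d)" by ((simp add: ring_norm; fail) | (rule ring_eqI, (simp add: ring_norm; fail), simp_all))
    also have "\<dots> = (a \<otimes> c) \<otimes> (s \<otimes> s')" unfolding ab cd by ((simp add: ring_norm; fail) | (rule ring_eqI, (simp add: ring_norm; fail), simp_all))
    finally show "fraction R (a \<otimes> c) (b \<otimes> d) = fraction R (r \<otimes> r') (s \<otimes> s')"
      using fraction_eq_iff[of "r \<otimes> r'" "s \<otimes> s'" "a \<otimes> c" "b \<otimes> d"] reg_mult ab(2) cd(2) assms(2,4) by simp
  qed
  then show ?thesis by (simp add: total_frac_def)
qed

lemma frac_add:
  assumes "r \<in> carrier R" "reg s" "r' \<in> carrier R" "reg s'"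
  shows "fraction R r s \<oplus>\<^bsub>TF\<^esub> fraction R r' s' = fraction R (r \<otimes> s' \<oplus> r' \<otimes> s) (s \<otimes> s')"
proof -
  note [simp] = assms(1,3) regD(1)[OF assms(2)] regD(1)[OF assms(4)]
  have "(\<Union>(a, b)\<in>fraction R r s. \<Union>(c, d)\<in>fraction R r' s'. fraction R (a \<otimes> d \<oplus> c \<otimes> b) (b \<otimes> d))
      = fraction R (r \<otimes> s' \<oplus> r' \<otimes> s) (s \<otimes> s')"
  proof (rule constant_Union)
    show "(r, s) \<in> fraction R r s" "(r', s') \<in> fraction R r' s'" using assms by (auto simp: fraction_mem)
    fix a b c d assume "(a, b) \<in> fraction R r s" "(c, d) \<in> fraction R r' s'"
    then have ab: "a \<in> carrier R" "reg b" "r \<otimes> b = a \<otimes> s" and cd: "c \<in> carrier R" "reg d" "r' \<otimes> d = c \<otimes> s'"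
      by (auto simp: fraction_def)
    note [simp] = ab(1) cd(1) regD(1)[OF ab(2)] regD(1)[OF cd(2)]
    have "(r \<otimes> s' \<oplus> r' \<otimes> s) \<otimes> (b \<otimes> d) = (r \<otimes> b) \<otimes> (s' \<otimes> d) \<oplus> (r' \<otimes> d) \<otimes> (s \<otimes> b)" by ((simp add: ring_norm; fail) | (rule ring_eqI, (simp add: ring_norm; fail), simp_all))
    also have "\<dots> = (a \<otimes> d \<oplus> c \<otimes> b) \<otimes> (s \<otimes> s')" unfolding ab cd by ((simp add: ring_norm; fail) | (rule ring_eqI, (simp add: ring_norm; fail), simp_all))
    finally show "fraction R (a \<otimes> d \<oplus> c \<otimes> b) (b \<otimes> d) = fraction R (r \<otimes> s' \<oplus> r' \<otimes> s) (s \<otimes> s')"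
      using fraction_eq_iff[of "r \<otimes> s' \<oplus> r' \<otimes> s" "s \<otimes> s'" "a \<otimes> d \<oplus> c \<otimes> b" "b \<otimes> d"]
        reg_mult ab(2) cd(2) assms(2,4) by simp
  qed
  then show ?thesis by (simp add: total_frac_def)
qed

lemma frac_zero: "\<zero>\<^bsub>TF\<^esub> = fraction R \<zero> \<one>" and frac_one: "\<one>\<^bsub>TF\<^esub> = fraction R \<one> \<one>"
  by (simp_all add: total_frac_def)

lemma frac_eqI:
  assumes "r \<in> carrier R" "reg s" "r' \<in> carrier R" "reg s'" "r \<otimes> s' = r' \<otimes> s"
  shows "fraction R r s = fraction R r' s'"
  using assms fraction_eq_iff by simp

text \<open>
The ring axioms for fractions, checked on representatives by cross-multiplication.
\<close>

theorem total_frac_cring: "cring TF"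
proof (rule cringI)
  note FI = frac_carrierI reg_mult reg_one
  show "abelian_group TF"
  proof (rule abelian_groupI)
    fix x y assume "x \<in> carrier TF" "y \<in> carrier TF"
    then obtain r s r' s' where 1: "r \<in> carrier R" "reg s" "x = fraction R r s" and 2: "r' \<in> carrier R" "reg s'" "y = fraction R r' s'"
      by (elim frac_carrierE)
    note [simp] = 1(1) 2(1) regD(1)[OF 1(2)] regD(1)[OF 2(2)]
    show "x \<oplus>\<^bsub>TF\<^esub> y \<in> carrier TF" using 1 2 by (simp add: frac_add FI)
    have "r \<otimes> s' \<oplus> r' \<otimes> s = r' \<otimes> s \<oplus> r \<otimes> s'" "s \<otimes> s' = s' \<otimes> s" by (simp_all add: m_comm a_comm)
    then show "x \<oplus>\<^bsub>TF\<^esub> y = y \<oplus>\<^bsub>TF\<^esub> x" using 1 2 by (simp add: frac_add)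
    fix z assume "z \<in> carrier TF"
    then obtain r'' s'' where 3: "r'' \<in> carrier R" "reg s''" "z = fraction R r'' s''" by (rule frac_carrierE)
    note [simp] = 3(1) regD(1)[OF 3(2)]
    have "(r \<otimes> s' \<oplus> r' \<otimes> s) \<otimes> s'' \<oplus> r'' \<otimes> (s \<otimes> s') = r \<otimes> (s' \<otimes> s'') \<oplus> (r' \<otimes> s'' \<oplus> r'' \<otimes> s') \<otimes> s"
      by ((simp add: ring_norm; fail) | (rule ring_eqI, (simp add: ring_norm; fail), simp_all))
    then show "x \<oplus>\<^bsub>TF\<^esub> y \<oplus>\<^bsub>TF\<^esub> z = x \<oplus>\<^bsub>TF\<^esub> (y \<oplus>\<^bsub>TF\<^esub> z)"
      using 1(2) 2(2) 3(2) unfolding 1(3) 2(3) 3(3) by (simp add: frac_add reg_mult m_assoc)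
  next
    show "\<zero>\<^bsub>TF\<^esub> \<in> carrier TF" unfolding frac_zero by (simp add: FI)
    fix x assume "x \<in> carrier TF"
    then obtain r s where 1: "r \<in> carrier R" "reg s" "x = fraction R r s" by (rule frac_carrierE)
    note [simp] = 1(1) regD(1)[OF 1(2)]
    show "\<zero>\<^bsub>TF\<^esub> \<oplus>\<^bsub>TF\<^esub> x = x" using 1 by (simp add: frac_zero frac_add reg_one)
    have e: "(\<ominus> r) \<otimes> s \<oplus> r \<otimes> s = \<zero>" by (simp add: l_minus l_neg)
    have "fraction R (\<ominus> r) s \<oplus>\<^bsub>TF\<^esub> x = \<zero>\<^bsub>TF\<^esub>"
      using 1(2) unfolding 1(3) frac_zero by (simp add: frac_add e) (rule frac_eqI, simp_all add: reg_mult reg_one)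
    then show "\<exists>y\<in>carrier TF. y \<oplus>\<^bsub>TF\<^esub> x = \<zero>\<^bsub>TF\<^esub>" using 1(2) by (intro bexI[of _ "fraction R (\<ominus> r) s"]) (simp_all add: FI)
  qed
  show "comm_monoid TF"
  proof (rule comm_monoidI)
    fix x y assume "x \<in> carrier TF" "y \<in> carrier TF"
    then obtain r s r' s' where 1: "r \<in> carrier R" "reg s" "x = fraction R r s" and 2: "r' \<in> carrier R" "reg s'" "y = fraction R r' s'"
      by (elim frac_carrierE)
    note [simp] = 1(1) 2(1) regD(1)[OF 1(2)] regD(1)[OF 2(2)]
    show "x \<otimes>\<^bsub>TF\<^esub> y \<in> carrier TF" using 1 2 by (simp add: frac_mult FI)
    show "x \<otimes>\<^bsub>TF\<^esub> y = y \<otimes>\<^bsub>TF\<^esub> x" using 1 2 by (simp add: frac_mult m_comm)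
    fix z assume "z \<in> carrier TF"
    then obtain r'' s'' where 3: "r'' \<in> carrier R" "reg s''" "z = fraction R r'' s''" by (rule frac_carrierE)
    note [simp] = 3(1) regD(1)[OF 3(2)]
    show "x \<otimes>\<^bsub>TF\<^esub> y \<otimes>\<^bsub>TF\<^esub> z = x \<otimes>\<^bsub>TF\<^esub> (y \<otimes>\<^bsub>TF\<^esub> z)"
      using 1(2) 2(2) 3(2) unfolding 1(3) 2(3) 3(3) by (simp add: frac_mult reg_mult m_assoc)
  next
    show "\<one>\<^bsub>TF\<^esub> \<in> carrier TF" unfolding frac_one by (simp add: FI)
    fix x assume "x \<in> carrier TF"
    then obtain r s where 1: "r \<in> carrier R" "reg s" "x = fraction R r s" by (rule frac_carrierE)
    show "\<one>\<^bsub>TF\<^esub> \<otimes>\<^bsub>TF\<^esub> x = x" using 1 by (simp add: frac_one frac_mult reg_one regD)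
  qed
  fix x y z assume "x \<in> carrier TF" "y \<in> carrier TF" "z \<in> carrier TF"
  then obtain r s r' s' r'' s'' where 1: "r \<in> carrier R" "reg s" "x = fraction R r s"
    and 2: "r' \<in> carrier R" "reg s'" "y = fraction R r' s'" and 3: "r'' \<in> carrier R" "reg s''" "z = fraction R r'' s''"
    by (elim frac_carrierE)
  note [simp] = 1(1) 2(1) 3(1) regD(1)[OF 1(2)] regD(1)[OF 2(2)] regD(1)[OF 3(2)]
  have "(r \<otimes> s' \<oplus> r' \<otimes> s) \<otimes> r'' \<otimes> ((s \<otimes> s'') \<otimes> (s' \<otimes> s'')) = (r \<otimes> r'' \<otimes> (s' \<otimes> s'') \<oplus> r' \<otimes> r'' \<otimes> (s \<otimes> s'')) \<otimes> (s \<otimes> s' \<otimes> s'')"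
    by ((simp add: ring_norm; fail) | (rule ring_eqI, (simp add: ring_norm; fail), simp_all))
  then show "(x \<oplus>\<^bsub>TF\<^esub> y) \<otimes>\<^bsub>TF\<^esub> z = x \<otimes>\<^bsub>TF\<^esub> z \<oplus>\<^bsub>TF\<^esub> y \<otimes>\<^bsub>TF\<^esub> z"
    using 1(2) 2(2) 3(2) unfolding 1(3) 2(3) 3(3)
    by (simp add: frac_mult frac_add reg_mult) (rule frac_eqI, simp_all add: reg_mult)
qed

abbreviation em where "em \<equiv> emb R"

lemma emb_zero: "em \<zero> = \<zero>\<^bsub>TF\<^esub>" and emb_one: "em \<one> = \<one>\<^bsub>TF\<^esub>"
  unfolding emb_def frac_zero frac_one by (rule refl)+

lemma emb_simps:
  assumes "r \<in> carrier R" "s \<in> carrier R"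
  shows "em r \<in> carrier TF" "em (r \<oplus> s) = em r \<oplus>\<^bsub>TF\<^esub> em s" "em (r \<otimes> s) = em r \<otimes>\<^bsub>TF\<^esub> em s"
proof -
  show "em r \<in> carrier TF" unfolding emb_def by (rule frac_carrierI[OF assms(1) reg_one])
  show "em (r \<oplus> s) = em r \<oplus>\<^bsub>TF\<^esub> em s" "em (r \<otimes> s) = em r \<otimes>\<^bsub>TF\<^esub> em s"
    unfolding emb_def using assms by (simp_all add: frac_add frac_mult reg_one)
qed

lemma emb_inj: "r \<in> carrier R \<Longrightarrow> s \<in> carrier R \<Longrightarrow> em r = em s \<longleftrightarrow> r = s"
  by (simp add: emb_def fraction_eq_iff reg_one)

lemma emb_hom: "em \<in> ring_hom R TF"
  by (rule ring_hom_memI) (auto simp: emb_simps emb_one)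

lemma emb_uminus: "r \<in> carrier R \<Longrightarrow> em (\<ominus> r) = \<ominus>\<^bsub>TF\<^esub> em r"
  using ring_hom_ring.axioms emb_hom ring_hom_cring.hom_a_inv[of R TF em] total_frac_cring is_cring
  by (simp add: ring_hom_cring_def ring_hom_cring_axioms_def)

lemma emb_minus: "r \<in> carrier R \<Longrightarrow> s \<in> carrier R \<Longrightarrow> em (r \<ominus> s) = em r \<ominus>\<^bsub>TF\<^esub> em s"
  by (simp add: a_minus_def emb_simps emb_uminus)

lemma frac_inverse:
  assumes "reg s" "reg t"
  shows "fraction R s t \<in> Units TF" "fraction R s t \<otimes>\<^bsub>TF\<^esub> fraction R t s = \<one>\<^bsub>TF\<^esub>"
proof -
  interpret T: cring TF by (rule total_frac_cring)
  have c: "s \<in> carrier R" "t \<in> carrier R" using assms regD by auto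
  show 1: "fraction R s t \<otimes>\<^bsub>TF\<^esub> fraction R t s = \<one>\<^bsub>TF\<^esub>"
    using assms c by (simp add: frac_mult frac_one) (rule frac_eqI, simp_all add: reg_mult reg_one m_comm)
  then have "fraction R t s \<otimes>\<^bsub>TF\<^esub> fraction R s t = \<one>\<^bsub>TF\<^esub>"
    using assms c by (simp add: T.m_comm frac_carrierI)
  then show "fraction R s t \<in> Units TF"
    using 1 assms c frac_carrierI unfolding Units_def by blast
qed

lemma emb_unit_iff:
  assumes "s \<in> carrier R"
  shows "em s \<in> Units TF \<longleftrightarrow> reg s"
proof
  interpret T: cring TF by (rule total_frac_cring)
  assume u: "em s \<in> Units TF"
  show "reg s" unfolding regular_element_def
  proof (intro conjI ballI impI assms)
    fix r assume r: "r \<in> carrier R" "s \<otimes> r = \<zero>"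
    have "em s \<otimes>\<^bsub>TF\<^esub> em r = \<zero>\<^bsub>TF\<^esub>"
      unfolding emb_simps(3)[OF assms r(1), symmetric] r(2) emb_zero by (rule refl)
    then have "em s \<otimes>\<^bsub>TF\<^esub> em r = em s \<otimes>\<^bsub>TF\<^esub> \<zero>\<^bsub>TF\<^esub>"
      using T.r_null[OF emb_simps(1)[OF assms assms]] by simp
    then have "em r = \<zero>\<^bsub>TF\<^esub>" using T.Units_l_cancel[OF u] r by (simp add: emb_simps emb_zero)
    then show "r = \<zero>" using emb_inj[of r \<zero>] r by (simp add: emb_simps emb_zero)
  qed
next
  assume "reg s" then show "em s \<in> Units TF" unfolding emb_def using frac_inverse reg_one by blast
qed

lemma frac_emb:
  assumes "r \<in> carrier R" "reg s"
  shows "em s \<otimes>\<^bsub>TF\<^esub> fraction R r s = em r"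
  unfolding emb_def using assms regD(1)[OF assms(2)]
  by (simp add: frac_mult reg_one) (rule frac_eqI, simp_all add: reg_one reg_mult m_comm)

theorem total_frac_pair: "fraction_pair TF (base R)"
proof -
  interpret T: cring TF by (rule total_frac_cring)
  show ?thesis
  proof (intro fraction_pair.intro fraction_pair_axioms.intro total_frac_cring)
    show "subring (base R) TF"
    proof (rule T.subringI)
      show "base R \<subseteq> carrier TF" using emb_simps by auto
      show "\<one>\<^bsub>TF\<^esub> \<in> base R" using imageI[OF one_closed, of em] unfolding emb_one .
      show "\<ominus>\<^bsub>TF\<^esub> h \<in> base R" if "h \<in> base R" for h
        using that by (auto simp: emb_uminus[symmetric])
      show "h \<otimes>\<^bsub>TF\<^esub> k \<in> base R" if "h \<in> base R" "k \<in> base R" for h k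
        using that by (auto simp: emb_simps(3)[symmetric])
      show "h \<oplus>\<^bsub>TF\<^esub> k \<in> base R" if "h \<in> base R" "k \<in> base R" for h k
        using that by (auto simp: emb_simps(2)[symmetric])
    qed
    fix q assume "q \<in> carrier TF"
    then obtain r s where q: "r \<in> carrier R" "reg s" "q = fraction R r s" by (rule frac_carrierE)
    then show "\<exists>s\<in>base R \<inter> Units TF. s \<otimes>\<^bsub>TF\<^esub> q \<in> base R"
      using frac_emb[OF q(1,2)] emb_unit_iff[of s] regD(1)[OF q(2)] by (intro bexI[of _ "em s"]) auto
  qed
qed

lemma emb_closed: "r \<in> carrier R \<Longrightarrow> emb R r \<in> carrier TF"
  by (rule emb_simps(1))

lemma emb_ideal_submod:
  assumes K: "ideal K R"
  shows "submod TF (base R) (emb R ` K)"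
proof -
  interpret K: ideal K R by fact
  have Kc: "k \<in> K \<Longrightarrow> k \<in> carrier R" for k using K.a_subset by auto
  show ?thesis
    unfolding submod_def
  proof (intro conjI ballI)
    show "emb R ` K \<subseteq> carrier TF" using Kc emb_closed by auto
    show "\<zero>\<^bsub>TF\<^esub> \<in> emb R ` K" unfolding emb_zero[symmetric] by simp
    show "u \<oplus>\<^bsub>TF\<^esub> v \<in> emb R ` K" if "u \<in> emb R ` K" "v \<in> emb R ` K" for u v
      using that by (auto simp: emb_simps(2)[symmetric] Kc)
    show "r \<otimes>\<^bsub>TF\<^esub> u \<in> emb R ` K" if "r \<in> base R" "u \<in> emb R ` K" for r u
      using that by (auto simp: emb_simps(3)[symmetric] Kc K.I_l_closed)
  qed
qed

lemma submod_preimage_ideal: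
  assumes J: "submod TF (base R) J"
  shows "ideal {r \<in> carrier R. emb R r \<in> J} R"
proof (rule idealI)
  interpret P: fraction_pair TF "base R" by (rule total_frac_pair)
  note JD = P.smodD[OF J]
  show "ring R" by (rule ring_axioms)
  show "subgroup {r \<in> carrier R. emb R r \<in> J} (add_monoid R)"
  proof (rule add.subgroupI)
    have "\<zero> \<in> {r \<in> carrier R. emb R r \<in> J}" using JD(2) by (simp add: emb_zero)
    then show "{r \<in> carrier R. emb R r \<in> J} \<noteq> {}" by blast
  qed (use JD P.smod_uminus[OF J] in \<open>auto simp: emb_simps emb_uminus\<close>)
  show "r \<otimes> a \<in> {r \<in> carrier R. emb R r \<in> J}" "a \<otimes> r \<in> {r \<in> carrier R. emb R r \<in> J}"
    if "a \<in> {r \<in> carrier R. emb R r \<in> J}" "r \<in> carrier R" for a r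
    using that JD(4)[of "emb R r" "emb R a"] by (auto simp: emb_simps P.m_comm)
qed

end

section \<open>Cosets modulo a submodule\<close>

context fraction_pair
begin

lemma coset_mem: "y \<in> V +> w \<longleftrightarrow> (\<exists>h\<in>V. y = h \<oplus> w)"
  by (auto simp: a_r_coset_def')

lemma coset_eq_iff:
  assumes V: "smod V" and [simp]: "w \<in> carrier Q" "w' \<in> carrier Q"
  shows "V +> w = V +> w' \<longleftrightarrow> w \<ominus> w' \<in> V"
proof
  assume e: "V +> w = V +> w'"
  have "w \<in> V +> w" using smodD(2)[OF V] by (auto simp: coset_mem intro!: bexI[of _ \<zero>])
  then obtain h where h: "h \<in> V" and w: "w = h \<oplus> w'" unfolding e coset_mem by blast
  have [simp]: "h \<in> carrier Q" using smodD(1)[OF V h] .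
  have "w \<ominus> w' = h" unfolding w by ((simp add: ring_norm; fail) | (rule ring_eqI, (simp add: ring_norm; fail), simp_all))
  then show "w \<ominus> w' \<in> V" using h by simp
next
  have sub: "V +> a \<subseteq> V +> b" if d: "a \<ominus> b \<in> V" and [simp]: "a \<in> carrier Q" "b \<in> carrier Q" for a b
  proof
    fix y assume "y \<in> V +> a"
    then obtain h where h: "h \<in> V" and y: "y = h \<oplus> a" unfolding coset_mem by blast
    have [simp]: "h \<in> carrier Q" using smodD(1)[OF V h] .
    have "y = (h \<oplus> (a \<ominus> b)) \<oplus> b" unfolding y by ((simp add: ring_norm; fail) | (rule ring_eqI, (simp add: ring_norm; fail), simp_all))
    then show "y \<in> V +> b" unfolding coset_mem using smodD(3)[OF V h d] by blast
  qed
  assume d: "w \<ominus> w' \<in> V"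
  have "w' \<ominus> w = \<ominus> (w \<ominus> w')" by ((simp add: ring_norm; fail) | (rule ring_eqI, (simp add: ring_norm; fail), simp_all))
  then have "w' \<ominus> w \<in> V" using smod_uminus[OF V d] by simp
  then show "V +> w = V +> w'" using sub[OF d] sub[of w' w] by auto
qed

lemma coset_add:
  assumes V: "smod V" and [simp]: "w \<in> carrier Q" "w' \<in> carrier Q"
  shows "(V +> w) <+>\<^bsub>Q\<^esub> (V +> w') = V +> (w \<oplus> w')"
proof (intro equalityI subsetI)
  fix y assume "y \<in> (V +> w) <+>\<^bsub>Q\<^esub> (V +> w')"
  then obtain h h' where h: "h \<in> V" "h' \<in> V" and y: "y = (h \<oplus> w) \<oplus> (h' \<oplus> w')"
    unfolding set_add_def' by (auto simp: coset_mem)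
  have [simp]: "h \<in> carrier Q" "h' \<in> carrier Q" using smodD(1)[OF V] h by auto
  have "y = (h \<oplus> h') \<oplus> (w \<oplus> w')" unfolding y by ((simp add: ring_norm; fail) | (rule ring_eqI, (simp add: ring_norm; fail), simp_all))
  then show "y \<in> V +> (w \<oplus> w')" unfolding coset_mem using smodD(3)[OF V h] by blast
next
  fix y assume "y \<in> V +> (w \<oplus> w')"
  then obtain h where h: "h \<in> V" and y: "y = h \<oplus> (w \<oplus> w')" unfolding coset_mem by blast
  have [simp]: "h \<in> carrier Q" using smodD(1)[OF V] h by auto
  have "y = (h \<oplus> w) \<oplus> (\<zero> \<oplus> w')" unfolding y by ((simp add: ring_norm; fail) | (rule ring_eqI, (simp add: ring_norm; fail), simp_all))
  moreover have "h \<oplus> w \<in> V +> w" "\<zero> \<oplus> w' \<in> V +> w'" using h smodD(2)[OF V] coset_mem by blast+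
  ultimately show "y \<in> (V +> w) <+>\<^bsub>Q\<^esub> (V +> w')"
    unfolding set_add_def' by blast
qed

end

text \<open>
One-dimensional Cohen-Macaulay local rings in the form used for duality. The equivalence with the
definition by depth and Krull dimension is \<open>cohen_macaulay_one_dim\<close> and
\<open>one_dim_ring.cohen_macaulay\<close>.
\<close>

locale one_dim_ring = cring R for R (structure) + fixes \<mm> :: "'a set"
  assumes noetherian: "noetherian_ring R"
    and maxid: "maximalideal \<mm> R"
    and maxid_unique: "maximalideal \<nn> R \<Longrightarrow> \<nn> = \<mm>"
    and pair: "one_dim_local_pair (total_frac R) (base R) (emb R ` \<mm>)"

sublocale one_dim_ring \<subseteq> P: one_dim_local_pair "total_frac R" "base R" "emb R ` \<mm>"
  by (rule pair)

context one_dim_ring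
begin

abbreviation qmul (infixl "\<star>" 70) where "x \<star> y \<equiv> x \<otimes>\<^bsub>total_frac R\<^esub> y"
abbreviation qadd (infixl "\<boxplus>" 65) where "x \<boxplus> y \<equiv> x \<oplus>\<^bsub>total_frac R\<^esub> y"
abbreviation qsub (infixl "\<boxminus>" 65) where "x \<boxminus> y \<equiv> x \<ominus>\<^bsub>total_frac R\<^esub> y"
abbreviation emR where "emR \<equiv> emb R"
abbreviation Bq where "Bq x \<equiv> R Quot (PIdl x)"
abbreviation rho where "rho x r \<equiv> (PIdl x) +> r"
abbreviation Wm where "Wm W \<equiv> (frac_module R)\<lparr>carrier := W\<rparr>"
abbreviation Em where "Em W x \<equiv> quotient_module R (Wm W) x"
abbreviation xW where "xW W x \<equiv> (\<lambda>w. emR x \<star> w) ` W"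
abbreviation kap where "kap W x w \<equiv> xW W x +>\<^bsub>TF\<^esub> w"

lemma mm_ideal: "ideal \<mm> R" using maxid unfolding maximalideal_def by simp

lemma mm_carrier: "r \<in> \<mm> \<Longrightarrow> r \<in> carrier R"
  using additive_subgroup.a_subset[OF ideal.axioms(1)[OF mm_ideal]] by auto

lemma one_not_mm: "\<one> \<notin> \<mm>"
proof
  assume "\<one> \<in> \<mm>"
  then show False using P.maxideal(3) imageI[of "\<one>" \<mm> emR] unfolding emb_one by blast
qed

lemma divide:
  assumes "reg x" "q \<in> carrier TF"
  obtains e where "e \<in> carrier TF" "emR x \<star> e = q"
proof -
  have x: "emR x \<in> Units TF" using emb_unit_iff[of x] assms regD(1) by auto
  obtain v where v: "emR x \<in> carrier TF" "v \<in> carrier TF" "emR x \<star> v = \<one>\<^bsub>TF\<^esub>" using P.UnitsE[OF x] by metis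
  have "emR x \<star> (v \<star> q) = q" using v assms(2) by (simp add: P.m_assoc[symmetric])
  then show thesis using v assms(2) by (intro that[of "v \<star> q"]) auto
qed

subsection \<open>The quotient ring\<close>

lemma pideal: "x \<in> carrier R \<Longrightarrow> ideal (PIdl x) R" by (rule cgenideal_ideal)

lemma pideal_iff: "r \<in> PIdl x \<longleftrightarrow> (\<exists>c\<in>carrier R. r = c \<otimes> x)"
  unfolding cgenideal_def by auto

lemma B_cring: "x \<in> carrier R \<Longrightarrow> cring (Bq x)"
  using ideal.quotient_is_cring[OF pideal is_cring] .

lemma rho_hom: "x \<in> carrier R \<Longrightarrow> ring_hom_ring R (Bq x) (rho x)"
  using ideal.rcos_ring_hom_ring[OF pideal] .

lemma B_carrier: "carrier (Bq x) = rho x ` carrier R"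
  unfolding FactRing_def A_RCOSETS_def' by auto

lemma rho_eq_iff: "x \<in> carrier R \<Longrightarrow> r \<in> carrier R \<Longrightarrow> s \<in> carrier R \<Longrightarrow> rho x r = rho x s \<longleftrightarrow> r \<ominus> s \<in> PIdl x"
  using quotient_eq_iff_same_a_r_cos[OF pideal] by simp

lemma rho_simps:
  assumes x: "x \<in> carrier R" and r: "r \<in> carrier R" "s \<in> carrier R"
  shows "rho x r \<in> carrier (Bq x)" "rho x r \<oplus>\<^bsub>Bq x\<^esub> rho x s = rho x (r \<oplus> s)"
    "rho x r \<otimes>\<^bsub>Bq x\<^esub> rho x s = rho x (r \<otimes> s)" "\<one>\<^bsub>Bq x\<^esub> = rho x \<one>" "\<zero>\<^bsub>Bq x\<^esub> = rho x \<zero>"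
proof -
  interpret h: ring_hom_ring R "Bq x" "rho x" using rho_hom[OF x] .
  show "rho x r \<in> carrier (Bq x)" "rho x r \<oplus>\<^bsub>Bq x\<^esub> rho x s = rho x (r \<oplus> s)"
    "rho x r \<otimes>\<^bsub>Bq x\<^esub> rho x s = rho x (r \<otimes> s)" "\<one>\<^bsub>Bq x\<^esub> = rho x \<one>" "\<zero>\<^bsub>Bq x\<^esub> = rho x \<zero>"
    using r by simp_all
qed

lemma pideal_mm: "x \<in> \<mm> \<Longrightarrow> PIdl x \<subseteq> \<mm>"
  using ideal.I_l_closed[OF mm_ideal] by (auto simp: pideal_iff)

lemma proj_preimage:
  assumes x: "x \<in> carrier R" and K: "ideal K (Bq x)"
  defines "K0 \<equiv> {r \<in> carrier R. rho x r \<in> K}"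
  shows "ideal K0 R" "x \<in> K0" "K = rho x ` K0"
proof -
  interpret h: ring_hom_ring R "Bq x" "rho x" using rho_hom[OF x] .
  interpret K: ideal K "Bq x" by fact
  show "ideal K0 R" unfolding K0_def by (rule h.ideal_vimage[OF K])
  have "rho x x = \<zero>\<^bsub>Bq x\<^esub>" unfolding rho_simps(5)[OF x x x] using x
    by (subst rho_eq_iff) (auto simp: pideal_iff minus_eq intro!: bexI[of _ \<one>])
  then show "x \<in> K0" unfolding K0_def using x by simp
  show "K = rho x ` K0" unfolding K0_def using K.a_subset B_carrier by auto
qed

lemma B_maximal:
  assumes x: "x \<in> \<mm>"
  shows "maximalideal (rho x ` \<mm>) (Bq x)"
proof -
  have xc: "x \<in> carrier R" using mm_carrier[OF x] .
  interpret M: maximalideal \<mm> R by (rule maxid)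
  have mem: "r \<in> \<mm>" if "r \<in> carrier R" "rho x r \<in> rho x ` \<mm>" for r
  proof -
    from that(2) obtain m where m: "m \<in> \<mm>" "rho x r = rho x m" by blast
    then have "r \<ominus> m \<in> \<mm>" using rho_eq_iff[OF xc that(1)] mm_carrier[OF m(1)] pideal_mm[OF x] by auto
    then have "(r \<ominus> m) \<oplus> m \<in> \<mm>" using m by simp
    then show ?thesis using that(1) mm_carrier[OF m(1)] by (simp add: minus_eq a_assoc l_neg)
  qed
  show ?thesis
  proof (rule maximalidealI)
    show "ideal (rho x ` \<mm>) (Bq x)" by (rule ring_ideal_imp_quot_ideal[OF pideal[OF xc] mm_ideal])
    show "carrier (Bq x) \<noteq> rho x ` \<mm>"
    proof
      assume "carrier (Bq x) = rho x ` \<mm>"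
      then have "rho x \<one> \<in> rho x ` \<mm>" using B_carrier by auto
      then show False using mem[OF one_closed] one_not_mm by simp
    qed
    fix K assume K: "ideal K (Bq x)" "rho x ` \<mm> \<subseteq> K" "K \<subseteq> carrier (Bq x)"
    note K0 = proj_preimage[OF xc K(1)]
    have "\<mm> \<subseteq> {r \<in> carrier R. rho x r \<in> K}" using K(2) mm_carrier by auto
    then have "{r \<in> carrier R. rho x r \<in> K} = \<mm> \<or> {r \<in> carrier R. rho x r \<in> K} = carrier R"
      using M.I_maximal[OF K0(1)] by auto
    moreover have "K = rho x ` L" if "{r \<in> carrier R. rho x r \<in> K} = L" for L
      using K0(3) unfolding that .
    ultimately show "K = rho x ` \<mm> \<or> K = carrier (Bq x)" unfolding B_carrier by blast
  qed
qed

lemma B_local: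
  assumes x: "x \<in> \<mm>"
  shows "local_ring (Bq x) (rho x ` \<mm>)"
  unfolding local_ring_def
proof (intro conjI allI impI)
  have xc: "x \<in> carrier R" using mm_carrier[OF x] .
  show "cring (Bq x)" using B_cring[OF xc] .
  show "maximalideal (rho x ` \<mm>) (Bq x)" using B_maximal[OF x] .
  fix K assume Kmax: "maximalideal K (Bq x)"
  interpret K: maximalideal K "Bq x" by fact
  have K: "ideal K (Bq x)" by (rule K.ideal_axioms)
  note K0 = proj_preimage[OF xc K]
  let ?K0 = "{r \<in> carrier R. rho x r \<in> K}"
  have "maximalideal ?K0 R"
  proof (rule maximalidealI)
    show "ideal ?K0 R" by (rule K0)
    show "carrier R \<noteq> ?K0"
    proof
      assume "carrier R = ?K0"
      then have "K = carrier (Bq x)" using K0(3) unfolding B_carrier by metis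
      then show False using K.I_notcarr by blast
    qed
    fix L assume L: "ideal L R" "?K0 \<subseteq> L" "L \<subseteq> carrier R"
    have "ideal (rho x ` L) (Bq x)" by (rule ring_ideal_imp_quot_ideal[OF pideal[OF xc] L(1)])
    moreover have "K \<subseteq> rho x ` L" by (subst K0(3)) (rule image_mono[OF L(2)])
    moreover have "rho x ` L \<subseteq> carrier (Bq x)" using L(3) B_carrier by auto
    ultimately have "rho x ` L = K \<or> rho x ` L = carrier (Bq x)" using K.I_maximal by simp
    moreover have "L = ?K0" if "rho x ` L = K" using that L by auto
    moreover have "L = carrier R" if e: "rho x ` L = carrier (Bq x)"
    proof (intro equalityI L(3) subsetI)
      fix r assume r: "r \<in> carrier R"
      then have "rho x r \<in> rho x ` L" using e B_carrier by auto
      then obtain l where l: "l \<in> L" "rho x r = rho x l" by blast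
      have lc: "l \<in> carrier R" using l L by auto
      have "r \<ominus> l \<in> PIdl x" using l rho_eq_iff[OF xc r lc] by simp
      then have "r \<ominus> l \<in> L" using ideal.I_l_closed[OF L(1), of x] K0(2) L(2) by (auto simp: pideal_iff)
      then have "(r \<ominus> l) \<oplus> l \<in> L" using additive_subgroup.a_closed[OF ideal.axioms(1)[OF L(1)]] l by simp
      then show "r \<in> L" using r lc by (simp add: minus_eq a_assoc l_neg)
    qed
    ultimately show "L = ?K0 \<or> L = carrier R" by blast
  qed
  then have "?K0 = \<mm>" by (rule maxid_unique)
  then show "K = rho x ` \<mm>" using K0(3) by metis
qed

subsection \<open>The quotient module\<close>

lemma frac_module_module: "module R (frac_module R)"
proof (rule moduleI)
  show "cring R" by (rule is_cring)
  show "abelian_group (frac_module R)"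
    by (rule abelian_groupI)
      (auto simp: P.a_ac intro!: bexI[of _ "\<ominus>\<^bsub>TF\<^esub> _"] P.l_neg simp: ring_as_module_def ring.defs module.defs)
qed (auto simp: ring_as_module_def ring.defs module.defs emb_simps emb_one P.l_distr P.r_distr P.m_assoc)

lemma submodule_iff: "submodule H R (frac_module R) \<longleftrightarrow> P.smod H"
proof
  interpret F: module R "frac_module R" by (rule frac_module_module)
  assume "submodule H R (frac_module R)"
  note S = F.submoduleE[OF this]
  have "\<zero>\<^bsub>frac_module R\<^esub> \<in> H" using submodule.axioms(1)[OF \<open>submodule _ _ _\<close>] subgroup.one_closed by fastforce
  then show "P.smod H"
    using S by (auto simp: submod_def ring_as_module_def ring.defs module.defs)
next
  interpret F: module R "frac_module R" by (rule frac_module_module)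
  assume H: "P.smod H"
  have smul: "r \<odot>\<^bsub>frac_module R\<^esub> a = emR r \<star> a" for r a
    by (simp add: ring_as_module_def ring.defs module.defs)
  have inv: "\<ominus>\<^bsub>frac_module R\<^esub> a \<in> H" if a: "a \<in> H" for a
  proof -
    have ac: "a \<in> carrier (frac_module R)"
      using P.smodD(1)[OF H a] by (simp add: ring_as_module_def ring.defs module.defs)
    have "(\<ominus> \<one>) \<odot>\<^bsub>frac_module R\<^esub> a = \<ominus>\<^bsub>frac_module R\<^esub> a"
      using F.smult_l_minus[OF one_closed ac] F.smult_one[OF ac] by simp
    then show ?thesis using P.smodD(4)[OF H _ a, of "emR (\<ominus> \<one>)"] unfolding smul by simp
  qed
  show "submodule H R (frac_module R)"
  proof (rule F.submoduleI)
    show "\<ominus>\<^bsub>frac_module R\<^esub> a \<in> H" if "a \<in> H" for a by (rule inv[OF that])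
  qed (use P.smodD[OF H] in \<open>auto simp: ring_as_module_def ring.defs module.defs\<close>)
qed

lemma Wm_module: "P.smod W \<Longrightarrow> module R (Wm W)"
  using submodule.submodule_is_module[OF _ frac_module_module, of W] submodule_iff[of W] by simp

lemma Wm_simps:
  "carrier (Wm W) = W" "w \<oplus>\<^bsub>Wm W\<^esub> v = w \<boxplus> v" "\<zero>\<^bsub>Wm W\<^esub> = \<zero>\<^bsub>TF\<^esub>" "r \<odot>\<^bsub>Wm W\<^esub> w = emR r \<star> w"
  by (simp_all add: ring_as_module_def ring.defs module.defs)

lemma xW_smod: "P.smod W \<Longrightarrow> x \<in> carrier R \<Longrightarrow> P.smod (xW W x)"
  by (rule P.smod_scale) (auto simp: emb_simps)

lemma Em_carrier: "carrier (Em W x) = kap W x ` W"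
  unfolding quotient_module_def Let_def
  by (auto simp: ring.defs module.defs ring_as_module_def FactRing_def A_RCOSETS_def' a_r_coset_def')

lemma Em_add: "C \<oplus>\<^bsub>Em W x\<^esub> D = C <+>\<^bsub>TF\<^esub> D"
  unfolding quotient_module_def Let_def
  by (simp add: ring.defs module.defs ring_as_module_def FactRing_def set_add_def')

lemma Em_zero: "\<zero>\<^bsub>Em W x\<^esub> = xW W x"
  unfolding quotient_module_def Let_def
  by (simp add: ring.defs module.defs ring_as_module_def FactRing_def)

lemma Em_smult: "C \<odot>\<^bsub>Em W x\<^esub> D = (\<Union>r\<in>C. \<Union>w\<in>D. kap W x (emR r \<star> w))"
  unfolding quotient_module_def Let_def
  by (simp add: ring.defs module.defs ring_as_module_def FactRing_def a_r_coset_def')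

context
  fixes W x
  assumes W: "P.smod W" and x: "x \<in> carrier R"
begin

lemma emx [simp]: "emR x \<in> carrier TF" using x emb_simps by simp

lemma kap_eq_iff: "w \<in> W \<Longrightarrow> w' \<in> W \<Longrightarrow> kap W x w = kap W x w' \<longleftrightarrow> w \<boxminus> w' \<in> xW W x"
  using P.coset_eq_iff[OF xW_smod[OF W x]] P.smodD(1)[OF W] by simp

lemma kap_add: "w \<in> W \<Longrightarrow> w' \<in> W \<Longrightarrow> kap W x w \<oplus>\<^bsub>Em W x\<^esub> kap W x w' = kap W x (w \<boxplus> w')"
  unfolding Em_add using P.coset_add[OF xW_smod[OF W x]] P.smodD(1)[OF W] by simp

lemma kap_zero: "\<zero>\<^bsub>Em W x\<^esub> = kap W x \<zero>\<^bsub>TF\<^esub>"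
proof -
  have "xW W x +>\<^bsub>TF\<^esub> \<zero>\<^bsub>TF\<^esub> = xW W x"
    using P.smodD(1)[OF xW_smod[OF W x]] by (auto simp: P.coset_mem)
  then show ?thesis unfolding Em_zero by simp
qed

lemma kap_smult:
  assumes r: "r \<in> carrier R" and w: "w \<in> W"
  shows "rho x r \<odot>\<^bsub>Em W x\<^esub> kap W x w = kap W x (emR r \<star> w)"
proof -
  have wc: "w \<in> carrier TF" using P.smodD(1)[OF W w] .
  have one: "kap W x (emR r' \<star> w') = kap W x (emR r \<star> w)" if "r' \<in> rho x r" "w' \<in> kap W x w" for r' w'
  proof -
    obtain c where c: "c \<in> carrier R" "r' = c \<otimes> x \<oplus> r"
      using \<open>r' \<in> rho x r\<close> by (auto simp: a_r_coset_def' pideal_iff)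
    obtain v where v: "v \<in> W" "w' = emR x \<star> v \<boxplus> w"
      using \<open>w' \<in> kap W x w\<close> by (auto simp: P.coset_mem)
    have rc: "r' \<in> carrier R" using c r x by simp
    have w'W: "w' \<in> W" unfolding v(2) using P.smodD(3,4)[OF W] v(1) w x by simp
    define p where "p = emR c" define y where "y = emR x" define s where "s = emR r"
    have [simp]: "p \<in> carrier TF" "y \<in> carrier TF" "s \<in> carrier TF" "v \<in> carrier TF" "w \<in> carrier TF"
      using c r x v w P.smodD(1)[OF W] emb_simps by (auto simp: p_def s_def y_def)
    have e: "emR r' = p \<star> y \<boxplus> s" unfolding c(2) p_def y_def s_def using c r x by (simp add: emb_simps)
    have "emR r' \<star> w' \<boxminus> emR r \<star> w = y \<star> (p \<star> (y \<star> v) \<boxplus> p \<star> w \<boxplus> s \<star> v)"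
      unfolding e v(2) y_def[symmetric] s_def[symmetric] by ((simp add: P.ring_norm; fail) | (rule P.ring_eqI, (simp add: P.ring_norm; fail), simp_all))
    moreover have "p \<star> (y \<star> v) \<boxplus> p \<star> w \<boxplus> s \<star> v \<in> W"
      using P.smodD(3,4)[OF W] v(1) w c(1) r x by (simp add: p_def y_def s_def)
    ultimately have "emR r' \<star> w' \<boxminus> emR r \<star> w \<in> xW W x" unfolding y_def by (metis imageI)
    then show ?thesis using kap_eq_iff P.smodD(4)[OF W] rc r w w'W by simp
  qed
  have "r \<in> rho x r" using r x by (auto simp: a_r_coset_def' pideal_iff intro!: exI[of _ \<zero>] bexI[of _ \<zero>])
  moreover have "w \<in> kap W x w"
    unfolding P.coset_mem
    by (rule bexI[of _ "\<zero>\<^bsub>TF\<^esub>"], use wc in simp, rule P.smodD(2)[OF xW_smod[OF W x]])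
  ultimately show ?thesis unfolding Em_smult using one by blast
qed

lemma Em_module: "module (Bq x) (Em W x)"
proof -
  note WD = P.smodD[OF W]
  have k: "w \<in> W \<Longrightarrow> kap W x w \<in> carrier (Em W x)" for w by (simp add: Em_carrier)
  have emc: "r \<in> carrier R \<Longrightarrow> emR r \<in> carrier TF" for r by (simp add: emb_simps)
  note smp = kap_add kap_smult rho_simps[OF x] WD P.a_assoc P.m_assoc
  show ?thesis
  proof (rule moduleI)
    show "cring (Bq x)" using B_cring[OF x] .
    show "abelian_group (Em W x)"
    proof (rule abelian_groupI)
      fix C D assume "C \<in> carrier (Em W x)" "D \<in> carrier (Em W x)"
      then obtain w v where wv: "w \<in> W" "v \<in> W" "C = kap W x w" "D = kap W x v" by (auto simp: Em_carrier)
      show "C \<oplus>\<^bsub>Em W x\<^esub> D \<in> carrier (Em W x)" using wv k WD by (simp add: kap_add)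
      show "C \<oplus>\<^bsub>Em W x\<^esub> D = D \<oplus>\<^bsub>Em W x\<^esub> C" using wv WD(1) by (simp add: kap_add P.a_comm)
      fix F assume "F \<in> carrier (Em W x)"
      then obtain u where u: "u \<in> W" "F = kap W x u" by (auto simp: Em_carrier)
      show "C \<oplus>\<^bsub>Em W x\<^esub> D \<oplus>\<^bsub>Em W x\<^esub> F = C \<oplus>\<^bsub>Em W x\<^esub> (D \<oplus>\<^bsub>Em W x\<^esub> F)"
        using wv u WD by (simp add: kap_add P.a_assoc)
    next
      show "\<zero>\<^bsub>Em W x\<^esub> \<in> carrier (Em W x)" unfolding kap_zero using WD(2) k by simp
      fix C assume "C \<in> carrier (Em W x)"
      then obtain w where w: "w \<in> W" "C = kap W x w" by (auto simp: Em_carrier)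
      show "\<zero>\<^bsub>Em W x\<^esub> \<oplus>\<^bsub>Em W x\<^esub> C = C" unfolding kap_zero using w WD by (simp add: kap_add)
      show "\<exists>D\<in>carrier (Em W x). D \<oplus>\<^bsub>Em W x\<^esub> C = \<zero>\<^bsub>Em W x\<^esub>"
        by (rule bexI[of _ "kap W x (\<ominus>\<^bsub>TF\<^esub> w)"])
          (use w WD P.smod_uminus[OF W] k in \<open>simp_all add: kap_add kap_zero P.l_neg\<close>)
    qed
  next
    fix a C assume a: "a \<in> carrier (Bq x)" and C: "C \<in> carrier (Em W x)"
    obtain r where r: "r \<in> carrier R" "a = rho x r" using a unfolding B_carrier by blast
    obtain w where w: "w \<in> W" "C = kap W x w" using C unfolding Em_carrier by blast
    show "a \<odot>\<^bsub>Em W x\<^esub> C \<in> carrier (Em W x)" using r w k WD by (simp add: kap_smult)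
    fix b assume b: "b \<in> carrier (Bq x)"
    obtain s where s: "s \<in> carrier R" "b = rho x s" using b unfolding B_carrier by blast
    have 1: "emR (r \<oplus> s) \<star> w = emR r \<star> w \<boxplus> emR s \<star> w" "emR (r \<otimes> s) \<star> w = emR r \<star> (emR s \<star> w)"
      using r s w WD(1) by (simp_all add: emb_simps P.l_distr P.m_assoc)
    show "(a \<oplus>\<^bsub>Bq x\<^esub> b) \<odot>\<^bsub>Em W x\<^esub> C = a \<odot>\<^bsub>Em W x\<^esub> C \<oplus>\<^bsub>Em W x\<^esub> b \<odot>\<^bsub>Em W x\<^esub> C"
      using r s w WD(4) 1 by (simp add: kap_smult kap_add rho_simps(2)[OF x])
    show "(a \<otimes>\<^bsub>Bq x\<^esub> b) \<odot>\<^bsub>Em W x\<^esub> C = a \<odot>\<^bsub>Em W x\<^esub> (b \<odot>\<^bsub>Em W x\<^esub> C)"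
      using r s w WD(4) 1 by (simp add: kap_smult rho_simps(3)[OF x])
  next
    fix a C D assume a: "a \<in> carrier (Bq x)" and C: "C \<in> carrier (Em W x)" "D \<in> carrier (Em W x)"
    obtain r where r: "r \<in> carrier R" "a = rho x r" using a unfolding B_carrier by blast
    obtain w v where w: "w \<in> W" "C = kap W x w" "v \<in> W" "D = kap W x v" using C unfolding Em_carrier by blast
    have "emR r \<star> (w \<boxplus> v) = emR r \<star> w \<boxplus> emR r \<star> v" using r w WD(1) emc by (simp add: P.r_distr)
    then show "a \<odot>\<^bsub>Em W x\<^esub> (C \<oplus>\<^bsub>Em W x\<^esub> D) = a \<odot>\<^bsub>Em W x\<^esub> C \<oplus>\<^bsub>Em W x\<^esub> a \<odot>\<^bsub>Em W x\<^esub> D"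
      using r w WD(3,4) by (simp add: kap_smult kap_add)
  next
    fix C assume C: "C \<in> carrier (Em W x)"
    obtain w where w: "w \<in> W" "C = kap W x w" using C unfolding Em_carrier by blast
    show "\<one>\<^bsub>Bq x\<^esub> \<odot>\<^bsub>Em W x\<^esub> C = C"
      using w WD(1) kap_smult[OF one_closed w(1)] by (simp add: rho_simps(4)[OF x x x] emb_one)
  qed
qed

end

end

section \<open>Baer's criterion\<close>

text \<open>
Linear maps from submodules of \<open>N\<close> to \<open>E\<close> that extend \<open>S0\<close>, represented by their graphs so that
unions of chains are again of this kind.
\<close>

definition partial_extension ::
  "('b, 'm) ring_scheme \<Rightarrow> ('b, 'n, 'k) module_scheme \<Rightarrow> ('b, 'c, 'l) module_scheme \<Rightarrow> ('n \<times> 'c) set \<Rightarrow> ('n \<times> 'c) set \<Rightarrow> bool" where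
  "partial_extension B N E S0 S \<longleftrightarrow> S0 \<subseteq> S \<and> S \<subseteq> carrier N \<times> carrier E \<and>
     (\<forall>n p n' p'. (n, p) \<in> S \<longrightarrow> (n', p') \<in> S \<longrightarrow> (n \<oplus>\<^bsub>N\<^esub> n', p \<oplus>\<^bsub>E\<^esub> p') \<in> S) \<and>
     (\<forall>r\<in>carrier B. \<forall>n p. (n, p) \<in> S \<longrightarrow> (r \<odot>\<^bsub>N\<^esub> n, r \<odot>\<^bsub>E\<^esub> p) \<in> S) \<and>
     (\<forall>n p p'. (n, p) \<in> S \<longrightarrow> (n, p') \<in> S \<longrightarrow> p = p')"

abbreviation self_module :: "'b ring \<Rightarrow> ('b, 'b) module" where
  "self_module B \<equiv> ring_as_module (\<lambda>x. x) B"

lemma self_module_simps [simp]: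
  "carrier (ring_as_module \<phi> B) = carrier B" "x \<oplus>\<^bsub>ring_as_module \<phi> B\<^esub> y = x \<oplus>\<^bsub>B\<^esub> y"
  "\<zero>\<^bsub>ring_as_module \<phi> B\<^esub> = \<zero>\<^bsub>B\<^esub>" "r \<odot>\<^bsub>ring_as_module \<phi> B\<^esub> b = \<phi> r \<otimes>\<^bsub>B\<^esub> b"
  by (simp_all add: ring_as_module_def ring.defs module.defs)

lemma partial_extensionD:
  assumes "partial_extension B N E S0 S"
  shows "S0 \<subseteq> S" "(n, p) \<in> S \<Longrightarrow> n \<in> carrier N \<and> p \<in> carrier E"
    "(n, p) \<in> S \<Longrightarrow> (n', p') \<in> S \<Longrightarrow> (n \<oplus>\<^bsub>N\<^esub> n', p \<oplus>\<^bsub>E\<^esub> p') \<in> S"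
    "r \<in> carrier B \<Longrightarrow> (n, p) \<in> S \<Longrightarrow> (r \<odot>\<^bsub>N\<^esub> n, r \<odot>\<^bsub>E\<^esub> p) \<in> S"
    "(n, p) \<in> S \<Longrightarrow> (n, p') \<in> S \<Longrightarrow> p = p'"
  using assms unfolding partial_extension_def by blast+

lemma partial_extension_step:
  assumes N: "module B N" and E: "module B E"
    and baer: "\<And>K g. ideal K B \<Longrightarrow> g \<in> linear_maps B ((self_module B)\<lparr>carrier := K\<rparr>) E \<Longrightarrow>
        \<exists>e\<in>carrier E. \<forall>k\<in>K. g k = k \<odot>\<^bsub>E\<^esub> e"
    and S: "partial_extension B N E S0 S" "S \<noteq> {}" and y: "y \<in> carrier N" "y \<notin> Domain S"
  shows "\<exists>S'. partial_extension B N E S0 S' \<and> S \<subset> S'"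
proof -
  interpret N: module B N by fact
  interpret E: module B E by fact
  note SD = partial_extensionD[OF S(1)]
  define K where "K = {r \<in> carrier B. r \<odot>\<^bsub>N\<^esub> y \<in> Domain S}"
  define g where "g r = (SOME p. (r \<odot>\<^bsub>N\<^esub> y, p) \<in> S)" for r
  have gS: "(r \<odot>\<^bsub>N\<^esub> y, g r) \<in> S" if "r \<in> K" for r
    using that unfolding g_def K_def by (auto intro: someI_ex)
  have gu: "g r = p" if "r \<in> carrier B" "(r \<odot>\<^bsub>N\<^esub> y, p) \<in> S" for r p
    using SD(5)[OF gS that(2)] that by (auto simp: K_def)
  have KI: "r \<in> K" if "r \<in> carrier B" "(r \<odot>\<^bsub>N\<^esub> y, p) \<in> S" for r p
    using that by (auto simp: K_def)
  have Kc: "r \<in> K \<Longrightarrow> r \<in> carrier B" for r by (simp add: K_def)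
  have zS: "(\<zero>\<^bsub>N\<^esub>, \<zero>\<^bsub>E\<^esub>) \<in> S"
  proof -
    obtain n p where np: "(n, p) \<in> S" using S(2) by auto
    have "(\<zero>\<^bsub>B\<^esub> \<odot>\<^bsub>N\<^esub> n, \<zero>\<^bsub>B\<^esub> \<odot>\<^bsub>E\<^esub> p) \<in> S" by (rule SD(4)[OF _ np]) simp
    then show ?thesis using SD(2)[OF np] by simp
  qed
  have Kadd: "(((r \<oplus>\<^bsub>B\<^esub> s) \<odot>\<^bsub>N\<^esub> y), g r \<oplus>\<^bsub>E\<^esub> g s) \<in> S" if "r \<in> K" "s \<in> K" for r s
    using SD(3)[OF gS[OF that(1)] gS[OF that(2)]] that y by (simp add: N.smult_l_distr Kc)
  have Kmul: "((r \<otimes>\<^bsub>B\<^esub> s) \<odot>\<^bsub>N\<^esub> y, r \<odot>\<^bsub>E\<^esub> g s) \<in> S" if "r \<in> carrier B" "s \<in> K" for r s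
    using SD(4)[OF that(1) gS[OF that(2)]] that y by (simp add: N.smult_assoc1 Kc)
  have K: "ideal K B"
  proof (rule idealI)
    show "ring B" by (rule N.R.ring_axioms)
    show "subgroup K (add_monoid B)"
    proof (rule N.R.add.subgroupI)
      show "K \<subseteq> carrier B" by (auto simp: K_def)
      show "K \<noteq> {}" using KI[OF N.R.zero_closed, of "\<zero>\<^bsub>E\<^esub>"] zS y by auto
      show "\<ominus>\<^bsub>B\<^esub> a \<in> K" if "a \<in> K" for a
      proof -
        have "(\<ominus>\<^bsub>B\<^esub> \<one>\<^bsub>B\<^esub>) \<otimes>\<^bsub>B\<^esub> a = \<ominus>\<^bsub>B\<^esub> a" using Kc[OF that] by (simp add: N.R.l_minus)
        then show ?thesis using KI[OF _ Kmul[of "\<ominus>\<^bsub>B\<^esub> \<one>\<^bsub>B\<^esub>" a]] that Kc[OF that] by simp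
      qed
      show "a \<oplus>\<^bsub>B\<^esub> b \<in> K" if "a \<in> K" "b \<in> K" for a b
        using KI[OF _ Kadd[OF that]] that Kc by simp
    qed
    show "x \<otimes>\<^bsub>B\<^esub> a \<in> K" "a \<otimes>\<^bsub>B\<^esub> x \<in> K" if "a \<in> K" "x \<in> carrier B" for a x
      using KI[OF _ Kmul[OF that(2,1)]] that Kc by (simp_all add: N.R.m_comm)
  qed
  have "g \<in> linear_maps B ((self_module B)\<lparr>carrier := K\<rparr>) E"
    unfolding linear_maps_def
  proof (intro CollectI conjI ballI)
    show "g \<in> carrier ((self_module B)\<lparr>carrier := K\<rparr>) \<rightarrow> carrier E" using SD(2)[OF gS] by auto
    show "g (x \<oplus>\<^bsub>(self_module B)\<lparr>carrier := K\<rparr>\<^esub> z) = g x \<oplus>\<^bsub>E\<^esub> g z"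
      if "x \<in> carrier ((self_module B)\<lparr>carrier := K\<rparr>)" "z \<in> carrier ((self_module B)\<lparr>carrier := K\<rparr>)" for x z
      using that gu[OF _ Kadd] Kc by simp
    show "g (r \<odot>\<^bsub>(self_module B)\<lparr>carrier := K\<rparr>\<^esub> x) = r \<odot>\<^bsub>E\<^esub> g x"
      if "r \<in> carrier B" "x \<in> carrier ((self_module B)\<lparr>carrier := K\<rparr>)" for r x
      using that gu[OF _ Kmul] Kc by simp
  qed
  from baer[OF K this] obtain e where e: "e \<in> carrier E" "\<And>k. k \<in> K \<Longrightarrow> g k = k \<odot>\<^bsub>E\<^esub> e" by blast
  define S' where "S' = {(n \<oplus>\<^bsub>N\<^esub> r \<odot>\<^bsub>N\<^esub> y, p \<oplus>\<^bsub>E\<^esub> r \<odot>\<^bsub>E\<^esub> e) | n p r. (n, p) \<in> S \<and> r \<in> carrier B}"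
  have S'I: "(a, b) \<in> S'" if "(n, p) \<in> S" "r \<in> carrier B" "a = n \<oplus>\<^bsub>N\<^esub> r \<odot>\<^bsub>N\<^esub> y" "b = p \<oplus>\<^bsub>E\<^esub> r \<odot>\<^bsub>E\<^esub> e" for a b n p r
    unfolding S'_def using that by blast
  have S'E: "\<exists>n p r. (n, p) \<in> S \<and> n \<in> carrier N \<and> p \<in> carrier E \<and> r \<in> carrier B \<and> a = n \<oplus>\<^bsub>N\<^esub> r \<odot>\<^bsub>N\<^esub> y \<and> b = p \<oplus>\<^bsub>E\<^esub> r \<odot>\<^bsub>E\<^esub> e"
    if "(a, b) \<in> S'" for a b
    using that SD(2) unfolding S'_def by blast
  have SS': "S \<subseteq> S'"
  proof (clarify)
    fix n p assume np: "(n, p) \<in> S"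
    show "(n, p) \<in> S'" by (rule S'I[OF np N.R.zero_closed]) (use SD(2)[OF np] y e in auto)
  qed
  have yS': "(y, e) \<in> S'" by (rule S'I[OF zS N.R.one_closed]) (use y e in auto)
  have "partial_extension B N E S0 S'"
    unfolding partial_extension_def
  proof (intro conjI allI impI ballI)
    show "S0 \<subseteq> S'" using SD(1) SS' by auto
    show "S' \<subseteq> carrier N \<times> carrier E" using S'E y e by fastforce
    fix n p
    show "(n \<oplus>\<^bsub>N\<^esub> n', p \<oplus>\<^bsub>E\<^esub> p') \<in> S'" if a: "(n, p) \<in> S'" "(n', p') \<in> S'" for n' p'
    proof -
      obtain m q r where 1: "(m, q) \<in> S" "m \<in> carrier N" "q \<in> carrier E" "r \<in> carrier B" "n = m \<oplus>\<^bsub>N\<^esub> r \<odot>\<^bsub>N\<^esub> y" "p = q \<oplus>\<^bsub>E\<^esub> r \<odot>\<^bsub>E\<^esub> e"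
        using S'E[OF a(1)] by blast
      obtain m' q' r' where 2: "(m', q') \<in> S" "m' \<in> carrier N" "q' \<in> carrier E" "r' \<in> carrier B" "n' = m' \<oplus>\<^bsub>N\<^esub> r' \<odot>\<^bsub>N\<^esub> y" "p' = q' \<oplus>\<^bsub>E\<^esub> r' \<odot>\<^bsub>E\<^esub> e"
        using S'E[OF a(2)] by blast
      show ?thesis
        by (rule S'I[OF SD(3)[OF 1(1) 2(1)] N.R.a_closed[OF 1(4) 2(4)]])
          (use 1 2 y e in \<open>simp_all add: N.smult_l_distr E.smult_l_distr N.M.a_ac E.M.a_ac\<close>)
    qed
    show "(s \<odot>\<^bsub>N\<^esub> n, s \<odot>\<^bsub>E\<^esub> p) \<in> S'" if s: "s \<in> carrier B" and a: "(n, p) \<in> S'" for s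
    proof -
      obtain m q r where 1: "(m, q) \<in> S" "m \<in> carrier N" "q \<in> carrier E" "r \<in> carrier B" "n = m \<oplus>\<^bsub>N\<^esub> r \<odot>\<^bsub>N\<^esub> y" "p = q \<oplus>\<^bsub>E\<^esub> r \<odot>\<^bsub>E\<^esub> e"
        using S'E[OF a] by blast
      show ?thesis
        by (rule S'I[OF SD(4)[OF s 1(1)] N.R.m_closed[OF s 1(4)]])
          (use 1 y e s in \<open>simp_all add: N.smult_r_distr E.smult_r_distr N.smult_assoc1 E.smult_assoc1\<close>)
    qed
    show "p = p'" if a: "(n, p) \<in> S'" "(n, p') \<in> S'" for p'
    proof -
      obtain m q r where 1: "(m, q) \<in> S" "m \<in> carrier N" "q \<in> carrier E" "r \<in> carrier B" and n1: "n = m \<oplus>\<^bsub>N\<^esub> r \<odot>\<^bsub>N\<^esub> y" and p1: "p = q \<oplus>\<^bsub>E\<^esub> r \<odot>\<^bsub>E\<^esub> e"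
        using S'E[OF a(1)] by blast
      obtain m' q' r' where 2: "(m', q') \<in> S" "m' \<in> carrier N" "q' \<in> carrier E" "r' \<in> carrier B" and n2: "n = m' \<oplus>\<^bsub>N\<^esub> r' \<odot>\<^bsub>N\<^esub> y" and p2: "p' = q' \<oplus>\<^bsub>E\<^esub> r' \<odot>\<^bsub>E\<^esub> e"
        using S'E[OF a(2)] by blast
      define t where "t = r \<ominus>\<^bsub>B\<^esub> r'"
      have tc: "t \<in> carrier B" using 1 2 by (simp add: t_def)
      have ty: "t \<odot>\<^bsub>N\<^esub> y = m' \<oplus>\<^bsub>N\<^esub> (\<ominus>\<^bsub>B\<^esub> \<one>\<^bsub>B\<^esub>) \<odot>\<^bsub>N\<^esub> m"
      proof -
        have ry: "r \<odot>\<^bsub>N\<^esub> y \<in> carrier N" "r' \<odot>\<^bsub>N\<^esub> y \<in> carrier N" using 1 2 y by auto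
        have eq: "m \<oplus>\<^bsub>N\<^esub> r \<odot>\<^bsub>N\<^esub> y = m' \<oplus>\<^bsub>N\<^esub> r' \<odot>\<^bsub>N\<^esub> y" using n1 n2 by simp
        have "t \<odot>\<^bsub>N\<^esub> y = r \<odot>\<^bsub>N\<^esub> y \<oplus>\<^bsub>N\<^esub> \<ominus>\<^bsub>N\<^esub> (r' \<odot>\<^bsub>N\<^esub> y)"
          using 1 2 y by (simp add: t_def a_minus_def N.smult_l_distr N.smult_l_minus)
        also have "r \<odot>\<^bsub>N\<^esub> y = \<ominus>\<^bsub>N\<^esub> m \<oplus>\<^bsub>N\<^esub> (m' \<oplus>\<^bsub>N\<^esub> r' \<odot>\<^bsub>N\<^esub> y)"
          using ry 1 2 by (simp add: eq[symmetric] N.M.a_assoc[symmetric] N.M.l_neg)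
        also have "\<ominus>\<^bsub>N\<^esub> m \<oplus>\<^bsub>N\<^esub> (m' \<oplus>\<^bsub>N\<^esub> r' \<odot>\<^bsub>N\<^esub> y) \<oplus>\<^bsub>N\<^esub> \<ominus>\<^bsub>N\<^esub> (r' \<odot>\<^bsub>N\<^esub> y) = m' \<oplus>\<^bsub>N\<^esub> \<ominus>\<^bsub>N\<^esub> m"
          using ry 1(2) 2(2) by (simp add: N.M.a_assoc N.M.r_neg) (rule N.M.a_comm, simp_all)
        also have "\<ominus>\<^bsub>N\<^esub> m = (\<ominus>\<^bsub>B\<^esub> \<one>\<^bsub>B\<^esub>) \<odot>\<^bsub>N\<^esub> m" using 1 by (simp add: N.smult_l_minus)
        finally show ?thesis .
      qed
      have "(m' \<oplus>\<^bsub>N\<^esub> (\<ominus>\<^bsub>B\<^esub> \<one>\<^bsub>B\<^esub>) \<odot>\<^bsub>N\<^esub> m, q' \<oplus>\<^bsub>E\<^esub> (\<ominus>\<^bsub>B\<^esub> \<one>\<^bsub>B\<^esub>) \<odot>\<^bsub>E\<^esub> q) \<in> S"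
        by (rule SD(3)[OF 2(1) SD(4)[OF _ 1(1)]]) simp
      then have tS: "(t \<odot>\<^bsub>N\<^esub> y, q' \<oplus>\<^bsub>E\<^esub> (\<ominus>\<^bsub>B\<^esub> \<one>\<^bsub>B\<^esub>) \<odot>\<^bsub>E\<^esub> q) \<in> S" unfolding ty .
      have "t \<odot>\<^bsub>E\<^esub> e = q' \<oplus>\<^bsub>E\<^esub> (\<ominus>\<^bsub>B\<^esub> \<one>\<^bsub>B\<^esub>) \<odot>\<^bsub>E\<^esub> q"
        using gu[OF tc tS] e(2)[OF KI[OF tc tS]] by simp
      moreover have "t \<odot>\<^bsub>E\<^esub> e = r \<odot>\<^bsub>E\<^esub> e \<oplus>\<^bsub>E\<^esub> \<ominus>\<^bsub>E\<^esub> (r' \<odot>\<^bsub>E\<^esub> e)"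
        using 1 2 e by (simp add: t_def a_minus_def E.smult_l_distr E.smult_l_minus)
      ultimately have te: "r \<odot>\<^bsub>E\<^esub> e \<oplus>\<^bsub>E\<^esub> \<ominus>\<^bsub>E\<^esub> (r' \<odot>\<^bsub>E\<^esub> e) = q' \<oplus>\<^bsub>E\<^esub> \<ominus>\<^bsub>E\<^esub> q"
        using 1 by (simp add: E.smult_l_minus)
      have re: "r \<odot>\<^bsub>E\<^esub> e \<in> carrier E" "r' \<odot>\<^bsub>E\<^esub> e \<in> carrier E" using 1 2 e by auto
      have "q \<oplus>\<^bsub>E\<^esub> r \<odot>\<^bsub>E\<^esub> e = q \<oplus>\<^bsub>E\<^esub> ((r \<odot>\<^bsub>E\<^esub> e \<oplus>\<^bsub>E\<^esub> \<ominus>\<^bsub>E\<^esub> (r' \<odot>\<^bsub>E\<^esub> e)) \<oplus>\<^bsub>E\<^esub> r' \<odot>\<^bsub>E\<^esub> e)"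
        using re 1 by (simp add: E.M.a_assoc E.M.l_neg)
      also have "\<dots> = (q \<oplus>\<^bsub>E\<^esub> \<ominus>\<^bsub>E\<^esub> q) \<oplus>\<^bsub>E\<^esub> (q' \<oplus>\<^bsub>E\<^esub> r' \<odot>\<^bsub>E\<^esub> e)"
        unfolding te using re 1 2 by (simp add: E.M.a_ac del: E.M.r_neg)
      also have "\<dots> = q' \<oplus>\<^bsub>E\<^esub> r' \<odot>\<^bsub>E\<^esub> e" using re 1 2 by (simp add: E.M.r_neg)
      finally show "p = p'" unfolding p1 p2 .
    qed
  qed
  moreover have "S \<noteq> S'" using yS' y(2) by auto
  ultimately show ?thesis using SS' by blast
qed

text \<open>
Zorn's lemma yields a maximal partial extension. Its domain is all of \<open>N\<close>: for \<open>n\<close> outside, the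
elements of \<open>B\<close> that multiply \<open>n\<close> into the domain form an ideal, and the element \<open>e\<close> that represents
the resulting map on this ideal is an admissible value at \<open>n\<close>.
\<close>

theorem baer_criterion:
  fixes B :: "'b ring" and E :: "('b, 'c, 'l) module_scheme"
  assumes E: "module B E"
    and baer: "\<And>K g. ideal K B \<Longrightarrow> g \<in> linear_maps B ((self_module B)\<lparr>carrier := K\<rparr>) E \<Longrightarrow>
        \<exists>e\<in>carrier E. \<forall>k\<in>K. g k = k \<odot>\<^bsub>E\<^esub> e"
  shows "injective_module B E"
  unfolding injective_module_def
proof (intro conjI E allI impI ballI)
  fix M N :: "('b, 'b) module" and f g
  assume M: "module B M" and N: "module B N" and f: "f \<in> linear_maps B M N" "inj_on f (carrier M)"
    and g: "g \<in> linear_maps B M E"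
  interpret M: module B M by fact
  interpret N: module B N by fact
  interpret E: module B E by fact
  define S0 where "S0 = (\<lambda>x. (f x, g x)) ` carrier M"
  have fD: "\<And>x. x \<in> carrier M \<Longrightarrow> f x \<in> carrier N" "\<And>x y. x \<in> carrier M \<Longrightarrow> y \<in> carrier M \<Longrightarrow> f x \<oplus>\<^bsub>N\<^esub> f y = f (x \<oplus>\<^bsub>M\<^esub> y)"
    "\<And>r x. r \<in> carrier B \<Longrightarrow> x \<in> carrier M \<Longrightarrow> r \<odot>\<^bsub>N\<^esub> f x = f (r \<odot>\<^bsub>M\<^esub> x)"
    using f(1) unfolding linear_maps_def by auto
  have gD: "\<And>x. x \<in> carrier M \<Longrightarrow> g x \<in> carrier E" "\<And>x y. x \<in> carrier M \<Longrightarrow> y \<in> carrier M \<Longrightarrow> g x \<oplus>\<^bsub>E\<^esub> g y = g (x \<oplus>\<^bsub>M\<^esub> y)"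
    "\<And>r x. r \<in> carrier B \<Longrightarrow> x \<in> carrier M \<Longrightarrow> r \<odot>\<^bsub>E\<^esub> g x = g (r \<odot>\<^bsub>M\<^esub> x)"
    using g(1) unfolding linear_maps_def by auto
  define F where "F = {S. partial_extension B N E S0 S}"
  have "S0 \<in> F"
    unfolding F_def partial_extension_def S0_def using f(2)
    by (auto simp: fD gD dest: inj_onD)
  have "\<exists>S\<in>F. \<forall>Z\<in>F. S \<subseteq> Z \<longrightarrow> Z = S"
  proof (rule subset_Zorn_nonempty)
    show "F \<noteq> {}" using \<open>S0 \<in> F\<close> by auto
    fix C assume C: "C \<noteq> {}" "subset.chain F C"
    have CF: "partial_extension B N E S0 S" if "S \<in> C" for S
      using C(2) that unfolding subset.chain_def F_def by auto
    have two: "\<exists>S\<in>C. a \<in> S \<and> b \<in> S" if "a \<in> \<Union>C" "b \<in> \<Union>C" for a b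
    proof -
      obtain S S' where S: "S \<in> C" "a \<in> S" "S' \<in> C" "b \<in> S'" using \<open>a \<in> \<Union>C\<close> \<open>b \<in> \<Union>C\<close> by blast
      then have "S \<subseteq> S' \<or> S' \<subseteq> S" using C(2) unfolding subset.chain_def by blast
      then show ?thesis using S by blast
    qed
    note D = partial_extensionD[OF CF]
    show "\<Union>C \<in> F"
      unfolding F_def partial_extension_def
    proof (intro CollectI conjI allI impI ballI)
      show "S0 \<subseteq> \<Union>C" using C(1) D(1) by blast
      show "\<Union>C \<subseteq> carrier N \<times> carrier E" using D(2) by auto
      show "(n \<oplus>\<^bsub>N\<^esub> n', p \<oplus>\<^bsub>E\<^esub> p') \<in> \<Union>C" if "(n, p) \<in> \<Union>C" "(n', p') \<in> \<Union>C" for n p n' p'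
        using two[OF that] D(3) by blast
      show "(r \<odot>\<^bsub>N\<^esub> n, r \<odot>\<^bsub>E\<^esub> p) \<in> \<Union>C" if "r \<in> carrier B" "(n, p) \<in> \<Union>C" for r n p
        using D(4) that by blast
      show "p = p'" if "(n, p) \<in> \<Union>C" "(n, p') \<in> \<Union>C" for n p p'
        using two[OF that] D(5) by blast
    qed
  qed
  then obtain S where S: "partial_extension B N E S0 S" and max: "\<And>S'. partial_extension B N E S0 S' \<Longrightarrow> S \<subseteq> S' \<Longrightarrow> S' = S"
    unfolding F_def by auto
  note SD = partial_extensionD[OF S]
  have ne: "S \<noteq> {}" using SD(1) M.M.zero_closed unfolding S0_def by blast
  have total: "\<exists>p. (n, p) \<in> S" if "n \<in> carrier N" for n
  proof (rule ccontr)
    assume "\<nexists>p. (n, p) \<in> S"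
    then have "n \<notin> Domain S" by auto
    from partial_extension_step[OF N E baer S ne that this] show False using max by blast
  qed
  define h where "h n = (SOME p. (n, p) \<in> S)" for n
  have hS: "(n, h n) \<in> S" if "n \<in> carrier N" for n unfolding h_def using total[OF that] by (rule someI_ex)
  have hu: "h n = p" if "(n, p) \<in> S" for n p using SD(5)[OF hS that] SD(2)[OF that] by auto
  have "h \<in> linear_maps B N E"
    unfolding linear_maps_def using SD(2)[OF hS] hu[OF SD(3)[OF hS hS]] hu[OF SD(4)[OF _ hS]] by auto
  moreover have "h (f x) = g x" if "x \<in> carrier M" for x
    by (rule hu) (use SD(1) that in \<open>auto simp: S0_def\<close>)
  ultimately show "\<exists>h\<in>linear_maps B N E. \<forall>x\<in>carrier M. h (f x) = g x" by blast
qed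

section \<open>Canonical fractional ideals are the dualizing ones\<close>

lemma ideal_as_module:
  assumes "cring B" "ideal K B"
  shows "module B ((self_module B)\<lparr>carrier := K\<rparr>)"
proof -
  interpret B: cring B by fact
  interpret K: ideal K B by fact
  have Kc: "k \<in> K \<Longrightarrow> k \<in> carrier B" for k using K.a_subset by auto
  show ?thesis
  proof (rule moduleI)
    show "abelian_group ((self_module B)\<lparr>carrier := K\<rparr>)"
      by (rule abelian_groupI) (auto simp: Kc B.a_ac intro!: bexI[of _ "\<ominus>\<^bsub>B\<^esub> _"] B.r_neg B.l_neg)
  qed (auto simp: Kc assms B.l_distr B.r_distr B.m_assoc K.I_l_closed)
qed

lemma self_module_module: "cring B \<Longrightarrow> module B (self_module B)"
proof -
  assume B: "cring B"
  have e: "(self_module B)\<lparr>carrier := carrier B\<rparr> = self_module B"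
    by (simp add: ring_as_module_def ring.defs module.defs)
  show ?thesis using ideal_as_module[OF B ring.oneideal[OF cring.axioms(1)[OF B]]] unfolding e .
qed

context one_dim_ring
begin

lemma emc [simp]: "r \<in> carrier R \<Longrightarrow> emR r \<in> carrier TF" by (simp add: emb_simps)

lemma regular_unit: "reg x \<Longrightarrow> emR x \<in> Units TF"
  using emb_unit_iff regD(1) by blast

lemma xW_cancel:
  assumes W: "P.smod W" and x: "reg x" and y: "y \<in> carrier TF" "emR x \<star> y \<in> xW W x"
  shows "y \<in> W"
proof -
  obtain w where w: "w \<in> W" "emR x \<star> y = emR x \<star> w" using y(2) by blast
  then show ?thesis using P.unit_cancel[OF regular_unit[OF x] y(1) P.smodD(1)[OF W w(1)]] by simp
qed

text \<open>
A homomorphism \<open>J \<rightarrow> Q/W\<close> that kills \<open>x\<close> becomes, after multiplication of its values by \<open>x\<close>, a map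
from the ideal \<open>J/xR\<close> of \<open>R/xR\<close> to \<open>W/xW\<close>. Injectivity extends it to \<open>R/xR\<close>; the value at \<open>1\<close>,
divided by \<open>x\<close>, is the required fraction.
\<close>

lemma injective_imp_baer:
  assumes W: "P.smod W" and x: "reg x" and inj: "injective_module (Bq x) (Em W x)"
  shows "baer_at TF (base R) W (emR x)"
  unfolding baer_at_def
proof (intro allI impI)
  note WD = P.smodD[OF W]
  have xc: "x \<in> carrier R" using regD(1)[OF x] .
  note kE = kap_eq_iff[OF W xc] and kA = kap_add[OF W xc] and kS = kap_smult[OF W xc]
  fix J f
  assume J: "P.smod J" "J \<subseteq> base R" "emR x \<in> J" and f: "hom_mod TF (base R) W J f" and fx: "f (emR x) \<in> W"
  note JD = P.smodD[OF J(1)]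
  have fc: "j \<in> J \<Longrightarrow> f j \<in> carrier TF" for j using f unfolding hom_mod_def by auto
  have fadd: "f (i \<boxplus> j) \<boxminus> (f i \<boxplus> f j) \<in> W" if "i \<in> J" "j \<in> J" for i j
    using f that unfolding hom_mod_def by auto
  have fmul: "f (emR r \<star> j) \<boxminus> emR r \<star> f j \<in> W" if "r \<in> carrier R" "j \<in> J" for r j
    using f that unfolding hom_mod_def by auto
  define J0 where "J0 = {r \<in> carrier R. emR r \<in> J}"
  have J0: "ideal J0 R" unfolding J0_def by (rule submod_preimage_ideal[OF J(1)])
  have J0D: "j \<in> J0 \<Longrightarrow> j \<in> carrier R" "j \<in> J0 \<Longrightarrow> emR j \<in> J" for j
    unfolding J0_def by simp_all
  interpret J0: ideal J0 R by (rule J0)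
  define w where "w j = emR x \<star> f (emR j)" for j
  have fJ [simp]: "j \<in> J0 \<Longrightarrow> f (emR j) \<in> carrier TF" for j using fc J0D by simp
  have wW: "w j \<in> W" if j: "j \<in> J0" for j
  proof -
    note [simp] = fJ[OF j] fc[OF J(3)] J0D(1)[OF j] xc
    have xj: "f (emR x \<star> emR j) \<in> carrier TF" using fc JD(4)[of "emR x" "emR j"] J0D(2)[OF j] by simp
    have 1: "f (emR x \<star> emR j) \<boxminus> emR x \<star> f (emR j) \<in> W" by (rule fmul[OF xc J0D(2)[OF j]])
    have "f (emR j \<star> emR x) \<boxminus> emR j \<star> f (emR x) \<in> W" by (rule fmul[OF J0D(1)[OF j] J(3)])
    then have 2: "f (emR x \<star> emR j) \<boxminus> emR j \<star> f (emR x) \<in> W" by (simp add: P.m_comm)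
    have "emR j \<star> f (emR x) \<in> W" using WD(4) fx by simp
    then have "f (emR x \<star> emR j) \<in> W" using P.smod_minus_cancel[OF W xj _ 2] by simp
    then show ?thesis unfolding w_def using P.smod_minus_cancel2[OF W _ _ 1] by simp
  qed
  have w_mod: "kap W x (w i) = kap W x (w j)" if ij: "i \<in> J0" "j \<in> J0" "rho x i = rho x j" for i j
  proof -
    obtain c where c: "c \<in> carrier R" "i \<ominus> j = c \<otimes> x"
      using ij rho_eq_iff[OF xc] J0D(1) pideal_iff by auto
    have ic: "i \<in> carrier R" and jc: "j \<in> carrier R" using ij J0D by auto
    have "i = j \<oplus> (i \<ominus> j)" using ic jc by (simp add: minus_eq a_ac r_neg)
    then have ie: "emR i = emR j \<boxplus> emR c \<star> emR x" unfolding c(2) using c(1) xc jc by (metis emb_simps(2,3) m_closed)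
    have cx: "emR c \<star> emR x \<in> J" using JD(4) J(3) c(1) by simp
    note [simp] = fJ[OF ij(1)] fJ[OF ij(2)] fc[OF cx] fc[OF J(3)]
    have 1: "f (emR i) \<boxminus> (f (emR j) \<boxplus> f (emR c \<star> emR x)) \<in> W" unfolding ie by (rule fadd[OF J0D(2)[OF ij(2)] cx])
    have 2: "f (emR c \<star> emR x) \<in> W"
      using P.smod_minus_cancel[OF W _ _ fmul[OF c(1) J(3)]] WD(4)[OF _ fx] c(1) by simp
    have e: "a \<boxminus> b = (a \<boxminus> (b \<boxplus> d)) \<boxplus> d" if [simp]: "a \<in> carrier TF" "b \<in> carrier TF" "d \<in> carrier TF" for a b d
      by ((simp add: P.ring_norm; fail) | (rule P.ring_eqI, (simp add: P.ring_norm; fail), simp_all))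
    have "f (emR i) \<boxminus> f (emR j) \<in> W"
      using WD(3)[OF 1 2] e[of "f (emR i)" "f (emR j)" "f (emR c \<star> emR x)"] by simp
    moreover have "w i \<boxminus> w j = emR x \<star> (f (emR i) \<boxminus> f (emR j))"
      unfolding w_def using xc by (simp add: P.minus_eq P.r_distr P.r_minus)
    ultimately have "w i \<boxminus> w j \<in> xW W x" by simp
    then show ?thesis using kE wW ij by simp
  qed
  define K where "K = rho x ` J0"
  have K: "ideal K (Bq x)" unfolding K_def by (rule ring_ideal_imp_quot_ideal[OF pideal[OF xc] J0])
  define M where "M = (self_module (Bq x))\<lparr>carrier := K\<rparr>"
  define g where "g C = kap W x (w (SOME j. j \<in> J0 \<and> C = rho x j))" for C
  have g: "g (rho x j) = kap W x (w j)" if j: "j \<in> J0" for j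
  proof -
    have "\<exists>i. i \<in> J0 \<and> rho x j = rho x i" using j by blast
    from someI_ex[OF this] have i: "(SOME i. i \<in> J0 \<and> rho x j = rho x i) \<in> J0"
      "rho x (SOME i. i \<in> J0 \<and> rho x j = rho x i) = rho x j" by simp_all
    show ?thesis unfolding g_def by (rule w_mod[OF i(1) j i(2)])
  qed
  have M: "module (Bq x) M" unfolding M_def by (rule ideal_as_module[OF B_cring[OF xc] K])
  have N: "module (Bq x) (self_module (Bq x))" by (rule self_module_module[OF B_cring[OF xc]])
  have incl: "(\<lambda>C. C) \<in> linear_maps (Bq x) M (self_module (Bq x))"
    unfolding linear_maps_def M_def using additive_subgroup.a_subset[OF ideal.axioms(1)[OF K]] by auto
  have glin: "g \<in> linear_maps (Bq x) M (Em W x)"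
    unfolding linear_maps_def
  proof (intro CollectI conjI ballI)
    show "g \<in> carrier M \<rightarrow> carrier (Em W x)"
      using g wW by (auto simp: M_def K_def Em_carrier)
    fix C D assume "C \<in> carrier M" "D \<in> carrier M"
    then obtain i j where ij: "i \<in> J0" "j \<in> J0" and CD: "C = rho x i" "D = rho x j" by (auto simp: M_def K_def)
    have ijc: "i \<in> carrier R" "j \<in> carrier R" using ij J0D by auto
    have ijJ: "i \<oplus> j \<in> J0" using ij by simp
    note [simp] = fJ[OF ij(1)] fJ[OF ij(2)] fJ[OF ijJ]
    have eij: "emR (i \<oplus> j) = emR i \<boxplus> emR j" using ijc by (simp add: emb_simps)
    have "f (emR (i \<oplus> j)) \<boxminus> (f (emR i) \<boxplus> f (emR j)) \<in> W"
      unfolding eij by (rule fadd[OF J0D(2)[OF ij(1)] J0D(2)[OF ij(2)]])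
    then have "emR x \<star> (f (emR (i \<oplus> j)) \<boxminus> (f (emR i) \<boxplus> f (emR j))) \<in> xW W x" by (rule imageI)
    moreover have "w (i \<oplus> j) \<boxminus> (w i \<boxplus> w j) = emR x \<star> (f (emR (i \<oplus> j)) \<boxminus> (f (emR i) \<boxplus> f (emR j)))"
      unfolding w_def using xc by (simp add: P.minus_eq P.r_distr P.r_minus P.minus_add)
    ultimately have "kap W x (w (i \<oplus> j)) = kap W x (w i \<boxplus> w j)"
      using kE[OF wW[OF ijJ] WD(3)[OF wW[OF ij(1)] wW[OF ij(2)]]] by simp
    then show "g (C \<oplus>\<^bsub>M\<^esub> D) = g C \<oplus>\<^bsub>Em W x\<^esub> g D"
      unfolding CD g[OF ij(1)] g[OF ij(2)] kA[OF wW[OF ij(1)] wW[OF ij(2)]]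
      using g[OF ijJ] rho_simps(2)[OF xc ijc] by (simp add: M_def)
  next
    fix r C assume "r \<in> carrier (Bq x)" "C \<in> carrier M"
    then obtain s j where s: "s \<in> carrier R" "r = rho x s" and j: "j \<in> J0" "C = rho x j"
      unfolding M_def K_def B_carrier by auto
    have jc: "j \<in> carrier R" using j J0D by auto
    have sj: "s \<otimes> j \<in> J0" using J0.I_l_closed[OF j(1) s(1)] .
    note [simp] = fJ[OF j(1)] fJ[OF sj]
    have e: "emR (s \<otimes> j) = emR s \<star> emR j" using s jc by (simp add: emb_simps)
    have "f (emR (s \<otimes> j)) \<boxminus> emR s \<star> f (emR j) \<in> W" unfolding e by (rule fmul[OF s(1) J0D(2)[OF j(1)]])
    then have "emR x \<star> (f (emR (s \<otimes> j)) \<boxminus> emR s \<star> f (emR j)) \<in> xW W x" by (rule imageI)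
    moreover have "w (s \<otimes> j) \<boxminus> emR s \<star> w j = emR x \<star> (f (emR (s \<otimes> j)) \<boxminus> emR s \<star> f (emR j))"
      unfolding w_def using xc s(1) by (simp add: P.minus_eq P.r_distr P.r_minus P.m_lcomm)
    ultimately have "kap W x (w (s \<otimes> j)) = kap W x (emR s \<star> w j)"
      using kE[OF wW[OF sj] WD(4)[OF _ wW[OF j(1)]]] s(1) by simp
    then show "g (r \<odot>\<^bsub>M\<^esub> C) = r \<odot>\<^bsub>Em W x\<^esub> g C"
      unfolding j(2) s(2) g[OF j(1)] kS[OF s(1) wW[OF j(1)]]
      using g[OF sj] rho_simps(3)[OF xc s(1) jc] by (simp add: M_def)
  qed
  have "\<exists>h\<in>linear_maps (Bq x) (self_module (Bq x)) (Em W x). \<forall>C\<in>carrier M. h C = g C"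
  proof -
    have "\<forall>f\<in>linear_maps (Bq x) M (self_module (Bq x)). inj_on f (carrier M) \<longrightarrow>
        (\<forall>g\<in>linear_maps (Bq x) M (Em W x). \<exists>h\<in>linear_maps (Bq x) (self_module (Bq x)) (Em W x).
           \<forall>C\<in>carrier M. h (f C) = g C)"
      using inj M N unfolding injective_module_def by simp
    from bspec[OF this incl] show ?thesis using glin by (auto simp: inj_on_def)
  qed
  then obtain h where h: "h \<in> linear_maps (Bq x) (self_module (Bq x)) (Em W x)" "\<And>C. C \<in> K \<Longrightarrow> h C = g C"
    by (auto simp: M_def)
  have "h (rho x \<one>) \<in> carrier (Em W x)"
    using h(1) rho_simps(1)[OF xc one_closed one_closed] unfolding linear_maps_def by auto
  then obtain v where v: "v \<in> W" "h (rho x \<one>) = kap W x v" unfolding Em_carrier by auto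
  have vc: "v \<in> carrier TF" using WD(1)[OF v(1)] .
  obtain q where q: "q \<in> carrier TF" "emR x \<star> q = v" using divide[OF x vc] .
  have fin: "f (emR j) \<boxminus> q \<star> emR j \<in> W" if j: "j \<in> J0" for j
  proof (rule xW_cancel[OF W x])
    have jc: "j \<in> carrier R" using j J0D by auto
    note [simp] = fJ[OF j] q(1) jc
    show "f (emR j) \<boxminus> q \<star> emR j \<in> carrier TF" by simp
    have "h (rho x j) = h (rho x j \<odot>\<^bsub>self_module (Bq x)\<^esub> rho x \<one>)"
      using rho_simps(3)[OF xc jc one_closed] by simp
    also have "\<dots> = rho x j \<odot>\<^bsub>Em W x\<^esub> h (rho x \<one>)"
      using h(1) rho_simps(1)[OF xc jc jc] rho_simps(1)[OF xc one_closed one_closed]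
      unfolding linear_maps_def by simp
    also have "\<dots> = kap W x (emR j \<star> v)" unfolding v(2) by (rule kS[OF jc v(1)])
    finally have "kap W x (w j) = kap W x (emR j \<star> v)"
      using h(2)[of "rho x j"] g[OF j] j by (simp add: K_def)
    then have "w j \<boxminus> emR j \<star> v \<in> xW W x" using kE[OF wW[OF j] WD(4)[OF _ v(1)]] jc by simp
    moreover have "w j \<boxminus> emR j \<star> v = emR x \<star> (f (emR j) \<boxminus> q \<star> emR j)"
      unfolding w_def q(2)[symmetric] using xc by (simp add: P.minus_eq P.r_distr P.r_minus P.m_ac)
    ultimately show "emR x \<star> (f (emR j) \<boxminus> q \<star> emR j) \<in> xW W x" by simp
  qed
  show "\<exists>q\<in>carrier TF. \<forall>j\<in>J. f j \<boxminus> q \<star> j \<in> W"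
  proof (intro bexI[of _ q] ballI q(1))
    fix j assume j: "j \<in> J"
    then obtain i where i: "i \<in> carrier R" "j = emR i" using J(2) by blast
    have "i \<in> J0" unfolding J0_def using i j by simp
    then show "f j \<boxminus> q \<star> j \<in> W" unfolding i(2) by (rule fin)
  qed
qed

end

context one_dim_ring
begin

text \<open>
The image of \<open>1\<close> under the embedding of the residue field into \<open>W/xW\<close> is represented by some \<open>w \<in> W\<close>,
and \<open>w/x\<close> is a socle element of \<open>Q/W\<close>.
\<close>

lemma residue_socle:
  assumes W: "P.smod W" and x: "x \<in> \<mm>" "reg x"
    and f: "f \<in> linear_maps (Bq x) (residue_field_module (Bq x) (rho x ` \<mm>)) (Em W x)"
      "inj_on f (carrier (residue_field_module (Bq x) (rho x ` \<mm>)))"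
  shows "\<exists>e\<in>carrier TF. e \<notin> W \<and> (\<forall>r\<in>emR ` \<mm>. r \<star> e \<in> W)"
proof -
  have xc: "x \<in> carrier R" using mm_carrier[OF x(1)] .
  note WD = P.smodD[OF W] and kE = kap_eq_iff[OF W xc] and kS = kap_smult[OF W xc]
  let ?n = "rho x ` \<mm>" let ?k = "residue_field_module (Bq x) ?n"
  interpret B: cring "Bq x" by (rule B_cring[OF xc])
  interpret n: maximalideal ?n "Bq x" by (rule B_maximal[OF x(1)])
  let ?s = "\<lambda>C. ?n +>\<^bsub>Bq x\<^esub> C"
  interpret s: ring_hom_ring "Bq x" "Bq x Quot ?n" ?s by (rule n.rcos_ring_hom_ring)
  let ?one = "?s \<one>\<^bsub>Bq x\<^esub>"
  have one: "?one \<in> carrier ?k" by simp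
  have lin: "f (C \<odot>\<^bsub>?k\<^esub> D) = C \<odot>\<^bsub>Em W x\<^esub> f D" if "C \<in> carrier (Bq x)" "D \<in> carrier ?k" for C D
    using f(1) that unfolding linear_maps_def by blast
  have "f ?one \<in> carrier (Em W x)" using f(1) one unfolding linear_maps_def by blast
  then obtain w where w: "w \<in> W" "f ?one = kap W x w" unfolding Em_carrier by auto
  have wc: "w \<in> carrier TF" using WD(1)[OF w(1)] .
  have sm: "f (?s (rho x r)) = kap W x (emR r \<star> w)" if r: "r \<in> carrier R" for r
  proof -
    have rB: "rho x r \<in> carrier (Bq x)" using rho_simps(1)[OF xc r r] .
    have e: "?s (rho x r) = rho x r \<odot>\<^bsub>?k\<^esub> ?one"
      using rB by (simp add: s.hom_mult[symmetric] del: s.hom_mult)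
    show ?thesis unfolding e lin[OF rB one] w(2) kS[OF r w(1)] by (rule refl)
  qed
  have seq: "?s C = ?s D \<longleftrightarrow> C \<ominus>\<^bsub>Bq x\<^esub> D \<in> ?n" if "C \<in> carrier (Bq x)" "D \<in> carrier (Bq x)" for C D
    using B.quotient_eq_iff_same_a_r_cos[OF n.ideal_axioms that] by simp
  have z: "rho x \<zero> = \<zero>\<^bsub>Bq x\<^esub>" using rho_simps(5)[OF xc xc xc] by simp
  have k0: "emR \<zero> \<star> w = \<zero>\<^bsub>TF\<^esub>" using wc by (simp add: emb_zero)
  have 1: "emR r \<star> w \<in> xW W x" if r: "r \<in> \<mm>" for r
  proof -
    have rc: "r \<in> carrier R" using mm_carrier[OF r] .
    have "?s (rho x r) = ?s (rho x \<zero>)"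
      unfolding z using seq[of "rho x r" "\<zero>\<^bsub>Bq x\<^esub>"] rho_simps(1)[OF xc rc rc] r by (simp add: B.minus_eq)
    then have "kap W x (emR r \<star> w) = kap W x \<zero>\<^bsub>TF\<^esub>" using sm[OF rc] sm[OF zero_closed] k0 by simp
    then have "emR r \<star> w \<boxminus> \<zero>\<^bsub>TF\<^esub> \<in> xW W x" using kE[OF WD(4)[OF _ w(1)] WD(2)] rc by simp
    then show ?thesis using rc wc by (simp add: P.minus_eq)
  qed
  have 2: "w \<notin> xW W x"
  proof
    assume "w \<in> xW W x"
    then have "kap W x w = kap W x \<zero>\<^bsub>TF\<^esub>" using kE[OF w(1) WD(2)] wc by (simp add: P.minus_eq)
    then have "f ?one = f (?s (rho x \<zero>))" using sm[OF zero_closed] k0 w(2) by simp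
    moreover have "?s (rho x \<zero>) \<in> carrier ?k" unfolding z by simp
    ultimately have "?one = ?s (rho x \<zero>)" using f(2) one by (meson inj_onD)
    then have "\<one>\<^bsub>Bq x\<^esub> \<in> ?n" using seq[of "\<one>\<^bsub>Bq x\<^esub>" "\<zero>\<^bsub>Bq x\<^esub>"] unfolding z by (simp add: B.minus_eq)
    then show False using n.one_imp_carrier n.I_notcarr by simp
  qed
  obtain e where e: "e \<in> carrier TF" "emR x \<star> e = w" using divide[OF x(2) wc] .
  have "emR r \<star> e \<in> W" if r: "r \<in> \<mm>" for r
  proof (rule xW_cancel[OF W x(2)])
    have rc: "r \<in> carrier R" using mm_carrier[OF r] .
    show "emR r \<star> e \<in> carrier TF" using rc e by simp
    have "emR x \<star> (emR r \<star> e) = emR r \<star> w" unfolding e(2)[symmetric] using rc xc e(1) by (simp add: P.m_ac)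
    then show "emR x \<star> (emR r \<star> e) \<in> xW W x" using 1[OF r] by simp
  qed
  moreover have "e \<notin> W" using 2 e(2) by auto
  ultimately show ?thesis using e(1) by auto
qed

theorem canonical_imp_dualizing:
  assumes W: "regular_fractional TF (base R) W" and can: "canonical_module_dim1 R \<mm> (Wm W)"
  shows "dualizing TF (base R) W"
proof -
  note Ws = P.regular_fractionalD(1)[OF W]
  obtain x where x: "x \<in> \<mm>" "reg x" and "canonical_module_dim0 (Bq x) (Em W x)"
    using can unfolding canonical_module_dim1_def by blast
  then obtain \<nn> f where n: "local_ring (Bq x) \<nn>" and inj: "injective_module (Bq x) (Em W x)"
    and f: "f \<in> linear_maps (Bq x) (residue_field_module (Bq x) \<nn>) (Em W x)" "inj_on f (carrier (residue_field_module (Bq x) \<nn>))"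
    unfolding canonical_module_dim0_def injective_hull_def by blast
  have nn: "\<nn> = rho x ` \<mm>" using n B_maximal[OF x(1)] unfolding local_ring_def by blast
  obtain e where e: "e \<in> carrier TF" "e \<notin> W" "\<And>r. r \<in> emR ` \<mm> \<Longrightarrow> r \<star> e \<in> W"
    using residue_socle[OF Ws x f[unfolded nn]] by blast
  show ?thesis
    by (rule P.dualizing_if_baer[OF W _ regular_unit[OF x(2)] injective_imp_baer[OF Ws x(2) inj] e]) (use x in auto)
qed

end

lemma FactRing_carrier: "carrier (S Quot I) = (\<lambda>a. I +>\<^bsub>S\<^esub> a) ` carrier S"
  unfolding FactRing_def A_RCOSETS_def' by auto

lemma ring_as_module_module:
  assumes A: "cring A" and B: "cring B" and h: "\<phi> \<in> ring_hom A B"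
  shows "module A (ring_as_module \<phi> B)"
proof -
  interpret A: cring A by fact
  interpret B: cring B by fact
  note hD = ring_hom_closed[OF h] ring_hom_add[OF h] ring_hom_mult[OF h] ring_hom_one[OF h]
  show ?thesis
  proof (rule moduleI)
    show "abelian_group (ring_as_module \<phi> B)"
      by (rule abelian_groupI) (auto simp: B.a_ac intro!: bexI[of _ "\<ominus>\<^bsub>B\<^esub> _"] B.r_neg B.l_neg)
  qed (auto simp: A hD B.l_distr B.r_distr B.m_assoc)
qed

context one_dim_ring
begin

lemma rho_mem_maximal:
  assumes x: "x \<in> \<mm>" and r: "r \<in> carrier R" "rho x r \<in> rho x ` \<mm>"
  shows "r \<in> \<mm>"
proof -
  from r(2) obtain m where m: "m \<in> \<mm>" "rho x r = rho x m" by blast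
  then have "r \<ominus> m \<in> \<mm>" using rho_eq_iff[OF mm_carrier[OF x] r(1)] mm_carrier[OF m(1)] pideal_mm[OF x] by auto
  then have "(r \<ominus> m) \<oplus> m \<in> \<mm>" using m additive_subgroup.a_closed[OF ideal.axioms(1)[OF mm_ideal]] by simp
  then show ?thesis using r(1) mm_carrier[OF m(1)] by (simp add: minus_eq a_assoc l_neg)
qed

lemma regular_parameter_exists:
  obtains x where "x \<in> \<mm>" "reg x"
  using P.regular_parameter emb_unit_iff mm_carrier by blast

text \<open>
Multiplication by the common denominator \<open>c\<close> turns \<open>W\<close> into an ideal of the Noetherian ring \<open>R\<close>.
\<close>

lemma Wm_fin_gen:
  assumes W: "regular_fractional TF (base R) W"
  shows "fin_gen_module R (Wm W)"
proof -
  note Ws = P.regular_fractionalD(1)[OF W]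
  interpret M: module R "Wm W" by (rule Wm_module[OF Ws])
  obtain c where c: "c \<in> base R" "c \<in> Units TF" "\<And>w. w \<in> W \<Longrightarrow> c \<star> w \<in> base R"
    using P.regular_fractionalD(3)[OF W] by blast
  have cc: "c \<in> carrier TF" using c(2) by auto
  define pre where "pre N = {r \<in> carrier R. emR r \<in> (\<lambda>w. c \<star> w) ` N}" for N
  have pre: "ideal (pre N) R" if "P.smod N" for N
    unfolding pre_def by (rule submod_preimage_ideal[OF P.smod_scale[OF that cc]])
  obtain G where G: "G \<subseteq> carrier R" "finite G" "pre W = Idl G"
    using noetherian_ring.finetely_gen[OF noetherian pre[OF Ws]] by blast
  have "\<forall>g\<in>G. \<exists>w\<in>W. emR g = c \<star> w"
    using genideal_self[OF G(1)] G(3) unfolding pre_def by blast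
  then obtain s where s: "\<And>g. g \<in> G \<Longrightarrow> s g \<in> W" "\<And>g. g \<in> G \<Longrightarrow> emR g = c \<star> s g" by metis
  show ?thesis
    unfolding fin_gen_module_def
  proof (intro conjI exI[of _ "s ` G"] allI impI)
    show "module R (Wm W)" by (rule M.module_axioms)
    show "finite (s ` G)" using G by simp
    show "s ` G \<subseteq> carrier (Wm W)" using s by auto
    fix N assume N: "submodule N R (Wm W)" "s ` G \<subseteq> N"
    note ND = M.submoduleE[OF N(1), unfolded Wm_simps]
    obtain n0 where n0: "n0 \<in> N" using ND(2) by blast
    have "emR \<zero> \<star> n0 = \<zero>\<^bsub>TF\<^esub>" using n0 ND(1) P.smodD(1)[OF Ws] by (auto simp: emb_zero)
    then have zN: "\<zero>\<^bsub>TF\<^esub> \<in> N" using ND(4)[OF zero_closed n0] by simp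
    have Ns: "P.smod N"
      unfolding submod_def using zN ND(1,4,5) P.smodD(1)[OF Ws] by blast
    have "G \<subseteq> pre N" unfolding pre_def using N(2) s(2) G(1) by blast
    then have sub: "pre W \<subseteq> pre N" unfolding G(3) by (rule genideal_minimal[OF pre[OF Ns]])
    have "w \<in> N" if w: "w \<in> W" for w
    proof -
      obtain r where r: "r \<in> carrier R" "c \<star> w = emR r" using c(3)[OF w] by blast
      have "r \<in> pre W" unfolding pre_def using r w by auto
      then have "r \<in> pre N" using sub by blast
      then obtain n where n: "n \<in> N" "emR r = c \<star> n" unfolding pre_def by blast
      have "w = n"
        by (rule P.unit_cancel[OF c(2) P.smodD(1)[OF Ws w] P.smodD(1)[OF Ns n(1)] trans[OF r(2) n(2)]])
      then show ?thesis using n by simp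
    qed
    then show "N = carrier (Wm W)" using ND(1) by auto
  qed
qed

text \<open>
Baer's criterion reduces the claim to a map \<open>g\<close> on an ideal of \<open>R/xR\<close>. Dividing its values by \<open>x\<close>
turns \<open>g\<close> into a homomorphism from an ideal of \<open>R\<close> containing \<open>x\<close> to \<open>Q/W\<close>, which is
a multiplication by some \<open>q\<close>, and \<open>qx\<close> represents the required element of \<open>W/xW\<close>.
\<close>

lemma dualizing_imp_injective:
  assumes W: "dualizing TF (base R) W" and x: "x \<in> \<mm>" "reg x"
  shows "injective_module (Bq x) (Em W x)"
proof (rule baer_criterion)
  have xc: "x \<in> carrier R" using mm_carrier[OF x(1)] .
  note Ws = P.dualizingD(2)[OF W]
  note WD = P.smodD[OF Ws] and kE = kap_eq_iff[OF Ws xc] and kA = kap_add[OF Ws xc] and kS = kap_smult[OF Ws xc]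
  show "module (Bq x) (Em W x)" by (rule Em_module[OF Ws xc])
  fix K g assume K: "ideal K (Bq x)" and g: "g \<in> linear_maps (Bq x) ((self_module (Bq x))\<lparr>carrier := K\<rparr>) (Em W x)"
  define J0 where "J0 = {r \<in> carrier R. rho x r \<in> K}"
  have J0: "ideal J0 R" "x \<in> J0" "K = rho x ` J0"
    unfolding J0_def by (rule proj_preimage[OF xc K])+
  have J0c: "j \<in> J0 \<Longrightarrow> j \<in> carrier R" for j by (simp add: J0_def)
  have J0K: "j \<in> J0 \<Longrightarrow> rho x j \<in> K" for j by (simp add: J0_def)
  have J0a: "i \<in> J0 \<Longrightarrow> j \<in> J0 \<Longrightarrow> i \<oplus> j \<in> J0" for i j
    using additive_subgroup.a_closed[OF ideal.axioms(1)[OF J0(1)]] .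
  have J0m: "r \<in> carrier R \<Longrightarrow> j \<in> J0 \<Longrightarrow> r \<otimes> j \<in> J0" for r j
    using ideal.I_l_closed[OF J0(1)] .
  have gc: "\<exists>w\<in>W. g (rho x j) = kap W x w" if "j \<in> J0" for j
  proof -
    have "g (rho x j) \<in> kap W x ` W"
      using g J0K[OF that] unfolding linear_maps_def Em_carrier[symmetric] by auto
    then show ?thesis by blast
  qed
  have ga: "g (rho x (i \<oplus> j)) = g (rho x i) \<oplus>\<^bsub>Em W x\<^esub> g (rho x j)" if "i \<in> J0" "j \<in> J0" for i j
  proof -
    have "g (C \<oplus>\<^bsub>Bq x\<^esub> D) = g C \<oplus>\<^bsub>Em W x\<^esub> g D" if "C \<in> K" "D \<in> K" for C D
      using g that unfolding linear_maps_def by simp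
    from this[OF J0K[OF that(1)] J0K[OF that(2)]] show ?thesis
      unfolding rho_simps(2)[OF xc J0c[OF that(1)] J0c[OF that(2)]] .
  qed
  have gm: "g (rho x (r \<otimes> j)) = rho x r \<odot>\<^bsub>Em W x\<^esub> g (rho x j)" if "r \<in> carrier R" "j \<in> J0" for r j
  proof -
    have "g (C \<otimes>\<^bsub>Bq x\<^esub> D) = C \<odot>\<^bsub>Em W x\<^esub> g D" if "C \<in> carrier (Bq x)" "D \<in> K" for C D
      using g that unfolding linear_maps_def by simp
    from this[OF rho_simps(1)[OF xc that(1) that(1)] J0K[OF that(2)]] show ?thesis
      unfolding rho_simps(3)[OF xc that(1) J0c[OF that(2)]] .
  qed
  define G where "G q e \<longleftrightarrow> (\<exists>j\<in>J0. q = emR j \<and> emR x \<star> e \<in> W \<and> g (rho x j) = kap W x (emR x \<star> e))" for q e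
  define J where "J = emR ` J0"
  have Js: "P.smod J" unfolding J_def by (rule emb_ideal_submod[OF J0(1)])
  have ex: "\<exists>e. e \<in> carrier TF \<and> G q e" if "q \<in> J" for q
  proof -
    obtain j where j: "j \<in> J0" "q = emR j" using \<open>q \<in> J\<close> unfolding J_def by blast
    obtain w where w: "w \<in> W" "g (rho x j) = kap W x w" using gc[OF j(1)] by blast
    obtain e where e: "e \<in> carrier TF" "emR x \<star> e = w" using divide[OF x(2) WD(1)[OF w(1)]] .
    have "G q e" unfolding G_def using j w e by auto
    then show ?thesis using e by blast
  qed
  define f where "f q = (SOME e. e \<in> carrier TF \<and> G q e)" for q
  have f: "f q \<in> carrier TF" "G q (f q)" if "q \<in> J" for q
    using someI_ex[OF ex[OF that]] unfolding f_def by simp_all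
  have uniq: "e \<boxminus> e' \<in> W" if ee: "e \<in> carrier TF" "e' \<in> carrier TF" and G: "G q e" "G q e'" for q e e'
  proof (rule xW_cancel[OF Ws x(2)])
    note [simp] = ee xc
    obtain j where j: "j \<in> J0" "q = emR j" "emR x \<star> e \<in> W" "g (rho x j) = kap W x (emR x \<star> e)"
      using G(1) unfolding G_def by blast
    obtain j' where j': "j' \<in> J0" "q = emR j'" "emR x \<star> e' \<in> W" "g (rho x j') = kap W x (emR x \<star> e')"
      using G(2) unfolding G_def by blast
    have "j = j'" using emb_inj[OF J0c[OF j(1)] J0c[OF j'(1)]] j(2) j'(2) by simp
    then have "kap W x (emR x \<star> e) = kap W x (emR x \<star> e')" using j(4) j'(4) by simp
    then have "emR x \<star> e \<boxminus> emR x \<star> e' \<in> xW W x" using kE[OF j(3) j'(3)] by simp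
    moreover have "emR x \<star> e \<boxminus> emR x \<star> e' = emR x \<star> (e \<boxminus> e')" by (simp add: P.minus_eq P.r_distr P.r_minus)
    ultimately show "emR x \<star> (e \<boxminus> e') \<in> xW W x" by simp
    show "e \<boxminus> e' \<in> carrier TF" by simp
  qed
  have hm: "hom_mod TF (base R) W J f"
  proof (rule P.hom_modI[OF Ws Js, where G = G])
    show "f q \<in> carrier TF" "G q (f q)" if "q \<in> J" for q by (rule f[OF that])+
    show "e \<boxminus> e' \<in> W" if "e \<in> carrier TF" "e' \<in> carrier TF" "G q e" "G q e'" for q e e'
      by (rule uniq[OF that])
    show "G (p \<boxplus> q) (e \<boxplus> e')" if ee: "e \<in> carrier TF" "e' \<in> carrier TF" and G: "G p e" "G q e'" for p q e e'
    proof -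
      obtain j where j: "j \<in> J0" "p = emR j" "emR x \<star> e \<in> W" "g (rho x j) = kap W x (emR x \<star> e)"
        using G(1) unfolding G_def by blast
      obtain j' where j': "j' \<in> J0" "q = emR j'" "emR x \<star> e' \<in> W" "g (rho x j') = kap W x (emR x \<star> e')"
        using G(2) unfolding G_def by blast
      have d: "emR x \<star> (e \<boxplus> e') = emR x \<star> e \<boxplus> emR x \<star> e'" using ee xc by (simp add: P.r_distr)
      have "g (rho x (j \<oplus> j')) = kap W x (emR x \<star> (e \<boxplus> e'))"
        unfolding ga[OF j(1) j'(1)] j(4) j'(4) d by (rule kA[OF j(3) j'(3)])
      moreover have "emR x \<star> (e \<boxplus> e') \<in> W" unfolding d by (rule WD(3)[OF j(3) j'(3)])
      moreover have "p \<boxplus> q = emR (j \<oplus> j')" using j j' J0c by (simp add: emb_simps)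
      ultimately show ?thesis unfolding G_def using J0a[OF j(1) j'(1)] by blast
    qed
    show "G (t \<star> q) (t \<star> e)" if t: "t \<in> base R" and ee: "e \<in> carrier TF" and G: "G q e" for t q e
    proof -
      obtain r where r: "r \<in> carrier R" "t = emR r" using t by blast
      obtain j where j: "j \<in> J0" "q = emR j" "emR x \<star> e \<in> W" "g (rho x j) = kap W x (emR x \<star> e)"
        using G unfolding G_def by blast
      have d: "emR x \<star> (emR r \<star> e) = emR r \<star> (emR x \<star> e)" using ee xc r by (simp add: P.m_lcomm)
      have "g (rho x (r \<otimes> j)) = kap W x (emR x \<star> (emR r \<star> e))"
        unfolding gm[OF r(1) j(1)] j(4) d by (rule kS[OF r(1) j(3)])
      moreover have "emR x \<star> (emR r \<star> e) \<in> W" unfolding d by (rule WD(4)[OF _ j(3)]) (use r in simp)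
      moreover have "t \<star> q = emR (r \<otimes> j)" using j r J0c by (simp add: emb_simps)
      ultimately show ?thesis unfolding G_def r(2) using J0m[OF r(1) j(1)] by blast
    qed
  qed
  have xJ: "emR x \<in> J" unfolding J_def using J0(2) by blast
  have "regular_fractional TF (base R) J"
  proof (rule P.regular_fractionalI[OF Js xJ regular_unit[OF x(2)], of "\<one>\<^bsub>TF\<^esub>"])
    show "\<one>\<^bsub>TF\<^esub> \<star> y \<in> base R" if "y \<in> J" for y
      using that J0c by (auto simp: J_def)
  qed simp_all
  from P.dualizing_baer[OF W this hm] obtain q where q: "q \<in> carrier TF" "\<And>y. y \<in> J \<Longrightarrow> f y \<boxminus> q \<star> y \<in> W" by blast
  have fx: "f (emR x) \<in> W"
  proof (rule xW_cancel[OF Ws x(2) f(1)[OF xJ]])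
    obtain j where j: "j \<in> J0" "emR x = emR j" "emR x \<star> f (emR x) \<in> W" "g (rho x j) = kap W x (emR x \<star> f (emR x))"
      using f(2)[OF xJ] unfolding G_def by blast
    have jx: "j = x" using emb_inj[OF xc J0c[OF j(1)]] j(2) by simp
    have z0: "\<zero> \<in> J0" using additive_subgroup.zero_closed[OF ideal.axioms(1)[OF J0(1)]] .
    have "rho x x = rho x \<zero>" using rho_eq_iff[OF xc xc zero_closed] xc
      by (auto simp: pideal_iff minus_eq intro!: bexI[of _ \<one>])
    moreover have "g (rho x \<zero>) = kap W x \<zero>\<^bsub>TF\<^esub>"
    proof -
      obtain w where w: "w \<in> W" "g (rho x \<zero>) = kap W x w" using gc[OF z0] by blast
      have "g (rho x (\<zero> \<otimes> \<zero>)) = kap W x (emR \<zero> \<star> w)"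
        unfolding gm[OF zero_closed z0] w(2) by (rule kS[OF zero_closed w(1)])
      then show ?thesis using WD(1)[OF w(1)] by (simp add: emb_zero)
    qed
    ultimately have "kap W x (emR x \<star> f (emR x)) = kap W x \<zero>\<^bsub>TF\<^esub>" using j(4) jx by simp
    then have "emR x \<star> f (emR x) \<boxminus> \<zero>\<^bsub>TF\<^esub> \<in> xW W x" using kE[OF j(3) WD(2)] by simp
    then show "emR x \<star> f (emR x) \<in> xW W x" using f(1)[OF xJ] xc by (simp add: P.minus_eq)
  qed
  have v: "q \<star> emR x \<in> W" using P.smod_minus_cancel2[OF Ws _ fx q(2)[OF xJ]] q(1) xc by simp
  show "\<exists>e\<in>carrier (Em W x). \<forall>C\<in>K. g C = C \<odot>\<^bsub>Em W x\<^esub> e"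
  proof (intro bexI[of _ "kap W x (q \<star> emR x)"] ballI)
    show "kap W x (q \<star> emR x) \<in> carrier (Em W x)" using v by (simp add: Em_carrier)
    fix C assume "C \<in> K"
    then obtain i where i: "i \<in> J0" "C = rho x i" using J0(3) by blast
    have iJ: "emR i \<in> J" unfolding J_def using i by blast
    have ic: "i \<in> carrier R" using J0c[OF i(1)] .
    obtain j where j: "j \<in> J0" "emR i = emR j" "emR x \<star> f (emR i) \<in> W" "g (rho x j) = kap W x (emR x \<star> f (emR i))"
      using f(2)[OF iJ] unfolding G_def by blast
    have ji: "j = i" using emb_inj[OF ic J0c[OF j(1)]] j(2) by simp
    have "emR x \<star> (f (emR i) \<boxminus> q \<star> emR i) \<in> xW W x" using q(2)[OF iJ] by (rule imageI)
    moreover have "emR x \<star> f (emR i) \<boxminus> emR i \<star> (q \<star> emR x) = emR x \<star> (f (emR i) \<boxminus> q \<star> emR i)"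
      using f(1)[OF iJ] q(1) xc ic by (simp add: P.minus_eq P.r_distr P.r_minus P.m_ac)
    ultimately have "kap W x (emR x \<star> f (emR i)) = kap W x (emR i \<star> (q \<star> emR x))"
      using kE[OF j(3) WD(4)[OF _ v]] ic by simp
    then show "g C = C \<odot>\<^bsub>Em W x\<^esub> kap W x (q \<star> emR x)"
      unfolding i(2) kS[OF ic v] using j(4) ji by simp
  qed
qed

text \<open>
A socle element \<open>e\<close> of \<open>Q/W\<close> defines an embedding \<open>r \<mapsto> rxe\<close> of the residue field into the injective
module \<open>W/xW\<close>. It is essential: any nonzero submodule contains a nonzero socle element, and the
socle of \<open>Q/W\<close> is simple.
\<close>

theorem dualizing_imp_canonical:
  assumes W: "dualizing TF (base R) W"
  shows "canonical_module_dim1 R \<mm> (Wm W)"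
proof -
  obtain x where x: "x \<in> \<mm>" "reg x" by (rule regular_parameter_exists)
  have xc: "x \<in> carrier R" using mm_carrier[OF x(1)] .
  note Ws = P.dualizingD(2)[OF W]
  note WD = P.smodD[OF Ws] and kE = kap_eq_iff[OF Ws xc] and kA = kap_add[OF Ws xc] and kS = kap_smult[OF Ws xc]
  obtain e where e: "e \<in> carrier TF" "e \<notin> W" "\<And>r. r \<in> emR ` \<mm> \<Longrightarrow> r \<star> e \<in> W"
    using P.dualizing_socle_exists[OF W] by blast
  define v where "v = emR x \<star> e"
  have v: "v \<in> W" unfolding v_def using e(3) x(1) by blast
  let ?n = "rho x ` \<mm>" let ?k = "residue_field_module (Bq x) ?n"
  interpret B: cring "Bq x" by (rule B_cring[OF xc])
  interpret n: maximalideal ?n "Bq x" by (rule B_maximal[OF x(1)])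
  let ?s = "\<lambda>C. ?n +>\<^bsub>Bq x\<^esub> C"
  interpret s: ring_hom_ring "Bq x" "Bq x Quot ?n" ?s by (rule n.rcos_ring_hom_ring)
  interpret rh: ring_hom_ring R "Bq x" "rho x" by (rule rho_hom[OF xc])
  have seq: "?s (rho x r) = ?s (rho x t) \<longleftrightarrow> r \<ominus> t \<in> \<mm>" if "r \<in> carrier R" "t \<in> carrier R" for r t
  proof -
    have d: "rho x (r \<ominus> t) = rho x r \<ominus>\<^bsub>Bq x\<^esub> rho x t" using that by (simp add: a_minus_def)
    have "?s (rho x r) = ?s (rho x t) \<longleftrightarrow> rho x (r \<ominus> t) \<in> ?n"
      unfolding d using B.quotient_eq_iff_same_a_r_cos[OF n.ideal_axioms, of "rho x r" "rho x t"] that by simp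
    then show ?thesis using rho_mem_maximal[OF x(1), of "r \<ominus> t"] that by blast
  qed
  have k_carr: "carrier ?k = (\<lambda>r. ?s (rho x r)) ` carrier R"
    by (simp only: self_module_simps FactRing_carrier image_image)
  have veq: "emR r \<star> v \<boxminus> emR t \<star> v = emR x \<star> (emR (r \<ominus> t) \<star> e)" if "r \<in> carrier R" "t \<in> carrier R" for r t
    unfolding v_def using that e(1) xc by (simp add: emb_minus P.minus_eq P.l_distr P.r_distr P.l_minus P.r_minus P.m_lcomm)
  have kv: "kap W x (emR r \<star> v) = kap W x (emR t \<star> v) \<longleftrightarrow> ?s (rho x r) = ?s (rho x t)"
    if rt: "r \<in> carrier R" "t \<in> carrier R" for r t
  proof -
    have rtc: "r \<ominus> t \<in> carrier R" using rt by simp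
    have "kap W x (emR r \<star> v) = kap W x (emR t \<star> v) \<longleftrightarrow> emR x \<star> (emR (r \<ominus> t) \<star> e) \<in> xW W x"
      unfolding veq[OF rt, symmetric] by (rule kE) (use WD(4) v rt in auto)
    also have "\<dots> \<longleftrightarrow> emR (r \<ominus> t) \<star> e \<in> W"
      using xW_cancel[OF Ws x(2)] rtc e(1) by auto
    also have "\<dots> \<longleftrightarrow> r \<ominus> t \<in> \<mm>"
    proof
      assume a: "emR (r \<ominus> t) \<star> e \<in> W"
      show "r \<ominus> t \<in> \<mm>"
      proof (rule ccontr)
        assume "r \<ominus> t \<notin> \<mm>"
        then have "emR (r \<ominus> t) \<notin> emR ` \<mm>" using emb_inj[OF rtc] mm_carrier by auto
        then obtain u where u: "u \<in> base R" "emR (r \<ominus> t) \<star> u = \<one>\<^bsub>TF\<^esub>" using P.invertible[of "emR (r \<ominus> t)"] rtc by blast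
        have uc: "u \<in> carrier TF" using u(1) by auto
        have "u \<star> (emR (r \<ominus> t) \<star> e) = (emR (r \<ominus> t) \<star> u) \<star> e" using uc rtc e(1) by (simp add: P.m_ac)
        then have "u \<star> (emR (r \<ominus> t) \<star> e) = e" unfolding u(2) using e(1) by simp
        then show False using WD(4)[OF u(1) a] e(2) by simp
      qed
    qed (use e(3) in blast)
    finally show ?thesis using seq[OF rt] by simp
  qed
  define f where "f D = kap W x (emR (SOME r. r \<in> carrier R \<and> D = ?s (rho x r)) \<star> v)" for D
  have f: "f (?s (rho x r)) = kap W x (emR r \<star> v)" if r: "r \<in> carrier R" for r
  proof -
    have "\<exists>t. t \<in> carrier R \<and> ?s (rho x r) = ?s (rho x t)" using r by blast
    from someI_ex[OF this] show ?thesis unfolding f_def using kv[OF _ r] by simp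
  qed
  have vW: "emR r \<star> v \<in> W" if "r \<in> carrier R" for r using WD(4)[OF _ v] that by simp
  have flin: "f \<in> linear_maps (Bq x) ?k (Em W x)"
    unfolding linear_maps_def
  proof (intro CollectI conjI ballI)
    show "f \<in> carrier ?k \<rightarrow> carrier (Em W x)"
      unfolding k_carr using f vW by (auto simp: Em_carrier)
    fix C D assume "C \<in> carrier ?k" "D \<in> carrier ?k"
    then obtain r t where rt: "r \<in> carrier R" "t \<in> carrier R" and CD: "C = ?s (rho x r)" "D = ?s (rho x t)"
      unfolding k_carr by blast
    have 1: "C \<oplus>\<^bsub>?k\<^esub> D = ?s (rho x (r \<oplus> t))" unfolding CD using rt by simp
    have 2: "emR (r \<oplus> t) \<star> v = emR r \<star> v \<boxplus> emR t \<star> v" using rt WD(1)[OF v] by (simp add: emb_simps P.l_distr)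
    have rtc: "r \<oplus> t \<in> carrier R" using rt by simp
    show "f (C \<oplus>\<^bsub>?k\<^esub> D) = f C \<oplus>\<^bsub>Em W x\<^esub> f D"
      unfolding 1 f[OF rtc] 2 unfolding CD f[OF rt(1)] f[OF rt(2)] by (rule kA[OF vW[OF rt(1)] vW[OF rt(2)], symmetric])
  next
    fix c D assume "c \<in> carrier (Bq x)" "D \<in> carrier ?k"
    then obtain r t where rt: "r \<in> carrier R" "t \<in> carrier R" and CD: "c = rho x r" "D = ?s (rho x t)"
      unfolding k_carr B_carrier by blast
    have 1: "c \<odot>\<^bsub>?k\<^esub> D = ?s (rho x (r \<otimes> t))" unfolding CD using rt by simp
    have 2: "emR (r \<otimes> t) \<star> v = emR r \<star> (emR t \<star> v)" using rt WD(1)[OF v] by (simp add: emb_simps P.m_assoc)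
    have rtc: "r \<otimes> t \<in> carrier R" using rt by simp
    show "f (c \<odot>\<^bsub>?k\<^esub> D) = c \<odot>\<^bsub>Em W x\<^esub> f D"
      unfolding 1 f[OF rtc] 2 unfolding CD f[OF rt(2)] by (rule kS[OF rt(1) vW[OF rt(2)], symmetric])
  qed
  have finj: "inj_on f (carrier ?k)"
  proof (rule inj_onI)
    fix C D assume "C \<in> carrier ?k" "D \<in> carrier ?k" and e: "f C = f D"
    then obtain r t where rt: "r \<in> carrier R" "t \<in> carrier R" and CD: "C = ?s (rho x r)" "D = ?s (rho x t)"
      unfolding k_carr by blast
    from e show "C = D" unfolding CD f[OF rt(1)] f[OF rt(2)] kv[OF rt] .
  qed
  have fess: "N \<inter> f ` carrier ?k \<noteq> {\<zero>\<^bsub>Em W x\<^esub>}"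
    if N: "submodule N (Bq x) (Em W x)" "N \<noteq> {\<zero>\<^bsub>Em W x\<^esub>}" for N
  proof -
    interpret E: module "Bq x" "Em W x" by (rule Em_module[OF Ws xc])
    note ND = E.submoduleE[OF N(1)]
    note kz = kap_zero[OF Ws xc]
    have "\<zero>\<^bsub>Em W x\<^esub> \<in> N"
    proof -
      obtain C where C: "C \<in> N" using ND(2) by blast
      have "\<zero>\<^bsub>Bq x\<^esub> \<odot>\<^bsub>Em W x\<^esub> C \<in> N" by (rule ND(4)[OF _ C]) simp
      then show ?thesis using E.smult_l_null ND(1) C by auto
    qed
    then obtain C where C: "C \<in> N" "C \<noteq> \<zero>\<^bsub>Em W x\<^esub>" using N(2) by blast
    then obtain w where w: "w \<in> W" "C = kap W x w" using ND(1) unfolding Em_carrier by blast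
    have wc: "w \<in> carrier TF" using WD(1)[OF w(1)] .
    obtain e1 where e1: "e1 \<in> carrier TF" "emR x \<star> e1 = w" using divide[OF x(2) wc] .
    have "e1 \<notin> W"
    proof
      assume "e1 \<in> W"
      then have "w \<boxminus> \<zero>\<^bsub>TF\<^esub> \<in> xW W x" using e1 wc by (auto simp: P.minus_eq)
      then have "kap W x w = kap W x \<zero>\<^bsub>TF\<^esub>" using kE[OF w(1) WD(2)] by simp
      then show False using C(2) w(2) kz by simp
    qed
    obtain u where u: "u \<in> W" "u \<in> Units TF" using P.regular_fractionalD(2)[OF P.dualizingD(1)[OF W]] by blast
    obtain s where s: "s \<in> base R" "s \<star> e1 \<notin> W" "\<And>r. r \<in> emR ` \<mm> \<Longrightarrow> r \<star> (s \<star> e1) \<in> W"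
      using P.socle_element[OF Ws u e1(1) \<open>e1 \<notin> W\<close>] by blast
    have sc: "s \<in> carrier TF" using s(1) by auto
    obtain t where t: "t \<in> base R" "e \<boxminus> t \<star> (s \<star> e1) \<in> W"
      using P.dualizing_socle_simple[OF W _ s(2,3) e(1,3)] sc e1(1) by auto
    obtain r where r: "r \<in> carrier R" "t \<star> s = emR r" using P.A_closed(4)[OF t(1) s(1)] by blast
    have tc: "t \<in> carrier TF" using t(1) by auto
    have "v \<boxminus> emR r \<star> w = emR x \<star> (e \<boxminus> t \<star> (s \<star> e1))"
      unfolding r(2)[symmetric] e1(2)[symmetric] v_def using e(1) e1(1) xc sc tc
      by (simp add: P.minus_eq P.r_distr P.r_minus P.m_ac)
    then have "v \<boxminus> emR r \<star> w \<in> xW W x" using t(2) by simp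
    then have "kap W x v = kap W x (emR r \<star> w)" using kE[OF v WD(4)[OF _ w(1)]] r(1) by simp
    also have "\<dots> = rho x r \<odot>\<^bsub>Em W x\<^esub> C" unfolding w(2) by (rule kS[OF r(1) w(1), symmetric])
    finally have "kap W x v \<in> N" using ND(4)[OF _ C(1), of "rho x r"] rho_simps(1)[OF xc r(1) r(1)] by simp
    moreover have fv: "f (?s (rho x \<one>)) = kap W x v"
      using f[OF one_closed] WD(1)[OF v] by (simp add: emb_one)
    moreover have "?s (rho x \<one>) \<in> carrier ?k" unfolding k_carr by blast
    ultimately have mem: "kap W x v \<in> N \<inter> f ` carrier ?k" by (metis IntI imageI)
    have "kap W x v \<noteq> \<zero>\<^bsub>Em W x\<^esub>"
    proof
      assume "kap W x v = \<zero>\<^bsub>Em W x\<^esub>"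
      then have "v \<boxminus> \<zero>\<^bsub>TF\<^esub> \<in> xW W x" using kE[OF v WD(2)] kz by simp
      then have "emR x \<star> e \<in> xW W x" using WD(1)[OF v] by (simp add: P.minus_eq v_def)
      then show False using xW_cancel[OF Ws x(2) e(1)] e(2) by blast
    qed
    then show ?thesis using mem by blast
  qed
  have kmod: "module (Bq x) ?k"
    by (rule ring_as_module_module[OF B.is_cring n.quotient_is_cring[OF B.is_cring] n.rcos_ring_hom])
  have hull: "injective_hull (Bq x) ?k (Em W x)"
    unfolding injective_hull_def using kmod dualizing_imp_injective[OF W x] flin finj fess by blast
  have "w = \<zero>\<^bsub>TF\<^esub>" if "w \<in> W" "emR x \<star> w = \<zero>\<^bsub>TF\<^esub>" for w
    using P.unit_cancel[OF regular_unit[OF x(2)] WD(1)[OF that(1)] P.zero_closed] that(2) xc by simp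
  then have tor: "\<forall>w\<in>carrier (Wm W). x \<odot>\<^bsub>Wm W\<^esub> w = \<zero>\<^bsub>Wm W\<^esub> \<longrightarrow> w = \<zero>\<^bsub>Wm W\<^esub>" by simp
  have "canonical_module_dim0 (Bq x) (Em W x)"
    unfolding canonical_module_dim0_def using B_local[OF x(1)] hull by blast
  then show ?thesis
    unfolding canonical_module_dim1_def using Wm_fin_gen[OF P.dualizingD(1)[OF W]] x tor by blast
qed

theorem canonical_fractional_ideal_iff:
  assumes u: "u \<in> W" "u \<in> Units TF"
  shows "canonical_fractional_ideal R \<mm> W \<longleftrightarrow> dualizing TF (base R) W"
proof -
  have fr: "fractional_ideal R W \<longleftrightarrow> regular_fractional TF (base R) W"
  proof
    assume "fractional_ideal R W"
    then obtain y where s: "P.smod W" and y: "reg y" "frac_scale R (emR y) W \<subseteq> base R"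
      unfolding fractional_ideal_def submodule_iff by blast
    show "regular_fractional TF (base R) W"
      by (rule P.regular_fractionalI[OF s u _ regular_unit[OF y(1)]])
        (use y regD(1)[OF y(1)] in \<open>auto simp: frac_scale_def\<close>)
  next
    assume a: "regular_fractional TF (base R) W"
    obtain c where c: "c \<in> base R" "c \<in> Units TF" "\<And>w. w \<in> W \<Longrightarrow> c \<star> w \<in> base R"
      using P.regular_fractionalD(3)[OF a] by blast
    obtain y where y: "y \<in> carrier R" "c = emR y" using c(1) by blast
    have "reg y" using emb_unit_iff[OF y(1)] c(2) y(2) by simp
    then show "fractional_ideal R W"
      unfolding fractional_ideal_def submodule_iff
      using P.regular_fractionalD(1)[OF a] c(3) y by (auto simp: frac_scale_def)
  qed
  show ?thesis
    unfolding canonical_fractional_ideal_def fr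
    using canonical_imp_dualizing dualizing_imp_canonical P.dualizingD(1) by blast
qed

end

section \<open>Noetherian local rings of dimension one\<close>

lemma (in noetherian_ring) maximal_ideal_of_family:
  assumes "F \<noteq> {}" "\<And>J. J \<in> F \<Longrightarrow> ideal J R"
  shows "\<exists>M\<in>F. \<forall>J\<in>F. M \<subseteq> J \<longrightarrow> J = M"
proof (rule subset_Zorn_nonempty[OF assms(1)])
  fix C assume C: "C \<noteq> {}" "subset.chain F C"
  have "subset.chain {I. ideal I R} C"
    using C(2) assms(2) unfolding subset.chain_def by blast
  then have "\<Union>C \<in> C" by (rule ideal_chain_is_trivial[OF C(1)])
  then show "\<Union>C \<in> F" using C(2) unfolding subset.chain_def by blast
qed

lemma (in noetherian_ring) proper_ideal_in_maximal:
  assumes I: "ideal I R" "I \<noteq> carrier R"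
  shows "\<exists>\<nn>. maximalideal \<nn> R \<and> I \<subseteq> \<nn>"
proof -
  define F where "F = {J. ideal J R \<and> J \<noteq> carrier R \<and> I \<subseteq> J}"
  have "\<exists>M\<in>F. \<forall>J\<in>F. M \<subseteq> J \<longrightarrow> J = M"
    by (rule maximal_ideal_of_family) (use I in \<open>auto simp: F_def\<close>)
  then obtain M where M: "M \<in> F" "\<And>J. J \<in> F \<Longrightarrow> M \<subseteq> J \<Longrightarrow> J = M" by blast
  have "maximalideal M R"
  proof (rule maximalidealI)
    show "ideal M R" "carrier R \<noteq> M" using M(1) by (auto simp: F_def)
    fix J assume J: "ideal J R" "M \<subseteq> J" "J \<subseteq> carrier R"
    show "J = M \<or> J = carrier R"
    proof (rule disjCI)
      assume "J \<noteq> carrier R"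
      then have "J \<in> F" using J M(1) by (auto simp: F_def)
      then show "J = M" using M(2) J by blast
    qed
  qed
  then show ?thesis using M(1) by (auto simp: F_def)
qed

context cring
begin

lemma reg_power: "reg x \<Longrightarrow> reg (x [^] (n::nat))"
  by (induction n) (auto simp: reg_one reg_mult)

text \<open>
An ideal that is maximal among those disjoint from the products \<open>s x\<^sup>n\<close> with \<open>s\<close> outside \<open>P\<close> is prime, lies
in \<open>P\<close>, and omits \<open>x\<close>. The zero ideal is disjoint from these products because \<open>x\<close> is regular.
\<close>

lemma smaller_prime:
  assumes noeth: "noetherian_ring R" and P: "primeideal P R" and x: "x \<in> P" "reg x"
  shows "\<exists>P0. primeideal P0 R \<and> P0 \<subset> P"
proof -
  interpret N: noetherian_ring R by (rule noeth)
  interpret P: primeideal P R by (rule P)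
  have xc: "x \<in> carrier R" using regD(1)[OF x(2)] .
  have one: "\<one> \<in> carrier R - P" using P.one_imp_carrier P.I_notcarr by auto
  define M where "M = {s \<otimes> x [^] n | s n. s \<in> carrier R - P \<and> (n::nat) = n}"
  have MI: "s \<in> carrier R - P \<Longrightarrow> s \<otimes> x [^] (n::nat) \<in> M" for s n unfolding M_def by blast
  have M1: "a \<in> M" if "a \<in> carrier R - P" for a using MI[OF that, of 0] that by simp
  have Mmult: "a \<otimes> b \<in> M" if "a \<in> M" "b \<in> M" for a b
  proof -
    obtain s n where s: "s \<in> carrier R - P" "a = s \<otimes> x [^] (n::nat)" using \<open>a \<in> M\<close> unfolding M_def by blast
    obtain t k where t: "t \<in> carrier R - P" "b = t \<otimes> x [^] (k::nat)" using \<open>b \<in> M\<close> unfolding M_def by blast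
    have "s \<otimes> t \<in> carrier R - P" using s t P.I_prime by auto
    moreover have "a \<otimes> b = (s \<otimes> t) \<otimes> x [^] (n + k)"
      using s t xc by (simp add: nat_pow_mult[symmetric] m_ac)
    ultimately show ?thesis using MI by simp
  qed
  define F where "F = {I. ideal I R \<and> I \<inter> M = {}}"
  have "\<zero> \<notin> M"
  proof
    assume "\<zero> \<in> M"
    then obtain s n where s: "s \<in> carrier R - P" "\<zero> = s \<otimes> x [^] (n::nat)" unfolding M_def by blast
    then have "x [^] n \<otimes> s = \<zero>" using xc by (simp add: m_comm)
    then have "s = \<zero>" using regD(2)[OF reg_power[OF x(2)]] s(1) by blast
    then show False using s(1) by simp
  qed
  then have "{\<zero>} \<in> F" unfolding F_def using zeroideal by auto
  then have "\<exists>I\<in>F. \<forall>J\<in>F. I \<subseteq> J \<longrightarrow> J = I"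
    by (intro N.maximal_ideal_of_family) (auto simp: F_def)
  then obtain P0 where P0F: "P0 \<in> F" and maxF: "\<forall>J\<in>F. P0 \<subseteq> J \<longrightarrow> J = P0" by blast
  have P0: "ideal P0 R" "P0 \<inter> M = {}" using P0F unfolding F_def by simp_all
  have max: "J = P0" if "ideal J R" "J \<inter> M = {}" "P0 \<subseteq> J" for J
    using maxF that unfolding F_def by simp
  interpret P0: ideal P0 R by (rule P0)
  have meets: "\<exists>p\<in>P0. \<exists>r\<in>carrier R. p \<oplus> r \<otimes> a \<in> M" if a: "a \<in> carrier R" "a \<notin> P0" for a
  proof -
    let ?J = "P0 <+>\<^bsub>R\<^esub> PIdl a"
    have J: "ideal ?J R" by (rule add_ideals[OF P0(1) cgenideal_ideal[OF a(1)]])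
    have mem: "p \<oplus> r \<otimes> a \<in> ?J" if "p \<in> P0" "r \<in> carrier R" for p r
      using that unfolding set_add_def' cgenideal_def by blast
    have "P0 \<subseteq> ?J"
    proof
      fix p assume p: "p \<in> P0"
      then show "p \<in> ?J" using mem[OF p zero_closed] a P0.Icarr by simp
    qed
    moreover have "a \<in> ?J" using mem[OF P0.zero_closed one_closed] a by simp
    ultimately have "?J \<inter> M \<noteq> {}" using max[OF J] a(2) by blast
    then show ?thesis unfolding set_add_def' cgenideal_def by blast
  qed
  have "primeideal P0 R"
  proof (rule primeidealI[OF P0(1) is_cring])
    show "carrier R \<noteq> P0" using P0(2) M1[OF one] by auto
    fix a b assume ab: "a \<in> carrier R" "b \<in> carrier R" "a \<otimes> b \<in> P0"
    show "a \<in> P0 \<or> b \<in> P0"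
    proof (rule ccontr)
      assume "\<not> (a \<in> P0 \<or> b \<in> P0)"
      then obtain p r q t where 1: "p \<in> P0" "r \<in> carrier R" "p \<oplus> r \<otimes> a \<in> M"
        and 2: "q \<in> P0" "t \<in> carrier R" "q \<oplus> t \<otimes> b \<in> M" using meets ab by meson
      have [simp]: "p \<in> carrier R" "q \<in> carrier R" "r \<in> carrier R" "t \<in> carrier R" "a \<in> carrier R" "b \<in> carrier R"
        using 1 2 ab P0.Icarr by auto
      have "(p \<oplus> r \<otimes> a) \<otimes> (q \<oplus> t \<otimes> b) = (q \<oplus> t \<otimes> b) \<otimes> p \<oplus> ((r \<otimes> a) \<otimes> q \<oplus> (r \<otimes> t) \<otimes> (a \<otimes> b))"
        by ((simp add: ring_norm; fail) | (rule ring_eqI, (simp add: ring_norm; fail), simp_all))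
      moreover have "(q \<oplus> t \<otimes> b) \<otimes> p \<oplus> ((r \<otimes> a) \<otimes> q \<oplus> (r \<otimes> t) \<otimes> (a \<otimes> b)) \<in> P0"
        by (intro P0.a_closed P0.I_l_closed 1 2 ab) simp_all
      ultimately show False using Mmult[OF 1(3) 2(3)] P0(2) by auto
    qed
  qed
  moreover have "P0 \<subseteq> P" using P0(2) M1 P0.Icarr by blast
  moreover have "x \<in> M" using MI[OF one, of 1] xc by simp
  ultimately show ?thesis using x(1) P0(2) by blast
qed

lemma no_prime_chain:
  assumes "krull_dim R = 1" "primeideal P0 R" "primeideal P1 R" "primeideal P2 R" "P0 \<subset> P1" "P1 \<subset> P2"
  shows False
proof -
  define P where "P i = (if i = 0 then P0 else if i = 1 then P1 else P2)" for i :: nat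
  have "(\<forall>i\<le>2. primeideal (P i) R) \<and> (\<forall>i<2. P i \<subset> P (Suc i))"
    using assms by (auto simp: P_def less_2_cases_iff)
  then have "enat 2 \<le> krull_dim R" unfolding krull_dim_def by (intro Sup_upper) blast
  then show False using assms(1) by (simp add: one_enat_def)
qed

lemma Idl_empty: "Idl {} = {\<zero>}"
  using genideal_minimal[OF zeroideal, of "{}"] additive_subgroup.zero_closed[OF ideal.axioms(1)[OF genideal_ideal[of "{}"]]]
  by auto

lemma regular_sequence_single:
  assumes "reg x" "Idl {x} \<noteq> carrier R"
  shows "regular_sequence R [x]"
  unfolding regular_sequence_def
proof (intro conjI allI impI ballI)
  show "set [x] \<subseteq> carrier R" using regD(1)[OF assms(1)] by simp
  show "Idl (set [x]) \<noteq> carrier R" using assms(2) by simp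
  fix i r assume "i < length [x]" and r: "r \<in> carrier R" "[x] ! i \<otimes> r \<in> Idl (set (take i [x]))"
  then have "i = 0" by simp
  then show "r \<in> Idl (set (take i [x]))" using regD(2)[OF assms(1) r(1)] r(2) by (simp add: Idl_empty)
qed

lemma regular_sequence_hd:
  assumes "regular_sequence R xs" "0 < length xs"
  shows "reg (xs ! 0)"
  unfolding regular_element_def
proof (intro conjI ballI impI)
  show "xs ! 0 \<in> carrier R"
    using assms(1) nth_mem[OF assms(2)] unfolding regular_sequence_def by blast
  fix r assume r: "r \<in> carrier R" "xs ! 0 \<otimes> r = \<zero>"
  have "xs ! 0 \<otimes> r \<in> Idl (set (take 0 xs)) \<longrightarrow> r \<in> Idl (set (take 0 xs))"
    using assms r(1) unfolding regular_sequence_def by blast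
  then show "r = \<zero>" using r(2) by (simp add: Idl_empty)
qed

text \<open>
A prime ideal with a regular element contains a strictly smaller prime; in dimension one it cannot
also be strictly contained in the maximal ideal.
\<close>

theorem one_dim_ringI:
  assumes noeth: "noetherian_ring R" and loc: "local_ring R \<mm>" and dim: "krull_dim R = 1"
    and x: "x \<in> \<mm>" "reg x"
  shows "one_dim_ring R \<mm>"
proof -
  interpret N: noetherian_ring R by (rule noeth)
  interpret P: fraction_pair TF "base R" by (rule total_frac_pair)
  have max: "maximalideal \<mm> R" and max_unique: "\<And>\<nn>. maximalideal \<nn> R \<Longrightarrow> \<nn> = \<mm>"
    using loc unfolding local_ring_def by blast+
  interpret M: maximalideal \<mm> R by (rule max)
  have mprime: "primeideal \<mm> R" by (rule maximalideal_prime[OF max])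
  have proper: "I \<subseteq> \<mm>" if "ideal I R" "\<one> \<notin> I" for I
    using N.proper_ideal_in_maximal[OF that(1)] max_unique that(2) one_closed by metis
  have one_m: "\<one> \<notin> \<mm>" using M.one_imp_carrier M.I_notcarr by auto
  have emb_mem: "emb R r \<in> emb R ` K \<longleftrightarrow> r \<in> K" if "r \<in> carrier R" "K \<subseteq> carrier R" for r K
    using emb_inj[OF that(1)] that(2) by blast
  have "one_dim_local_pair TF (base R) (emb R ` \<mm>)"
  proof (intro one_dim_local_pair.intro one_dim_local_pair_axioms.intro)
    show "fraction_pair TF (base R)" by (rule total_frac_pair)
    show "submod TF (base R) (emb R ` \<mm>)" by (rule emb_ideal_submod[OF M.ideal_axioms])
    show "emb R ` \<mm> \<subseteq> base R" using M.a_subset by auto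
    show "\<one>\<^bsub>TF\<^esub> \<notin> emb R ` \<mm>" unfolding emb_one[symmetric] using emb_mem[OF one_closed M.a_subset] one_m by simp
    show "emb R ` \<mm> \<inter> Units TF \<noteq> {}" using x emb_unit_iff[of x] regD(1)[OF x(2)] by blast
  next
    fix r assume r: "r \<in> base R" "r \<notin> emb R ` \<mm>"
    then obtain s where s: "s \<in> carrier R" "r = emb R s" "s \<notin> \<mm>" by blast
    have "s \<in> PIdl s" using cgenideal_self[OF s(1)] .
    then have "\<one> \<in> PIdl s" using proper[OF cgenideal_ideal[OF s(1)]] s(3) by blast
    then obtain t where t: "t \<in> carrier R" "\<one> = t \<otimes> s" unfolding cgenideal_def by blast
    have "r \<otimes>\<^bsub>TF\<^esub> emb R t = \<one>\<^bsub>TF\<^esub>"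
      unfolding s(2) emb_one[symmetric] emb_simps(3)[OF s(1) t(1), symmetric] using t s(1) by (simp add: m_comm)
    then show "\<exists>s\<in>base R. r \<otimes>\<^bsub>TF\<^esub> s = \<one>\<^bsub>TF\<^esub>" using t(1) by blast
  next
    fix F assume F: "F \<noteq> {}" "\<And>J. J \<in> F \<Longrightarrow> submod TF (base R) J \<and> J \<subseteq> base R"
    define pre where "pre J = {r \<in> carrier R. emb R r \<in> J}" for J
    have pre: "J = emb R ` pre J" if "J \<in> F" for J using F(2)[OF that] unfolding pre_def by auto
    have "\<exists>M\<in>pre ` F. \<forall>J\<in>pre ` F. M \<subseteq> J \<longrightarrow> J = M"
      by (rule N.maximal_ideal_of_family) (use F submod_preimage_ideal in \<open>auto simp: pre_def\<close>)
    then obtain M where M: "M \<in> F" "\<And>J. J \<in> F \<Longrightarrow> pre M \<subseteq> pre J \<Longrightarrow> pre J = pre M" by blast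
    have "J = M" if "J \<in> F" "M \<subseteq> J" for J
    proof -
      have "pre M \<subseteq> pre J" using that(2) unfolding pre_def by blast
      then show ?thesis using M(2)[OF that(1)] pre[OF that(1)] pre[OF M(1)] by simp
    qed
    then show "\<exists>M\<in>F. \<forall>J\<in>F. M \<subseteq> J \<longrightarrow> J = M" using M(1) by blast
  next
    fix P assume P: "submod TF (base R) P" "P \<subseteq> base R" "\<one>\<^bsub>TF\<^esub> \<notin> P"
      "\<And>r s. r \<in> base R \<Longrightarrow> s \<in> base R \<Longrightarrow> r \<otimes>\<^bsub>TF\<^esub> s \<in> P \<Longrightarrow> r \<in> P \<or> s \<in> P" "P \<inter> Units TF \<noteq> {}"
    define P0 where "P0 = {r \<in> carrier R. emb R r \<in> P}"
    have PP0: "P = emb R ` P0" using P(2) unfolding P0_def by auto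
    have P0i: "ideal P0 R" unfolding P0_def by (rule submod_preimage_ideal[OF P(1)])
    have P0p: "primeideal P0 R"
    proof (rule primeidealI[OF P0i is_cring])
      show "carrier R \<noteq> P0" using P(3) one_closed unfolding P0_def emb_one[symmetric] by blast
      fix a b assume "a \<in> carrier R" "b \<in> carrier R" "a \<otimes> b \<in> P0"
      then show "a \<in> P0 \<or> b \<in> P0" using P(4)[of "emb R a" "emb R b"] unfolding P0_def by (auto simp: emb_simps)
    qed
    obtain y where y: "y \<in> P0" "emb R y \<in> Units TF" using P(5) PP0 by blast
    have yr: "reg y" using emb_unit_iff[of y] y P0_def by auto
    obtain P1 where P1: "primeideal P1 R" "P1 \<subset> P0" using smaller_prime[OF noeth P0p y(1) yr] by blast
    have "\<one> \<notin> P0" using P(3) emb_one unfolding P0_def by auto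
    then have "P0 \<subseteq> \<mm>" by (rule proper[OF P0i])
    then have "P0 = \<mm>" using no_prime_chain[OF dim P1(1) P0p mprime P1(2)] by blast
    then show "P = emb R ` \<mm>" using PP0 by simp
  qed
  then show ?thesis
    by (intro one_dim_ring.intro one_dim_ring_axioms.intro is_cring noeth max max_unique)
qed

end

theorem cohen_macaulay_one_dim:
  assumes CM: "cohen_macaulay_local R \<mm>" and dim: "krull_dim R = 1"
  shows "one_dim_ring R \<mm>"
proof -
  have noeth: "noetherian_ring R" and loc: "local_ring R \<mm>" and dp: "depth R \<mm> = 1"
    using CM dim unfolding cohen_macaulay_local_def by auto
  interpret cring R using loc unfolding local_ring_def by blast
  have "\<exists>xs. regular_sequence R xs \<and> set xs \<subseteq> \<mm> \<and> length xs \<noteq> 0"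
  proof (rule ccontr)
    assume "\<nexists>xs. regular_sequence R xs \<and> set xs \<subseteq> \<mm> \<and> length xs \<noteq> 0"
    then have "depth R \<mm> \<le> 0" unfolding depth_def
      by (intro Sup_least) (auto simp: zero_enat_def)
    then show False using dp by simp
  qed
  then obtain xs where xs: "regular_sequence R xs" "set xs \<subseteq> \<mm>" "length xs \<noteq> 0" by blast
  have "xs ! 0 \<in> \<mm>" using xs nth_mem by auto
  moreover have "reg (xs ! 0)" by (rule regular_sequence_hd[OF xs(1)]) (use xs(3) in simp)
  ultimately show ?thesis using one_dim_ringI[OF noeth loc dim] by blast
qed

text \<open>
A regular element of \<open>\<mm>\<close> is a regular sequence. There is no longer one: a second entry \<open>x2\<close> would be a
nonzerodivisor modulo the first entry, but it kills the socle elements modulo the ideal generated by that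
entry.
\<close>

theorem (in one_dim_ring) cohen_macaulay:
  assumes dim: "krull_dim R = 1"
  shows "cohen_macaulay_local R \<mm>"
proof -
  interpret M: maximalideal \<mm> R by (rule maxid)
  obtain x where x: "x \<in> \<mm>" "reg x"
    using P.regular_parameter emb_unit_iff mm_carrier by blast
  have "depth R \<mm> = 1"
  proof (rule antisym)
    have "Idl {x} \<subseteq> \<mm>" by (rule genideal_minimal[OF M.ideal_axioms]) (use x in simp)
    then have "Idl {x} \<noteq> carrier R" using one_not_mm one_closed by auto
    then have "regular_sequence R [x]" by (rule regular_sequence_single[OF x(2)])
    then have "enat (length [x]) \<le> depth R \<mm>"
      unfolding depth_def using x by (intro Sup_upper) force
    then show "1 \<le> depth R \<mm>" by (simp add: one_enat_def)
    have "length xs \<le> 1" if xs: "regular_sequence R xs" "set xs \<subseteq> \<mm>" for xs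
    proof (rule ccontr)
      assume l: "\<not> length xs \<le> 1"
      define x1 where "x1 = xs ! 0"
      define x2 where "x2 = xs ! 1"
      have x1: "x1 \<in> \<mm>" "x2 \<in> \<mm>" 
      proof -
        have "0 < length xs" "1 < length xs" using l by linarith+
        then show "x1 \<in> \<mm>" "x2 \<in> \<mm>"
          unfolding x1_def x2_def using subsetD[OF xs(2) nth_mem] by blast+
      qed
      have c: "x1 \<in> carrier R" "x2 \<in> carrier R" using x1 mm_carrier by auto
      have "take 1 xs = [x1]" using l unfolding x1_def by (cases xs) auto
      then have e: "Idl (set (take 1 xs)) = PIdl x1" using cgenideal_eq_genideal[OF c(1)] by simp
      have r2: "r \<in> PIdl x1" if "r \<in> carrier R" "x2 \<otimes> r \<in> PIdl x1" for r
      proof -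
        have "xs ! 1 \<otimes> r \<in> Idl (set (take 1 xs)) \<longrightarrow> r \<in> Idl (set (take 1 xs))"
          using xs(1) l that(1) unfolding regular_sequence_def by (meson not_le)
        then show ?thesis using that(2) unfolding e x2_def by blast
      qed
      have r1: "reg x1" unfolding x1_def by (rule regular_sequence_hd[OF xs(1)]) (use l in auto)
      let ?J = "emb R ` (PIdl x1)"
      have J: "P.smod ?J" by (rule emb_ideal_submod[OF pideal[OF c(1)]])
      have u: "emb R x1 \<in> ?J" "emb R x1 \<in> Units TF"
        using cgenideal_self[OF c(1)] emb_unit_iff[OF c(1)] r1 by auto
      have mem: "emb R r \<in> ?J \<longleftrightarrow> r \<in> PIdl x1" if "r \<in> carrier R" for r
        using emb_inj[OF that] additive_subgroup.a_subset[OF ideal.axioms(1)[OF pideal[OF c(1)]]] by blast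
      have "\<one>\<^bsub>TF\<^esub> \<notin> ?J"
        unfolding emb_one[symmetric] mem[OF one_closed] using pideal_mm[OF x1(1)] one_not_mm by blast
      from P.socle_element[OF J u P.one_closed this] obtain s
        where s: "s \<in> base R" "s \<otimes>\<^bsub>TF\<^esub> \<one>\<^bsub>TF\<^esub> \<notin> ?J" "\<And>r. r \<in> emb R ` \<mm> \<Longrightarrow> r \<otimes>\<^bsub>TF\<^esub> (s \<otimes>\<^bsub>TF\<^esub> \<one>\<^bsub>TF\<^esub>) \<in> ?J" by blast
      obtain t where t: "t \<in> carrier R" "s = emb R t" using s(1) by blast
      have 1: "t \<notin> PIdl x1" using s(2) t mem[OF t(1)] emb_simps(1)[OF t(1) t(1)] by simp
      have "emb R (x2 \<otimes> t) \<in> ?J" using s(3)[of "emb R x2"] x1(2) t c emb_simps by simp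
      then have "x2 \<otimes> t \<in> PIdl x1" using mem[of "x2 \<otimes> t"] c t by simp
      then show False using r2[OF t(1)] 1 by blast
    qed
    then show "depth R \<mm> \<le> 1" unfolding depth_def
      by (intro Sup_least) (auto simp: one_enat_def)
  qed
  moreover have "local_ring R \<mm>"
    unfolding local_ring_def using is_cring maxid maxid_unique by blast
  ultimately show ?thesis
    unfolding cohen_macaulay_local_def using noetherian dim by simp
qed

section \<open>The elements of the quadratic quotients\<close>

text \<open>
The pair \<open>(r, s)\<close> stands for \<open>r + st\<close>, where \<open>t\<^sup>2 = -at - b\<close>.
\<close>

definition quad_ring :: "('a, 'm) ring_scheme \<Rightarrow> 'a set \<Rightarrow> 'a \<Rightarrow> 'a \<Rightarrow> ('a \<times> 'a) ring" where
  "quad_ring R J a b =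
     \<lparr>carrier = carrier R \<times> J,
      monoid.mult = (\<lambda>(r, s) (r', s'). (r \<otimes>\<^bsub>R\<^esub> r' \<ominus>\<^bsub>R\<^esub> b \<otimes>\<^bsub>R\<^esub> (s \<otimes>\<^bsub>R\<^esub> s'), r \<otimes>\<^bsub>R\<^esub> s' \<oplus>\<^bsub>R\<^esub> r' \<otimes>\<^bsub>R\<^esub> s \<ominus>\<^bsub>R\<^esub> a \<otimes>\<^bsub>R\<^esub> (s \<otimes>\<^bsub>R\<^esub> s'))),
      monoid.one = (\<one>\<^bsub>R\<^esub>, \<zero>\<^bsub>R\<^esub>),
      ring.zero = (\<zero>\<^bsub>R\<^esub>, \<zero>\<^bsub>R\<^esub>),
      ring.add = (\<lambda>(r, s) (r', s'). (r \<oplus>\<^bsub>R\<^esub> r', s \<oplus>\<^bsub>R\<^esub> s'))\<rparr>"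

context cring
begin

context
  fixes J a b
  assumes J: "ideal J R" and ab [simp]: "a \<in> carrier R" "b \<in> carrier R"
begin

lemma quad_simps:
  "carrier (quad_ring R J a b) = carrier R \<times> J"
  "(r, s) \<otimes>\<^bsub>quad_ring R J a b\<^esub> (r', s') = (r \<otimes> r' \<ominus> b \<otimes> (s \<otimes> s'), r \<otimes> s' \<oplus> r' \<otimes> s \<ominus> a \<otimes> (s \<otimes> s'))"
  "(r, s) \<oplus>\<^bsub>quad_ring R J a b\<^esub> (r', s') = (r \<oplus> r', s \<oplus> s')"
  "\<one>\<^bsub>quad_ring R J a b\<^esub> = (\<one>, \<zero>)" "\<zero>\<^bsub>quad_ring R J a b\<^esub> = (\<zero>, \<zero>)"
  by (simp_all add: quad_ring_def)

lemma quad_ring_cring: "cring (quad_ring R J a b)"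
proof -
  interpret J: ideal J R by (rule J)
  have Jc [simp]: "j \<in> J \<Longrightarrow> j \<in> carrier R" for j by (rule J.Icarr)
  have cl: "r \<otimes> s' \<oplus> r' \<otimes> s \<ominus> a \<otimes> (s \<otimes> s') \<in> J"
    if "r \<in> carrier R" "r' \<in> carrier R" "s \<in> J" "s' \<in> J" for r r' s s'
    using that by (simp add: a_minus_def J.I_l_closed)
  show ?thesis
  proof (rule cringI)
    show "abelian_group (quad_ring R J a b)"
    proof (rule abelian_groupI)
      fix x assume "x \<in> carrier (quad_ring R J a b)"
      then show "\<exists>y\<in>carrier (quad_ring R J a b). y \<oplus>\<^bsub>quad_ring R J a b\<^esub> x = \<zero>\<^bsub>quad_ring R J a b\<^esub>"
        by (intro bexI[of _ "(\<ominus> fst x, \<ominus> snd x)"]) (auto simp: quad_simps l_neg)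
    qed (auto simp: quad_simps a_ac)
    show "comm_monoid (quad_ring R J a b)"
    proof (rule comm_monoidI)
      fix x y z assume x: "x \<in> carrier (quad_ring R J a b)" and y: "y \<in> carrier (quad_ring R J a b)" and z: "z \<in> carrier (quad_ring R J a b)"
      obtain x1 x2 y1 y2 z1 z2 where e: "x = (x1, x2)" "y = (y1, y2)" "z = (z1, z2)" by (cases x, cases y, cases z)
      have [simp]: "x1 \<in> carrier R" "y1 \<in> carrier R" "z1 \<in> carrier R" "x2 \<in> carrier R" "y2 \<in> carrier R" "z2 \<in> carrier R"
        using x y z by (auto simp: e quad_simps)
      have "(x1 \<otimes> y1 \<ominus> b \<otimes> (x2 \<otimes> y2)) \<otimes> z1 \<ominus> b \<otimes> ((x1 \<otimes> y2 \<oplus> y1 \<otimes> x2 \<ominus> a \<otimes> (x2 \<otimes> y2)) \<otimes> z2)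
          = x1 \<otimes> (y1 \<otimes> z1 \<ominus> b \<otimes> (y2 \<otimes> z2)) \<ominus> b \<otimes> (x2 \<otimes> (y1 \<otimes> z2 \<oplus> z1 \<otimes> y2 \<ominus> a \<otimes> (y2 \<otimes> z2)))"
        by ((simp add: ring_norm; fail) | (rule ring_eqI, (simp add: ring_norm; fail), simp_all))
      moreover have "(x1 \<otimes> y1 \<ominus> b \<otimes> (x2 \<otimes> y2)) \<otimes> z2 \<oplus> z1 \<otimes> (x1 \<otimes> y2 \<oplus> y1 \<otimes> x2 \<ominus> a \<otimes> (x2 \<otimes> y2)) \<ominus> a \<otimes> ((x1 \<otimes> y2 \<oplus> y1 \<otimes> x2 \<ominus> a \<otimes> (x2 \<otimes> y2)) \<otimes> z2)
          = x1 \<otimes> (y1 \<otimes> z2 \<oplus> z1 \<otimes> y2 \<ominus> a \<otimes> (y2 \<otimes> z2)) \<oplus> (y1 \<otimes> z1 \<ominus> b \<otimes> (y2 \<otimes> z2)) \<otimes> x2 \<ominus> a \<otimes> (x2 \<otimes> (y1 \<otimes> z2 \<oplus> z1 \<otimes> y2 \<ominus> a \<otimes> (y2 \<otimes> z2)))"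
        by ((simp add: ring_norm; fail) | (rule ring_eqI, (simp add: ring_norm; fail), simp_all))
      ultimately show "x \<otimes>\<^bsub>quad_ring R J a b\<^esub> y \<otimes>\<^bsub>quad_ring R J a b\<^esub> z = x \<otimes>\<^bsub>quad_ring R J a b\<^esub> (y \<otimes>\<^bsub>quad_ring R J a b\<^esub> z)"
        unfolding e quad_simps by simp
    next
      fix x y assume x: "x \<in> carrier (quad_ring R J a b)" and y: "y \<in> carrier (quad_ring R J a b)"
      obtain x1 x2 y1 y2 where e: "x = (x1, x2)" "y = (y1, y2)" by (cases x, cases y)
      have J2: "x2 \<in> J" "y2 \<in> J" using x y by (auto simp: e quad_simps)
      have [simp]: "x1 \<in> carrier R" "y1 \<in> carrier R" "x2 \<in> carrier R" "y2 \<in> carrier R"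
        using x y by (auto simp: e quad_simps)
      show "x \<otimes>\<^bsub>quad_ring R J a b\<^esub> y \<in> carrier (quad_ring R J a b)"
        unfolding e quad_simps using cl J2 by simp
      show "x \<otimes>\<^bsub>quad_ring R J a b\<^esub> y = y \<otimes>\<^bsub>quad_ring R J a b\<^esub> x"
        unfolding e quad_simps by (simp add: m_comm a_comm)
    next
      fix x assume x: "x \<in> carrier (quad_ring R J a b)"
      show "\<one>\<^bsub>quad_ring R J a b\<^esub> \<otimes>\<^bsub>quad_ring R J a b\<^esub> x = x"
        using x by (cases x) (auto simp: quad_simps a_minus_def)
    qed (auto simp: quad_simps)
    fix x y z assume x: "x \<in> carrier (quad_ring R J a b)" and y: "y \<in> carrier (quad_ring R J a b)" and z: "z \<in> carrier (quad_ring R J a b)"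
    obtain x1 x2 y1 y2 z1 z2 where e: "x = (x1, x2)" "y = (y1, y2)" "z = (z1, z2)" by (cases x, cases y, cases z)
    have [simp]: "x1 \<in> carrier R" "y1 \<in> carrier R" "z1 \<in> carrier R" "x2 \<in> carrier R" "y2 \<in> carrier R" "z2 \<in> carrier R"
      using x y z by (auto simp: e quad_simps)
    have "(x1 \<oplus> y1) \<otimes> z1 \<ominus> b \<otimes> ((x2 \<oplus> y2) \<otimes> z2) = (x1 \<otimes> z1 \<ominus> b \<otimes> (x2 \<otimes> z2)) \<oplus> (y1 \<otimes> z1 \<ominus> b \<otimes> (y2 \<otimes> z2))"
      by ((simp add: ring_norm; fail) | (rule ring_eqI, (simp add: ring_norm; fail), simp_all))
    moreover have "(x1 \<oplus> y1) \<otimes> z2 \<oplus> z1 \<otimes> (x2 \<oplus> y2) \<ominus> a \<otimes> ((x2 \<oplus> y2) \<otimes> z2)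
        = (x1 \<otimes> z2 \<oplus> z1 \<otimes> x2 \<ominus> a \<otimes> (x2 \<otimes> z2)) \<oplus> (y1 \<otimes> z2 \<oplus> z1 \<otimes> y2 \<ominus> a \<otimes> (y2 \<otimes> z2))"
      by ((simp add: ring_norm; fail) | (rule ring_eqI, (simp add: ring_norm; fail), simp_all))
    ultimately show "(x \<oplus>\<^bsub>quad_ring R J a b\<^esub> y) \<otimes>\<^bsub>quad_ring R J a b\<^esub> z
        = x \<otimes>\<^bsub>quad_ring R J a b\<^esub> z \<oplus>\<^bsub>quad_ring R J a b\<^esub> y \<otimes>\<^bsub>quad_ring R J a b\<^esub> z"
      unfolding e quad_simps by simp
  qed
qed

end

lemma finsum_in_submonoid:
  assumes "H \<subseteq> carrier R" "\<zero> \<in> H" "\<And>x y. x \<in> H \<Longrightarrow> y \<in> H \<Longrightarrow> x \<oplus> y \<in> H" "\<And>i. i \<in> A \<Longrightarrow> f i \<in> H"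
  shows "finsum R f A \<in> H"
  using assms(4)
proof (induction A rule: infinite_finite_induct)
  case (insert i A)
  then have "f \<in> A \<rightarrow> carrier R" "f i \<in> carrier R" using assms(1) by auto
  then show ?case using insert assms(3) by (simp add: finsum_insert)
qed (use assms(2) in auto)

lemma ideal_pow_props:
  assumes I: "ideal I R"
  shows "ideal (ideal_pow R I n) R" "ideal_pow R I 0 = carrier R" "ideal_pow R I 1 = I"
    "x \<in> ideal_pow R I m \<Longrightarrow> y \<in> ideal_pow R I n \<Longrightarrow> x \<otimes> y \<in> ideal_pow R I (m + n)"
    "ideal_pow R I (Suc n) = ideal_prod R (ideal_pow R I n) I"
proof -
  interpret M: comm_monoid "ideals_set R" by (rule ideals_set_is_comm_monoid)
  have Ic: "I \<in> carrier (ideals_set R)" using I by (simp add: ideals_set_def)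
  show "ideal (ideal_pow R I n) R" for n using M.nat_pow_closed[OF Ic, of n] by (simp add: ideals_set_def)
  show "ideal_pow R I 0 = carrier R" by (simp add: ideals_set_def)
  show "ideal_pow R I 1 = I" using M.nat_pow_eone[OF Ic] by simp
  have mu: "J \<otimes>\<^bsub>ideals_set R\<^esub> K = ideal_prod R J K" for J K by (simp add: ideals_set_def)
  show "ideal_pow R I (Suc n) = ideal_prod R (ideal_pow R I n) I" by (simp add: mu)
  have "ideal_pow R I (m + n) = ideal_prod R (ideal_pow R I m) (ideal_pow R I n)"
    using M.nat_pow_mult[OF Ic, of m n] by (simp add: mu)
  then show "x \<in> ideal_pow R I m \<Longrightarrow> y \<in> ideal_pow R I n \<Longrightarrow> x \<otimes> y \<in> ideal_pow R I (m + n)"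
    by (simp add: ideal_prod.prod)
qed

lemma ideal_pow_Suc_sub:
  assumes I: "ideal I R"
  shows "ideal_pow R I (Suc n) \<subseteq> I"
  unfolding ideal_pow_props(5)[OF I] using ideal_prod_inter[OF ideal_pow_props(1)[OF I] I] by blast

lemma rees_subring:
  assumes I: "ideal I R"
  shows "subring (rees_algebra R I) (UP R)"
proof -
  interpret U: UP_cring R "UP R" by unfold_locales
  note ip = ideal_pow_props[OF I]
  have as: "additive_subgroup (ideal_pow R I n) R" for n using ideal.axioms(1)[OF ip(1)] .
  note sg = additive_subgroup.a_closed[OF as] additive_subgroup.zero_closed[OF as] additive_subgroup.a_inv_closed[OF as]
  have D: "p \<in> carrier (UP R)" "up_ring.coeff (UP R) p n \<in> ideal_pow R I n" if "p \<in> rees_algebra R I" for p n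
    using that unfolding rees_algebra_def by auto
  show ?thesis
  proof (rule U.P.subringI)
    show "rees_algebra R I \<subseteq> carrier (UP R)" using D by blast
    show "\<one>\<^bsub>UP R\<^esub> \<in> rees_algebra R I"
      unfolding rees_algebra_def using sg(2) ip(2) by auto
    show "\<ominus>\<^bsub>UP R\<^esub> p \<in> rees_algebra R I" if "p \<in> rees_algebra R I" for p
      unfolding rees_algebra_def using D[OF that] sg(3) by auto
    show "p \<oplus>\<^bsub>UP R\<^esub> q \<in> rees_algebra R I" if "p \<in> rees_algebra R I" "q \<in> rees_algebra R I" for p q
      unfolding rees_algebra_def using D[OF that(1)] D[OF that(2)] sg(1) by auto
    show "p \<otimes>\<^bsub>UP R\<^esub> q \<in> rees_algebra R I" if pq: "p \<in> rees_algebra R I" "q \<in> rees_algebra R I" for p q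
    proof -
      have "(\<Oplus>i\<in>{..n}. up_ring.coeff (UP R) p i \<otimes> up_ring.coeff (UP R) q (n - i)) \<in> ideal_pow R I n" for n
      proof (rule finsum_in_submonoid)
        show "ideal_pow R I n \<subseteq> carrier R" using additive_subgroup.a_subset[OF as] .
        fix i assume "i \<in> {..n}"
        then show "up_ring.coeff (UP R) p i \<otimes> up_ring.coeff (UP R) q (n - i) \<in> ideal_pow R I n"
          using ip(4)[OF D(2)[OF pq(1), of i] D(2)[OF pq(2), of "n - i"]] by simp
      qed (use sg in auto)
      then show ?thesis unfolding rees_algebra_def using D(1)[OF pq(1)] D(1)[OF pq(2)] by simp
    qed
  qed
qed

text \<open>
Division by the monic polynomial \<open>t\<^sup>2 + at + b\<close> leaves a unique remainder \<open>r + st\<close>. The remainder of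
an element of the Rees algebra has \<open>s \<in> I\<close>, since \<open>t\<close> satisfies a monic equation over \<open>R\<close> and the
coefficients in positive degree lie in \<open>I\<close>. This identifies the residue class ring with the pairs in
\<open>R \<times> I\<close>.
\<close>

theorem rees_quotient_iso:
  assumes nontriv: "\<one> \<noteq> \<zero>" and I: "ideal I R" and ab [simp]: "a \<in> carrier R" "b \<in> carrier R"
  shows "cring (rees_quotient R I a b)" "\<exists>g. g \<in> ring_iso (quad_ring R I a b) (rees_quotient R I a b)"
proof -
  interpret U: UP_cring R "UP R" by unfold_locales
  let ?P = "UP R" let ?T = "quad_ring R (carrier R) a b" let ?M = "quad_ring R I a b"
  let ?A = "rees_algebra R I" let ?f = "quadratic_poly R a b"
  note ip = ideal_pow_props[OF I] and qs = quad_simps[OF oneideal ab] and qI = quad_simps[OF I ab]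
  interpret I: ideal I R by (rule I)
  interpret T: cring ?T by (rule quad_ring_cring[OF oneideal ab])
  interpret M: cring ?M by (rule quad_ring_cring[OF I ab])
  define c :: "'a \<Rightarrow> 'a \<times> 'a" where "c r = (r, \<zero>)" for r
  interpret c: ring_hom_cring R ?T c
  proof (intro ring_hom_cring.intro ring_hom_cring_axioms.intro is_cring T.is_cring ring_hom_memI)
    show "c (x \<otimes> y) = c x \<otimes>\<^bsub>?T\<^esub> c y" if "x \<in> carrier R" "y \<in> carrier R" for x y
      using that by (simp add: c_def qs a_minus_def)
  qed (auto simp: c_def qs)
  interpret E: UP_pre_univ_prop R ?T c ?P
    by (intro UP_pre_univ_prop.intro c.ring_hom_cring_axioms U.UP_cring_axioms)
  define \<tau> where "\<tau> = (\<zero>, \<one>)"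
  have \<tau>: "\<tau> \<in> carrier ?T" by (simp add: \<tau>_def qs)
  define ev where "ev = UnivPoly.eval R ?T c \<tau>"
  have ev_hom: "ev \<in> ring_hom ?P ?T" unfolding ev_def by (rule E.eval_ring_hom[OF \<tau>])
  interpret ev: ring_hom_cring ?P ?T ev
    by (intro ring_hom_cring.intro ring_hom_cring_axioms.intro ev_hom U.UP_cring T.is_cring)
  have ev_monom: "ev (up_ring.monom ?P r n) = c r \<otimes>\<^bsub>?T\<^esub> \<tau> [^]\<^bsub>?T\<^esub> n" if "r \<in> carrier R" for r n
    unfolding ev_def by (rule E.eval_monom[OF that \<tau>])
  have c_mult: "c r \<otimes>\<^bsub>?T\<^esub> (u, v) = (r \<otimes> u, r \<otimes> v)" if "r \<in> carrier R" "u \<in> carrier R" "v \<in> carrier R" for r u v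
    unfolding c_def qs using that by (simp add: a_minus_def)
  have \<tau>2: "\<tau> [^]\<^bsub>?T\<^esub> (2::nat) = (\<ominus> b, \<ominus> a)"
  proof -
    have "\<tau> [^]\<^bsub>?T\<^esub> (2::nat) = \<tau> \<otimes>\<^bsub>?T\<^esub> \<tau>" using \<tau> by (simp add: numeral_2_eq_2)
    then show ?thesis unfolding \<tau>_def qs by (simp add: a_minus_def)
  qed
  have \<tau>1: "\<tau> [^]\<^bsub>?T\<^esub> (1::nat) = (\<zero>, \<one>)" using \<tau> by (simp add: \<tau>_def)
  have \<tau>0: "\<tau> [^]\<^bsub>?T\<^esub> (0::nat) = (\<one>, \<zero>)" by (simp add: qs)
  have lin: "ev (up_ring.monom ?P u 0 \<oplus>\<^bsub>?P\<^esub> up_ring.monom ?P v 1) = (u, v)" if "u \<in> carrier R" "v \<in> carrier R" for u v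
  proof -
    have "ev (up_ring.monom ?P u 0 \<oplus>\<^bsub>?P\<^esub> up_ring.monom ?P v 1) = ev (up_ring.monom ?P u 0) \<oplus>\<^bsub>?T\<^esub> ev (up_ring.monom ?P v 1)"
      using that by (intro ev.hom_add U.monom_closed)
    also have "\<dots> = (u, v)"
      unfolding ev_monom[OF that(1)] ev_monom[OF that(2)] \<tau>0 \<tau>1 using that by (simp add: c_mult qs)
    finally show ?thesis .
  qed
  have fP: "?f \<in> carrier ?P" unfolding quadratic_poly_def by simp
  have ev_f: "ev ?f = (\<zero>, \<zero>)"
  proof -
    have "ev ?f = (ev (up_ring.monom ?P \<one> 2) \<oplus>\<^bsub>?T\<^esub> ev (up_ring.monom ?P a 1)) \<oplus>\<^bsub>?T\<^esub> ev (up_ring.monom ?P b 0)"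
      unfolding quadratic_poly_def by (simp add: ev.hom_add)
    also have "\<dots> = (\<zero>, \<zero>)"
      unfolding ev_monom[OF one_closed] ev_monom[OF ab(1)] ev_monom[OF ab(2)] \<tau>0 \<tau>1 \<tau>2
      by (simp add: c_mult qs l_neg minus_eq)
    finally show ?thesis .
  qed
  have cf: "up_ring.coeff ?P ?f n = (if n = 2 then \<one> else \<zero>) \<oplus> (if n = 1 then a else \<zero>) \<oplus> (if n = 0 then b else \<zero>)" for n
    unfolding quadratic_poly_def by auto
  have degf: "deg R ?f = 2"
  proof (rule antisym)
    show "deg R ?f \<le> 2" by (rule U.deg_aboveI[OF _ fP]) (simp add: cf)
    show "2 \<le> deg R ?f" by (rule U.deg_belowI[OF _ fP]) (use nontriv in \<open>simp add: cf\<close>)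
  qed
  have f0: "?f \<noteq> \<zero>\<^bsub>?P\<^esub>"
  proof
    assume "?f = \<zero>\<^bsub>?P\<^esub>"
    then have "up_ring.coeff ?P ?f 2 = \<zero>" by simp
    then show False using nontriv by (simp add: cf)
  qed
  have division: "\<exists>q u v. q \<in> carrier ?P \<and> u \<in> carrier R \<and> v \<in> carrier R \<and> p = ?f \<otimes>\<^bsub>?P\<^esub> q \<oplus>\<^bsub>?P\<^esub> (up_ring.monom ?P u 0 \<oplus>\<^bsub>?P\<^esub> up_ring.monom ?P v 1)"
    if p: "p \<in> carrier ?P" for p
  proof -
    obtain q r and k :: nat where q: "q \<in> carrier ?P" "r \<in> carrier ?P"
      and e: "up_ring.coeff ?P ?f (deg R ?f) [^] k \<odot>\<^bsub>?P\<^esub> p = ?f \<otimes>\<^bsub>?P\<^esub> q \<oplus>\<^bsub>?P\<^esub> r"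
      and r: "r = \<zero>\<^bsub>?P\<^esub> \<or> deg R r < deg R ?f"
      using U.long_div_theorem[OF fP p f0] by blast
    have "up_ring.coeff ?P ?f (deg R ?f) = \<one>" unfolding degf by (simp add: cf)
    then have pe: "p = ?f \<otimes>\<^bsub>?P\<^esub> q \<oplus>\<^bsub>?P\<^esub> r" using e p by simp
    have "r = up_ring.monom ?P (up_ring.coeff ?P r 0) 0 \<oplus>\<^bsub>?P\<^esub> up_ring.monom ?P (up_ring.coeff ?P r 1) 1"
    proof (rule U.up_eqI)
      fix n
      have rz: "up_ring.coeff ?P r n = \<zero>" if "2 \<le> n"
        using r
      proof
        assume "deg R r < deg R ?f"
        then show ?thesis using U.deg_aboveD[OF _ q(2), of n] that by (simp add: degf)
      qed simp
      consider "n = 0" | "n = 1" | "2 \<le> n" by linarith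
      then show "up_ring.coeff ?P r n = up_ring.coeff ?P (up_ring.monom ?P (up_ring.coeff ?P r 0) 0 \<oplus>\<^bsub>?P\<^esub> up_ring.monom ?P (up_ring.coeff ?P r 1) 1) n"
        by cases (use q(2) rz in auto)
    qed (use q(2) in auto)
    then show ?thesis using pe q U.coeff_closed[OF q(2)] by metis
  qed
  have ev_div: "ev (?f \<otimes>\<^bsub>?P\<^esub> q \<oplus>\<^bsub>?P\<^esub> (up_ring.monom ?P u 0 \<oplus>\<^bsub>?P\<^esub> up_ring.monom ?P v 1)) = (u, v)"
    if "q \<in> carrier ?P" "u \<in> carrier R" "v \<in> carrier R" for q u v
  proof -
    have m: "up_ring.monom ?P u 0 \<oplus>\<^bsub>?P\<^esub> up_ring.monom ?P v 1 \<in> carrier ?P" using that by simp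
    have "ev (?f \<otimes>\<^bsub>?P\<^esub> q) = (\<zero>, \<zero>)"
      using ev.hom_mult[OF fP that(1)] ev.hom_closed[OF that(1)] T.l_null[OF ev.hom_closed[OF that(1)]]
      unfolding ev_f qs(5) by simp
    then show ?thesis
      using ev.hom_add[OF U.P.m_closed[OF fP that(1)] m] lin[OF that(2,3)] that by (simp add: qs)
  qed
  have kernel: "ev p = (\<zero>, \<zero>) \<longleftrightarrow> p \<in> PIdl\<^bsub>?P\<^esub> ?f" if p: "p \<in> carrier ?P" for p
  proof -
    obtain q u v where q: "q \<in> carrier ?P" "u \<in> carrier R" "v \<in> carrier R"
      and pe: "p = ?f \<otimes>\<^bsub>?P\<^esub> q \<oplus>\<^bsub>?P\<^esub> (up_ring.monom ?P u 0 \<oplus>\<^bsub>?P\<^esub> up_ring.monom ?P v 1)"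
      using division[OF p] by blast
    show ?thesis
    proof
      assume "ev p = (\<zero>, \<zero>)"
      then have "u = \<zero>" "v = \<zero>" using ev_div[OF q] unfolding pe by auto
      then have "p = q \<otimes>\<^bsub>?P\<^esub> ?f" unfolding pe using q fP by (simp add: U.P.m_comm)
      then show "p \<in> PIdl\<^bsub>?P\<^esub> ?f" unfolding cgenideal_def using q by blast
    next
      assume "p \<in> PIdl\<^bsub>?P\<^esub> ?f"
      then obtain q' where q': "q' \<in> carrier ?P" "p = q' \<otimes>\<^bsub>?P\<^esub> ?f" unfolding cgenideal_def by blast
      have "ev p = ev q' \<otimes>\<^bsub>?T\<^esub> \<zero>\<^bsub>?T\<^esub>" unfolding q'(2) ev.hom_mult[OF q'(1) fP] ev_f qs(5) ..
      then show "ev p = (\<zero>, \<zero>)" using T.r_null[OF ev.hom_closed[OF q'(1)]] by (simp add: qs)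
    qed
  qed
  have A: "subring ?A ?P" by (rule rees_subring[OF I])
  have AP: "?A \<subseteq> carrier ?P" using subringE(1)[OF A] .
  have img: "ev p \<in> carrier R \<times> I" if p: "p \<in> ?A" for p
  proof -
    have pP: "p \<in> carrier ?P" and pc: "\<And>n. up_ring.coeff ?P p n \<in> ideal_pow R I n" using p unfolding rees_algebra_def by auto
    have "(\<Oplus>\<^bsub>?T\<^esub>i\<in>{..deg R p}. c (up_ring.coeff ?P p i) \<otimes>\<^bsub>?T\<^esub> \<tau> [^]\<^bsub>?T\<^esub> i) \<in> carrier R \<times> I"
    proof (rule T.finsum_in_submonoid)
      show "carrier R \<times> I \<subseteq> carrier ?T" using I.a_subset by (auto simp: qs)
      show "\<zero>\<^bsub>?T\<^esub> \<in> carrier R \<times> I" by (simp add: qs)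
      show "x \<oplus>\<^bsub>?T\<^esub> y \<in> carrier R \<times> I" if "x \<in> carrier R \<times> I" "y \<in> carrier R \<times> I" for x y
        using that by (auto simp: qs)
      fix i
      show "c (up_ring.coeff ?P p i) \<otimes>\<^bsub>?T\<^esub> \<tau> [^]\<^bsub>?T\<^esub> i \<in> carrier R \<times> I"
      proof (cases i)
        case 0
        then show ?thesis unfolding 0 \<tau>0 using U.coeff_closed[OF pP] by (simp add: c_mult)
      next
        case (Suc n)
        have ci: "up_ring.coeff ?P p i \<in> I" using pc[of i] ideal_pow_Suc_sub[OF I, of n] Suc by blast
        have "\<tau> [^]\<^bsub>?T\<^esub> i \<in> carrier ?T" using \<tau> by simp
        then obtain u v where uv: "\<tau> [^]\<^bsub>?T\<^esub> i = (u, v)" "u \<in> carrier R" "v \<in> carrier R" unfolding qs by blast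
        show ?thesis unfolding uv(1) using uv ci I.Icarr[OF ci] by (simp add: c_mult I.I_r_closed)
      qed
    qed
    then show ?thesis unfolding ev_def U.eval_on_carrier[OF pP] .
  qed
  have mem: "up_ring.monom ?P u 0 \<oplus>\<^bsub>?P\<^esub> up_ring.monom ?P v 1 \<in> ?A" if "u \<in> carrier R" "v \<in> I" for u v
  proof -
    have z: "\<zero> \<in> ideal_pow R I n" for n using additive_subgroup.zero_closed[OF ideal.axioms(1)[OF ip(1)]] .
    have "up_ring.coeff ?P (up_ring.monom ?P u 0 \<oplus>\<^bsub>?P\<^esub> up_ring.monom ?P v 1) n \<in> ideal_pow R I n" for n
    proof -
      consider "n = 0" | "n = 1" | "2 \<le> n" by linarith
      then show ?thesis
      proof cases
        case 1 then show ?thesis using that I.Icarr[OF that(2)] ip(2) by simp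
      next
        case 2
        have "up_ring.coeff ?P (up_ring.monom ?P u 0 \<oplus>\<^bsub>?P\<^esub> up_ring.monom ?P v 1) 1 = v" using that I.Icarr[OF that(2)] by simp
        then show ?thesis unfolding 2 ip(3) using that by simp
      next
        case 3 then show ?thesis using that I.Icarr[OF that(2)] z by simp
      qed
    qed
    then show ?thesis unfolding rees_algebra_def using that I.Icarr[OF that(2)] by simp
  qed
  let ?RA = "?P\<lparr>carrier := ?A\<rparr>"
  have RA: "cring ?RA" using U.P.subcringI'[OF A] U.P.subcring_iff[OF AP] by simp
  interpret RA: cring ?RA by (rule RA)
  have opsM: "monoid.mult ?M = monoid.mult ?T" "ring.add ?M = ring.add ?T" "monoid.one ?M = monoid.one ?T" "ring.zero ?M = ring.zero ?T"
    by (simp_all add: quad_ring_def)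
  have evM: "ev \<in> ring_hom ?RA ?M"
  proof (rule ring_hom_memI)
    show "ev p \<in> carrier ?M" if "p \<in> carrier ?RA" for p using img that unfolding qI by simp
    show "ev (p \<otimes>\<^bsub>?RA\<^esub> q) = ev p \<otimes>\<^bsub>?M\<^esub> ev q" if "p \<in> carrier ?RA" "q \<in> carrier ?RA" for p q
      using that subsetD[OF AP] unfolding opsM by simp
    show "ev (p \<oplus>\<^bsub>?RA\<^esub> q) = ev p \<oplus>\<^bsub>?M\<^esub> ev q" if "p \<in> carrier ?RA" "q \<in> carrier ?RA" for p q
      using that subsetD[OF AP] unfolding opsM by simp
    show "ev \<one>\<^bsub>?RA\<^esub> = \<one>\<^bsub>?M\<^esub>" using ev.hom_one unfolding opsM by simp
  qed
  interpret H: ring_hom_ring ?RA ?M ev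
    by (rule ring_hom_ringI2[OF RA.ring_axioms M.ring_axioms evM])
  have surj: "ev ` carrier ?RA = carrier ?M"
  proof (intro equalityI subsetI)
    fix y assume "y \<in> carrier ?M"
    then obtain u v where uv: "y = (u, v)" "u \<in> carrier R" "v \<in> I" unfolding qI by blast
    have "ev (up_ring.monom ?P u 0 \<oplus>\<^bsub>?P\<^esub> up_ring.monom ?P v 1) = y" using lin[OF uv(2) I.Icarr[OF uv(3)]] uv(1) by simp
    then show "y \<in> ev ` carrier ?RA" using mem[OF uv(2,3)] by force
  next
    fix y assume "y \<in> ev ` carrier ?RA"
    then obtain p where p: "p \<in> ?A" "y = ev p" by auto
    show "y \<in> carrier ?M" unfolding p(2) qI by (rule img[OF p(1)])
  qed
  have ker: "a_kernel ?RA ?M ev = PIdl\<^bsub>?P\<^esub> ?f \<inter> ?A"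
    unfolding a_kernel_def' qI using kernel AP by auto
  have S: "rees_quotient R I a b = ?RA Quot a_kernel ?RA ?M ev"
    unfolding rees_quotient_def ker ..
  show cr: "cring (rees_quotient R I a b)"
    unfolding S by (rule ideal.quotient_is_cring[OF H.kernel_is_ideal RA])
  have "(\<lambda>Y. the_elem (ev ` Y)) \<in> ring_iso (rees_quotient R I a b) ?M"
    unfolding S by (rule H.FactRing_iso_set[OF surj])
  from ring_iso_set_sym[OF cring.axioms(1)[OF cr] this]
  show "\<exists>g. g \<in> ring_iso ?M (rees_quotient R I a b)" by blast
qed

end

section \<open>Quadratic extensions\<close>

text \<open>
The element \<open>\<Psi> x y\<close> is \<open>x + yt\<close> in \<open>Q' = Q + Qt\<close> with \<open>t\<^sup>2 + at + b = 0\<close>, and \<open>A' = A + Jt\<close> is local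
with maximal ideal \<open>\<mm> + Jt\<close>.
\<close>

locale quadratic_extension = R: one_dim_local_pair Q A \<mm> + S: one_dim_local_pair Q' A' \<mm>'
  for Q (structure) and A \<mm> and Q' and A' \<mm>' +
  fixes \<Psi> :: "'a \<Rightarrow> 'a \<Rightarrow> 'c" and a b :: 'a and J :: "'a set"
  assumes J: "submod Q A J" "J \<subseteq> \<mm>" "J \<inter> Units Q \<noteq> {}" and ab: "a \<in> A" "b \<in> A"
    and Psi_closed: "x \<in> carrier Q \<Longrightarrow> y \<in> carrier Q \<Longrightarrow> \<Psi> x y \<in> carrier Q'"
    and Psi_surj: "q \<in> carrier Q' \<Longrightarrow> \<exists>x\<in>carrier Q. \<exists>y\<in>carrier Q. q = \<Psi> x y"
    and Psi_inj: "x \<in> carrier Q \<Longrightarrow> y \<in> carrier Q \<Longrightarrow> x' \<in> carrier Q \<Longrightarrow> y' \<in> carrier Q \<Longrightarrow>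
        \<Psi> x y = \<Psi> x' y' \<Longrightarrow> x = x' \<and> y = y'"
    and Psi_add: "x \<in> carrier Q \<Longrightarrow> y \<in> carrier Q \<Longrightarrow> x' \<in> carrier Q \<Longrightarrow> y' \<in> carrier Q \<Longrightarrow>
        \<Psi> x y \<oplus>\<^bsub>Q'\<^esub> \<Psi> x' y' = \<Psi> (x \<oplus> x') (y \<oplus> y')"
    and Psi_mult: "x \<in> carrier Q \<Longrightarrow> y \<in> carrier Q \<Longrightarrow> x' \<in> carrier Q \<Longrightarrow> y' \<in> carrier Q \<Longrightarrow>
        \<Psi> x y \<otimes>\<^bsub>Q'\<^esub> \<Psi> x' y' = \<Psi> (x \<otimes> x' \<ominus> b \<otimes> (y \<otimes> y')) (x \<otimes> y' \<oplus> x' \<otimes> y \<ominus> a \<otimes> (y \<otimes> y'))"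
    and Psi_one: "\<one>\<^bsub>Q'\<^esub> = \<Psi> \<one> \<zero>"
    and A'_eq: "A' = {\<Psi> r i | r i. r \<in> A \<and> i \<in> J}"
    and mm'_eq: "\<mm>' = {\<Psi> r i | r i. r \<in> \<mm> \<and> i \<in> J}"
begin

abbreviation qmul' (infixl "\<star>" 70) where "x \<star> y \<equiv> x \<otimes>\<^bsub>Q'\<^esub> y"

lemma abc [simp]: "a \<in> carrier Q" "b \<in> carrier Q" using ab by auto

lemma JD: "j \<in> J \<Longrightarrow> j \<in> carrier Q" "j \<in> J \<Longrightarrow> j \<in> A" "j \<in> J \<Longrightarrow> j \<in> \<mm>"
  "\<zero> \<in> J" "i \<in> J \<Longrightarrow> j \<in> J \<Longrightarrow> i \<oplus> j \<in> J" "r \<in> A \<Longrightarrow> j \<in> J \<Longrightarrow> r \<otimes> j \<in> J"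
  using R.smodD[OF J(1)] J(2) R.mm_A by auto

lemma A'I: "r \<in> A \<Longrightarrow> i \<in> J \<Longrightarrow> \<Psi> r i \<in> A'" unfolding A'_eq by blast

lemma A'E:
  assumes "q \<in> A'"
  obtains r i where "r \<in> A" "i \<in> J" "q = \<Psi> r i"
  using assms unfolding A'_eq by blast

lemma mm'I: "r \<in> \<mm> \<Longrightarrow> i \<in> J \<Longrightarrow> \<Psi> r i \<in> \<mm>'" unfolding mm'_eq by blast

lemma mm'E:
  assumes "q \<in> \<mm>'"
  obtains r i where "r \<in> \<mm>" "i \<in> J" "q = \<Psi> r i"
  using assms unfolding mm'_eq by blast

lemma Psi_E:
  assumes "q \<in> carrier Q'"
  obtains x y where "x \<in> carrier Q" "y \<in> carrier Q" "q = \<Psi> x y"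
  using Psi_surj[OF assms] by blast

lemma Psi_scalar:
  "c \<in> carrier Q \<Longrightarrow> x \<in> carrier Q \<Longrightarrow> y \<in> carrier Q \<Longrightarrow> \<Psi> c \<zero> \<star> \<Psi> x y = \<Psi> (c \<otimes> x) (c \<otimes> y)"
  using Psi_mult[of c \<zero> x y] by (simp add: R.minus_eq)

lemma Psi_zero: "\<zero>\<^bsub>Q'\<^esub> = \<Psi> \<zero> \<zero>"
proof -
  have "\<Psi> \<zero> \<zero> \<oplus>\<^bsub>Q'\<^esub> \<Psi> \<zero> \<zero> = \<Psi> \<zero> \<zero>" using Psi_add[of \<zero> \<zero> \<zero> \<zero>] by simp
  then show ?thesis using Psi_closed[of \<zero> \<zero>] S.add.r_cancel_one[of "\<Psi> \<zero> \<zero>" "\<Psi> \<zero> \<zero>"] by simp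
qed

lemma Psi_unit:
  assumes "c \<in> Units Q"
  shows "\<Psi> c \<zero> \<in> Units Q'"
proof -
  obtain d where d: "c \<in> carrier Q" "d \<in> carrier Q" "c \<otimes> d = \<one>" using R.UnitsE[OF assms] by metis
  have "\<Psi> c \<zero> \<star> \<Psi> d \<zero> = \<one>\<^bsub>Q'\<^esub>" using Psi_scalar[OF d(1,2) R.zero_closed] d by (simp add: Psi_one)
  then show ?thesis using S.unit_factor[of "\<Psi> c \<zero>" "\<Psi> d \<zero>"] Psi_closed d by simp
qed

lemma clear_denominator:
  assumes w: "w \<in> carrier Q'"
  shows "\<exists>c\<in>A \<inter> Units Q. \<Psi> c \<zero> \<star> w \<in> A'"
proof -
  obtain x y where xy: "x \<in> carrier Q" "y \<in> carrier Q" "w = \<Psi> x y" using Psi_E[OF w] .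
  obtain s t k where s: "s \<in> A" "s \<in> Units Q" "s \<otimes> x \<in> A" and t: "t \<in> A" "t \<in> Units Q" "t \<otimes> y \<in> A"
    and k: "k \<in> J" "k \<in> Units Q" using R.fraction_form[OF xy(1)] R.fraction_form[OF xy(2)] J(3) by blast
  have kA: "k \<in> A" using JD(2)[OF k(1)] .
  have [simp]: "s \<in> carrier Q" "t \<in> carrier Q" "k \<in> carrier Q" using s t k by auto
  note [simp] = xy(1,2)
  let ?c = "k \<otimes> (s \<otimes> t)"
  have c: "?c \<in> A" "?c \<in> Units Q" using s t k kA by simp_all
  have e: "?c \<otimes> x = k \<otimes> (t \<otimes> (s \<otimes> x))" "?c \<otimes> y = (s \<otimes> (t \<otimes> y)) \<otimes> k"
    by ((simp add: R.ring_norm; fail) | (rule R.ring_eqI, (simp add: R.ring_norm; fail), simp_all))+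
  have "\<Psi> ?c \<zero> \<star> w = \<Psi> (?c \<otimes> x) (?c \<otimes> y)" unfolding xy(3) by (rule Psi_scalar) simp_all
  moreover have "\<Psi> (?c \<otimes> x) (?c \<otimes> y) \<in> A'"
    unfolding e
    by (rule A'I[OF R.A_closed(4)[OF kA R.A_closed(4)[OF t(1) s(3)]] JD(6)[OF R.A_closed(4)[OF s(1) t(3)] k(1)]])
  ultimately have "\<Psi> ?c \<zero> \<star> w \<in> A'" by metis
  then show ?thesis using c by blast
qed

definition dual_J :: "'a set \<Rightarrow> 'a set" where
  "dual_J W = {q \<in> carrier Q. \<forall>j\<in>J. q \<otimes> j \<in> W}"

text \<open>
The fractional ideal \<open>(W : J) + Wt\<close>. Up to isomorphism it is \<open>Hom\<^sub>A(A', W)\<close>.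
\<close>

definition ext_dual :: "'a set \<Rightarrow> 'c set" where
  "ext_dual W = {\<Psi> x y | x y. x \<in> dual_J W \<and> y \<in> W}"

context
  fixes W
  assumes W: "dualizing Q A W"
begin

lemma Ws: "submod Q A W" by (rule R.dualizingD(2)[OF W])

lemmas WD = R.smodD[OF Ws]

lemma dual_J_smod: "submod Q A (dual_J W)"
  unfolding dual_J_def by (rule R.smod_colon[OF Ws]) (use JD in auto)

lemmas HD = R.smodD[OF dual_J_smod]

lemma dual_J_mult: "x \<in> dual_J W \<Longrightarrow> j \<in> J \<Longrightarrow> x \<otimes> j \<in> W" unfolding dual_J_def by simp

lemma W_sub_dual_J: "w \<in> W \<Longrightarrow> w \<in> dual_J W"
  unfolding dual_J_def using WD JD by (auto simp: R.m_comm[of w])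

lemma ext_dualE:
  assumes "q \<in> ext_dual W"
  obtains x y where "x \<in> dual_J W" "y \<in> W" "q = \<Psi> x y" "x \<in> carrier Q" "y \<in> carrier Q"
  using assms WD(1) HD(1) unfolding ext_dual_def by blast

lemma ext_dualI: "x \<in> dual_J W \<Longrightarrow> y \<in> W \<Longrightarrow> \<Psi> x y \<in> ext_dual W" unfolding ext_dual_def by blast

lemma ext_dual_iff:
  "x \<in> carrier Q \<Longrightarrow> y \<in> carrier Q \<Longrightarrow> \<Psi> x y \<in> ext_dual W \<longleftrightarrow> x \<in> dual_J W \<and> y \<in> W"
proof
  assume xy: "x \<in> carrier Q" "y \<in> carrier Q" and "\<Psi> x y \<in> ext_dual W"
  then obtain x' y' where e: "x' \<in> dual_J W" "y' \<in> W" "\<Psi> x y = \<Psi> x' y'" "x' \<in> carrier Q" "y' \<in> carrier Q"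
    by (elim ext_dualE)
  then show "x \<in> dual_J W \<and> y \<in> W" using Psi_inj[OF xy e(4,5,3)] by simp
qed (use ext_dualI in blast)

lemma ext_dual_smod: "submod Q' A' (ext_dual W)"
  unfolding submod_def
proof (intro conjI ballI subsetI)
  show "\<zero>\<^bsub>Q'\<^esub> \<in> ext_dual W" unfolding Psi_zero by (rule ext_dualI[OF HD(2) WD(2)])
  fix p assume p: "p \<in> ext_dual W"
  then obtain x y where xy: "x \<in> dual_J W" "y \<in> W" "p = \<Psi> x y" "x \<in> carrier Q" "y \<in> carrier Q" by (rule ext_dualE)
  note [simp] = xy(4,5)
  show "p \<in> carrier Q'" unfolding xy(3) using Psi_closed by simp
  show "p \<oplus>\<^bsub>Q'\<^esub> q \<in> ext_dual W" if "q \<in> ext_dual W" for q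
  proof -
    from that obtain x' y' where xy': "x' \<in> dual_J W" "y' \<in> W" "q = \<Psi> x' y'" "x' \<in> carrier Q" "y' \<in> carrier Q" by (rule ext_dualE)
    show ?thesis unfolding xy(3) xy'(3) Psi_add[OF xy(4,5) xy'(4,5)]
      by (rule ext_dualI[OF HD(3)[OF xy(1) xy'(1)] WD(3)[OF xy(2) xy'(2)]])
  qed
  show "r \<star> p \<in> ext_dual W" if "r \<in> A'" for r
  proof -
    from that obtain s i where si: "s \<in> A" "i \<in> J" "r = \<Psi> s i" by (rule A'E)
    have [simp]: "s \<in> carrier Q" "i \<in> carrier Q" using si JD by auto
    have iy: "i \<otimes> y \<in> W" using WD(4)[OF JD(2)[OF si(2)] xy(2)] .
    have xi: "x \<otimes> i \<in> W" using dual_J_mult[OF xy(1) si(2)] .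
    have "s \<otimes> x \<ominus> b \<otimes> (i \<otimes> y) \<in> dual_J W"
      by (rule R.smod_minus[OF dual_J_smod HD(4)[OF si(1) xy(1)] HD(4)[OF ab(2) W_sub_dual_J[OF iy]]])
    moreover have "s \<otimes> y \<oplus> x \<otimes> i \<ominus> a \<otimes> (i \<otimes> y) \<in> W"
      by (rule R.smod_minus[OF Ws WD(3)[OF WD(4)[OF si(1) xy(2)] xi] WD(4)[OF ab(1) iy]])
    ultimately show ?thesis unfolding si(3) xy(3) using Psi_mult[of s i x y] ext_dualI by simp
  qed
qed

lemma ext_dual_regular: "regular_fractional Q' A' (ext_dual W)"
proof -
  obtain w c where w: "w \<in> W" "w \<in> Units Q" and c: "c \<in> A" "c \<in> Units Q" "\<And>x. x \<in> W \<Longrightarrow> c \<otimes> x \<in> A"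
    using R.regular_fractionalD[OF R.dualizingD(1)[OF W]] by blast
  obtain k where k: "k \<in> J" "k \<in> Units Q" using J(3) by blast
  have [simp]: "c \<in> carrier Q" "k \<in> carrier Q" using c k by auto
  show ?thesis
  proof (rule S.regular_fractionalI[OF ext_dual_smod, of "\<Psi> w \<zero>" "\<Psi> (c \<otimes> k) \<zero>"])
    show "\<Psi> w \<zero> \<in> ext_dual W" by (rule ext_dualI[OF W_sub_dual_J[OF w(1)] WD(2)])
    show "\<Psi> w \<zero> \<in> Units Q'" by (rule Psi_unit[OF w(2)])
    show "\<Psi> (c \<otimes> k) \<zero> \<in> A'" using c k JD by (intro A'I) auto
    show "\<Psi> (c \<otimes> k) \<zero> \<in> Units Q'" using c k by (intro Psi_unit) auto
    fix p assume "p \<in> ext_dual W"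
    then obtain x y where xy: "x \<in> dual_J W" "y \<in> W" "p = \<Psi> x y" "x \<in> carrier Q" "y \<in> carrier Q" by (rule ext_dualE)
    note [simp] = xy(4,5)
    have e: "(c \<otimes> k) \<otimes> x = c \<otimes> (x \<otimes> k)" "(c \<otimes> k) \<otimes> y = (c \<otimes> y) \<otimes> k"
      by ((simp add: R.ring_norm; fail) | (rule R.ring_eqI, (simp add: R.ring_norm; fail), simp_all))+
    have "\<Psi> (c \<otimes> k) \<zero> \<star> p = \<Psi> ((c \<otimes> k) \<otimes> x) ((c \<otimes> k) \<otimes> y)"
      unfolding xy(3) by (rule Psi_scalar) simp_all
    also have "\<dots> \<in> A'"
      unfolding e by (rule A'I[OF c(3)[OF dual_J_mult[OF xy(1) k(1)]] JD(6)[OF c(3)[OF xy(2)] k(1)]])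
    finally show "\<Psi> (c \<otimes> k) \<zero> \<star> p \<in> A'" .
  qed
qed

text \<open>
Every \<open>\<Psi> u1 u2\<close> outside \<open>L\<close> is separated from \<open>L\<close> by an \<open>A\<close>-linear functional with coefficients \<open>p\<close>
and \<open>s\<close>. Let \<open>L1\<close> be the part of \<open>L\<close> in \<open>Q\<close> and \<open>L2\<close> the projection of \<open>L\<close> to the coefficients of \<open>t\<close>. If
\<open>u2\<close> is not in \<open>L2\<close>, a functional in the second coordinate suffices. Otherwise \<open>u2\<close> can be subtracted, which
leaves an element of \<open>Q\<close> outside \<open>L1\<close>. A fraction \<open>p\<close> that separates it induces a homomorphism
\<open>L2 \<rightarrow> Q/W\<close>, \<open>y \<mapsto> px\<close> for \<open>x + yt \<in> L\<close>, and \<open>dualizing_baer\<close> provides the second coefficient.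
\<close>

lemma separating_functional:
  assumes L: "regular_fractional Q' A' L" and u: "u1 \<in> carrier Q" "u2 \<in> carrier Q" "\<Psi> u1 u2 \<notin> L"
  shows "\<exists>p\<in>carrier Q. \<exists>s\<in>carrier Q. (\<forall>x\<in>carrier Q. \<forall>y\<in>carrier Q. \<Psi> x y \<in> L \<longrightarrow> p \<otimes> x \<oplus> s \<otimes> y \<in> W) \<and>
      p \<otimes> u1 \<oplus> s \<otimes> u2 \<notin> W"
proof -
  note Lr = S.regular_fractionalD[OF L]
  note LD = S.smodD[OF Lr(1)]
  note [simp] = u(1,2)
  define L1 where "L1 = {x \<in> carrier Q. \<Psi> x \<zero> \<in> L}"
  define L2 where "L2 = {y \<in> carrier Q. \<exists>x\<in>carrier Q. \<Psi> x y \<in> L}"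
  have scal: "\<Psi> (r \<otimes> x) (r \<otimes> y) \<in> L" if "r \<in> A" "x \<in> carrier Q" "y \<in> carrier Q" "\<Psi> x y \<in> L" for r x y
    using LD(4)[OF A'I[OF that(1) JD(4)] that(4)] Psi_scalar[of r x y] that by simp
  have add: "\<Psi> (x \<oplus> x') (y \<oplus> y') \<in> L"
    if "x \<in> carrier Q" "y \<in> carrier Q" "x' \<in> carrier Q" "y' \<in> carrier Q" "\<Psi> x y \<in> L" "\<Psi> x' y' \<in> L" for x y x' y'
    using LD(3)[OF that(5,6)] Psi_add[OF that(1-4)] by simp
  have L1s: "submod Q A L1"
    unfolding submod_def
  proof (intro conjI ballI)
    show "\<zero> \<in> L1" using LD(2) by (simp add: L1_def Psi_zero[symmetric])
    show "x \<oplus> x' \<in> L1" if "x \<in> L1" "x' \<in> L1" for x x'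
      using add[of x \<zero> x' \<zero>] that by (simp add: L1_def)
    show "r \<otimes> x \<in> L1" if "r \<in> A" "x \<in> L1" for r x
      using scal[of r x \<zero>] that by (simp add: L1_def)
  qed (auto simp: L1_def)
  have L2s: "submod Q A L2"
    unfolding submod_def
  proof (intro conjI ballI)
    show "\<zero> \<in> L2" using LD(2) by (auto simp: L2_def Psi_zero)
    show "y \<oplus> y' \<in> L2" if yy: "y \<in> L2" "y' \<in> L2" for y y'
    proof -
      obtain x x' where "x \<in> carrier Q" "\<Psi> x y \<in> L" "x' \<in> carrier Q" "\<Psi> x' y' \<in> L" "y \<in> carrier Q" "y' \<in> carrier Q"
        using yy unfolding L2_def by blast
      then show ?thesis using add[of x y x' y'] unfolding L2_def by auto
    qed
    show "r \<otimes> y \<in> L2" if r: "r \<in> A" and yy: "y \<in> L2" for r y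
    proof -
      obtain x where "x \<in> carrier Q" "\<Psi> x y \<in> L" "y \<in> carrier Q" using yy unfolding L2_def by blast
      then show ?thesis using scal[OF r, of x y] r unfolding L2_def by auto
    qed
  qed (auto simp: L2_def)
  obtain v d where v: "v \<in> L" "v \<in> Units Q'" and d: "d \<in> A'" "d \<in> Units Q'" "\<And>q. q \<in> L \<Longrightarrow> d \<star> q \<in> A'"
    using Lr by blast
  obtain k where k: "k \<in> J" "k \<in> Units Q" using J(3) by blast
  have [simp]: "k \<in> carrier Q" using k by auto
  \<comment> \<open>A unit of the big ring that lies in \<open>L\<close> forces a unit of the small one to lie in \<open>L\<close>.\<close>
  obtain c where c: "c \<in> A" "c \<in> Units Q" "\<Psi> c \<zero> \<in> L"
  proof -
    obtain v' where v': "v \<in> carrier Q'" "v' \<in> carrier Q'" "v \<star> v' = \<one>\<^bsub>Q'\<^esub>" using S.UnitsE[OF v(2)] by metis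
    obtain c where c: "c \<in> A" "c \<in> Units Q" "\<Psi> c \<zero> \<star> v' \<in> A'" using clear_denominator[OF v'(2)] by blast
    have cc: "\<Psi> c \<zero> \<in> carrier Q'" using c(1) Psi_closed by simp
    have "(\<Psi> c \<zero> \<star> v') \<star> v = \<Psi> c \<zero> \<star> (v \<star> v')" using v'(1,2) cc by (simp add: S.m_ac)
    then have "(\<Psi> c \<zero> \<star> v') \<star> v = \<Psi> c \<zero>" unfolding v'(3) using cc by simp
    then have "\<Psi> c \<zero> \<in> L" using LD(4)[OF c(3) v(1)] by simp
    then show thesis using c(1,2) by (intro that) auto
  qed
  obtain e where e: "e \<in> A" "e \<in> Units Q" "\<And>q. q \<in> L \<Longrightarrow> \<Psi> e \<zero> \<star> q \<in> A'"
  proof -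
    obtain d' where d': "d \<in> carrier Q'" "d' \<in> carrier Q'" "d \<star> d' = \<one>\<^bsub>Q'\<^esub>" using S.UnitsE[OF d(2)] by metis
    obtain e where e: "e \<in> A" "e \<in> Units Q" "\<Psi> e \<zero> \<star> d' \<in> A'" using clear_denominator[OF d'(2)] by blast
    have ec: "\<Psi> e \<zero> \<in> carrier Q'" using e(1) Psi_closed by simp
    have "\<Psi> e \<zero> \<star> q \<in> A'" if q: "q \<in> L" for q
    proof -
      have qc: "q \<in> carrier Q'" using LD(1)[OF q] .
      have "(\<Psi> e \<zero> \<star> d') \<star> (d \<star> q) = (d \<star> d') \<star> (\<Psi> e \<zero> \<star> q)" using d'(1,2) ec qc by (simp add: S.m_ac)
      then have "(\<Psi> e \<zero> \<star> d') \<star> (d \<star> q) = \<Psi> e \<zero> \<star> q" unfolding d'(3) using ec qc by simp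
      then show ?thesis using S.A_closed(4)[OF e(3) d(3)[OF q]] by simp
    qed
    then show thesis using e(1,2) by (intro that) auto
  qed
  have [simp]: "c \<in> carrier Q" "e \<in> carrier Q" using c e by auto
  have eL: "e \<otimes> x \<in> A \<and> e \<otimes> y \<in> J" if xy: "x \<in> carrier Q" "y \<in> carrier Q" "\<Psi> x y \<in> L" for x y
  proof -
    have "\<Psi> (e \<otimes> x) (e \<otimes> y) \<in> A'" using e(3)[OF xy(3)] Psi_scalar[of e x y] xy by simp
    then obtain r i where "r \<in> A" "i \<in> J" "\<Psi> (e \<otimes> x) (e \<otimes> y) = \<Psi> r i" by (rule A'E)
    then show ?thesis using Psi_inj[of "e \<otimes> x" "e \<otimes> y" r i] xy JD by auto
  qed
  have "regular_fractional Q A L1"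
    by (rule R.regular_fractionalI[OF L1s _ c(2) e(1,2)]) (use c eL in \<open>auto simp: L1_def\<close>)
  have kc: "k \<otimes> c \<in> L2"
  proof -
    have "\<Psi> \<zero> k \<star> \<Psi> c \<zero> \<in> L" by (rule LD(4)[OF A'I[OF R.A_closed(1) k(1)] c(3)])
    moreover have "\<Psi> \<zero> k \<star> \<Psi> c \<zero> = \<Psi> \<zero> (c \<otimes> k)" using Psi_mult[of \<zero> k c \<zero>] by (simp add: R.minus_eq)
    ultimately show ?thesis unfolding L2_def using R.m_comm[of k c] by auto
  qed
  have L2r: "regular_fractional Q A L2"
  proof (rule R.regular_fractionalI[OF L2s kc _ e(1,2)])
    show "k \<otimes> c \<in> Units Q" using k c by simp
    show "e \<otimes> y \<in> A" if "y \<in> L2" for y using that eL JD(2) unfolding L2_def by blast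
  qed
  show ?thesis
  proof (cases "u2 \<in> L2")
    case False
    obtain s where s: "s \<in> carrier Q" "\<And>y. y \<in> L2 \<Longrightarrow> s \<otimes> y \<in> W" "s \<otimes> u2 \<notin> W"
      using R.dualizingD(3)[OF W L2r u(2) False] by blast
    have "\<zero> \<otimes> x \<oplus> s \<otimes> y \<in> W" if "x \<in> carrier Q" "y \<in> carrier Q" "\<Psi> x y \<in> L" for x y
      using s(2)[of y] that s(1) unfolding L2_def by auto
    moreover have "\<zero> \<otimes> u1 \<oplus> s \<otimes> u2 \<notin> W" using s by simp
    ultimately show ?thesis using s(1) R.zero_closed by blast
  next
    case True
    then obtain x0 where x0: "x0 \<in> carrier Q" "\<Psi> x0 u2 \<in> L" unfolding L2_def by blast
    note [simp] = x0(1)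
    have "u1 \<ominus> x0 \<notin> L1"
    proof
      assume "u1 \<ominus> x0 \<in> L1"
      then have "\<Psi> ((u1 \<ominus> x0) \<oplus> x0) (\<zero> \<oplus> u2) \<in> L" using add[of "u1 \<ominus> x0" \<zero> x0 u2] x0 by (simp add: L1_def)
      moreover have "(u1 \<ominus> x0) \<oplus> x0 = u1" by (simp add: R.minus_eq R.a_assoc R.l_neg)
      ultimately show False using u(3) by simp
    qed
    then obtain p where p: "p \<in> carrier Q" "\<And>x. x \<in> L1 \<Longrightarrow> p \<otimes> x \<in> W" "p \<otimes> (u1 \<ominus> x0) \<notin> W"
      using R.dualizingD(3)[OF W \<open>regular_fractional Q A L1\<close>, of "u1 \<ominus> x0"] by auto
    note [simp] = p(1)
    \<comment> \<open>the graph of the homomorphism \<open>L2 \<rightarrow> Q/W\<close> that \<open>p\<close> induces\<close>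
    define G where "G y z \<longleftrightarrow> (\<exists>x\<in>carrier Q. \<Psi> x y \<in> L \<and> z = p \<otimes> x)" for y z
    define f where "f y = (SOME z. G y z)" for y
    have Gf: "G y (f y)" if "y \<in> L2" for y
    proof -
      have "\<exists>z. G y z" using that unfolding L2_def G_def by blast
      then show ?thesis unfolding f_def by (rule someI_ex)
    qed
    have fc: "f y \<in> carrier Q" if "y \<in> L2" for y using Gf[OF that] unfolding G_def by auto
    have uniq: "z \<ominus> z' \<in> W" if y: "y \<in> carrier Q" and G: "G y z" "G y z'" for y z z'
    proof -
      obtain x x' where x: "x \<in> carrier Q" "\<Psi> x y \<in> L" "z = p \<otimes> x" and x': "x' \<in> carrier Q" "\<Psi> x' y \<in> L" "z' = p \<otimes> x'"
        using G unfolding G_def by blast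
      note [simp] = x(1) x'(1) y
      have "\<Psi> (\<ominus> \<one> \<otimes> x') (\<ominus> \<one> \<otimes> y) \<in> L" using scal[of "\<ominus> \<one>" x' y] x' by simp
      then have "\<Psi> (x \<oplus> \<ominus> \<one> \<otimes> x') (y \<oplus> \<ominus> \<one> \<otimes> y) \<in> L" using add[of x y "\<ominus> \<one> \<otimes> x'" "\<ominus> \<one> \<otimes> y"] x by simp
      moreover have "x \<oplus> \<ominus> \<one> \<otimes> x' = x \<ominus> x'" "y \<oplus> \<ominus> \<one> \<otimes> y = \<zero>"
        by (simp_all add: R.minus_eq R.l_minus R.r_neg)
      ultimately have "x \<ominus> x' \<in> L1" by (simp add: L1_def)
      then have "p \<otimes> (x \<ominus> x') \<in> W" by (rule p)
      moreover have "z \<ominus> z' = p \<otimes> (x \<ominus> x')" unfolding x(3) x'(3) by (simp add: R.minus_eq R.r_distr R.r_minus)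
      ultimately show ?thesis by simp
    qed
    have "hom_mod Q A W L2 f"
    proof (rule R.hom_modI[OF Ws L2s, where G = G])
      show "f y \<in> carrier Q" "G y (f y)" if "y \<in> L2" for y by (rule fc[OF that] Gf[OF that])+
      show "z \<ominus> z' \<in> W" if "y \<in> L2" "G y z" "G y z'" for y z z'
        by (rule uniq[OF _ that(2,3)]) (use that(1) in \<open>simp add: L2_def\<close>)
      show "G (y \<oplus> y') (z \<oplus> z')" if yy: "y \<in> L2" "y' \<in> L2" and G: "G y z" "G y' z'" for y y' z z'
      proof -
        obtain x x' where x: "x \<in> carrier Q" "\<Psi> x y \<in> L" "z = p \<otimes> x" and x': "x' \<in> carrier Q" "\<Psi> x' y' \<in> L" "z' = p \<otimes> x'"
          using G unfolding G_def by blast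
        have yc: "y \<in> carrier Q" "y' \<in> carrier Q" using yy unfolding L2_def by auto
        have "z \<oplus> z' = p \<otimes> (x \<oplus> x')" using x x' by (simp add: R.r_distr)
        then show ?thesis unfolding G_def using add[OF x(1) yc(1) x'(1) yc(2) x(2) x'(2)] x x' by (intro bexI[of _ "x \<oplus> x'"]) auto
      qed
      show "G (r \<otimes> y) (r \<otimes> z)" if r: "r \<in> A" and yy: "y \<in> L2" and G: "G y z" for r y z
      proof -
        obtain x where x: "x \<in> carrier Q" "\<Psi> x y \<in> L" "z = p \<otimes> x" using G unfolding G_def by blast
        have yc: "y \<in> carrier Q" using yy unfolding L2_def by auto
        have "r \<otimes> z = p \<otimes> (r \<otimes> x)" using x r by (simp add: R.m_lcomm)
        then show ?thesis unfolding G_def using scal[OF r x(1) yc x(2)] x r by (intro bexI[of _ "r \<otimes> x"]) auto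
      qed
    qed
    from R.dualizing_baer[OF W L2r this] obtain q where q: "q \<in> carrier Q" "\<And>y. y \<in> L2 \<Longrightarrow> f y \<ominus> q \<otimes> y \<in> W" by blast
    note [simp] = q(1)
    have l: "p \<otimes> x \<ominus> q \<otimes> y \<in> W" if xy: "x \<in> carrier Q" "y \<in> carrier Q" "\<Psi> x y \<in> L" for x y
    proof -
      have yL: "y \<in> L2" using xy unfolding L2_def by blast
      note [simp] = xy(1,2) fc[OF yL]
      have "G y (p \<otimes> x)" unfolding G_def using xy by blast
      from uniq[OF xy(2) this Gf[OF yL]] have "p \<otimes> x \<ominus> f y \<in> W" .
      then have "(p \<otimes> x \<ominus> f y) \<oplus> (f y \<ominus> q \<otimes> y) \<in> W" using WD(3) q(2)[OF yL] by simp
      moreover have "(p \<otimes> x \<ominus> g) \<oplus> (g \<ominus> q \<otimes> y) = p \<otimes> x \<ominus> q \<otimes> y" if [simp]: "g \<in> carrier Q" for g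
        by ((simp add: R.ring_norm; fail) | (rule R.ring_eqI, (simp add: R.ring_norm; fail), simp_all))
      ultimately show ?thesis by simp
    qed
    have fin: "(\<forall>x\<in>carrier Q. \<forall>y\<in>carrier Q. \<Psi> x y \<in> L \<longrightarrow> p \<otimes> x \<oplus> \<ominus> q \<otimes> y \<in> W) \<and>
        p \<otimes> u1 \<oplus> \<ominus> q \<otimes> u2 \<notin> W"
    proof (intro conjI ballI impI)
      show "p \<otimes> x \<oplus> \<ominus> q \<otimes> y \<in> W" if "x \<in> carrier Q" "y \<in> carrier Q" "\<Psi> x y \<in> L" for x y
        using l[OF that] that(1,2) by (simp add: R.minus_eq R.l_minus)
      show "p \<otimes> u1 \<oplus> \<ominus> q \<otimes> u2 \<notin> W"
      proof
        assume h: "p \<otimes> u1 \<oplus> \<ominus> q \<otimes> u2 \<in> W"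
        have "p \<otimes> u1 \<oplus> \<ominus> q \<otimes> u2 \<ominus> (p \<otimes> x0 \<ominus> q \<otimes> u2) = p \<otimes> (u1 \<ominus> x0)" by ((simp add: R.ring_norm; fail) | (rule R.ring_eqI, (simp add: R.ring_norm; fail), simp_all))
        then show False using R.smod_minus[OF Ws h l[OF x0(1) u(2) x0(2)]] p(3) by simp
      qed
    qed
    show ?thesis by (rule bexI[of _ p], rule bexI[of _ "\<ominus> q"], rule fin) simp_all
  qed
qed

text \<open>
The functional \<open>x + yt \<mapsto> px + sy\<close> is the coefficient of \<open>t\<close> in the product with \<open>(s + ap) + pt\<close>. So
multiplication by this element separates: the coefficients of \<open>t\<close> lie in \<open>W\<close> on \<open>L\<close>, and those at
\<open>1\<close> lie in \<open>(W : J)\<close> because \<open>L\<close> is stable under multiplication by \<open>jt\<close> for \<open>j \<in> J\<close>.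
\<close>

theorem ext_dual_dualizing: "dualizing Q' A' (ext_dual W)"
  unfolding dualizing_def
proof (intro conjI allI impI ext_dual_regular)
  fix L u assume L: "regular_fractional Q' A' L" and u: "u \<in> carrier Q' - L"
  note LD = S.smodD[OF S.regular_fractionalD(1)[OF L]]
  have [simp]: "a \<in> carrier Q" "b \<in> carrier Q" by simp_all
  from u obtain u1 u2 where u12: "u1 \<in> carrier Q" "u2 \<in> carrier Q" "u = \<Psi> u1 u2" using Psi_E by blast
  obtain p s where p: "p \<in> carrier Q" and s: "s \<in> carrier Q"
    and l: "\<And>x y. x \<in> carrier Q \<Longrightarrow> y \<in> carrier Q \<Longrightarrow> \<Psi> x y \<in> L \<Longrightarrow> p \<otimes> x \<oplus> s \<otimes> y \<in> W" and lu: "p \<otimes> u1 \<oplus> s \<otimes> u2 \<notin> W"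
    using separating_functional[OF L u12(1,2)] u unfolding u12(3) by blast
  note [simp] = p s
  \<comment> \<open>The functional \<open>(x, y) \<mapsto> p x + s y\<close> is the \<open>t\<close>-coefficient of the multiplication by \<open>q\<close>.\<close>
  \<comment> \<open>the summand \<open>ap\<close> cancels the contribution of \<open>t\<^sup>2 = -at - b\<close> to the coefficient of \<open>t\<close>\<close>
  define q where "q = \<Psi> (s \<oplus> a \<otimes> p) p"
  have qc: "q \<in> carrier Q'" unfolding q_def by (rule Psi_closed) simp_all
  have qm: "q \<star> \<Psi> x y = \<Psi> ((s \<oplus> a \<otimes> p) \<otimes> x \<ominus> b \<otimes> (p \<otimes> y)) (p \<otimes> x \<oplus> s \<otimes> y)"
    if [simp]: "x \<in> carrier Q" "y \<in> carrier Q" for x y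
  proof -
    have e: "(s \<oplus> a \<otimes> p) \<otimes> y \<oplus> x \<otimes> p \<ominus> a \<otimes> (p \<otimes> y) = p \<otimes> x \<oplus> s \<otimes> y" by ((simp add: R.ring_norm; fail) | (rule R.ring_eqI, (simp add: R.ring_norm; fail), simp_all))
    show ?thesis unfolding q_def using Psi_mult[of "s \<oplus> a \<otimes> p" p x y] e by simp
  qed
  show "\<exists>q\<in>carrier Q'. (\<forall>j\<in>L. q \<star> j \<in> ext_dual W) \<and> q \<star> u \<notin> ext_dual W"
  proof (intro bexI[OF _ qc] conjI ballI)
    show "q \<star> u \<notin> ext_dual W"
      unfolding u12(3) qm[OF u12(1,2)] using lu u12 by (simp add: ext_dual_iff)
    fix v assume v: "v \<in> L"
    then obtain x y where xy: "x \<in> carrier Q" "y \<in> carrier Q" "v = \<Psi> x y" using Psi_E LD(1) by blast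
    note [simp] = xy(1,2)
    define c where "c = (s \<oplus> a \<otimes> p) \<otimes> x \<ominus> b \<otimes> (p \<otimes> y)"
    define d where "d = p \<otimes> x \<oplus> s \<otimes> y"
    have cd [simp]: "c \<in> carrier Q" "d \<in> carrier Q" by (simp_all add: c_def d_def)
    have dW: "d \<in> W" unfolding d_def using l xy v by simp
    have "c \<otimes> j \<in> W" if j: "j \<in> J" for j
    proof -
      note [simp] = JD(1)[OF j]
      have e1: "\<Psi> \<zero> j \<star> \<Psi> x y = \<Psi> (\<ominus> b \<otimes> (j \<otimes> y)) (x \<otimes> j \<ominus> a \<otimes> (j \<otimes> y))"
        using Psi_mult[of \<zero> j x y] by (simp add: R.minus_eq R.l_minus)
      have "\<Psi> \<zero> j \<star> \<Psi> x y \<in> L" using LD(4)[OF A'I[OF R.A_closed(1) j]] v xy by simp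
      then have "p \<otimes> (\<ominus> b \<otimes> (j \<otimes> y)) \<oplus> s \<otimes> (x \<otimes> j \<ominus> a \<otimes> (j \<otimes> y)) \<in> W" unfolding e1 by (rule l[rotated 2]) simp_all
      then have "(p \<otimes> (\<ominus> b \<otimes> (j \<otimes> y)) \<oplus> s \<otimes> (x \<otimes> j \<ominus> a \<otimes> (j \<otimes> y))) \<oplus> a \<otimes> (j \<otimes> d) \<in> W"
        using WD(3) WD(4)[OF ab(1) WD(4)[OF JD(2)[OF j] dW]] by simp
      moreover have "(p \<otimes> (\<ominus> b \<otimes> (j \<otimes> y)) \<oplus> s \<otimes> (x \<otimes> j \<ominus> a \<otimes> (j \<otimes> y))) \<oplus> a \<otimes> (j \<otimes> d) = c \<otimes> j"
        unfolding c_def d_def by ((simp add: R.ring_norm; fail) | (rule R.ring_eqI, (simp add: R.ring_norm; fail), simp_all))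
      ultimately show ?thesis by simp
    qed
    then have "c \<in> dual_J W" by (simp add: dual_J_def)
    then show "q \<star> v \<in> ext_dual W"
      unfolding xy(3) qm[OF xy(1,2)] using dW ext_dualI by (simp add: c_def d_def)
  qed
qed

text \<open>
The fractional ideal \<open>z\<^sup>-\<^sup>1(W : J)\<close>.
\<close>

definition reduced_dual :: "'a \<Rightarrow> 'a set" where
  "reduced_dual z = {x \<in> carrier Q. z \<otimes> x \<in> dual_J W}"

text \<open>
Let \<open>\<Omega> = V (ext_dual W)\<close> with a unit \<open>V\<close>, and let \<open>v = V\<^sup>-\<^sup>1\<close>, which lies in \<open>ext_dual W\<close> as
\<open>1 \<in> \<Omega>\<close>. For \<open>w = v/z\<close> and \<open>K = z\<^sup>-\<^sup>1 (ext_dual W)\<close> one gets \<open>w \<in> K\<close> and \<open>K\<mm>' \<subseteq> w\<mm>'\<close>, in particular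
\<open>\<mm>' \<subseteq> w\<mm>'\<close>. Multiplication by \<open>w\<close> maps \<open>B + Bt\<close> to itself, so all powers of \<open>w\<close> have a common
denominator and the chain of the modules \<open>w\<^sup>n\<mm>'\<close> is stationary. Cancelling \<open>w\<^sup>n\<close> gives \<open>w\<mm>' \<subseteq> \<mm>'\<close>,
so that \<open>K\<mm>' \<subseteq> \<mm>'\<close>. For \<open>x\<close> in \<open>z\<^sup>-\<^sup>1(W : J)\<close> this gives \<open>xJ \<subseteq> J\<close> and \<open>x\<mm> \<subseteq> \<mm>\<close>, and multiplication by an
\<open>x\<close> with \<open>xJ \<subseteq> J\<close> preserves \<open>(W : J)\<close>.
\<close>

lemma almost_gorenstein_imp_ring:
  assumes z: "z \<in> Units Q" "z \<in> dual_J W"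
    and B: "submod Q A B" "B \<subseteq> A" "B \<inter> Units Q \<noteq> {}" "\<And>x y. x \<in> reduced_dual z \<Longrightarrow> y \<in> B \<Longrightarrow> x \<otimes> y \<in> B"
    and \<Omega>: "dualizing Q' A' \<Omega>" "A' \<subseteq> \<Omega>" "\<And>q \<mu>. q \<in> \<Omega> \<Longrightarrow> \<mu> \<in> \<mm>' \<Longrightarrow> q \<star> \<mu> \<in> \<mm>'"
  shows "\<And>x y. x \<in> reduced_dual z \<Longrightarrow> y \<in> reduced_dual z \<Longrightarrow> x \<otimes> y \<in> reduced_dual z"
    "\<And>x r. x \<in> reduced_dual z \<Longrightarrow> r \<in> \<mm> \<Longrightarrow> x \<otimes> r \<in> \<mm>"
proof -
  have [simp]: "z \<in> carrier Q" using z by auto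
  obtain V where V: "V \<in> Units Q'" "\<Omega> = (\<lambda>x. V \<star> x) ` ext_dual W"
    using S.dualizing_unique[OF ext_dual_dualizing \<Omega>(1)] by blast
  have Vc [simp]: "V \<in> carrier Q'" using V by auto
  note ED = S.smodD[OF ext_dual_smod]
  have "\<one>\<^bsub>Q'\<^esub> \<in> \<Omega>" using \<Omega>(2) S.A_closed(2) by blast
  then obtain v where v0: "v \<in> ext_dual W" "\<one>\<^bsub>Q'\<^esub> = V \<star> v" unfolding V(2) by (rule imageE)
  have v: "v \<in> ext_dual W" "V \<star> v = \<one>\<^bsub>Q'\<^esub>" using v0 by simp_all
  have vc [simp]: "v \<in> carrier Q'" using ED(1)[OF v(1)] .
  have vU: "v \<in> Units Q'" using S.unit_factor[of v V] v(2) by (simp add: S.m_comm)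
  obtain y where y: "y \<in> carrier Q" "z \<otimes> y = \<one>" "y \<in> Units Q" using R.UnitsE[OF z(1)] by metis
  note [simp] = y(1)
  let ?y = "\<Psi> y \<zero>" let ?z = "\<Psi> z \<zero>"
  have yc [simp]: "?y \<in> carrier Q'" "?z \<in> carrier Q'" by (simp_all add: Psi_closed)
  have zy: "?z \<star> ?y = \<one>\<^bsub>Q'\<^esub>" using Psi_scalar[of z y \<zero>] y by (simp add: Psi_one)
  define K where "K = {q \<in> carrier Q'. ?z \<star> q \<in> ext_dual W}"
  have K_iff: "\<Psi> s t \<in> K \<longleftrightarrow> s \<in> reduced_dual z \<and> z \<otimes> t \<in> W" if "s \<in> carrier Q" "t \<in> carrier Q" for s t
    unfolding K_def reduced_dual_def using that Psi_scalar[of z s t] Psi_closed[OF that] by (auto simp: ext_dual_iff)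
  define w where "w = ?y \<star> v"
  have wc [simp]: "w \<in> carrier Q'" by (simp add: w_def)
  have wU: "w \<in> Units Q'" unfolding w_def using Psi_unit[OF y(3)] vU by simp
  have zw: "?z \<star> w = v"
  proof -
    have "?z \<star> w = (?z \<star> ?y) \<star> v" unfolding w_def by (simp add: S.m_assoc)
    then show ?thesis unfolding zy by simp
  qed
  have wK: "w \<in> K" unfolding K_def using zw v by simp
  have oneK: "\<one>\<^bsub>Q'\<^esub> \<in> K" unfolding K_def using ext_dualI[OF z(2) WD(2)] by simp
  have mm'c: "\<mu> \<in> carrier Q'" if "\<mu> \<in> \<mm>'" for \<mu> using S.mm_A[OF that] by simp
  have Kmu: "\<exists>\<mu>'\<in>\<mm>'. q \<star> \<mu> = w \<star> \<mu>'" if q: "q \<in> K" and mu: "\<mu> \<in> \<mm>'" for q \<mu>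
  proof -
    have qc: "q \<in> carrier Q'" using q unfolding K_def by simp
    note [simp] = qc mm'c[OF mu]
    have "V \<star> (?z \<star> q) \<in> \<Omega>" unfolding V(2) using q by (simp add: K_def)
    then have 1: "(V \<star> (?z \<star> q)) \<star> \<mu> \<in> \<mm>'" by (rule \<Omega>(3)[OF _ mu])
    have "w \<star> ((V \<star> (?z \<star> q)) \<star> \<mu>) = (V \<star> v) \<star> ((?z \<star> ?y) \<star> (q \<star> \<mu>))"
      unfolding w_def by (simp add: S.m_ac)
    then have "w \<star> ((V \<star> (?z \<star> q)) \<star> \<mu>) = q \<star> \<mu>" unfolding v(2) zy by simp
    then show ?thesis using 1 by metis
  qed
  have BD: "x \<in> B \<Longrightarrow> x \<in> carrier Q" for x using R.smodD(1)[OF B(1)] .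
  have stable: "\<exists>s'\<in>B. \<exists>t'\<in>B. w \<star> \<Psi> s t = \<Psi> s' t'" if st: "s \<in> B" "t \<in> B" for s t
  proof -
    obtain x1 x2 where x: "x1 \<in> carrier Q" "x2 \<in> carrier Q" "w = \<Psi> x1 x2" using Psi_E[OF wc] .
    have x1: "x1 \<in> reduced_dual z" and x2: "z \<otimes> x2 \<in> W" using wK K_iff[OF x(1,2)] x(3) by simp_all
    have x2': "x2 \<in> reduced_dual z" unfolding reduced_dual_def using x(2) W_sub_dual_J[OF x2] by simp
    note BB = R.smodD(3,4)[OF B(1)]
    have 1: "x1 \<otimes> s \<ominus> b \<otimes> (x2 \<otimes> t) \<in> B"
      by (rule R.smod_minus[OF B(1) B(4)[OF x1 st(1)] BB(2)[OF ab(2) B(4)[OF x2' st(2)]]])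
    have 2: "x1 \<otimes> t \<oplus> x2 \<otimes> s \<ominus> a \<otimes> (x2 \<otimes> t) \<in> B"
      by (rule R.smod_minus[OF B(1) BB(1)[OF B(4)[OF x1 st(2)] B(4)[OF x2' st(1)]] BB(2)[OF ab(1) B(4)[OF x2' st(2)]]])
    have "w \<star> \<Psi> s t = \<Psi> (x1 \<otimes> s \<ominus> b \<otimes> (x2 \<otimes> t)) (x1 \<otimes> t \<oplus> x2 \<otimes> s \<ominus> a \<otimes> (x2 \<otimes> t))"
      unfolding x(3) using Psi_mult[OF x(1,2) BD[OF st(1)] BD[OF st(2)]] R.m_comm[OF x(2) BD[OF st(1)]] by simp
    then show ?thesis using 1 2 by blast
  qed
  obtain b0 where b0: "b0 \<in> B" "b0 \<in> Units Q" using B(3) by blast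
  obtain k where k: "k \<in> J" "k \<in> Units Q" using J(3) by blast
  have [simp]: "b0 \<in> carrier Q" "k \<in> carrier Q" using b0 k by auto
  have pw: "\<exists>s\<in>B. \<exists>t\<in>B. w [^]\<^bsub>Q'\<^esub> n \<star> \<Psi> b0 \<zero> = \<Psi> s t" for n :: nat
  proof (induction n)
    case 0
    show ?case using b0 R.smodD(2)[OF B(1)] Psi_closed[of b0 \<zero>] by force
  next
    case (Suc n)
    then obtain s t where st: "s \<in> B" "t \<in> B" "w [^]\<^bsub>Q'\<^esub> n \<star> \<Psi> b0 \<zero> = \<Psi> s t" by blast
    have "w [^]\<^bsub>Q'\<^esub> Suc n \<star> \<Psi> b0 \<zero> = w \<star> (w [^]\<^bsub>Q'\<^esub> n \<star> \<Psi> b0 \<zero>)"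
      using Psi_closed[of b0 \<zero>] by (simp add: S.m_ac)
    then show ?case unfolding st(3) using stable[OF st(1,2)] by metis
  qed
  define d where "d = \<Psi> (k \<otimes> b0) \<zero>"
  have d: "d \<in> Units Q'" unfolding d_def using k b0 by (intro Psi_unit) simp
  have dpw: "d \<star> (w [^]\<^bsub>Q'\<^esub> n) \<in> A'" for n :: nat
  proof -
    obtain s t where st: "s \<in> B" "t \<in> B" "w [^]\<^bsub>Q'\<^esub> n \<star> \<Psi> b0 \<zero> = \<Psi> s t" using pw by blast
    have de: "d = \<Psi> k \<zero> \<star> \<Psi> b0 \<zero>" unfolding d_def using Psi_scalar[of k b0 \<zero>] by simp
    have "d \<star> (w [^]\<^bsub>Q'\<^esub> n) = \<Psi> k \<zero> \<star> (w [^]\<^bsub>Q'\<^esub> n \<star> \<Psi> b0 \<zero>)"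
      unfolding de using Psi_closed[of b0 \<zero>] Psi_closed[of k \<zero>] by (simp add: S.m_ac)
    also have "\<dots> = \<Psi> (k \<otimes> s) (t \<otimes> k)"
      unfolding st(3) using Psi_scalar[of k s t] BD st by (simp add: R.m_comm)
    also have "\<dots> \<in> A'" using st k B(2) JD by (intro A'I) auto
    finally show ?thesis .
  qed
  \<comment> \<open>The ascending chain \<open>w\<^sup>n \<mm>'\<close> is bounded, so it becomes stationary.\<close>
  \<comment> \<open>the chain \<open>w\<^sup>n\<mm>'\<close>, whose members have the common denominator \<open>d\<close>\<close>
  define M where "M n = (\<lambda>\<mu>. w [^]\<^bsub>Q'\<^esub> n \<star> \<mu>) ` \<mm>'" for n :: nat
  have "\<exists>N\<in>range M. \<forall>J\<in>range M. N \<subseteq> J \<longrightarrow> J = N"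
  proof (rule S.maximal_condition_frac[OF _ _ d])
    show "submod Q' A' N" if "N \<in> range M" for N
      using that S.smod_scale[OF S.maxideal(1)] by (auto simp: M_def)
    show "d \<star> q \<in> A'" if N: "N \<in> range M" "q \<in> N" for N q
    proof -
      obtain n \<mu> where n: "\<mu> \<in> \<mm>'" "q = w [^]\<^bsub>Q'\<^esub> (n::nat) \<star> \<mu>" using N unfolding M_def by blast
      have "d \<star> q = (d \<star> w [^]\<^bsub>Q'\<^esub> n) \<star> \<mu>" unfolding n(2) using d mm'c[OF n(1)] by (simp add: S.m_assoc S.Units_closed)
      then show ?thesis using S.A_closed(4)[OF dpw[of n] S.mm_A[OF n(1)]] by simp
    qed
  qed simp
  then obtain N where N: "N \<in> range M" and maxN: "\<forall>J\<in>range M. N \<subseteq> J \<longrightarrow> J = N" by blast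
  from N obtain n where Nn: "N = M n" by blast
  have n: "M k = M n" if "M n \<subseteq> M k" for k
    using bspec[OF maxN rangeI[of M k]] that unfolding Nn by simp
  have "M n \<subseteq> M (Suc n)"
  proof
    fix q assume "q \<in> M n"
    then obtain \<mu> where mu: "\<mu> \<in> \<mm>'" "q = w [^]\<^bsub>Q'\<^esub> n \<star> \<mu>" unfolding M_def by blast
    obtain \<mu>' where mu': "\<mu>' \<in> \<mm>'" "\<one>\<^bsub>Q'\<^esub> \<star> \<mu> = w \<star> \<mu>'" using Kmu[OF oneK mu(1)] by blast
    have me: "\<mu> = w \<star> \<mu>'" using mu'(2) mm'c[OF mu(1)] by simp
    have "q = w [^]\<^bsub>Q'\<^esub> Suc n \<star> \<mu>'" unfolding mu(2) me using mm'c[OF mu'(1)] by (simp add: S.m_assoc)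
    then show "q \<in> M (Suc n)" unfolding M_def using mu'(1) by blast
  qed
  then have MM: "M (Suc n) = M n" by (rule n)
  have wmu: "w \<star> \<mu> \<in> \<mm>'" if mu: "\<mu> \<in> \<mm>'" for \<mu>
  proof -
    have "w [^]\<^bsub>Q'\<^esub> Suc n \<star> \<mu> \<in> M (Suc n)" unfolding M_def by (rule imageI[OF mu])
    then have "w [^]\<^bsub>Q'\<^esub> Suc n \<star> \<mu> \<in> M n" unfolding MM .
    then obtain \<mu>' where mu': "\<mu>' \<in> \<mm>'" "w [^]\<^bsub>Q'\<^esub> Suc n \<star> \<mu> = w [^]\<^bsub>Q'\<^esub> n \<star> \<mu>'" unfolding M_def by blast
    have "w [^]\<^bsub>Q'\<^esub> n \<star> (w \<star> \<mu>) = w [^]\<^bsub>Q'\<^esub> n \<star> \<mu>'" using mu'(2) mm'c[OF mu] by (simp add: S.m_assoc)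
    then have "w \<star> \<mu> = \<mu>'"
      using S.unit_cancel[OF S.Units_pow_closed[OF wU]] mm'c[OF mu] mm'c[OF mu'(1)] by simp
    then show ?thesis using mu'(1) by simp
  qed
  have KM: "q \<star> \<mu> \<in> \<mm>'" if "q \<in> K" "\<mu> \<in> \<mm>'" for q \<mu>
    using Kmu[OF that] wmu by auto
  have xK: "\<Psi> x \<zero> \<in> K" "x \<in> carrier Q" if "x \<in> reduced_dual z" for x
  proof -
    show "x \<in> carrier Q" using that unfolding reduced_dual_def by simp
    then show "\<Psi> x \<zero> \<in> K" using K_iff[of x \<zero>] that WD(2) by simp
  qed
  have xJ: "x \<otimes> j \<in> J" if x: "x \<in> reduced_dual z" and j: "j \<in> J" for x j
  proof -
    have zm: "\<zero> \<in> \<mm>" using R.smodD(2)[OF R.maxideal(1)] .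
    have "\<Psi> x \<zero> \<star> \<Psi> \<zero> j \<in> \<mm>'" by (rule KM[OF xK(1)[OF x] mm'I[OF zm j]])
    moreover have "\<Psi> x \<zero> \<star> \<Psi> \<zero> j = \<Psi> \<zero> (x \<otimes> j)" using Psi_scalar[of x \<zero> j] xK(2)[OF x] JD(1)[OF j] by simp
    ultimately have "\<Psi> \<zero> (x \<otimes> j) \<in> \<mm>'" by simp
    then obtain r i where "r \<in> \<mm>" "i \<in> J" "\<Psi> \<zero> (x \<otimes> j) = \<Psi> r i" by (rule mm'E)
    then show ?thesis using Psi_inj[of \<zero> "x \<otimes> j" r i] xK(2)[OF x] JD(1) j R.mm_A[of r] by auto
  qed
  show "x \<otimes> r \<in> \<mm>" if x: "x \<in> reduced_dual z" and r: "r \<in> \<mm>" for x r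
  proof -
    have rc: "r \<in> carrier Q" using R.mm_A[OF r] by simp
    have "\<Psi> x \<zero> \<star> \<Psi> r \<zero> \<in> \<mm>'" by (rule KM[OF xK(1)[OF x] mm'I[OF r JD(4)]])
    moreover have "\<Psi> x \<zero> \<star> \<Psi> r \<zero> = \<Psi> (x \<otimes> r) \<zero>" using Psi_scalar[of x r \<zero>] xK(2)[OF x] rc by simp
    ultimately have "\<Psi> (x \<otimes> r) \<zero> \<in> \<mm>'" by simp
    then obtain r' i where "r' \<in> \<mm>" "i \<in> J" "\<Psi> (x \<otimes> r) \<zero> = \<Psi> r' i" by (rule mm'E)
    then show ?thesis using Psi_inj[of "x \<otimes> r" \<zero> r' i] xK(2)[OF x] JD(1) rc R.mm_A[of r'] by auto
  qed
  show "x \<otimes> y \<in> reduced_dual z" if x: "x \<in> reduced_dual z" and y: "y \<in> reduced_dual z" for x y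
  proof -
    note [simp] = xK(2)[OF x] xK(2)[OF y]
    have "z \<otimes> (x \<otimes> y) \<otimes> j \<in> W" if j: "j \<in> J" for j
    proof -
      have "z \<otimes> (x \<otimes> y) \<otimes> j = (z \<otimes> x) \<otimes> (y \<otimes> j)" using JD(1)[OF j] by (simp add: R.m_assoc)
      moreover have "z \<otimes> x \<in> dual_J W" using x by (simp add: reduced_dual_def)
      ultimately show ?thesis using dual_J_mult[OF _ xJ[OF y j]] by simp
    qed
    then show ?thesis by (simp add: reduced_dual_def dual_J_def)
  qed
qed

text \<open>
The witness is \<open>\<Omega> = z\<^sup>-\<^sup>1 (ext_dual W)\<close>. Biduality says that \<open>x \<in> J\<close> as soon as \<open>zyx \<in> W\<close> for all \<open>y\<close>
in the ring \<open>z\<^sup>-\<^sup>1(W : J)\<close>; from it follow \<open>xJ \<subseteq> J\<close> for \<open>x\<close> in this ring and \<open>\<mm>t \<subseteq> J\<close> for \<open>t \<in> z\<^sup>-\<^sup>1W\<close>,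
which are the two inclusions that the coefficients of a product \<open>\<Omega>\<mm>'\<close> require.
\<close>

lemma ring_imp_almost_gorenstein:
  assumes z: "z \<in> Units Q"
    and one: "\<one> \<in> reduced_dual z"
    and mult: "\<And>x y. x \<in> reduced_dual z \<Longrightarrow> y \<in> reduced_dual z \<Longrightarrow> x \<otimes> y \<in> reduced_dual z"
    and mm: "\<And>x r. x \<in> reduced_dual z \<Longrightarrow> r \<in> \<mm> \<Longrightarrow> x \<otimes> r \<in> \<mm>"
  shows "\<exists>\<Omega>. dualizing Q' A' \<Omega> \<and> A' \<subseteq> \<Omega> \<and> (\<forall>q\<in>\<Omega>. \<forall>\<mu>\<in>\<mm>'. q \<star> \<mu> \<in> \<mm>')"
proof -
  obtain y where y: "z \<in> carrier Q" "y \<in> carrier Q" "z \<otimes> y = \<one>" "y \<in> Units Q" using R.UnitsE[OF z] by metis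
  note [simp] = y(1,2)
  define \<Omega> where "\<Omega> = (\<lambda>q. \<Psi> y \<zero> \<star> q) ` ext_dual W"
  have \<Omega>: "dualizing Q' A' \<Omega>" unfolding \<Omega>_def by (rule S.dualizing_scale[OF ext_dual_dualizing Psi_unit[OF y(4)]])
  have yz: "y \<otimes> (z \<otimes> x) = x" "z \<otimes> (y \<otimes> x) = x" if "x \<in> carrier Q" for x
    using y(3) that R.m_assoc[of y z x] R.m_assoc[of z y x] R.m_comm[of y z] by simp_all
  have \<Omega>E: "\<exists>s\<in>reduced_dual z. \<exists>t\<in>carrier Q. z \<otimes> t \<in> W \<and> q = \<Psi> s t" if q: "q \<in> \<Omega>" for q
  proof -
    obtain p where p: "p \<in> ext_dual W" "q = \<Psi> y \<zero> \<star> p" using q unfolding \<Omega>_def by blast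
    obtain h w where h: "h \<in> dual_J W" "w \<in> W" "p = \<Psi> h w" "h \<in> carrier Q" "w \<in> carrier Q" using p(1) by (rule ext_dualE)
    have "q = \<Psi> (y \<otimes> h) (y \<otimes> w)" unfolding p(2) h(3) using Psi_scalar h by simp
    moreover have "y \<otimes> h \<in> reduced_dual z" unfolding reduced_dual_def using h yz by simp
    moreover have "z \<otimes> (y \<otimes> w) \<in> W" using h yz by simp
    ultimately show ?thesis using h(5) by (intro bexI[of _ "y \<otimes> h"] bexI[of _ "y \<otimes> w"]) auto
  qed
  have zH: "z \<in> dual_J W" using one by (simp add: reduced_dual_def)
  have A'\<Omega>: "A' \<subseteq> \<Omega>"
  proof
    have "\<Psi> y \<zero> \<star> \<Psi> z \<zero> = \<one>\<^bsub>Q'\<^esub>" using Psi_scalar[of y z \<zero>] y(3) by (simp add: Psi_one R.m_comm)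
    then have 1: "\<one>\<^bsub>Q'\<^esub> \<in> \<Omega>" unfolding \<Omega>_def using ext_dualI[OF zH WD(2)] by (metis imageI)
    fix r assume r: "r \<in> A'"
    then have "r \<star> \<one>\<^bsub>Q'\<^esub> \<in> \<Omega>" using S.smodD(4)[OF S.dualizingD(2)[OF \<Omega>] r 1] by simp
    then show "r \<in> \<Omega>" using r by simp
  qed
  have Jr: "regular_fractional Q A J"
  proof -
    obtain k where k: "k \<in> J" "k \<in> Units Q" using J(3) by blast
    show ?thesis by (rule R.regular_fractionalI[OF J(1) k, of \<one>]) (use JD in auto)
  qed
  \<comment> \<open>\<open>J\<close> is its own bidual.\<close>
  have dualJ: "x \<in> J" if x: "x \<in> carrier Q" and d: "\<And>y. y \<in> reduced_dual z \<Longrightarrow> (z \<otimes> y) \<otimes> x \<in> W" for x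
  proof (rule ccontr)
    assume "x \<notin> J"
    then obtain q where q: "q \<in> carrier Q" "\<forall>j\<in>J. q \<otimes> j \<in> W" "q \<otimes> x \<notin> W" using R.dualizingD(3)[OF W Jr x] by blast
    have qH: "q \<in> dual_J W" using q by (simp add: dual_J_def)
    have "y \<otimes> q \<in> reduced_dual z" unfolding reduced_dual_def using q(1) qH yz by simp
    from d[OF this] show False using q yz by simp
  qed
  have qc: "x \<in> reduced_dual z \<Longrightarrow> x \<in> carrier Q" for x by (simp add: reduced_dual_def)
  have xJ: "x \<otimes> j \<in> J" if x: "x \<in> reduced_dual z" and j: "j \<in> J" for x j
  proof (rule dualJ)
    show "x \<otimes> j \<in> carrier Q" using qc[OF x] JD(1)[OF j] by simp
    fix y assume y: "y \<in> reduced_dual z"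
    have "z \<otimes> (y \<otimes> x) \<in> dual_J W" using mult[OF y x] by (simp add: reduced_dual_def)
    then have "z \<otimes> (y \<otimes> x) \<otimes> j \<in> W" using j by (rule dual_J_mult)
    then show "(z \<otimes> y) \<otimes> (x \<otimes> j) \<in> W" using qc[OF x] qc[OF y] JD(1)[OF j] by (simp add: R.m_assoc)
  qed
  have tJ: "r \<otimes> t \<in> J" if r: "r \<in> \<mm>" and t: "t \<in> carrier Q" "z \<otimes> t \<in> W" for r t
  proof (rule dualJ)
    have rc: "r \<in> carrier Q" using R.mm_A[OF r] by simp
    show "r \<otimes> t \<in> carrier Q" using rc t by simp
    fix y assume y: "y \<in> reduced_dual z"
    have "y \<otimes> r \<in> A" using mm[OF y r] R.mm_A by simp
    then have "(y \<otimes> r) \<otimes> (z \<otimes> t) \<in> W" using WD(4) t by simp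
    then show "(z \<otimes> y) \<otimes> (r \<otimes> t) \<in> W" using qc[OF y] rc t by (simp add: R.m_ac)
  qed
  have "q \<star> \<mu> \<in> \<mm>'" if q: "q \<in> \<Omega>" and mu: "\<mu> \<in> \<mm>'" for q \<mu>
  proof -
    obtain s t where s: "s \<in> reduced_dual z" and t: "t \<in> carrier Q" "z \<otimes> t \<in> W" and qe: "q = \<Psi> s t" using \<Omega>E[OF q] by blast
    obtain r j where r: "r \<in> \<mm>" and j: "j \<in> J" and me: "\<mu> = \<Psi> r j" using mu by (rule mm'E)
    have rc: "r \<in> carrier Q" using R.mm_A[OF r] by simp
    have tq: "t \<in> reduced_dual z" unfolding reduced_dual_def using t W_sub_dual_J by simp
    note tj = xJ[OF tq j] and sj = xJ[OF s j] and rt = tJ[OF r t]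
    have 1: "s \<otimes> r \<ominus> b \<otimes> (t \<otimes> j) \<in> \<mm>"
      by (rule R.smod_minus[OF R.maxideal(1) mm[OF s r] R.smodD(4)[OF R.maxideal(1) ab(2) JD(3)[OF tj]]])
    have 2: "s \<otimes> j \<oplus> r \<otimes> t \<ominus> a \<otimes> (t \<otimes> j) \<in> J"
      by (rule R.smod_minus[OF J(1) JD(5)[OF sj rt] JD(6)[OF ab(1) tj]])
    show ?thesis
      unfolding qe me using Psi_mult[OF qc[OF s] t(1) rc JD(1)[OF j]] mm'I[OF 1 2] by simp
  qed
  then show ?thesis using \<Omega> A'\<Omega> by blast
qed

end

end

section \<open>The quadratic quotient as a local ring of dimension one\<close>

text \<open>
The element \<open>g (r, i)\<close> is \<open>r + it\<close>; the isomorphism \<open>g\<close> is kept abstract because only the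
multiplication rule for these elements matters.
\<close>

locale quadratic_quotient = one_dim_ring R \<mm> + S: cring S
  for R (structure) and \<mm> and S :: "('c, 'k) ring_scheme" +
  fixes I :: "'a set" and a b :: 'a and g :: "'a \<times> 'a \<Rightarrow> 'c"
  assumes dim: "krull_dim R = 1"
    and I: "ideal I R" "I \<subseteq> \<mm>" "\<exists>i\<in>I. reg i"
    and ab [simp]: "a \<in> carrier R" "b \<in> carrier R"
    and g: "g \<in> ring_iso (quad_ring R I a b) S"
begin

abbreviation G where "G r i \<equiv> g (r, i)"

lemma ID: "i \<in> I \<Longrightarrow> i \<in> carrier R" "i \<in> I \<Longrightarrow> i \<in> \<mm>" "\<zero> \<in> I" "i \<in> I \<Longrightarrow> j \<in> I \<Longrightarrow> i \<oplus> j \<in> I"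
  "r \<in> carrier R \<Longrightarrow> i \<in> I \<Longrightarrow> r \<otimes> i \<in> I" "r \<in> carrier R \<Longrightarrow> i \<in> I \<Longrightarrow> i \<otimes> r \<in> I" "i \<in> I \<Longrightarrow> \<ominus> i \<in> I"
  "i \<in> I \<Longrightarrow> j \<in> I \<Longrightarrow> i \<ominus> j \<in> I"
proof -
  interpret I: ideal I R by (rule I(1))
  show "i \<in> I \<Longrightarrow> i \<in> carrier R" "i \<in> I \<Longrightarrow> i \<in> \<mm>" "\<zero> \<in> I" "i \<in> I \<Longrightarrow> j \<in> I \<Longrightarrow> i \<oplus> j \<in> I"
    "r \<in> carrier R \<Longrightarrow> i \<in> I \<Longrightarrow> r \<otimes> i \<in> I" "r \<in> carrier R \<Longrightarrow> i \<in> I \<Longrightarrow> i \<otimes> r \<in> I" "i \<in> I \<Longrightarrow> \<ominus> i \<in> I"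
    "i \<in> I \<Longrightarrow> j \<in> I \<Longrightarrow> i \<ominus> j \<in> I"
    using I(2) by (auto simp: I.I_l_closed I.I_r_closed a_minus_def)
qed

lemma MD: "r \<in> \<mm> \<Longrightarrow> s \<in> \<mm> \<Longrightarrow> r \<oplus> s \<in> \<mm>" "r \<in> \<mm> \<Longrightarrow> s \<in> \<mm> \<Longrightarrow> r \<ominus> s \<in> \<mm>" "c \<in> carrier R \<Longrightarrow> r \<in> \<mm> \<Longrightarrow> c \<otimes> r \<in> \<mm>"
  "\<zero> \<in> \<mm>" "r \<in> \<mm> \<Longrightarrow> \<ominus> r \<in> \<mm>"
proof -
  interpret M: ideal \<mm> R by (rule mm_ideal)
  show "r \<in> \<mm> \<Longrightarrow> s \<in> \<mm> \<Longrightarrow> r \<oplus> s \<in> \<mm>" "r \<in> \<mm> \<Longrightarrow> s \<in> \<mm> \<Longrightarrow> r \<ominus> s \<in> \<mm>" "c \<in> carrier R \<Longrightarrow> r \<in> \<mm> \<Longrightarrow> c \<otimes> r \<in> \<mm>"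
    "\<zero> \<in> \<mm>" "r \<in> \<mm> \<Longrightarrow> \<ominus> r \<in> \<mm>"
    by (auto simp: M.I_l_closed a_minus_def)
qed

lemmas qs = quad_simps[OF I(1) ab]

lemma G_closed: "r \<in> carrier R \<Longrightarrow> i \<in> I \<Longrightarrow> G r i \<in> carrier S"
  using ring_iso_memE(1)[OF g] by (simp add: qs)

lemma G_mult: "r \<in> carrier R \<Longrightarrow> i \<in> I \<Longrightarrow> s \<in> carrier R \<Longrightarrow> j \<in> I \<Longrightarrow>
  G r i \<otimes>\<^bsub>S\<^esub> G s j = G (r \<otimes> s \<ominus> b \<otimes> (i \<otimes> j)) (r \<otimes> j \<oplus> s \<otimes> i \<ominus> a \<otimes> (i \<otimes> j))"
  using ring_iso_memE(2)[OF g, of "(r, i)" "(s, j)"] by (simp add: qs)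

lemma G_add: "r \<in> carrier R \<Longrightarrow> i \<in> I \<Longrightarrow> s \<in> carrier R \<Longrightarrow> j \<in> I \<Longrightarrow>
  G r i \<oplus>\<^bsub>S\<^esub> G s j = G (r \<oplus> s) (i \<oplus> j)"
  using ring_iso_memE(3)[OF g, of "(r, i)" "(s, j)"] by (simp add: qs)

lemma G_one: "\<one>\<^bsub>S\<^esub> = G \<one> \<zero>"
  using ring_iso_memE(4)[OF g] by (simp add: qs)

lemma G_inj: "r \<in> carrier R \<Longrightarrow> i \<in> I \<Longrightarrow> s \<in> carrier R \<Longrightarrow> j \<in> I \<Longrightarrow> G r i = G s j \<Longrightarrow> r = s \<and> i = j"
  using ring_iso_memE(5)[OF g] unfolding bij_betw_def by (auto dest!: inj_onD simp: qs)

lemma G_E: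
  assumes "x \<in> carrier S"
  obtains r i where "r \<in> carrier R" "i \<in> I" "x = G r i"
  using ring_iso_memE(5)[OF g] assms unfolding bij_betw_def qs by blast

lemma G_zero: "\<zero>\<^bsub>S\<^esub> = G \<zero> \<zero>"
proof -
  have "G \<zero> \<zero> \<oplus>\<^bsub>S\<^esub> G \<zero> \<zero> = G \<zero> \<zero>" using G_add[of \<zero> \<zero> \<zero> \<zero>] ID by simp
  then show ?thesis using G_closed[of \<zero> \<zero>] ID S.add.r_cancel_one[of "G \<zero> \<zero>" "G \<zero> \<zero>"] by simp
qed

lemma G_scalar: "c \<in> carrier R \<Longrightarrow> r \<in> carrier R \<Longrightarrow> i \<in> I \<Longrightarrow> G c \<zero> \<otimes>\<^bsub>S\<^esub> G r i = G (c \<otimes> r) (c \<otimes> i)"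
  using G_mult[of c \<zero> r i] ID by (simp add: minus_eq)

lemma G_uminus: "r \<in> carrier R \<Longrightarrow> i \<in> I \<Longrightarrow> \<ominus>\<^bsub>S\<^esub> G r i = G (\<ominus> r) (\<ominus> i)"
  by (rule S.minus_equality) (use ID G_closed in \<open>auto simp: G_add G_zero l_neg\<close>)

lemma G_minus: "r \<in> carrier R \<Longrightarrow> i \<in> I \<Longrightarrow> s \<in> carrier R \<Longrightarrow> j \<in> I \<Longrightarrow> G r i \<ominus>\<^bsub>S\<^esub> G s j = G (r \<ominus> s) (i \<ominus> j)"
  using ID by (simp add: a_minus_def G_uminus G_add)

subsection \<open>Conjugates and norms\<close>

text \<open>
The product of \<open>r + it\<close> with its conjugate \<open>(r - ai) - it\<close>, obtained from the second root \<open>-a - t\<close>.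
\<close>

definition norm :: "'a \<Rightarrow> 'a \<Rightarrow> 'a" where
  "norm r i = r \<otimes> r \<ominus> a \<otimes> (r \<otimes> i) \<oplus> b \<otimes> (i \<otimes> i)"

lemma conjugate:
  assumes r: "r \<in> carrier R" and i: "i \<in> I"
  shows "G r i \<otimes>\<^bsub>S\<^esub> G (r \<ominus> a \<otimes> i) (\<ominus> i) = G (norm r i) \<zero>"
    "G r i \<oplus>\<^bsub>S\<^esub> G (r \<ominus> a \<otimes> i) (\<ominus> i) = G (r \<oplus> r \<ominus> a \<otimes> i) \<zero>"
    "norm r i \<in> carrier R" "r \<ominus> a \<otimes> i \<in> carrier R" "\<ominus> i \<in> I"
proof -
  have [simp]: "r \<in> carrier R" "i \<in> carrier R" "a \<in> carrier R" "b \<in> carrier R" using r i ID by auto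
  show 1: "r \<ominus> a \<otimes> i \<in> carrier R" "\<ominus> i \<in> I" using i ID by auto
  have e1: "r \<otimes> (r \<ominus> a \<otimes> i) \<ominus> b \<otimes> (i \<otimes> \<ominus> i) = norm r i" unfolding norm_def by ((simp add: ring_norm; fail) | (rule ring_eqI, (simp add: ring_norm; fail), simp_all))
  have e2: "r \<otimes> (\<ominus> i) \<oplus> (r \<ominus> a \<otimes> i) \<otimes> i \<ominus> a \<otimes> (i \<otimes> \<ominus> i) = \<zero>" by (simp add: ring_norm)
  show "G r i \<otimes>\<^bsub>S\<^esub> G (r \<ominus> a \<otimes> i) (\<ominus> i) = G (norm r i) \<zero>"
    using G_mult[OF r i 1] unfolding e1 e2 .
  have "r \<oplus> (r \<ominus> a \<otimes> i) = r \<oplus> r \<ominus> a \<otimes> i" by ((simp add: ring_norm; fail) | (rule ring_eqI, (simp add: ring_norm; fail), simp_all))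
  then show "G r i \<oplus>\<^bsub>S\<^esub> G (r \<ominus> a \<otimes> i) (\<ominus> i) = G (r \<oplus> r \<ominus> a \<otimes> i) \<zero>"
    using G_add[OF r i 1] by (simp add: r_neg)
  show "norm r i \<in> carrier R" unfolding norm_def by simp
qed

lemma mm_prime: "primeideal \<mm> R" by (rule maximalideal_prime[OF maxid])

text \<open>
The norm of \<open>r + it\<close> is congruent to \<open>r\<^sup>2\<close> modulo \<open>\<mm>\<close>, hence a unit, and the conjugate divided by the
norm is an inverse.
\<close>

lemma G_unit:
  assumes r: "r \<in> carrier R" "r \<notin> \<mm>" and i: "i \<in> I"
  shows "\<exists>u\<in>carrier S. u \<otimes>\<^bsub>S\<^esub> G r i = \<one>\<^bsub>S\<^esub>"
proof -
  have [simp]: "r \<in> carrier R" "i \<in> carrier R" using r i ID by auto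
  note c = conjugate[OF r(1) i]
  have "norm r i \<notin> \<mm>"
  proof
    assume n: "norm r i \<in> \<mm>"
    have "r \<otimes> r = norm r i \<ominus> (b \<otimes> (i \<otimes> i) \<ominus> a \<otimes> (r \<otimes> i))"
    proof -
      have [simp]: "a \<in> carrier R" "b \<in> carrier R" "r \<in> carrier R" "i \<in> carrier R" by simp_all
      show ?thesis unfolding norm_def by ((simp add: ring_norm; fail) | (rule ring_eqI, (simp add: ring_norm; fail), simp_all))
    qed
    moreover have "b \<otimes> (i \<otimes> i) \<ominus> a \<otimes> (r \<otimes> i) \<in> \<mm>" 
      by (rule MD(2)[OF MD(3)[OF ab(2) MD(3)[OF ID(1)[OF i] ID(2)[OF i]]] MD(3)[OF ab(1) MD(3)[OF r(1) ID(2)[OF i]]]])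
    ultimately have "r \<otimes> r \<in> \<mm>" using n MD(2) by simp
    then show False using primeideal.I_prime[OF mm_prime, of r r] r by simp
  qed
  then obtain n' where n': "n' \<in> carrier R" "n' \<otimes> norm r i = \<one>"
  proof -
    have "emR (norm r i) \<notin> emR ` \<mm>" using emb_inj[OF c(3)] mm_carrier \<open>norm r i \<notin> \<mm>\<close> by auto
    then obtain u where u: "u \<in> base R" "emR (norm r i) \<star> u = \<one>\<^bsub>TF\<^esub>" using P.invertible[of "emR (norm r i)"] c(3) by blast
    then obtain t where t: "t \<in> carrier R" "u = emR t" by blast
    have "emR (t \<otimes> norm r i) = emR \<one>" using u(2) t c(3) by (simp add: emb_simps emb_one P.m_comm)
    then have "t \<otimes> norm r i = \<one>" using emb_inj[of "t \<otimes> norm r i" \<one>] t c(3) by simp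
    then show thesis using t by (intro that) auto
  qed
  let ?u = "G n' \<zero> \<otimes>\<^bsub>S\<^esub> G (r \<ominus> a \<otimes> i) (\<ominus> i)"
  have cl: "G n' \<zero> \<in> carrier S" "G (r \<ominus> a \<otimes> i) (\<ominus> i) \<in> carrier S" "G r i \<in> carrier S"
    using G_closed n' ID c(4,5) i by auto
  have "?u \<otimes>\<^bsub>S\<^esub> G r i = G n' \<zero> \<otimes>\<^bsub>S\<^esub> (G r i \<otimes>\<^bsub>S\<^esub> G (r \<ominus> a \<otimes> i) (\<ominus> i))" using cl by (simp add: S.m_ac)
  also have "\<dots> = \<one>\<^bsub>S\<^esub>" unfolding c(1) G_one using G_scalar[OF n'(1) c(3) ID(3)] n' by simp
  finally show ?thesis using cl by (intro bexI[of _ ?u]) auto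
qed

definition nn :: "'c set" where "nn = {G r i | r i. r \<in> \<mm> \<and> i \<in> I}"

lemma nn_iff: "r \<in> carrier R \<Longrightarrow> i \<in> I \<Longrightarrow> G r i \<in> nn \<longleftrightarrow> r \<in> \<mm>"
  unfolding nn_def using G_inj mm_carrier by blast

lemma nn_ideal: "ideal nn S"
proof (rule idealI)
  have nE: "\<exists>r\<in>\<mm>. \<exists>i\<in>I. x = G r i \<and> r \<in> carrier R" if "x \<in> nn" for x using that mm_carrier unfolding nn_def by blast
  show "ring S" by (rule S.ring_axioms)
  show "subgroup nn (add_monoid S)"
  proof (rule S.add.subgroupI)
    show "nn \<subseteq> carrier S" using nE G_closed by blast
    show "nn \<noteq> {}" unfolding nn_def using MD(4) ID(3) by blast
    show "\<ominus>\<^bsub>S\<^esub> x \<in> nn" if x: "x \<in> nn" for x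
    proof -
      obtain r i where r: "r \<in> \<mm>" "i \<in> I" "x = G r i" "r \<in> carrier R" using nE[OF x] by blast
      show ?thesis unfolding r(3) using r nn_iff[of "\<ominus> r" "\<ominus> i"] ID MD by (simp add: G_uminus)
    qed
    show "x \<oplus>\<^bsub>S\<^esub> y \<in> nn" if xy: "x \<in> nn" "y \<in> nn" for x y
    proof -
      obtain r i where r: "r \<in> \<mm>" "i \<in> I" "x = G r i" "r \<in> carrier R" using nE[OF xy(1)] by blast
      obtain s j where s: "s \<in> \<mm>" "j \<in> I" "y = G s j" "s \<in> carrier R" using nE[OF xy(2)] by blast
      show ?thesis unfolding r(3) s(3) using r s nn_iff[of "r \<oplus> s" "i \<oplus> j"] ID MD by (simp add: G_add)
    qed
  qed
  show 1: "y \<otimes>\<^bsub>S\<^esub> x \<in> nn" if xy: "x \<in> nn" "y \<in> carrier S" for x y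
  proof -
    obtain r i where r: "r \<in> \<mm>" "i \<in> I" "x = G r i" "r \<in> carrier R" using nE[OF xy(1)] by blast
    obtain s j where s: "s \<in> carrier R" "j \<in> I" "y = G s j" using G_E[OF xy(2)] by blast
    have "s \<otimes> r \<ominus> b \<otimes> (j \<otimes> i) \<in> \<mm>" 
      by (rule MD(2)[OF MD(3)[OF s(1) r(1)] MD(3)[OF ab(2) ID(2)[OF ID(5)[OF ID(1)[OF s(2)] r(2)]]]])
    moreover have "s \<otimes> i \<oplus> r \<otimes> j \<ominus> a \<otimes> (j \<otimes> i) \<in> I" 
      by (rule ID(8)[OF ID(4)[OF ID(5)[OF s(1) r(2)] ID(5)[OF r(4) s(2)]] ID(5)[OF ab(1) ID(5)[OF ID(1)[OF s(2)] r(2)]]])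
    ultimately show ?thesis unfolding r(3) s(3) using G_mult[OF s(1,2) r(4,2)] nn_iff mm_carrier by simp
  qed
  show "x \<otimes>\<^bsub>S\<^esub> y \<in> nn" if xy: "x \<in> nn" "y \<in> carrier S" for x y
  proof -
    have "x \<in> carrier S" using nE[OF xy(1)] G_closed by blast
    then show ?thesis using 1[OF xy] S.m_comm xy(2) by simp
  qed
qed

lemma one_not_nn: "\<one>\<^bsub>S\<^esub> \<notin> nn"
  unfolding G_one using nn_iff[OF one_closed ID(3)] one_not_mm by simp

lemma proper_ideal_nn:
  assumes J: "ideal J S" "J \<noteq> carrier S"
  shows "J \<subseteq> nn"
proof
  fix x assume x: "x \<in> J"
  interpret J: ideal J S by (rule J(1))
  obtain r i where r: "r \<in> carrier R" "i \<in> I" "x = G r i" using G_E[OF J.Icarr[OF x]] by blast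
  have "r \<in> \<mm>"
  proof (rule ccontr)
    assume "r \<notin> \<mm>"
    then obtain u where u: "u \<in> carrier S" "u \<otimes>\<^bsub>S\<^esub> x = \<one>\<^bsub>S\<^esub>" using G_unit[OF r(1) _ r(2)] r(3) by blast
    then have "\<one>\<^bsub>S\<^esub> \<in> J" using J.I_l_closed[OF x u(1)] by simp
    then show False using J.one_imp_carrier J(2) by simp
  qed
  then show "x \<in> nn" using nn_iff r by simp
qed

lemma S_local: "local_ring S nn"
  unfolding local_ring_def
proof (intro conjI allI impI)
  show "cring S" by (rule S.is_cring)
  show mx: "maximalideal nn S"
  proof (rule maximalidealI[OF nn_ideal])
    show "carrier S \<noteq> nn" using one_not_nn by auto
    fix J assume "ideal J S" "nn \<subseteq> J" "J \<subseteq> carrier S"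
    then show "J = nn \<or> J = carrier S" using proper_ideal_nn by blast
  qed
  fix K assume K: "maximalideal K S"
  interpret K: maximalideal K S by (rule K)
  have "K \<subseteq> nn" using proper_ideal_nn[OF K.ideal_axioms] K.I_notcarr by blast
  moreover have "nn \<subseteq> carrier S" "nn \<noteq> carrier S"
    using additive_subgroup.a_subset[OF ideal.axioms(1)[OF nn_ideal]] one_not_nn by auto
  ultimately show "K = nn" using K.I_maximal[OF nn_ideal] by blast
qed

text \<open>
For an ideal of \<open>S\<close>: its intersection with \<open>R\<close> and its projection to the coefficients of \<open>t\<close>. Comparable
ideals with the same two parts are equal.
\<close>

definition part0 :: "'c set \<Rightarrow> 'a set" where "part0 J = {r \<in> carrier R. G r \<zero> \<in> J}"
definition part1 :: "'c set \<Rightarrow> 'a set" where "part1 J = {i \<in> I. \<exists>r\<in>carrier R. G r i \<in> J}"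

lemma part0_ideal:
  assumes "ideal J S"
  shows "ideal (part0 J) R"
proof (rule idealI)
  interpret J: ideal J S by fact
  show "ring R" by (rule ring_axioms)
  show "subgroup (part0 J) (add_monoid R)"
  proof (rule add.subgroupI)
    show "part0 J \<subseteq> carrier R" by (auto simp: part0_def)
    have "\<zero> \<in> part0 J" using J.zero_closed by (simp add: part0_def G_zero[symmetric])
    then show "part0 J \<noteq> {}" by blast
    show "\<ominus> r \<in> part0 J" if r: "r \<in> part0 J" for r
    proof -
      have rc: "r \<in> carrier R" and rJ: "G r \<zero> \<in> J" using r by (simp_all add: part0_def)
      have "G (\<ominus> r) (\<ominus> \<zero>) \<in> J" using J.a_inv_closed[OF rJ] unfolding G_uminus[OF rc ID(3)] .
      then show ?thesis using rc by (simp add: part0_def)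
    qed
    show "r \<oplus> s \<in> part0 J" if rs: "r \<in> part0 J" "s \<in> part0 J" for r s
    proof -
      have rc: "r \<in> carrier R" "s \<in> carrier R" and rJ: "G r \<zero> \<in> J" "G s \<zero> \<in> J" using rs by (simp_all add: part0_def)
      have "G (r \<oplus> s) (\<zero> \<oplus> \<zero>) \<in> J" using J.a_closed[OF rJ] unfolding G_add[OF rc(1) ID(3) rc(2) ID(3)] .
      then show ?thesis using rc by (simp add: part0_def)
    qed
  qed
  show 1: "c \<otimes> r \<in> part0 J" if r: "r \<in> part0 J" and c: "c \<in> carrier R" for r c
    using J.I_l_closed[of "G r \<zero>" "G c \<zero>"] G_closed[OF c ID(3)] r c G_scalar[of c r \<zero>] ID(3) by (simp add: part0_def)
  show "r \<otimes> c \<in> part0 J" if r: "r \<in> part0 J" and c: "c \<in> carrier R" for r c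
    using 1[OF r c] m_comm[of r c] r c by (simp add: part0_def)
qed

lemma part1_ideal:
  assumes "ideal J S"
  shows "ideal (part1 J) R"
proof (rule idealI)
  interpret J: ideal J S by fact
  have pE: "\<exists>r\<in>carrier R. G r i \<in> J \<and> i \<in> I \<and> i \<in> carrier R" if "i \<in> part1 J" for i
    using that ID(1) unfolding part1_def by blast
  have pI: "i \<in> part1 J" if "G r i \<in> J" "r \<in> carrier R" "i \<in> I" for r i
    using that unfolding part1_def by blast
  show "ring R" by (rule ring_axioms)
  show "subgroup (part1 J) (add_monoid R)"
  proof (rule add.subgroupI)
    show "part1 J \<subseteq> carrier R" using ID by (auto simp: part1_def)
    have "\<zero> \<in> part1 J" using pI[of \<zero> \<zero>] J.zero_closed ID(3) by (simp add: G_zero)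
    then show "part1 J \<noteq> {}" by blast
    show "\<ominus> i \<in> part1 J" if i: "i \<in> part1 J" for i
    proof -
      obtain r where r: "r \<in> carrier R" "G r i \<in> J" "i \<in> I" using pE[OF i] by blast
      show ?thesis using pI[of "\<ominus> r" "\<ominus> i"] J.a_inv_closed[OF r(2)] r ID by (simp add: G_uminus)
    qed
    show "i \<oplus> j \<in> part1 J" if ij: "i \<in> part1 J" "j \<in> part1 J" for i j
    proof -
      obtain r where r: "r \<in> carrier R" "G r i \<in> J" "i \<in> I" using pE[OF ij(1)] by blast
      obtain s where s: "s \<in> carrier R" "G s j \<in> J" "j \<in> I" using pE[OF ij(2)] by blast
      show ?thesis using pI[of "r \<oplus> s" "i \<oplus> j"] J.a_closed[OF r(2) s(2)] r s ID by (simp add: G_add)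
    qed
  qed
  show 1: "c \<otimes> i \<in> part1 J" if i: "i \<in> part1 J" and c: "c \<in> carrier R" for i c
  proof -
    obtain r where r: "r \<in> carrier R" "G r i \<in> J" "i \<in> I" using pE[OF i] by blast
    show ?thesis using pI[of "c \<otimes> r" "c \<otimes> i"] J.I_l_closed[OF r(2) G_closed[OF c ID(3)]] r c ID by (simp add: G_scalar)
  qed
  show "i \<otimes> c \<in> part1 J" if i: "i \<in> part1 J" and c: "c \<in> carrier R" for i c
    using 1[OF i c] m_comm[of i c] pE[OF i] c by auto
qed

lemma ideal_eq_by_parts:
  assumes J: "ideal J S" "ideal K S" "J \<subseteq> K" and p: "part0 K \<subseteq> part0 J" "part1 K \<subseteq> part1 J"
  shows "J = K"
proof (intro equalityI J(3) subsetI)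
  interpret J: ideal J S by (rule J(1))
  interpret K: ideal K S by (rule J(2))
  fix x assume x: "x \<in> K"
  obtain r i where r: "r \<in> carrier R" "i \<in> I" "x = G r i" using G_E[OF K.Icarr[OF x]] by blast
  have "i \<in> part1 K" using r x unfolding part1_def by blast
  then obtain s where s: "s \<in> carrier R" "G s i \<in> J" using p(2) unfolding part1_def by blast
  have "G r i \<ominus>\<^bsub>S\<^esub> G s i \<in> K" using x r(3) s(2) J(3) by (auto simp: a_minus_def)
  then have "r \<ominus> s \<in> part0 K" using G_minus[OF r(1,2) s(1) r(2)] r s ID(1)[OF r(2)] by (simp add: part0_def minus_eq r_neg)
  then have "G (r \<ominus> s) \<zero> \<in> J" using p(1) unfolding part0_def by blast
  then have "G (r \<ominus> s) \<zero> \<oplus>\<^bsub>S\<^esub> G s i \<in> J" using s(2) by simp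
  moreover have "(r \<ominus> s) \<oplus> s = r" using r s by (simp add: minus_eq a_assoc l_neg)
  ultimately show "x \<in> J" unfolding r(3) using G_add[of "r \<ominus> s" \<zero> s i] r s ID by simp
qed

text \<open>
Along a chain of ideals of \<open>S\<close> both parts increase and become stationary, and then so does the chain.
\<close>

lemma S_noetherian: "noetherian_ring S"
proof (rule S.trivial_ideal_chain_imp_noetherian)
  interpret N: noetherian_ring R by (rule noetherian)
  fix C assume C: "C \<noteq> {}" "subset.chain {J. ideal J S} C"
  have Ci: "ideal J S" if "J \<in> C" for J using C(2) that unfolding subset.chain_def by blast
  have lin: "J \<subseteq> K \<or> K \<subseteq> J" if "J \<in> C" "K \<in> C" for J K using C(2) that unfolding subset.chain_def by blast
  have mono: "part0 J \<subseteq> part0 K" "part1 J \<subseteq> part1 K" if "J \<subseteq> K" for J K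
    using that unfolding part0_def part1_def by blast+
  have "\<exists>M\<in>part0 ` C. \<forall>K\<in>part0 ` C. M \<subseteq> K \<longrightarrow> K = M"
    by (rule N.maximal_ideal_of_family) (use C(1) Ci part0_ideal in auto)
  then obtain J0 where J0: "J0 \<in> C" "\<And>K. K \<in> C \<Longrightarrow> part0 J0 \<subseteq> part0 K \<Longrightarrow> part0 K = part0 J0" by auto
  have "\<exists>M\<in>part1 ` C. \<forall>K\<in>part1 ` C. M \<subseteq> K \<longrightarrow> K = M"
    by (rule N.maximal_ideal_of_family) (use C(1) Ci part1_ideal in auto)
  then obtain J1 where J1: "J1 \<in> C" "\<And>K. K \<in> C \<Longrightarrow> part1 J1 \<subseteq> part1 K \<Longrightarrow> part1 K = part1 J1" by auto
  obtain J where J: "J \<in> C" "J0 \<subseteq> J" "J1 \<subseteq> J" using lin[OF J0(1) J1(1)] J0(1) J1(1) by blast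
  have "K \<subseteq> J" if K: "K \<in> C" for K
  proof -
    consider "K \<subseteq> J" | "J \<subseteq> K" using lin[OF K J(1)] by blast
    then show ?thesis
    proof cases
      case 2
      have "part0 K = part0 J" 
        using J0(2)[OF K mono(1)[OF order_trans[OF J(2) 2]]] J0(2)[OF J(1) mono(1)[OF J(2)]] by simp
      moreover have "part1 K = part1 J" 
        using J1(2)[OF K mono(2)[OF order_trans[OF J(3) 2]]] J1(2)[OF J(1) mono(2)[OF J(3)]] by simp
      ultimately show ?thesis using ideal_eq_by_parts[OF Ci[OF J(1)] Ci[OF K] 2] by simp
    qed
  qed
  then have "\<Union>C = J" using J(1) by blast
  then show "\<Union>C \<in> C" using J(1) by simp
qed

lemma part0_prime:
  assumes "primeideal P S"
  shows "primeideal (part0 P) R"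
proof -
  interpret P: primeideal P S by fact
  show ?thesis
  proof (rule primeidealI[OF part0_ideal[OF P.ideal_axioms] is_cring])
    show "carrier R \<noteq> part0 P"
    proof
      assume "carrier R = part0 P"
      then have "\<one>\<^bsub>S\<^esub> \<in> P" unfolding G_one part0_def using one_closed by blast
      then show False using P.one_imp_carrier P.I_notcarr by simp
    qed
    fix r s assume rs: "r \<in> carrier R" "s \<in> carrier R" "r \<otimes> s \<in> part0 P"
    then have "G r \<zero> \<otimes>\<^bsub>S\<^esub> G s \<zero> \<in> P" using G_scalar[of r s \<zero>] ID(3) by (simp add: part0_def)
    then show "r \<in> part0 P \<or> s \<in> part0 P" using P.I_prime G_closed rs ID(3) by (simp add: part0_def)
  qed
qed

text \<open>
Incomparability for the integral extension \<open>R \<subseteq> S\<close>, by hand. If both primes had the same trace on \<open>R\<close>,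
then for \<open>x \<in> P'\<close> outside \<open>P\<close> the norm would lie in \<open>P\<close>, so the conjugate of \<open>x\<close> does; then the trace
of \<open>x\<close> lies in \<open>P'\<close>, thus in \<open>P\<close>, and with it \<open>x\<close>.
\<close>

lemma part0_strict:
  assumes P: "primeideal P S" "primeideal P' S" "P \<subset> P'"
  shows "part0 P \<subset> part0 P'"
proof -
  interpret P: primeideal P S by (rule P(1))
  interpret P': primeideal P' S by (rule P(2))
  obtain x where x: "x \<in> P'" "x \<notin> P" using P(3) by blast
  obtain r i where r: "r \<in> carrier R" "i \<in> I" "x = G r i" using G_E[OF P'.Icarr[OF x(1)]] by blast
  note c = conjugate[OF r(1,2)]
  let ?x' = "G (r \<ominus> a \<otimes> i) (\<ominus> i)"
  have x': "?x' \<in> carrier S" "x \<in> carrier S" using G_closed c(4,5) r by auto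
  have n: "norm r i \<in> part0 P'" using P'.I_r_closed[OF x(1) x'(1)] c(1,3) r(3) by (simp add: part0_def)
  have t: "r \<oplus> r \<ominus> a \<otimes> i \<in> carrier R" using r ID by simp
  have "part0 P \<subseteq> part0 P'" using P(3) unfolding part0_def by blast
  moreover have "part0 P \<noteq> part0 P'"
  proof
    assume e: "part0 P = part0 P'"
    have "norm r i \<in> part0 P" unfolding e by (rule n)
    then have "x \<otimes>\<^bsub>S\<^esub> ?x' \<in> P" using c(1) r(3) by (simp add: part0_def)
    then have x'P: "?x' \<in> P" using P.I_prime x' x(2) by blast
    then have "x \<oplus>\<^bsub>S\<^esub> ?x' \<in> P'" using x(1) P(3) by auto
    then have "r \<oplus> r \<ominus> a \<otimes> i \<in> part0 P'" using c(2) r(3) t by (simp add: part0_def)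
    then have "r \<oplus> r \<ominus> a \<otimes> i \<in> part0 P" unfolding e .
    then have "x \<oplus>\<^bsub>S\<^esub> ?x' \<in> P" using c(2) r(3) by (simp add: part0_def)
    then have "(x \<oplus>\<^bsub>S\<^esub> ?x') \<ominus>\<^bsub>S\<^esub> ?x' \<in> P" using x'P by (simp add: a_minus_def)
    moreover have "(x \<oplus>\<^bsub>S\<^esub> ?x') \<ominus>\<^bsub>S\<^esub> ?x' = x" using x' by (simp add: a_minus_def S.a_assoc S.r_neg)
    ultimately show False using x(2) by simp
  qed
  ultimately show ?thesis by blast
qed

lemma G_reg:
  assumes "reg r"
  shows "S.reg (G r \<zero>)"
  unfolding regular_element_def
proof (intro conjI ballI impI)
  have rc: "r \<in> carrier R" using regD(1)[OF assms] .
  show "G r \<zero> \<in> carrier S" using G_closed[OF rc ID(3)] .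
  fix y assume y: "y \<in> carrier S" "G r \<zero> \<otimes>\<^bsub>S\<^esub> y = \<zero>\<^bsub>S\<^esub>"
  obtain s i where s: "s \<in> carrier R" "i \<in> I" "y = G s i" using G_E[OF y(1)] .
  have "G (r \<otimes> s) (r \<otimes> i) = G \<zero> \<zero>" using y(2) G_scalar[OF rc s(1,2)] by (simp add: s(3) G_zero)
  then have "r \<otimes> s = \<zero>" "r \<otimes> i = \<zero>" using G_inj[of "r \<otimes> s" "r \<otimes> i" \<zero> \<zero>] rc s ID by auto
  then have "s = \<zero>" "i = \<zero>" using regD(2)[OF assms] s ID(1) by blast+
  then show "y = \<zero>\<^bsub>S\<^esub>" by (simp add: s(3) G_zero)
qed

lemma S_dim: "krull_dim S = 1"
proof (rule antisym)
  obtain i0 where i0: "i0 \<in> I" "reg i0" using I(3) by blast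
  have nprime: "primeideal nn S"
    by (rule S.maximalideal_prime) (use S_local in \<open>simp add: local_ring_def\<close>)
  have "G i0 \<zero> \<in> nn" using nn_iff[of i0 \<zero>] ID i0 by simp
  then obtain P0 where P0: "primeideal P0 S" "P0 \<subset> nn" using S.smaller_prime[OF S_noetherian nprime _ G_reg[OF i0(2)]] by blast
  \<comment> \<open>a chain of two primes: \<open>nn\<close> contains a regular element, hence is not minimal\<close>
  define P where "P k = (if k = 0 then P0 else nn)" for k :: nat
  have "(\<forall>k\<le>1. primeideal (P k) S) \<and> (\<forall>k<1. P k \<subset> P (Suc k))"
    using P0 nprime by (auto simp: P_def)
  then have "enat 1 \<le> krull_dim S" unfolding krull_dim_def by (intro Sup_upper) blast
  then show "1 \<le> krull_dim S" by (simp add: one_enat_def)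
  have "n \<le> 1" if P: "\<forall>k\<le>n. primeideal (P k) S" "\<forall>k<n. P k \<subset> P (Suc k)" for n P
  proof (rule ccontr)
    assume n: "\<not> n \<le> 1"
    have p: "primeideal (P 0) S" "primeideal (P 1) S" "primeideal (P 2) S" "P 0 \<subset> P 1" "P 1 \<subset> P 2"
      using P n by (auto simp: numeral_2_eq_2)
    show False
      by (rule no_prime_chain[OF dim part0_prime[OF p(1)] part0_prime[OF p(2)] part0_prime[OF p(3)]
            part0_strict[OF p(1,2,4)] part0_strict[OF p(2,3,5)]])
  qed
  then show "krull_dim S \<le> 1" unfolding krull_dim_def
    by (intro Sup_least) (auto simp: one_enat_def)
qed

theorem S_one_dim: "one_dim_ring S nn"
proof -
  obtain i0 where i0: "i0 \<in> I" "reg i0" using I(3) by blast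
  have "G i0 \<zero> \<in> nn" using nn_iff[of i0 \<zero>] ID i0 by simp
  then show ?thesis by (rule S.one_dim_ringI[OF S_noetherian S_local S_dim _ G_reg[OF i0(2)]])
qed

end

context quadratic_quotient
begin

section \<open>The ring of fractions of the quadratic quotient\<close>

abbreviation tmul (infixl "\<odot>\<^sub>S" 70) where "x \<odot>\<^sub>S y \<equiv> x \<otimes>\<^bsub>S.TF\<^esub> y"
abbreviation tadd (infixl "\<oplus>\<^sub>S" 65) where "x \<oplus>\<^sub>S y \<equiv> x \<oplus>\<^bsub>S.TF\<^esub> y"
abbreviation emS where "emS \<equiv> emb S"

text \<open>
The inclusion of \<open>Q(R)\<close> into \<open>Q(S)\<close>; the choice of the representing fraction does not matter.
\<close>

definition psi :: "('a \<times> 'a) set \<Rightarrow> ('c \<times> 'c) set" where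
  "psi q = (SOME p. \<exists>r s. r \<in> carrier R \<and> reg s \<and> q = fraction R r s \<and> p = fraction S (G r \<zero>) (G s \<zero>))"

lemma psi_fraction:
  assumes "r \<in> carrier R" "reg s"
  shows "psi (fraction R r s) = fraction S (G r \<zero>) (G s \<zero>)"
proof -
  have "\<exists>p r' s'. r' \<in> carrier R \<and> reg s' \<and> fraction R r s = fraction R r' s' \<and> p = fraction S (G r' \<zero>) (G s' \<zero>)"
    using assms by blast
  from someI_ex[OF this] obtain r' s' where 1: "r' \<in> carrier R" "reg s'" "fraction R r s = fraction R r' s'"
    and p: "psi (fraction R r s) = fraction S (G r' \<zero>) (G s' \<zero>)" unfolding psi_def by blast
  have sc: "s \<in> carrier R" "s' \<in> carrier R" using regD(1) assms 1 by blast+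
  have e: "r \<otimes> s' = r' \<otimes> s" using 1(3) fraction_eq_iff[OF assms 1(1,2)] by simp
  have "fraction S (G r' \<zero>) (G s' \<zero>) = fraction S (G r \<zero>) (G s \<zero>)"
  proof (rule S.frac_eqI)
    show "G r' \<zero> \<in> carrier S" "G r \<zero> \<in> carrier S" using G_closed[OF _ ID(3)] 1 assms by auto
    show "S.reg (G s' \<zero>)" "S.reg (G s \<zero>)" using G_reg 1 assms by auto
    show "G r' \<zero> \<otimes>\<^bsub>S\<^esub> G s \<zero> = G r \<zero> \<otimes>\<^bsub>S\<^esub> G s' \<zero>"
      unfolding G_scalar[OF 1(1) sc(1) ID(3)] G_scalar[OF assms(1) sc(2) ID(3)] e using 1 assms by simp
  qed
  then show ?thesis using p by simp
qed

lemma G0: "r \<in> carrier R \<Longrightarrow> G r \<zero> \<in> carrier S"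
  "r \<in> carrier R \<Longrightarrow> s \<in> carrier R \<Longrightarrow> G r \<zero> \<otimes>\<^bsub>S\<^esub> G s \<zero> = G (r \<otimes> s) \<zero>"
  "r \<in> carrier R \<Longrightarrow> s \<in> carrier R \<Longrightarrow> G r \<zero> \<oplus>\<^bsub>S\<^esub> G s \<zero> = G (r \<oplus> s) \<zero>"
  using G_closed[OF _ ID(3)] G_scalar[OF _ _ ID(3)] G_add[OF _ ID(3) _ ID(3)] by simp_all

lemma psi_hom:
  shows "x \<in> carrier TF \<Longrightarrow> psi x \<in> carrier S.TF"
    "x \<in> carrier TF \<Longrightarrow> y \<in> carrier TF \<Longrightarrow> psi (x \<star> y) = psi x \<odot>\<^sub>S psi y"
    "x \<in> carrier TF \<Longrightarrow> y \<in> carrier TF \<Longrightarrow> psi (x \<boxplus> y) = psi x \<oplus>\<^sub>S psi y"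
    "psi \<one>\<^bsub>TF\<^esub> = \<one>\<^bsub>S.TF\<^esub>"
proof -
  show "psi x \<in> carrier S.TF" if "x \<in> carrier TF"
    using frac_carrierE[OF that] psi_fraction G0 G_reg S.frac_carrierI by metis
  show "psi \<one>\<^bsub>TF\<^esub> = \<one>\<^bsub>S.TF\<^esub>"
    unfolding frac_one psi_fraction[OF one_closed reg_one] S.frac_one G_one ..
  assume "x \<in> carrier TF" "y \<in> carrier TF"
  then obtain r s r' s' where 1: "r \<in> carrier R" "reg s" "x = fraction R r s"
    and 2: "r' \<in> carrier R" "reg s'" "y = fraction R r' s'"
    by (elim frac_carrierE)
  have sc: "s \<in> carrier R" "s' \<in> carrier R" using regD(1) 1 2 by blast+
  show "psi (x \<star> y) = psi x \<odot>\<^sub>S psi y"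
    unfolding 1(3) 2(3) frac_mult[OF 1(1,2) 2(1,2)] psi_fraction[OF 1(1,2)] psi_fraction[OF 2(1,2)]
      psi_fraction[OF m_closed[OF 1(1) 2(1)] reg_mult[OF 1(2) 2(2)]]
      S.frac_mult[OF G0(1)[OF 1(1)] G_reg[OF 1(2)] G0(1)[OF 2(1)] G_reg[OF 2(2)]]
      G0(2)[OF 1(1) 2(1)] G0(2)[OF sc] ..
  show "psi (x \<boxplus> y) = psi x \<oplus>\<^sub>S psi y"
    unfolding 1(3) 2(3) frac_add[OF 1(1,2) 2(1,2)] psi_fraction[OF 1(1,2)] psi_fraction[OF 2(1,2)]
      psi_fraction[OF a_closed[OF m_closed[OF 1(1) sc(2)] m_closed[OF 2(1) sc(1)]] reg_mult[OF 1(2) 2(2)]]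
      S.frac_add[OF G0(1)[OF 1(1)] G_reg[OF 1(2)] G0(1)[OF 2(1)] G_reg[OF 2(2)]]
      G0(2)[OF 1(1) sc(2)] G0(2)[OF 2(1) sc(1)] G0(2)[OF sc]
      G0(3)[OF m_closed[OF 1(1) sc(2)] m_closed[OF 2(1) sc(1)]] ..
qed

lemma psi_emb: "r \<in> carrier R \<Longrightarrow> psi (emR r) = emS (G r \<zero>)"
  unfolding emb_def[of R] emb_def[of S] using psi_fraction[OF _ reg_one] G_one by simp

definition i0 :: 'a where "i0 = (SOME i. i \<in> I \<and> reg i)"

lemma i0: "i0 \<in> I" "reg i0" "i0 \<in> carrier R"
proof -
  have "\<exists>i. i \<in> I \<and> reg i" using I(3) by blast
  from someI_ex[OF this] show "i0 \<in> I" "reg i0" unfolding i0_def by simp_all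
  then show "i0 \<in> carrier R" using ID(1) by simp
qed

text \<open>
The element \<open>t\<close> is not in \<open>S\<close>, but it is the fraction \<open>i0 t / i0\<close> for any regular \<open>i0 \<in> I\<close>.
\<close>

definition tau :: "('c \<times> 'c) set" where "tau = fraction S (G \<zero> i0) (G i0 \<zero>)"
definition Psi :: "('a \<times> 'a) set \<Rightarrow> ('a \<times> 'a) set \<Rightarrow> ('c \<times> 'c) set" where
  "Psi x y = psi x \<oplus>\<^sub>S psi y \<odot>\<^sub>S tau"

interpretation ST: cring S.TF by (rule S.total_frac_cring)

lemma tau_closed: "tau \<in> carrier S.TF"
  unfolding tau_def by (rule S.frac_carrierI[OF G_closed[OF zero_closed i0(1)] G_reg[OF i0(2)]])

lemma emS_closed: "x \<in> carrier S \<Longrightarrow> emS x \<in> carrier S.TF" by (rule S.emb_closed)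

lemma Psi_emb:
  assumes r: "r \<in> carrier R" and i: "i \<in> I"
  shows "Psi (emR r) (emR i) = emS (G r i)"
proof -
  have ic: "i \<in> carrier R" using ID(1)[OF i] .
  have c: "G r \<zero> \<in> carrier S" "G \<zero> i \<in> carrier S" "G i \<zero> \<in> carrier S" "G \<zero> i0 \<in> carrier S" "G i0 \<zero> \<in> carrier S"
    using G_closed r i ic i0 ID(3) by auto
  have 1: "emS (G i \<zero>) \<odot>\<^sub>S tau = emS (G \<zero> i)"
    unfolding emb_def tau_def S.frac_mult[OF c(3) S.reg_one c(4) G_reg[OF i0(2)]]
  proof (rule S.frac_eqI)
    show "G i \<zero> \<otimes>\<^bsub>S\<^esub> G \<zero> i0 \<in> carrier S" "G \<zero> i \<in> carrier S" using c by auto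
    show "S.reg (\<one>\<^bsub>S\<^esub> \<otimes>\<^bsub>S\<^esub> G i0 \<zero>)" "S.reg \<one>\<^bsub>S\<^esub>" using S.reg_mult[OF S.reg_one G_reg[OF i0(2)]] S.reg_one by auto
    have "G i \<zero> \<otimes>\<^bsub>S\<^esub> G \<zero> i0 = G \<zero> (i \<otimes> i0)" using G_scalar[OF ic zero_closed i0(1)] ic by simp
    moreover have "G \<zero> i \<otimes>\<^bsub>S\<^esub> G i0 \<zero> = G \<zero> (i \<otimes> i0)"
      using G_scalar[OF i0(3) zero_closed i] i0(3) ic S.m_comm[OF c(2,5)] by (simp add: m_comm)
    ultimately show "G i \<zero> \<otimes>\<^bsub>S\<^esub> G \<zero> i0 \<otimes>\<^bsub>S\<^esub> \<one>\<^bsub>S\<^esub> = G \<zero> i \<otimes>\<^bsub>S\<^esub> (\<one>\<^bsub>S\<^esub> \<otimes>\<^bsub>S\<^esub> G i0 \<zero>)"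
      using c G_closed[OF zero_closed ID(6)[OF i0(3) i]] by simp
  qed
  have "emS (G r \<zero>) \<oplus>\<^sub>S emS (G \<zero> i) = emS (G r \<zero> \<oplus>\<^bsub>S\<^esub> G \<zero> i)" using S.emb_simps(2)[OF c(1,2)] by simp
  also have "G r \<zero> \<oplus>\<^bsub>S\<^esub> G \<zero> i = G r i" using G_add[OF r ID(3) zero_closed i] r ic by simp
  finally show ?thesis unfolding Psi_def psi_emb[OF r] psi_emb[OF ic] 1 .
qed

lemma tau_square: "tau \<odot>\<^sub>S tau = \<ominus>\<^bsub>S.TF\<^esub> psi (emR b) \<ominus>\<^bsub>S.TF\<^esub> psi (emR a) \<odot>\<^sub>S tau"
proof -
  let ?i = "emS (G i0 \<zero>)"
  have ic: "i0 \<in> carrier R" by (rule i0)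
  have c: "G \<zero> i0 \<in> carrier S" "G i0 \<zero> \<in> carrier S" using G_closed i0 ID(3) by auto
  have iU: "?i \<in> Units S.TF" using S.emb_unit_iff[OF c(2)] G_reg[OF i0(2)] by simp
  define A B e t where "A = psi (emR a)" and "B = psi (emR b)" and "e = ?i" and "t = tau"
  have [simp]: "A \<in> carrier S.TF" "B \<in> carrier S.TF" "e \<in> carrier S.TF" "t \<in> carrier S.TF"
    unfolding A_def B_def e_def t_def using psi_hom(1) tau_closed emS_closed c by auto
  have it: "e \<odot>\<^sub>S t = emS (G \<zero> i0)"
    unfolding e_def t_def tau_def by (rule S.frac_emb[OF c(1) G_reg[OF i0(2)]])
  let ?p = "\<ominus> (b \<otimes> (i0 \<otimes> i0))" and ?q = "\<ominus> (a \<otimes> (i0 \<otimes> i0))"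
  have pq: "?p \<in> carrier R" "?q \<in> I" "?q \<in> carrier R" using ic i0 ID by auto
  have "(e \<odot>\<^sub>S t) \<odot>\<^sub>S (e \<odot>\<^sub>S t) = emS (G \<zero> i0 \<otimes>\<^bsub>S\<^esub> G \<zero> i0)" unfolding it using S.emb_simps(3)[OF c(1) c(1)] by simp
  also have "G \<zero> i0 \<otimes>\<^bsub>S\<^esub> G \<zero> i0 = G ?p ?q" using G_mult[OF zero_closed i0(1) zero_closed i0(1)] ic by (simp add: minus_eq)
  also have "emS (G ?p ?q) = psi (emR ?p) \<oplus>\<^sub>S psi (emR ?q) \<odot>\<^sub>S t"
    unfolding Psi_emb[OF pq(1,2), symmetric] Psi_def t_def ..
  also have "psi (emR ?p) = \<ominus>\<^bsub>S.TF\<^esub> (B \<odot>\<^sub>S (e \<odot>\<^sub>S e))"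
  proof -
    have "psi (emR ?p) \<oplus>\<^sub>S B \<odot>\<^sub>S (e \<odot>\<^sub>S e) = psi (emR (?p \<oplus> b \<otimes> (i0 \<otimes> i0)))"
      unfolding B_def e_def using ic by (simp add: emb_simps psi_hom psi_emb[symmetric])
    also have "\<dots> = \<zero>\<^bsub>S.TF\<^esub>" using ic psi_emb[OF zero_closed] S.emb_zero by (simp add: l_neg G_zero)
    finally show ?thesis using psi_hom(1) pq(1) by (intro ST.minus_equality[symmetric]) auto
  qed
  also have "psi (emR ?q) = \<ominus>\<^bsub>S.TF\<^esub> (A \<odot>\<^sub>S (e \<odot>\<^sub>S e))"
  proof -
    have "psi (emR ?q) \<oplus>\<^sub>S A \<odot>\<^sub>S (e \<odot>\<^sub>S e) = psi (emR (?q \<oplus> a \<otimes> (i0 \<otimes> i0)))"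
      unfolding A_def e_def using ic by (simp add: emb_simps psi_hom psi_emb[symmetric])
    also have "\<dots> = \<zero>\<^bsub>S.TF\<^esub>" using ic psi_emb[OF zero_closed] S.emb_zero by (simp add: l_neg G_zero)
    finally show ?thesis using psi_hom(1) pq(3) by (intro ST.minus_equality[symmetric]) auto
  qed
  finally have m: "(e \<odot>\<^sub>S t) \<odot>\<^sub>S (e \<odot>\<^sub>S t) = \<ominus>\<^bsub>S.TF\<^esub> (B \<odot>\<^sub>S (e \<odot>\<^sub>S e)) \<oplus>\<^sub>S \<ominus>\<^bsub>S.TF\<^esub> (A \<odot>\<^sub>S (e \<odot>\<^sub>S e)) \<odot>\<^sub>S t" .
  have "(e \<odot>\<^sub>S e) \<odot>\<^sub>S (t \<odot>\<^sub>S t) = (e \<odot>\<^sub>S t) \<odot>\<^sub>S (e \<odot>\<^sub>S t)" by (simp add: ST.m_ac)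
  also have "\<dots> = (e \<odot>\<^sub>S e) \<odot>\<^sub>S (\<ominus>\<^bsub>S.TF\<^esub> B \<ominus>\<^bsub>S.TF\<^esub> A \<odot>\<^sub>S t)"
    unfolding m by ((simp add: ST.ring_norm; fail) | (rule ST.ring_eqI, (simp add: ST.ring_norm; fail), simp_all))
  finally have "t \<odot>\<^sub>S t = \<ominus>\<^bsub>S.TF\<^esub> B \<ominus>\<^bsub>S.TF\<^esub> A \<odot>\<^sub>S t"
    using ST.Units_l_cancel[of "e \<odot>\<^sub>S e"] iU by (simp add: e_def)
  then show ?thesis unfolding t_def A_def B_def .
qed

lemma Psi_closed: "x \<in> carrier TF \<Longrightarrow> y \<in> carrier TF \<Longrightarrow> Psi x y \<in> carrier S.TF"
  unfolding Psi_def using psi_hom(1) tau_closed by simp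

lemma Psi_add:
  assumes "x \<in> carrier TF" "y \<in> carrier TF" "x' \<in> carrier TF" "y' \<in> carrier TF"
  shows "Psi x y \<oplus>\<^sub>S Psi x' y' = Psi (x \<boxplus> x') (y \<boxplus> y')"
  unfolding Psi_def using assms psi_hom(1) tau_closed
  by (simp add: psi_hom(3) ST.l_distr ST.a_ac)

lemma psi_uminus: "x \<in> carrier TF \<Longrightarrow> psi (\<ominus>\<^bsub>TF\<^esub> x) = \<ominus>\<^bsub>S.TF\<^esub> psi x"
proof -
  assume x: "x \<in> carrier TF"
  have "psi (\<ominus>\<^bsub>TF\<^esub> x) \<oplus>\<^sub>S psi x = psi \<zero>\<^bsub>TF\<^esub>" using x psi_hom(3)[of "\<ominus>\<^bsub>TF\<^esub> x" x] by (simp add: P.l_neg)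
  also have "\<dots> = \<zero>\<^bsub>S.TF\<^esub>" using psi_emb[OF zero_closed] by (simp add: emb_zero G_zero[symmetric] S.emb_zero)
  finally show ?thesis using psi_hom(1) x by (intro ST.minus_equality[symmetric]) auto
qed

lemma Psi_mult:
  assumes xy: "x \<in> carrier TF" "y \<in> carrier TF" "x' \<in> carrier TF" "y' \<in> carrier TF"
  shows "Psi x y \<odot>\<^sub>S Psi x' y' = Psi (x \<star> x' \<boxminus> emR b \<star> (y \<star> y')) (x \<star> y' \<boxplus> x' \<star> y \<boxminus> emR a \<star> (y \<star> y'))"
proof -
  define A B p q p' q' t where "A = psi (emR a)" and "B = psi (emR b)" and "p = psi x" and "q = psi y"
    and "p' = psi x'" and "q' = psi y'" and "t = tau"
  have [simp]: "A \<in> carrier S.TF" "B \<in> carrier S.TF" "p \<in> carrier S.TF" "q \<in> carrier S.TF" "p' \<in> carrier S.TF" "q' \<in> carrier S.TF" "t \<in> carrier S.TF"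
    unfolding A_def B_def p_def q_def p'_def q'_def t_def using psi_hom(1) tau_closed xy by auto
  have t2: "t \<odot>\<^sub>S t = \<ominus>\<^bsub>S.TF\<^esub> B \<ominus>\<^bsub>S.TF\<^esub> A \<odot>\<^sub>S t" unfolding t_def A_def B_def by (rule tau_square)
  have "(p \<oplus>\<^sub>S q \<odot>\<^sub>S t) \<odot>\<^sub>S (p' \<oplus>\<^sub>S q' \<odot>\<^sub>S t) = p \<odot>\<^sub>S p' \<oplus>\<^sub>S (p \<odot>\<^sub>S q' \<oplus>\<^sub>S p' \<odot>\<^sub>S q) \<odot>\<^sub>S t \<oplus>\<^sub>S (q \<odot>\<^sub>S q') \<odot>\<^sub>S (t \<odot>\<^sub>S t)"
    by ((simp add: ST.ring_norm; fail) | (rule ST.ring_eqI, (simp add: ST.ring_norm; fail), simp_all))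
  also have "\<dots> = (p \<odot>\<^sub>S p' \<ominus>\<^bsub>S.TF\<^esub> B \<odot>\<^sub>S (q \<odot>\<^sub>S q')) \<oplus>\<^sub>S (p \<odot>\<^sub>S q' \<oplus>\<^sub>S p' \<odot>\<^sub>S q \<ominus>\<^bsub>S.TF\<^esub> A \<odot>\<^sub>S (q \<odot>\<^sub>S q')) \<odot>\<^sub>S t"
    unfolding t2 by ((simp add: ST.ring_norm; fail) | (rule ST.ring_eqI, (simp add: ST.ring_norm; fail), simp_all))
  finally show ?thesis
    unfolding Psi_def A_def B_def p_def q_def p'_def q'_def t_def using xy
    by (simp add: a_minus_def psi_hom psi_uminus)
qed

lemma Psi_one: "\<one>\<^bsub>S.TF\<^esub> = Psi \<one>\<^bsub>TF\<^esub> \<zero>\<^bsub>TF\<^esub>"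
  using Psi_emb[OF one_closed ID(3)] by (simp add: emb_one emb_zero G_one[symmetric] S.emb_one)

lemma Psi_zero: "\<zero>\<^bsub>S.TF\<^esub> = Psi \<zero>\<^bsub>TF\<^esub> \<zero>\<^bsub>TF\<^esub>"
  using Psi_emb[OF zero_closed ID(3)] by (simp add: emb_zero G_zero[symmetric] S.emb_zero)

lemma Psi_scalar:
  assumes "c \<in> carrier R" "x \<in> carrier TF" "y \<in> carrier TF"
  shows "emS (G c \<zero>) \<odot>\<^sub>S Psi x y = Psi (emR c \<star> x) (emR c \<star> y)"
  unfolding Psi_def psi_emb[OF assms(1), symmetric] using assms psi_hom(1) tau_closed
  by (simp add: psi_hom(2) ST.r_distr ST.m_assoc)

lemma Psi_eq_zero:
  assumes xy: "x \<in> carrier TF" "y \<in> carrier TF" and z: "Psi x y = \<zero>\<^bsub>S.TF\<^esub>"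
  shows "x = \<zero>\<^bsub>TF\<^esub> \<and> y = \<zero>\<^bsub>TF\<^esub>"
proof -
  obtain r s where r: "r \<in> carrier R" "reg s" "x = fraction R r s" using frac_carrierE[OF xy(1)] .
  obtain r' s' where r': "r' \<in> carrier R" "reg s'" "y = fraction R r' s'" using frac_carrierE[OF xy(2)] .
  have sc: "s \<in> carrier R" "s' \<in> carrier R" using regD(1) r r' by blast+
  define c where "c = i0 \<otimes> (s \<otimes> s')"
  have c: "c \<in> carrier R" "reg c" using i0 sc reg_mult[OF i0(2) reg_mult[OF r(2) r'(2)]] by (auto simp: c_def)
  have cx: "emR c \<star> x = emR ((i0 \<otimes> s') \<otimes> r)"
  proof -
    have "emR c \<star> x = emR (i0 \<otimes> s') \<star> (emR s \<star> x)"
      unfolding c_def using i0 sc xy by (simp add: emb_simps P.m_ac)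
    also have "emR s \<star> x = emR r" unfolding r(3) by (rule frac_emb[OF r(1,2)])
    finally show ?thesis using i0 sc r by (simp add: emb_simps)
  qed
  have cy: "emR c \<star> y = emR ((i0 \<otimes> s) \<otimes> r')"
  proof -
    have "emR c \<star> y = emR (i0 \<otimes> s) \<star> (emR s' \<star> y)"
      unfolding c_def using i0 sc xy by (simp add: emb_simps P.m_ac)
    also have "emR s' \<star> y = emR r'" unfolding r'(3) by (rule frac_emb[OF r'(1,2)])
    finally show ?thesis using i0 sc r' by (simp add: emb_simps)
  qed
  let ?u = "(i0 \<otimes> s') \<otimes> r" and ?v = "(i0 \<otimes> s) \<otimes> r'"
  have uv: "?u \<in> carrier R" "?v \<in> I" using i0 sc r r' ID(6) by auto
  have "emS (G ?u ?v) = emS (G c \<zero>) \<odot>\<^sub>S Psi x y"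
    unfolding Psi_scalar[OF c(1) xy] cx cy by (rule Psi_emb[OF uv, symmetric])
  also have "\<dots> = emS \<zero>\<^bsub>S\<^esub>" unfolding z S.emb_zero using emS_closed[OF G0(1)[OF c(1)]] by simp
  finally have "G ?u ?v = G \<zero> \<zero>" using S.emb_inj[OF G_closed[OF uv] S.zero_closed] by (simp add: G_zero)
  then have "?u = \<zero>" "?v = \<zero>" using G_inj[OF uv zero_closed ID(3)] by blast+
  then have "r = \<zero>" "r' = \<zero>"
    using regD(2)[OF reg_mult[OF i0(2) r'(2)] r(1)] regD(2)[OF reg_mult[OF i0(2) r(2)] r'(1)] by auto
  moreover have "fraction R \<zero> t = \<zero>\<^bsub>TF\<^esub>" if "reg t" for t
    unfolding frac_zero by (rule frac_eqI) (use that regD(1)[OF that] reg_one in auto)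
  ultimately show ?thesis using r r' by simp
qed

lemma Psi_inj:
  assumes "x \<in> carrier TF" "y \<in> carrier TF" "x' \<in> carrier TF" "y' \<in> carrier TF" "Psi x y = Psi x' y'"
  shows "x = x' \<and> y = y'"
proof -
  have d: "(u \<boxminus> v) \<boxplus> v = u" if "u \<in> carrier TF" "v \<in> carrier TF" for u v
    using that by (simp add: P.minus_eq P.a_assoc P.l_neg)
  have "Psi (x \<boxminus> x') (y \<boxminus> y') \<oplus>\<^sub>S Psi x' y' = Psi x' y'"
    using Psi_add[of "x \<boxminus> x'" "y \<boxminus> y'" x' y'] assms d by simp
  then have "Psi (x \<boxminus> x') (y \<boxminus> y') = \<zero>\<^bsub>S.TF\<^esub>"
    using ST.add.r_cancel_one'[of "Psi x' y'" "Psi (x \<boxminus> x') (y \<boxminus> y')"] Psi_closed assms by simp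
  then have "x \<boxminus> x' = \<zero>\<^bsub>TF\<^esub> \<and> y \<boxminus> y' = \<zero>\<^bsub>TF\<^esub>"
    using Psi_eq_zero[OF P.minus_closed[OF assms(1,3)] P.minus_closed[OF assms(2,4)]] by blast
  then show ?thesis using assms by simp
qed

lemma norm_reg:
  assumes s: "s \<in> carrier R" "j \<in> I" "S.reg (G s j)"
  shows "reg (norm s j)"
  unfolding regular_element_def
proof (intro conjI ballI impI)
  note c = conjugate[OF s(1,2)]
  have jc: "j \<in> carrier R" using ID(1)[OF s(2)] .
  show "norm s j \<in> carrier R" by (rule c(3))
  fix r assume r: "r \<in> carrier R" "norm s j \<otimes> r = \<zero>"
  let ?y = "G s j" and ?y' = "G (s \<ominus> a \<otimes> j) (\<ominus> j)" and ?r = "G r \<zero>"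
  have cl: "?y \<in> carrier S" "?y' \<in> carrier S" "?r \<in> carrier S" using G_closed s c ID(3) r by auto
  have "?y \<otimes>\<^bsub>S\<^esub> (?y' \<otimes>\<^bsub>S\<^esub> ?r) = G (norm s j) \<zero> \<otimes>\<^bsub>S\<^esub> ?r" unfolding c(1)[symmetric] using cl by (simp add: S.m_assoc)
  also have "\<dots> = \<zero>\<^bsub>S\<^esub>" unfolding G0(2)[OF c(3) r(1)] r(2) G_zero ..
  finally have y'r: "?y' \<otimes>\<^bsub>S\<^esub> ?r = \<zero>\<^bsub>S\<^esub>" using S.regD(2)[OF s(3)] cl by simp
  have "G (r \<otimes> (s \<ominus> a \<otimes> j)) (r \<otimes> (\<ominus> j)) = G \<zero> \<zero>"
    using y'r S.m_comm[OF cl(2,3)] G_scalar[OF r(1) c(4,5)] by (simp add: G_zero)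
  then have 1: "r \<otimes> (s \<ominus> a \<otimes> j) = \<zero>" "r \<otimes> (\<ominus> j) = \<zero>"
    using G_inj[of "r \<otimes> (s \<ominus> a \<otimes> j)" "r \<otimes> (\<ominus> j)" \<zero> \<zero>] r c ID by auto
  have rj: "r \<otimes> j = \<zero>" using 1(2) r(1) jc by (simp add: r_minus)
  have "r \<otimes> s = r \<otimes> (s \<ominus> a \<otimes> j) \<oplus> a \<otimes> (r \<otimes> j)"
  proof -
    have [simp]: "r \<in> carrier R" "s \<in> carrier R" "j \<in> carrier R" "a \<in> carrier R" using r s jc by auto
    show ?thesis by ((simp add: ring_norm; fail) | (rule ring_eqI, (simp add: ring_norm; fail), simp_all))
  qed
  then have rs: "r \<otimes> s = \<zero>" unfolding 1 rj by simp
  have "?y \<otimes>\<^bsub>S\<^esub> ?r = \<zero>\<^bsub>S\<^esub>"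
    using S.m_comm[OF cl(1,3)] G_scalar[OF r(1) s(1,2)] rs rj by (simp add: G_zero)
  then have "?r = \<zero>\<^bsub>S\<^esub>" using S.regD(2)[OF s(3) cl(3)] by simp
  then show "r = \<zero>" using G_inj[OF r(1) ID(3) zero_closed ID(3)] by (simp add: G_zero)
qed

text \<open>
Multiplication by the conjugate makes the denominator of a fraction an element of \<open>R\<close>.
\<close>

lemma Psi_surj:
  assumes q: "q \<in> carrier S.TF"
  shows "\<exists>x\<in>carrier TF. \<exists>y\<in>carrier TF. q = Psi x y"
proof -
  obtain n d where nd: "n \<in> carrier S" "S.reg d" "q = fraction S n d" using S.frac_carrierE[OF q] .
  have dc: "d \<in> carrier S" using S.regD(1)[OF nd(2)] .
  obtain s j where s: "s \<in> carrier R" "j \<in> I" "d = G s j" using G_E[OF dc] .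
  note c = conjugate[OF s(1,2)]
  have N: "reg (norm s j)" using norm_reg[OF s(1,2)] nd(2) s(3) by simp
  let ?y' = "G (s \<ominus> a \<otimes> j) (\<ominus> j)" and ?N = "G (norm s j) \<zero>"
  have y': "?y' \<in> carrier S" using G_closed[OF c(4,5)] .
  obtain u v where uv: "u \<in> carrier R" "v \<in> I" "n \<otimes>\<^bsub>S\<^esub> ?y' = G u v" using G_E[of "n \<otimes>\<^bsub>S\<^esub> ?y'"] nd(1) y' by auto
  have vc: "v \<in> carrier R" using ID(1)[OF uv(2)] .
  have Nc: "?N \<in> carrier S" using G0(1)[OF c(3)] .
  have "d \<otimes>\<^bsub>S\<^esub> ?y' = ?N" unfolding s(3) by (rule c(1))
  then have "n \<otimes>\<^bsub>S\<^esub> ?N = (n \<otimes>\<^bsub>S\<^esub> ?y') \<otimes>\<^bsub>S\<^esub> d" using nd(1) dc y' S.m_comm[OF dc y'] by (simp add: S.m_assoc)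
  then have qe: "q = fraction S (G u v) ?N"
    unfolding nd(3) uv(3) by (rule S.frac_eqI[OF nd(1,2) G_closed[OF uv(1,2)] G_reg[OF N]])
  let ?x = "fraction R u (norm s j)" and ?y = "fraction R v (norm s j)"
  have xy: "?x \<in> carrier TF" "?y \<in> carrier TF" using frac_carrierI[OF uv(1) N] frac_carrierI[OF vc N] by auto
  have "emS ?N \<odot>\<^sub>S Psi ?x ?y = emS ?N \<odot>\<^sub>S q"
    unfolding Psi_scalar[OF c(3) xy] frac_emb[OF uv(1) N] frac_emb[OF vc N] Psi_emb[OF uv(1,2)]
      qe S.frac_emb[OF G_closed[OF uv(1,2)] G_reg[OF N]] ..
  moreover have "emS ?N \<in> Units S.TF" using S.emb_unit_iff[OF Nc] G_reg[OF N] by simp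
  ultimately have "Psi ?x ?y = q" using ST.Units_l_cancel[OF _ Psi_closed[OF xy] q] by simp
  then show ?thesis using xy by blast
qed

theorem total_frac_extension:
  "quadratic_extension TF (base R) (emR ` \<mm>) S.TF (base S) (emS ` nn) Psi (emR a) (emR b) (emR ` I)"
proof (intro quadratic_extension.intro quadratic_extension_axioms.intro)
  show "one_dim_local_pair TF (base R) (emR ` \<mm>)" by (rule pair)
  show "one_dim_local_pair S.TF (base S) (emS ` nn)" by (rule one_dim_ring.pair[OF S_one_dim])
  show "P.smod (emR ` I)" by (rule emb_ideal_submod[OF I(1)])
  show "emR ` I \<subseteq> emR ` \<mm>" using I(2) by blast
  show "emR ` I \<inter> Units TF \<noteq> {}" using i0 emb_unit_iff[OF i0(3)] by blast
  show "emR a \<in> base R" "emR b \<in> base R" by auto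
  show "base S = {Psi r i | r i. r \<in> base R \<and> i \<in> emR ` I}"
  proof (intro equalityI subsetI)
    fix q assume "q \<in> base S"
    then obtain x where x: "x \<in> carrier S" "q = emS x" by blast
    obtain r i where r: "r \<in> carrier R" "i \<in> I" "x = G r i" using G_E[OF x(1)] .
    show "q \<in> {Psi r i | r i. r \<in> base R \<and> i \<in> emR ` I}" unfolding x(2) r(3) Psi_emb[OF r(1,2), symmetric] using r by blast
  next
    fix q assume "q \<in> {Psi r i | r i. r \<in> base R \<and> i \<in> emR ` I}"
    then obtain r i where r: "r \<in> carrier R" "i \<in> I" "q = Psi (emR r) (emR i)" by blast
    show "q \<in> base S" unfolding r(3) Psi_emb[OF r(1,2)] using G_closed[OF r(1,2)] by blast
  qed
  show "emS ` nn = {Psi r i | r i. r \<in> emR ` \<mm> \<and> i \<in> emR ` I}"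
  proof (intro equalityI subsetI)
    fix q assume "q \<in> emS ` nn"
    then obtain r i where r: "r \<in> \<mm>" "i \<in> I" "q = emS (G r i)" unfolding nn_def by blast
    show "q \<in> {Psi r i | r i. r \<in> emR ` \<mm> \<and> i \<in> emR ` I}"
      unfolding r(3) Psi_emb[OF mm_carrier[OF r(1)] r(2), symmetric] using r by blast
  next
    fix q assume "q \<in> {Psi r i | r i. r \<in> emR ` \<mm> \<and> i \<in> emR ` I}"
    then obtain r i where r: "r \<in> \<mm>" "i \<in> I" "q = Psi (emR r) (emR i)" by blast
    show "q \<in> emS ` nn" unfolding r(3) Psi_emb[OF mm_carrier[OF r(1)] r(2)] nn_def using r by blast
  qed
qed (fact Psi_closed Psi_surj Psi_inj Psi_add Psi_mult Psi_one)+

end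

section \<open>Minimal reductions of fractional ideals\<close>

context cring
begin

lemma ideal_prod_principal:
  assumes L: "ideal L R" and x: "x \<in> carrier R" and e: "e \<in> ideal_prod R (PIdl x) L"
  shows "\<exists>l\<in>L. e = x \<otimes> l"
  using e
proof (induction rule: ideal_prod.induct)
  case (prod i j)
  interpret L: ideal L R by (rule L)
  obtain c where c: "c \<in> carrier R" "i = c \<otimes> x" using prod(1) unfolding cgenideal_def by blast
  have j: "j \<in> carrier R" using prod(2) L.a_subset by blast
  have "i \<otimes> j = x \<otimes> (c \<otimes> j)" using c x j by (simp add: m_ac)
  then show ?case using L.I_l_closed[OF prod(2) c(1)] by blast
next
  case (sum s1 s2)
  interpret L: ideal L R by (rule L)
  obtain l1 l2 where l: "l1 \<in> L" "s1 = x \<otimes> l1" "l2 \<in> L" "s2 = x \<otimes> l2" using sum by blast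
  have c: "l1 \<in> carrier R" "l2 \<in> carrier R" using l L.a_subset by blast+
  have "s1 \<oplus> s2 = x \<otimes> (l1 \<oplus> l2)" unfolding l(2,4) using c x by (simp add: r_distr)
  then show ?case using L.a_closed[OF l(1,3)] by blast
qed

end

context one_dim_ring
begin

lemma frac_scale_inverse:
  assumes z: "z \<in> Units TF" and H: "H \<subseteq> carrier TF"
  shows "frac_scale R (inv\<^bsub>TF\<^esub> z) H = {x \<in> carrier TF. z \<star> x \<in> H}"
proof (intro equalityI subsetI)
  have zc: "z \<in> carrier TF" "inv\<^bsub>TF\<^esub> z \<in> carrier TF" using z by auto
  have c: "z \<star> (inv\<^bsub>TF\<^esub> z \<star> x) = x" "inv\<^bsub>TF\<^esub> z \<star> (z \<star> x) = x" if "x \<in> carrier TF" for x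
    using that zc z by (simp_all add: P.m_assoc[symmetric])
  show "x \<in> {x \<in> carrier TF. z \<star> x \<in> H}" if x: "x \<in> frac_scale R (inv\<^bsub>TF\<^esub> z) H" for x
  proof -
    obtain h where h: "h \<in> H" "x = inv\<^bsub>TF\<^esub> z \<star> h" using x unfolding frac_scale_def by blast
    have "h \<in> carrier TF" using H h(1) by blast
    then show ?thesis using c(1)[of h] h zc by simp
  qed
  show "x \<in> frac_scale R (inv\<^bsub>TF\<^esub> z) H" if x: "x \<in> {x \<in> carrier TF. z \<star> x \<in> H}" for x
  proof -
    have "x \<in> carrier TF" "z \<star> x \<in> H" using x by auto
    then show ?thesis unfolding frac_scale_def using c(2)[of x] by (intro image_eqI[of _ _ "z \<star> x"]) auto
  qed
qed

text \<open>
Clearing denominators, let \<open>K = yH\<close> and let \<open>xK\<^sup>n = K\<^sup>n\<^sup>+\<^sup>1\<close>; then \<open>x/y\<close> generates the same module as \<open>z\<close>. Since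
\<open>K\<close> contains a regular element, \<open>x\<close> is regular and \<open>z\<close> is a unit. The ideal \<open>B = K\<^sup>n\<close> is stable under
\<open>z\<^sup>-\<^sup>1H\<close>, because \<open>HK\<^sup>n = y\<^sup>-\<^sup>1K\<^sup>n\<^sup>+\<^sup>1 = zK\<^sup>n\<close>. In this form the reduction expresses that \<open>H\<close> is integral
over \<open>z\<close>.
\<close>

lemma minimal_reduction_data:
  assumes H: "P.smod H" and w: "w \<in> H" "w \<in> Units TF" and zc: "z \<in> carrier TF"
    and red: "frac_minimal_reduction R H (frac_scale R z (base R))"
  shows "z \<in> Units TF" "z \<in> H"
    "\<exists>B. P.smod B \<and> B \<subseteq> base R \<and> B \<inter> Units TF \<noteq> {} \<and>
       (\<forall>q\<in>carrier TF. z \<star> q \<in> H \<longrightarrow> (\<forall>\<kappa>\<in>B. q \<star> \<kappa> \<in> B))"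
proof -
  note HD = P.smodD[OF H]
  obtain x y where x: "x \<in> carrier R" and y: "reg y" and yH: "frac_scale R (emR y) H \<subseteq> base R"
    and mr: "minimal_reduction R {r \<in> carrier R. emR r \<in> frac_scale R (emR y) H} (PIdl x)"
    and Z: "frac_scale R z (base R) = frac_scale R (fraction R x y) (base R)"
    using red unfolding frac_minimal_reduction_def by blast
  define K where "K = {r \<in> carrier R. emR r \<in> frac_scale R (emR y) H}"
  have yc: "y \<in> carrier R" using regD(1)[OF y] .
  have ec: "emR r \<in> carrier TF" if "r \<in> carrier R" for r using emb_simps(1)[OF that that] .
  have yu: "emR y \<in> Units TF" using emb_unit_iff[OF yc] y by blast
  have "reduction R K (PIdl x)" using mr unfolding minimal_reduction_def K_def by blast
  then obtain n where K: "ideal K R" "PIdl x \<subseteq> K" and n: "ideal_prod R (PIdl x) (ideal_pow R K n) = ideal_pow R K (Suc n)"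
    unfolding reduction_def by blast
  note ip = ideal_pow_props[OF K(1)]
  have Kc: "k \<in> carrier R" if "k \<in> K" for k using that unfolding K_def by simp
  have toK: "\<exists>k\<in>K. emR k = emR y \<star> h" if h: "h \<in> H" for h
  proof -
    have "emR y \<star> h \<in> frac_scale R (emR y) H" using h unfolding frac_scale_def by blast
    moreover from this obtain k where "k \<in> carrier R" "emR y \<star> h = emR k" using yH by blast
    ultimately show ?thesis unfolding K_def by auto
  qed
  have fromK: "\<exists>h\<in>H. emR k = emR y \<star> h" if "k \<in> K" for k using that unfolding K_def frac_scale_def by blast
  have prodK: "\<exists>l\<in>ideal_pow R K n. k \<otimes> \<kappa> = x \<otimes> l" if "k \<in> K" "\<kappa> \<in> ideal_pow R K n" for k \<kappa>
  proof (rule ideal_prod_principal[OF ip(1) x])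
    have "k \<in> ideal_pow R K 1" unfolding ip(3) by (rule that(1))
    then have "k \<otimes> \<kappa> \<in> ideal_pow R K (1 + n)" using that(2) by (rule ip(4))
    then show "k \<otimes> \<kappa> \<in> ideal_prod R (PIdl x) (ideal_pow R K n)" unfolding n by simp
  qed
  have powc: "l \<in> carrier R" if "l \<in> ideal_pow R K n" for l
    using additive_subgroup.a_subset[OF ideal.axioms(1)[OF ip(1)]] that by blast
  obtain k0 where k0: "k0 \<in> K" "emR k0 = emR y \<star> w" using toK[OF w(1)] by blast
  have k0r: "reg k0" using emb_unit_iff[OF Kc[OF k0(1)]] P.Units_m_closed[OF yu w(2)] k0(2) by simp
  have kpow: "k0 [^] m \<in> ideal_pow R K m" for m :: nat
  proof (induction m)
    case 0 show ?case unfolding ip(2) by simp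
  next
    case (Suc m)
    have "k0 \<in> ideal_pow R K 1" unfolding ip(3) by (rule k0(1))
    then have "k0 [^] m \<otimes> k0 \<in> ideal_pow R K (m + 1)" using Suc by (intro ip(4))
    moreover have "k0 [^] Suc m = k0 [^] m \<otimes> k0" by simp
    ultimately show ?case by (simp only: Suc_eq_plus1)
  qed
  have xr: "reg x"
  proof -
    obtain l where l: "l \<in> ideal_pow R K n" "k0 \<otimes> k0 [^] n = x \<otimes> l" using prodK[OF k0(1) kpow] by blast
    have "reg (x \<otimes> l)" using reg_mult[OF k0r reg_power[OF k0r, of n]] l(2) by simp
    then have "emR x \<star> emR l \<in> Units TF"
      using emb_unit_iff[of "x \<otimes> l"] emb_simps(3)[OF x powc[OF l(1)]] x powc[OF l(1)] by simp
    then show ?thesis using P.unit_factor[of "emR x" "emR l"] ec x powc[OF l(1)] emb_unit_iff[OF x] by simp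
  qed
  have fc: "fraction R x y \<in> carrier TF" using frac_carrierI[OF x y] .
  have one: "\<one>\<^bsub>TF\<^esub> \<in> base R" by simp
  have "fraction R x y \<star> \<one>\<^bsub>TF\<^esub> \<in> frac_scale R z (base R)" unfolding Z unfolding frac_scale_def using one by blast
  then obtain e' where e': "e' \<in> base R" "fraction R x y \<star> \<one>\<^bsub>TF\<^esub> = z \<star> e'" unfolding frac_scale_def by blast
  have e'c: "e' \<in> carrier TF" using e'(1) P.A_carr by blast
  have xy: "fraction R x y = z \<star> e'" using e'(2) fc by simp
  have "z \<star> \<one>\<^bsub>TF\<^esub> \<in> frac_scale R (fraction R x y) (base R)" unfolding Z[symmetric] unfolding frac_scale_def using one by blast
  then obtain e where e: "e \<in> base R" "z \<star> \<one>\<^bsub>TF\<^esub> = fraction R x y \<star> e" unfolding frac_scale_def by blast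
  have ze: "z = e \<star> fraction R x y" using e zc fc P.A_carr[OF e(1)] P.m_comm by simp
  show zU: "z \<in> Units TF" using P.unit_factor[of z e'] frac_inverse(1)[OF xr y] xy zc e'c by simp
  have "x \<in> K" using K(2) cgenideal_self[OF x] by blast
  then obtain h where h: "h \<in> H" "emR x = emR y \<star> h" using fromK by blast
  have xe: "emR x = emR y \<star> fraction R x y" using frac_emb[OF x y] by simp
  have "h = fraction R x y" using P.unit_cancel[OF yu HD(1)[OF h(1)] fc] h(2) xe by simp
  then show "z \<in> H" using HD(4)[OF e(1) h(1)] ze by simp
  let ?B = "emR ` ideal_pow R K n"
  have Bs: "P.smod ?B" by (rule emb_ideal_submod[OF ip(1)])
  have xu: "emR x \<in> Units TF" using emb_unit_iff[OF x] xr by blast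
  have stable: "q \<star> emR \<kappa> \<in> ?B" if q: "q \<in> carrier TF" "z \<star> q \<in> H" and k: "\<kappa> \<in> ideal_pow R K n" for q \<kappa>
  proof -
    obtain k1 where k1: "k1 \<in> K" "emR k1 = emR y \<star> (z \<star> q)" using toK[OF q(2)] by blast
    obtain l where l: "l \<in> ideal_pow R K n" "k1 \<otimes> \<kappa> = x \<otimes> l" using prodK[OF k1(1) k] by blast
    note cs [simp] = q(1) zc e'c ec[OF yc] ec[OF x] ec[OF powc[OF k]] ec[OF powc[OF l(1)]] ec[OF Kc[OF k1(1)]]
    have "emR x \<star> (q \<star> emR \<kappa>) = e' \<star> ((emR y \<star> (z \<star> q)) \<star> emR \<kappa>)"
      unfolding xe xy by (simp add: P.m_ac)
    also have "\<dots> = e' \<star> (emR x \<star> emR l)"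
      unfolding k1(2)[symmetric] emb_simps(3)[OF Kc[OF k1(1)] powc[OF k], symmetric]
        emb_simps(3)[OF x powc[OF l(1)], symmetric] l(2) by (rule refl)
    also have "\<dots> = emR x \<star> (e' \<star> emR l)" by (rule P.m_lcomm[OF cs(3,5,7)])
    finally have "q \<star> emR \<kappa> = e' \<star> emR l"
      by (rule P.unit_cancel[OF xu P.m_closed[OF cs(1,6)] P.m_closed[OF cs(3,7)]])
    moreover have "e' \<star> emR l \<in> ?B" by (rule P.smodD(4)[OF Bs e'(1) imageI[OF l(1)]])
    ultimately show ?thesis by simp
  qed
  have "emR (k0 [^] n) \<in> Units TF" using emb_unit_iff[of "k0 [^] n"] reg_power[OF k0r, of n] Kc[OF k0(1)] by simp
  then have "?B \<inter> Units TF \<noteq> {}" using kpow[of n] by blast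
  moreover have "?B \<subseteq> base R" using powc by blast
  ultimately show "\<exists>B. P.smod B \<and> B \<subseteq> base R \<and> B \<inter> Units TF \<noteq> {} \<and>
       (\<forall>q\<in>carrier TF. z \<star> q \<in> H \<longrightarrow> (\<forall>\<kappa>\<in>B. q \<star> \<kappa> \<in> B))"
    using Bs stable by blast
qed

section \<open>Almost Gorenstein quadratic quotients\<close>

lemma almost_gorenstein_iff:
  assumes dim: "krull_dim R = 1"
  shows "almost_gorenstein R \<longleftrightarrow> (\<exists>\<Omega>. dualizing TF (base R) \<Omega> \<and> base R \<subseteq> \<Omega> \<and>
    (\<forall>q\<in>\<Omega>. \<forall>\<mu>\<in>emR ` \<mm>. q \<star> \<mu> \<in> emR ` \<mm>))"
proof
  have one: "\<one>\<^bsub>TF\<^esub> \<in> \<Omega>" if "base R \<subseteq> \<Omega>" for \<Omega> using that P.A_closed(2) by blast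
  assume "almost_gorenstein R"
  then obtain \<nn> \<Omega> where cm: "cohen_macaulay_local R \<nn>" and om: "canonical_fractional_ideal R \<nn> \<Omega>"
      "base R \<subseteq> \<Omega>" "\<Omega> \<subseteq> frac_colon R (emR ` \<nn>) (emR ` \<nn>)" unfolding almost_gorenstein_def by blast
  have "maximalideal \<nn> R" using cm unfolding cohen_macaulay_local_def local_ring_def by blast
  then have e: "\<nn> = \<mm>" by (rule maxid_unique)
  have dz: "dualizing TF (base R) \<Omega>"
    using canonical_fractional_ideal_iff[OF one[OF om(2)] P.Units_one_closed] om(1) unfolding e by blast
  show "\<exists>\<Omega>. dualizing TF (base R) \<Omega> \<and> base R \<subseteq> \<Omega> \<and> (\<forall>q\<in>\<Omega>. \<forall>\<mu>\<in>emR ` \<mm>. q \<star> \<mu> \<in> emR ` \<mm>)"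
  proof (intro exI[of _ \<Omega>] conjI ballI)
    show "q \<star> \<mu> \<in> emR ` \<mm>" if "q \<in> \<Omega>" "\<mu> \<in> emR ` \<mm>" for q \<mu>
    proof -
      have "q \<in> frac_colon R (emR ` \<mm>) (emR ` \<mm>)" using om(3) that(1) unfolding e by (rule subsetD)
      then show ?thesis using that(2) unfolding frac_colon_def by blast
    qed
  qed (fact dz om(2))+
next
  have one: "\<one>\<^bsub>TF\<^esub> \<in> \<Omega>" if "base R \<subseteq> \<Omega>" for \<Omega> using that P.A_closed(2) by blast
  assume "\<exists>\<Omega>. dualizing TF (base R) \<Omega> \<and> base R \<subseteq> \<Omega> \<and> (\<forall>q\<in>\<Omega>. \<forall>\<mu>\<in>emR ` \<mm>. q \<star> \<mu> \<in> emR ` \<mm>)"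
  then obtain \<Omega> where om: "dualizing TF (base R) \<Omega>" "base R \<subseteq> \<Omega>"
      "\<forall>q\<in>\<Omega>. \<forall>\<mu>\<in>emR ` \<mm>. q \<star> \<mu> \<in> emR ` \<mm>"
    by (elim exE conjE) (rule that)
  have "canonical_fractional_ideal R \<mm> \<Omega>"
    by (rule iffD2[OF canonical_fractional_ideal_iff[OF one[OF om(2)] P.Units_one_closed] om(1)])
  moreover have "\<Omega> \<subseteq> frac_colon R (emR ` \<mm>) (emR ` \<mm>)"
  proof
    fix q assume q: "q \<in> \<Omega>"
    show "q \<in> frac_colon R (emR ` \<mm>) (emR ` \<mm>)" unfolding frac_colon_def
      by (rule CollectI, rule conjI[OF P.smodD(1)[OF P.dualizingD(2)[OF om(1)] q] bspec[OF om(3) q]])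
  qed
  ultimately show "almost_gorenstein R"
    unfolding almost_gorenstein_def using cohen_macaulay[OF dim] dim om(2) by (intro exI[of _ \<mm>] exI[of _ \<Omega>] conjI)
qed

text \<open>
As \<open>z \<in> (\<omega> : I)\<close>, the module \<open>V = z\<^sup>-\<^sup>1(\<omega> : I)\<close> contains \<open>R\<close>, so that the three conditions on \<open>V\<close> reduce to
\<open>VV \<subseteq> V\<close> and \<open>V\<mm> \<subseteq> \<mm>\<close>. These are the conclusions of \<open>almost_gorenstein_imp_ring\<close> and the hypotheses of
\<open>ring_imp_almost_gorenstein\<close>.
\<close>

theorem almost_gorenstein_rees_quotient_iff:
  assumes dim: "krull_dim R = 1" and I: "ideal I R" "I \<subseteq> \<mm>" "\<exists>i\<in>I. reg i"
    and om: "canonical_fractional_ideal R \<mm> \<omega>" "base R \<subseteq> \<omega>"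
    and zred: "z \<in> carrier TF" "frac_minimal_reduction R (frac_colon R \<omega> (emR ` I)) (frac_scale R z (base R))"
    and ab: "a \<in> carrier R" "b \<in> carrier R"
  shows "almost_gorenstein (rees_quotient R I a b) \<longleftrightarrow>
           subring (frac_scale R (inv\<^bsub>TF\<^esub> z) (frac_colon R \<omega> (emR ` I))) TF \<and>
           base R \<subseteq> frac_scale R (inv\<^bsub>TF\<^esub> z) (frac_colon R \<omega> (emR ` I)) \<and>
           frac_scale R (inv\<^bsub>TF\<^esub> z) (frac_colon R \<omega> (emR ` I)) \<subseteq> frac_colon R (emR ` \<mm>) (emR ` \<mm>)"
proof -
  have "\<zero> \<in> \<mm>" using additive_subgroup.zero_closed[OF ideal.axioms(1)[OF mm_ideal]] .
  then have nontriv: "\<one> \<noteq> \<zero>" using one_not_mm by metis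
  let ?H = "frac_colon R \<omega> (emR ` I)"
  let ?S = "rees_quotient R I a b"
  obtain g where g: "g \<in> ring_iso (quad_ring R I a b) ?S" using rees_quotient_iso(2)[OF nontriv I(1) ab] by blast
  interpret QQ: quadratic_quotient R \<mm> ?S I a b g
    by (intro quadratic_quotient.intro quadratic_quotient_axioms.intro one_dim_ring_axioms
        rees_quotient_iso(1)[OF nontriv I(1) ab] dim I ab g)
  interpret S: one_dim_ring ?S QQ.nn by (rule QQ.S_one_dim)
  interpret X: quadratic_extension TF "base R" "emR ` \<mm>" "total_frac ?S" "base ?S" "emb ?S ` QQ.nn"
      QQ.Psi "emR a" "emR b" "emR ` I"
    by (rule QQ.total_frac_extension)
  have one\<omega>: "\<one>\<^bsub>TF\<^esub> \<in> \<omega>" using om(2) P.A_closed(2) by blast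
  have W: "dualizing TF (base R) \<omega>"
    using canonical_fractional_ideal_iff[OF one\<omega> P.Units_one_closed] om(1) by blast
  have Id: "?H = X.dual_J \<omega>" unfolding frac_colon_def X.dual_J_def by simp
  have Hs: "P.smod ?H" unfolding Id by (rule X.dual_J_smod[OF W])
  have "\<one>\<^bsub>TF\<^esub> \<in> ?H" unfolding Id by (rule X.W_sub_dual_J[OF W one\<omega>])
  note red = minimal_reduction_data[OF Hs this P.Units_one_closed zred]
  define V where "V = frac_scale R (inv\<^bsub>TF\<^esub> z) ?H"
  have V: "V = X.reduced_dual \<omega> z"
    unfolding V_def X.reduced_dual_def[OF W] Id[symmetric]
    by (rule frac_scale_inverse[OF red(1)]) (use P.smodD(1)[OF Hs] in blast)
  have V_iff: "x \<in> V \<longleftrightarrow> x \<in> carrier TF \<and> z \<otimes>\<^bsub>TF\<^esub> x \<in> ?H" for x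
    unfolding V X.reduced_dual_def[OF W] Id[symmetric] by simp
  have Vc: "x \<in> carrier TF" if "x \<in> V" for x using that V_iff by blast
  have "P.smod V"
  proof -
    have "P.smod {x \<in> carrier TF. \<forall>j\<in>{z}. x \<otimes>\<^bsub>TF\<^esub> j \<in> ?H}"
      by (rule P.smod_colon[OF Hs]) (use zred(1) in simp)
    moreover have "V = {x \<in> carrier TF. \<forall>j\<in>{z}. x \<otimes>\<^bsub>TF\<^esub> j \<in> ?H}"
      using V_iff P.m_comm[OF zred(1)] by auto
    ultimately show ?thesis by simp
  qed
  note VD = P.smodD[OF this] and Vu = P.smod_uminus[OF this]
  have oneV: "\<one>\<^bsub>TF\<^esub> \<in> V" using V_iff red(2) zred(1) by simp
  have baseV: "base R \<subseteq> V"
  proof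
    fix r assume "r \<in> base R"
    then show "r \<in> V" using VD(4)[OF _ oneV, of r] P.A_carr[of r] by simp
  qed
  have char: "almost_gorenstein ?S \<longleftrightarrow>
      (\<forall>x\<in>V. \<forall>y\<in>V. x \<otimes>\<^bsub>TF\<^esub> y \<in> V) \<and> (\<forall>x\<in>V. \<forall>r\<in>emR ` \<mm>. x \<otimes>\<^bsub>TF\<^esub> r \<in> emR ` \<mm>)" (is "_ \<longleftrightarrow> ?stable")
  proof
    assume ag: "almost_gorenstein ?S"
    obtain \<Omega> where \<Omega>: "dualizing (total_frac ?S) (base ?S) \<Omega>" "base ?S \<subseteq> \<Omega>"
        "\<forall>q\<in>\<Omega>. \<forall>\<mu>\<in>emb ?S ` QQ.nn. q \<otimes>\<^bsub>total_frac ?S\<^esub> \<mu> \<in> emb ?S ` QQ.nn"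
      by (rule exE[OF iffD1[OF S.almost_gorenstein_iff[OF QQ.S_dim] ag]], elim conjE) (rule that)
    obtain B where B: "P.smod B" "B \<subseteq> base R" "B \<inter> Units TF \<noteq> {}"
        "\<forall>x\<in>carrier TF. z \<otimes>\<^bsub>TF\<^esub> x \<in> ?H \<longrightarrow> (\<forall>y\<in>B. x \<otimes>\<^bsub>TF\<^esub> y \<in> B)"
      by (rule exE[OF red(3)], elim conjE) (rule that)
    have VB: "x \<otimes>\<^bsub>TF\<^esub> y \<in> B" if "x \<in> X.reduced_dual \<omega> z" "y \<in> B" for x y
    proof -
      have "x \<in> carrier TF" "z \<otimes>\<^bsub>TF\<^esub> x \<in> ?H" using that(1) V_iff[of x] unfolding V by simp_all
      then show ?thesis using B(4) that(2) by simp
    qed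
    have Vn: "q \<otimes>\<^bsub>total_frac ?S\<^esub> \<mu> \<in> emb ?S ` QQ.nn" if "q \<in> \<Omega>" "\<mu> \<in> emb ?S ` QQ.nn" for q \<mu>
      by (rule bspec[OF bspec[OF \<Omega>(3) that(1)] that(2)])
    note c = X.almost_gorenstein_imp_ring[OF W red(1) red(2)[unfolded Id] B(1,2,3) VB \<Omega>(1,2) Vn]
    show ?stable unfolding V by (intro conjI ballI c)
  next
    assume st: ?stable
    have "\<exists>\<Omega>. dualizing (total_frac ?S) (base ?S) \<Omega> \<and> base ?S \<subseteq> \<Omega> \<and>
        (\<forall>q\<in>\<Omega>. \<forall>\<mu>\<in>emb ?S ` QQ.nn. q \<otimes>\<^bsub>total_frac ?S\<^esub> \<mu> \<in> emb ?S ` QQ.nn)"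
    proof (rule X.ring_imp_almost_gorenstein[OF W red(1)])
      show "\<one>\<^bsub>TF\<^esub> \<in> X.reduced_dual \<omega> z" using oneV unfolding V .
      show "x \<otimes>\<^bsub>TF\<^esub> y \<in> X.reduced_dual \<omega> z" if "x \<in> X.reduced_dual \<omega> z" "y \<in> X.reduced_dual \<omega> z" for x y
        by (rule bspec[OF bspec[OF conjunct1[OF st[unfolded V]] that(1)] that(2)])
      show "x \<otimes>\<^bsub>TF\<^esub> r \<in> emR ` \<mm>" if "x \<in> X.reduced_dual \<omega> z" "r \<in> emR ` \<mm>" for x r
        by (rule bspec[OF bspec[OF conjunct2[OF st[unfolded V]] that(1)] that(2)])
    qed
    then show "almost_gorenstein ?S" unfolding S.almost_gorenstein_iff[OF QQ.S_dim] .
  qed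
  have sub: "subring V TF \<longleftrightarrow> (\<forall>x\<in>V. \<forall>y\<in>V. x \<otimes>\<^bsub>TF\<^esub> y \<in> V)"
  proof
    assume "subring V TF"
    then show "\<forall>x\<in>V. \<forall>y\<in>V. x \<otimes>\<^bsub>TF\<^esub> y \<in> V" by (intro ballI subringE(6))
  next
    assume m: "\<forall>x\<in>V. \<forall>y\<in>V. x \<otimes>\<^bsub>TF\<^esub> y \<in> V"
    show "subring V TF"
    proof (rule P.subringI)
      show "V \<subseteq> carrier TF" using Vc by (rule subsetI)
      show "x \<otimes>\<^bsub>TF\<^esub> y \<in> V" if "x \<in> V" "y \<in> V" for x y using m that by simp
    qed (fact oneV Vu VD(3))+
  qed
  have col: "V \<subseteq> frac_colon R (emR ` \<mm>) (emR ` \<mm>) \<longleftrightarrow> (\<forall>x\<in>V. \<forall>r\<in>emR ` \<mm>. x \<otimes>\<^bsub>TF\<^esub> r \<in> emR ` \<mm>)" (is "_ \<longleftrightarrow> ?m")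
  proof
    assume c: "V \<subseteq> frac_colon R (emR ` \<mm>) (emR ` \<mm>)"
    have "\<forall>r\<in>emR ` \<mm>. x \<otimes>\<^bsub>TF\<^esub> r \<in> emR ` \<mm>" if "x \<in> V" for x
      using subsetD[OF c that] unfolding frac_colon_def mem_Collect_eq by (rule conjunct2)
    then show ?m by (rule ballI)
  next
    assume m: ?m
    show "V \<subseteq> frac_colon R (emR ` \<mm>) (emR ` \<mm>)"
    proof
      fix x assume x: "x \<in> V"
      show "x \<in> frac_colon R (emR ` \<mm>) (emR ` \<mm>)"
        unfolding frac_colon_def by (rule CollectI, rule conjI[OF Vc[OF x] bspec[OF m x]])
    qed
  qed
  show ?thesis unfolding V_def[symmetric] char sub col
    by (rule iffI, elim conjE, intro conjI baseV, assumption+, elim conjE, intro conjI, assumption+)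
qed

end

theorem corollary2p4:
  fixes R :: "('a, 'm) ring_scheme"
    and \<mm> I :: "'a set"
    and \<omega> Idual :: "('a \<times> 'a) set set"
    and z :: "('a \<times> 'a) set"
    and a b :: 'a
  assumes "cohen_macaulay_local R \<mm>"
    and "krull_dim R = 1"
    and "infinite (carrier (R Quot \<mm>))"
    and "canonical_fractional_ideal R \<mm> \<omega>"
    and "base R \<subseteq> \<omega>" and "\<omega> \<subseteq> integral_closure R"
    and "primary_ideal R I" and "radical R I = \<mm>"
    and "Idual = frac_colon R \<omega> (emb R ` I)"
    and "z \<in> carrier (total_frac R)"
    and "frac_minimal_reduction R Idual (frac_scale R z (base R))"
    and "a \<in> carrier R" and "b \<in> carrier R"
  shows "almost_gorenstein (rees_quotient R I a b) \<longleftrightarrow>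
           subring (frac_scale R (inv\<^bsub>total_frac R\<^esub> z) Idual) (total_frac R) \<and>
           base R \<subseteq> frac_scale R (inv\<^bsub>total_frac R\<^esub> z) Idual \<and>
           frac_scale R (inv\<^bsub>total_frac R\<^esub> z) Idual \<subseteq> frac_colon R (emb R ` \<mm>) (emb R ` \<mm>)"
proof -
  interpret one_dim_ring R \<mm> by (rule cohen_macaulay_one_dim[OF assms(1,2)])
  have I: "ideal I R" using assms(7) unfolding primary_ideal_def by blast
  interpret I: ideal I R by (rule I)
  have I\<mm>: "I \<subseteq> \<mm>"
  proof
    fix i assume i: "i \<in> I"
    have ic: "i \<in> carrier R" using I.a_subset i by blast
    have "i [^]\<^bsub>R\<^esub> (1::nat) \<in> I" using i ic by simp
    then show "i \<in> \<mm>" unfolding assms(8)[symmetric] radical_def using ic by blast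
  qed
  have "\<exists>i\<in>I. regular_element R i"
  proof -
    obtain x where x: "x \<in> \<mm>" "regular_element R x" using P.regular_parameter emb_unit_iff mm_carrier by blast
    obtain n :: nat where "x [^]\<^bsub>R\<^esub> n \<in> I" using x(1) unfolding assms(8)[symmetric] radical_def by blast
    then show ?thesis using reg_power[OF x(2)] by blast
  qed
  then show ?thesis
    unfolding assms(9)
    by (rule almost_gorenstein_rees_quotient_iff[OF assms(2) I I\<mm> _ assms(4,5,10) assms(11)[unfolded assms(9)] assms(12,13)])
qed

end
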